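(* Let $M$ be a von Neumann algebra with a faithful normal state $\varphi$. If $(M,\varphi)$ has the symmetric Haagerup property, then the completely positive maps $\Phi_k$ witnessing it may be chosen unital and state-preserving. That is, there exists a sequence $(\Phi_k)_{k}$ of normal completely positive maps $\Phi_k:M\to M$ with $\Phi_k(1)=1$ and $\varphi\circ\Phi_k=\varphi$ for all $k$, whose KMS $L^2$-implementations $\Phi_k^{(2)}\in B(L^2(M,\varphi))$ are compact and converge strongly to the identity of $L^2(M,\varphi)$.
   Context: All von Neumann algebras have separable preduals. For a faithful normal state $\varphi$ on $M$, $L^2(M,\varphi)$ is the Haagerup non-commutative $L^2$-space, i.e. the standard form Hilbert space of $M$. $D_\varphi$ is the density operator of $\varphi$, i.e. the positive self-adjoint operator affiliated with the crossed product $M\rtimes_{\sigma^\varphi}\mathbb R$ by the modular group with $D_\varphi^{it}=\lambda_t$ (left regular representation). The elements $D_\varphi^{1/4}xD_\varphi^{1/4}$, $x\in M$, are dense in $L^2(M,\varphi)$. In GNS terms, $L^2(M,\varphi)$ is the GNS space with cyclic vector $\Omega_\varphi=D_\varphi^{1/2}$, and $D_\varphi^{1/4}xD_\varphi^{1/4}=\nabla_\varphi^{1/4}x\Omega_\varphi$, where $\nabla_\varphi$ is the modular operator. For a positive normal map $\Phi:M\to M$ with $\varphi\circ\Phi\le\varphi$ on $M^+$, the KMS $L^2$-implementation $\Phi^{(2)}$ is the bounded operator on $L^2(M,\varphi)$ determined by $\Phi^{(2)}(D_\varphi^{1/4}xD_\varphi^{1/4})=D_\varphi^{1/4}\Phi(x)D_\varphi^{1/4}$,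 $x\in M$. The pair $(M,\varphi)$ has the symmetric Haagerup property if there is a sequence of normal completely positive maps $\Phi_k:M\to M$ with $\varphi\circ\Phi_k\le\varphi$ such that the operators $\Phi_k^{(2)}$ are compact and converge strongly to the identity. *)

theory Defs
  imports "HOL-Analysis.Analysis"
begin

section \<open>Complex Hilbert spaces\<close>

class complex_vector = real_vector +
  fixes scaleC :: "complex \<Rightarrow> 'a \<Rightarrow> 'a"  (infixr \<open>*\<^sub>C\<close> 75)
  assumes scaleC_add_right: "c *\<^sub>C (x + y) = c *\<^sub>C x + c *\<^sub>C y"
    and scaleC_add_left: "(c + d) *\<^sub>C x = c *\<^sub>C x + d *\<^sub>C x"
    and scaleC_scaleC: "c *\<^sub>C d *\<^sub>C x = (c * d) *\<^sub>C x"
    and scaleR_scaleC: "r *\<^sub>R x = complex_of_real r *\<^sub>C x"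

text \<open>The inner product is linear in the second variable; its real part is the inner product
  of the underlying real space, so that norm and topology are the ones of that space.\<close>

class complex_inner = complex_vector + real_inner +
  fixes cinner :: "'a \<Rightarrow> 'a \<Rightarrow> complex"
  assumes cinner_commute: "cinner x y = cnj (cinner y x)"
    and cinner_add_right: "cinner x (y + z) = cinner x y + cinner x z"
    and cinner_scaleC_right: "cinner x (c *\<^sub>C y) = c * cinner x y"
    and inner_Re_cinner: "inner x y = Re (cinner x y)"

class complex_hilbert = complex_inner + complete_space

instantiation complex :: complex_inner
begin

definition scaleC_complex :: "complex \<Rightarrow> complex \<Rightarrow> complex" where
  "scaleC_complex c x = c * x"

definition cinner_complex :: "complex \<Rightarrow> complex \<Rightarrow> complex" where
  "cinner_complex x y = cnj x * y"

instance
  by standard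
    (simp_all add: scaleC_complex_def cinner_complex_def algebra_simps scaleR_conv_of_real
      inner_complex_def)

end

instance complex :: complex_hilbert ..

lemma norm_scaleC:
  fixes x :: "'a::complex_inner"
  shows "norm (c *\<^sub>C x) = cmod c * norm x"
proof -
  have "cinner (c *\<^sub>C x) (c *\<^sub>C x) = c * cnj c * cinner x x"
    by (metis (no_types) cinner_commute cinner_scaleC_right complex_cnj_mult mult.commute mult.left_commute)
  also have "c * cnj c = complex_of_real ((cmod c)\<^sup>2)"
    by (rule complex_norm_square [symmetric])
  finally have "(norm (c *\<^sub>C x))\<^sup>2 = (cmod c)\<^sup>2 * (norm x)\<^sup>2"
    by (simp add: power2_norm_eq_inner inner_Re_cinner)
  then show ?thesis
    by (metis norm_ge_zero mult_nonneg_nonneg power2_eq_imp_eq power_mult_distrib)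
qed

lemma bounded_linear_scaleC: "bounded_linear (\<lambda>x::'a::complex_inner. c *\<^sub>C x)"
proof (rule bounded_linear_intro [where K = "cmod c"])
  fix r and x :: 'a
  show "c *\<^sub>C (r *\<^sub>R x) = r *\<^sub>R (c *\<^sub>C x)"
    by (simp add: scaleR_scaleC scaleC_scaleC mult.commute)
qed (simp_all add: scaleC_add_right norm_scaleC mult.commute)

instantiation blinfun :: (real_normed_vector, complex_inner) complex_vector
begin

definition scaleC_blinfun :: "complex \<Rightarrow> 'a \<Rightarrow>\<^sub>L 'b \<Rightarrow> 'a \<Rightarrow>\<^sub>L 'b" where
  "scaleC_blinfun c T = Blinfun (\<lambda>x. c *\<^sub>C blinfun_apply T x)"

lemma scaleC_blinfun_apply: "blinfun_apply (c *\<^sub>C T) x = c *\<^sub>C blinfun_apply T x"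
  for T :: "'a \<Rightarrow>\<^sub>L 'b"
  unfolding scaleC_blinfun_def
  by (simp add: bounded_linear_Blinfun_apply
      bounded_linear_compose [OF bounded_linear_scaleC blinfun.bounded_linear_right])

instance
  by standard
    (auto intro!: blinfun_eqI simp: scaleC_blinfun_apply blinfun.add_left blinfun.scaleR_left
      scaleC_add_right scaleC_add_left scaleC_scaleC scaleR_scaleC)

end


section \<open>Operators and von Neumann algebras\<close>

text \<open>Elements of the library type of bounded operators are only real-linear; the bounded
  operators of a complex Hilbert space are the complex-linear ones among them.\<close>

definition bounded_ops :: "('h::complex_inner \<Rightarrow>\<^sub>L 'h) set" where
  "bounded_ops = {T. \<forall>c \<xi>. blinfun_apply T (c *\<^sub>C \<xi>) = c *\<^sub>C blinfun_apply T \<xi>}"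

definition cadjoint :: "'h::complex_inner \<Rightarrow>\<^sub>L 'h \<Rightarrow> 'h \<Rightarrow>\<^sub>L 'h" where
  "cadjoint T = (THE S. \<forall>\<xi> \<eta>. cinner (blinfun_apply S \<eta>) \<xi> = cinner \<eta> (blinfun_apply T \<xi>))"

definition commutant :: "('h::complex_inner \<Rightarrow>\<^sub>L 'h) set \<Rightarrow> ('h \<Rightarrow>\<^sub>L 'h) set" where
  "commutant A = {T \<in> bounded_ops. \<forall>x\<in>A. T o\<^sub>L x = x o\<^sub>L T}"

definition von_neumann_algebra :: "('h::complex_hilbert \<Rightarrow>\<^sub>L 'h) set \<Rightarrow> bool" where
  "von_neumann_algebra M \<longleftrightarrow>
     M \<subseteq> bounded_ops \<and> (\<forall>x\<in>M. cadjoint x \<in> M) \<and> commutant (commutant M) = M"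

text \<open>Positivity of the operator on the n-fold direct sum of the Hilbert space given by a
  matrix of operators with index set \<open>{..<n}\<close>.\<close>

definition positive_matrix :: "nat \<Rightarrow> (nat \<Rightarrow> nat \<Rightarrow> 'h::complex_inner \<Rightarrow>\<^sub>L 'h) \<Rightarrow> bool" where
  "positive_matrix n x \<longleftrightarrow>
     (\<forall>\<xi>. (\<Sum>i<n. \<Sum>j<n. cinner (\<xi> i) (blinfun_apply (x i j) (\<xi> j))) \<in> \<real>\<^sub>\<ge>\<^sub>0)"

definition positive_op :: "'h::complex_inner \<Rightarrow>\<^sub>L 'h \<Rightarrow> bool" where
  "positive_op x \<longleftrightarrow> (\<forall>\<xi>. cinner \<xi> (blinfun_apply x \<xi>) \<in> \<real>\<^sub>\<ge>\<^sub>0)"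

definition compact_op :: "'h::complex_inner \<Rightarrow>\<^sub>L 'h \<Rightarrow> bool" where
  "compact_op T \<longleftrightarrow> compact (closure (blinfun_apply T ` cball 0 1))"

definition clinear_on :: "'a::complex_vector set \<Rightarrow> ('a \<Rightarrow> 'b::complex_vector) \<Rightarrow> bool" where
  "clinear_on M f \<longleftrightarrow>
     (\<forall>x\<in>M. \<forall>y\<in>M. f (x + y) = f x + f y) \<and> (\<forall>c. \<forall>x\<in>M. f (c *\<^sub>C x) = c *\<^sub>C f x)"


section \<open>The predual, normal maps, normal states\<close>

definition sigma_weak :: "('h::complex_hilbert \<Rightarrow>\<^sub>L 'h) set \<Rightarrow> ('h \<Rightarrow>\<^sub>L 'h) topology" where
  "sigma_weak M = topology_generated_by
     {{x \<in> M. (\<Sum>n. cinner (\<xi> n) (blinfun_apply x (\<eta> n))) \<in> U} | \<xi> \<eta> U.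
        summable (\<lambda>n. (norm (\<xi> n))\<^sup>2) \<and> summable (\<lambda>n. (norm (\<eta> n))\<^sup>2) \<and> open U}"

text \<open>Functionals and maps on \<open>M\<close> are functions on the whole operator type, whose values
  outside \<open>M\<close> are irrelevant.\<close>

definition predual :: "('h::complex_hilbert \<Rightarrow>\<^sub>L 'h) set \<Rightarrow> ('h \<Rightarrow>\<^sub>L 'h \<Rightarrow> complex) set" where
  "predual M = {\<omega>. clinear_on M \<omega> \<and> continuous_map (sigma_weak M) euclidean \<omega>}"

definition separable_predual :: "('h::complex_hilbert \<Rightarrow>\<^sub>L 'h) set \<Rightarrow> bool" where
  "separable_predual M \<longleftrightarrow>
     (\<exists>C. countable C \<and> C \<subseteq> predual M \<and>
        (\<forall>\<omega>\<in>predual M. \<forall>\<epsilon>>0. \<exists>\<rho>\<in>C. \<forall>x\<in>M. norm x \<le> 1 \<longrightarrow> cmod (\<omega> x - \<rho> x) \<le> \<epsilon>))"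

definition faithful_normal_state ::
  "('h::complex_hilbert \<Rightarrow>\<^sub>L 'h) set \<Rightarrow> ('h \<Rightarrow>\<^sub>L 'h \<Rightarrow> complex) \<Rightarrow> bool" where
  "faithful_normal_state M \<phi> \<longleftrightarrow>
     \<phi> \<in> predual M \<and>
     (\<forall>x\<in>M. positive_op x \<longrightarrow> \<phi> x \<in> \<real>\<^sub>\<ge>\<^sub>0) \<and>
     \<phi> id_blinfun = 1 \<and>
     (\<forall>x\<in>M. positive_op x \<and> \<phi> x = 0 \<longrightarrow> x = 0)"

definition normal_map ::
  "('h::complex_hilbert \<Rightarrow>\<^sub>L 'h) set \<Rightarrow> ('h \<Rightarrow>\<^sub>L 'h \<Rightarrow> 'h \<Rightarrow>\<^sub>L 'h) \<Rightarrow> bool" where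
  "normal_map M \<Phi> \<longleftrightarrow> continuous_map (sigma_weak M) (sigma_weak M) \<Phi>"

definition completely_positive ::
  "('h::complex_hilbert \<Rightarrow>\<^sub>L 'h) set \<Rightarrow> ('h \<Rightarrow>\<^sub>L 'h \<Rightarrow> 'h \<Rightarrow>\<^sub>L 'h) \<Rightarrow> bool" where
  "completely_positive M \<Phi> \<longleftrightarrow>
     \<Phi> ` M \<subseteq> M \<and> clinear_on M \<Phi> \<and>
     (\<forall>n x. (\<forall>i<n. \<forall>j<n. x i j \<in> M) \<and> positive_matrix n x \<longrightarrow>
        positive_matrix n (\<lambda>i j. \<Phi> (x i j)))"


section \<open>Unbounded operators\<close>

text \<open>Unbounded operators are represented by their graphs, so that \<open>A ^^ n\<close> is the n-fold
  product with its natural domain.\<close>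

definition graph_app :: "('k \<times> 'k) set \<Rightarrow> 'k \<Rightarrow> 'k" where
  "graph_app A \<xi> = (THE \<eta>. (\<xi>, \<eta>) \<in> A)"

definition graph_adjoint :: "('k::complex_inner \<times> 'k) set \<Rightarrow> ('k \<times> 'k) set" where
  "graph_adjoint A = {(\<eta>, \<zeta>). \<forall>(\<xi>, \<xi>')\<in>A. cinner \<xi>' \<eta> = cinner \<xi> \<zeta>}"

definition positive_selfadjoint :: "('k::complex_inner \<times> 'k) set \<Rightarrow> bool" where
  "positive_selfadjoint A \<longleftrightarrow>
     single_valued A \<and> closure (Domain A) = UNIV \<and> graph_adjoint A = A \<and>
     (\<forall>(\<xi>, \<eta>)\<in>A. cinner \<xi> \<eta> \<in> \<real>\<^sub>\<ge>\<^sub>0)"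

text \<open>The power of a positive self-adjoint operator with exponent \<open>1/n\<close>.\<close>

definition positive_root :: "nat \<Rightarrow> ('k::complex_inner \<times> 'k) set \<Rightarrow> ('k \<times> 'k) set" where
  "positive_root n A = (THE B. positive_selfadjoint B \<and> B ^^ n = A)"


section \<open>The standard Hilbert space of a state and its modular operator\<close>

text \<open>A GNS triple is determined by the state up to unitary equivalence. Its Hilbert space is
  \<open>L\<^sup>2(M, \<phi>)\<close>, and \<open>\<Omega>\<close> is the square root of the density operator.\<close>

definition gns_triple ::
  "('h::complex_hilbert \<Rightarrow>\<^sub>L 'h) set \<Rightarrow> ('h \<Rightarrow>\<^sub>L 'h \<Rightarrow> complex) \<Rightarrow>
   ('h \<Rightarrow>\<^sub>L 'h \<Rightarrow> 'k::complex_hilbert \<Rightarrow>\<^sub>L 'k) \<Rightarrow> 'k \<Rightarrow> bool" where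
  "gns_triple M \<phi> \<pi> \<Omega> \<longleftrightarrow>
     \<pi> ` M \<subseteq> bounded_ops \<and> clinear_on M \<pi> \<and> \<pi> id_blinfun = id_blinfun \<and>
     (\<forall>x\<in>M. \<forall>y\<in>M. \<pi> (x o\<^sub>L y) = \<pi> x o\<^sub>L \<pi> y) \<and>
     (\<forall>x\<in>M. \<pi> (cadjoint x) = cadjoint (\<pi> x)) \<and>
     (\<forall>x\<in>M. \<phi> x = cinner \<Omega> (blinfun_apply (\<pi> x) \<Omega>)) \<and>
     closure {blinfun_apply (\<pi> x) \<Omega> | x. x \<in> M} = UNIV"

definition tomita_op ::
  "('h::complex_hilbert \<Rightarrow>\<^sub>L 'h) set \<Rightarrow> ('h \<Rightarrow>\<^sub>L 'h \<Rightarrow> 'k::complex_hilbert \<Rightarrow>\<^sub>L 'k) \<Rightarrow> 'k \<Rightarrow>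
   ('k \<times> 'k) set" where
  "tomita_op M \<pi> \<Omega> =
     closure {(blinfun_apply (\<pi> x) \<Omega>, blinfun_apply (\<pi> (cadjoint x)) \<Omega>) | x. x \<in> M}"

text \<open>The Tomita operator is conjugate-linear, whence the order of the arguments on the
  right-hand side.\<close>

definition graph_antiadjoint :: "('k::complex_inner \<times> 'k) set \<Rightarrow> ('k \<times> 'k) set" where
  "graph_antiadjoint A = {(\<eta>, \<zeta>). \<forall>(\<xi>, \<xi>')\<in>A. cinner \<xi>' \<eta> = cinner \<zeta> \<xi>}"

text \<open>As \<open>O\<close> composes relations from left to right, this is \<open>S\<^sup>* S\<close> for the Tomita
  operator \<open>S\<close>.\<close>

definition modular_op ::
  "('h::complex_hilbert \<Rightarrow>\<^sub>L 'h) set \<Rightarrow> ('h \<Rightarrow>\<^sub>L 'h \<Rightarrow> 'k::complex_hilbert \<Rightarrow>\<^sub>L 'k) \<Rightarrow> 'k \<Rightarrow>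
   ('k \<times> 'k) set" where
  "modular_op M \<pi> \<Omega> = tomita_op M \<pi> \<Omega> O graph_antiadjoint (tomita_op M \<pi> \<Omega>)"

text \<open>The symmetric embedding of \<open>M\<close> into \<open>L\<^sup>2(M, \<phi>)\<close>, which multiplies by the fourth root
  of the density operator on both sides.\<close>

definition kms_embedding ::
  "('h::complex_hilbert \<Rightarrow>\<^sub>L 'h) set \<Rightarrow> ('h \<Rightarrow>\<^sub>L 'h \<Rightarrow> 'k::complex_hilbert \<Rightarrow>\<^sub>L 'k) \<Rightarrow> 'k \<Rightarrow>
   'h \<Rightarrow>\<^sub>L 'h \<Rightarrow> 'k" where
  "kms_embedding M \<pi> \<Omega> x =
     graph_app (positive_root 4 (modular_op M \<pi> \<Omega>)) (blinfun_apply (\<pi> x) \<Omega>)"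

text \<open>\<open>T\<close> is the KMS implementation of \<open>\<Phi>\<close>; it is unique because the range of the embedding is
  dense.\<close>

definition kms_implementation ::
  "('h::complex_hilbert \<Rightarrow>\<^sub>L 'h) set \<Rightarrow> ('h \<Rightarrow>\<^sub>L 'h \<Rightarrow> 'k::complex_hilbert \<Rightarrow>\<^sub>L 'k) \<Rightarrow> 'k \<Rightarrow>
   ('h \<Rightarrow>\<^sub>L 'h \<Rightarrow> 'h \<Rightarrow>\<^sub>L 'h) \<Rightarrow> 'k \<Rightarrow>\<^sub>L 'k \<Rightarrow> bool" where
  "kms_implementation M \<pi> \<Omega> \<Phi> T \<longleftrightarrow>
     T \<in> bounded_ops \<and>
     (\<forall>x\<in>M. blinfun_apply T (kms_embedding M \<pi> \<Omega> x) = kms_embedding M \<pi> \<Omega> (\<Phi> x))"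

definition symmetric_haagerup_property ::
  "('h::complex_hilbert \<Rightarrow>\<^sub>L 'h) set \<Rightarrow> ('h \<Rightarrow>\<^sub>L 'h \<Rightarrow> complex) \<Rightarrow>
   ('h \<Rightarrow>\<^sub>L 'h \<Rightarrow> 'k::complex_hilbert \<Rightarrow>\<^sub>L 'k) \<Rightarrow> 'k \<Rightarrow> bool" where
  "symmetric_haagerup_property M \<phi> \<pi> \<Omega> \<longleftrightarrow>
     (\<exists>(\<Phi> :: nat \<Rightarrow> 'h \<Rightarrow>\<^sub>L 'h \<Rightarrow> 'h \<Rightarrow>\<^sub>L 'h) (T :: nat \<Rightarrow> 'k \<Rightarrow>\<^sub>L 'k).
        (\<forall>k. normal_map M (\<Phi> k) \<and> completely_positive M (\<Phi> k) \<and>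
             (\<forall>x\<in>M. positive_op x \<longrightarrow> Re (\<phi> (\<Phi> k x)) \<le> Re (\<phi> x)) \<and>
             kms_implementation M \<pi> \<Omega> (\<Phi> k) (T k) \<and> compact_op (T k)) \<and>
        (\<forall>\<xi>. (\<lambda>k. blinfun_apply (T k) \<xi>) \<longlonglongrightarrow> \<xi>))"

end

theory Submission
 imports Defs
begin

text \<open>A completely positive \<open>\<Phi>\<close> of the given sequence need not satisfy \<open>\<Phi>(1) \<le> 1\<close>, but
  \<open>g = \<Phi>(1) - 1\<close> has a small symmetric embedding. Tomita's theory, in the bounded form in which the
  modular operator \<open>\<Delta>\<close> is replaced by \<open>R = (1 + \<Delta>)\<^sup>-\<^sup>1\<close>, gives a majorant \<open>y \<ge> g\<close> in the algebra
  with small \<open>\<phi>(y)\<close>. Let \<open>Y\<close> be the Radon--Nikodym element (Sakai) of the functional of \<open>J y J\<close>; the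
  multiplier \<open>(1 + Y)\<^sup>-\<^sup>1\<close>, moved by the modular conjugation, gives an element \<open>w\<close> close to \<open>1\<close> with
  \<open>w (1 + g) w\<^sup>* \<le> 1\<close> whose compression \<open>x \<mapsto> w x w\<^sup>*\<close> does not increase \<open>\<phi>\<close> and is contractive on
  \<open>L\<^sup>2\<close>. So \<open>\<Phi>' = w \<Phi>(\<cdot>) w\<^sup>*\<close> satisfies \<open>\<Phi>'(1) \<le> 1\<close>. With \<open>\<chi> = \<phi> - (1 - \<epsilon>) \<phi> \<circ> \<Phi>'\<close> and
  \<open>d = 1 - (1 - \<epsilon>) \<Phi>'(1)\<close>, the map \<open>(1 - \<epsilon>) \<Phi>' + \<chi>(\<cdot>) d / \<phi>(d)\<close> is unital and state-preserving; its
  implementation differs from that of \<open>(1 - \<epsilon>) \<Phi>'\<close> by a rank-one operator, which tends to \<open>0\<close>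
  strongly when \<open>\<epsilon> \<rightarrow> 0\<close> slowly enough.\<close>

text \<open>Only the symmetric embedding of g, the vector \<open>S \<Omega> - \<Omega>\<close>, is
  known to be small; neither the norm of g nor \<phi>(|g|) is controlled. Compressing by a function
  of \<Phi>(1) alone would give a map below 1 at 1, but outside the tracial case it may destroy the
  inequality for \<phi>. A compression by w does not increase \<phi> once
  \<open>adj w \<Omega>\<close> is the value at \<Omega> of a contraction in the commutant; this is
  why (1 + Y)^(-1) is passed through the commutant and J. The multiplier works because \<phi> +
  Y\<phi> + \<phi>Y \<le> (1 + Y)\<phi>(1 + Y), where Y\<phi> + \<phi>Y is the functional of J y J.
  All this needs J A J = A', which is obtained by averaging Sakai elements over their parameter.
  Before modular theory can start, the GNS image must be shown to be a von Neumann algebra, and that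
  rests on the normality of \<phi>. The loss 1 - \<epsilon> keeps the denominator \<phi>(d) at least
  \<epsilon>; taking \<epsilon> no smaller than the norm of \<open>S \<Omega> - \<Omega>\<close>
  keeps the normalised vector of the rank-one term bounded.\<close>

abbreviation (input) "app \<equiv> blinfun_apply"

abbreviation (input) cont01 :: "(real \<Rightarrow> 'a::topological_space) \<Rightarrow> bool" where
 "cont01 \<equiv> continuous_on {0..1}"

section \<open>Real Hilbert spaces\<close>

instance complex_hilbert \<subseteq> banach ..

lemma blinfunI:
 assumes "bounded_linear f"
 obtains T where "\<And>x. app T x = f x"
 using bounded_linear_Blinfun_apply[OF assms] by metis

lemma parallelogram:
 fixes x y :: "'a::real_inner"
 shows "(norm (x - y))\<^sup>2 = 2 * (norm x)\<^sup>2 + 2 * (norm y)\<^sup>2 - 4 * (norm ((1/2) *\<^sub>R (x + y)))\<^sup>2"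
 by (simp add: power2_norm_eq_inner inner_diff inner_add inner_commute algebra_simps)

text \<open>A minimising sequence is Cauchy: the midpoint of two of its members stays in the convex
  set, so its norm is at least the infimum \<open>d\<close>, and the parallelogram law turns this
  into a bound on their distance.\<close>

lemma ex_min_norm:
 fixes C :: "'a::{real_inner,banach} set"
 assumes "closed C" "convex C" "C \<noteq> {}"
 shows "\<exists>p\<in>C. \<forall>c\<in>C. norm p \<le> norm c"
proof -
 define d where "d = Inf (norm ` C)"
 have bdd: "bdd_below (norm ` C)" by (rule bdd_belowI[of _ 0]) auto
 have dle: "d \<le> norm c" if "c \<in> C" for c
  unfolding d_def using cInf_lower[OF _ bdd] that by blast
 have d0: "0 \<le> d" unfolding d_def using assms(3) by (intro cInf_greatest) auto
 have "\<exists>c\<in>C. norm c < d + 1 / (real n + 1)" for n :: nat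
 proof -
  have "d < d + 1 / (real n + 1)" by simp
  then have "\<exists>y\<in>norm ` C. y < d + 1 / (real n + 1)"
   using cInf_lessD[of "norm ` C" "d + 1 / (real n + 1)"] assms(3) d_def by blast
  then show ?thesis by blast
 qed
 then obtain c where c: "\<And>n. c n \<in> C" "\<And>n. norm (c n) < d + 1 / (real n + 1)" by metis
 have sq: "(norm (c n))\<^sup>2 \<le> d\<^sup>2 + (2 * d + 1) / (real n + 1)" for n
 proof -
  have "(norm (c n))\<^sup>2 \<le> (d + 1 / (real n + 1))\<^sup>2"
   using c(2)[of n] by (intro power_mono) auto
  also have "\<dots> = d\<^sup>2 + 2 * d / (real n + 1) + (1 / (real n + 1)) * (1 / (real n + 1))"
   by (simp add: power2_eq_square algebra_simps)
  also have "\<dots> \<le> d\<^sup>2 + 2 * d / (real n + 1) + 1 * (1 / (real n + 1))"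
   by (intro add_left_mono mult_right_mono) auto
  finally show ?thesis by (simp add: add_divide_distrib)
 qed
 have dist_sq: "(norm (c m - c n))\<^sup>2 \<le> 4 * ((2 * d + 1) / (real N + 1))" if "m \<ge> N" "n \<ge> N" for m n N
 proof -
  have "(1/2) *\<^sub>R (c m + c n) \<in> C"
   using convexD[OF assms(2) c(1)[of m] c(1)[of n], of "1/2" "1/2"] by (simp add: scaleR_add_right)
  then have "d\<^sup>2 \<le> (norm ((1/2) *\<^sub>R (c m + c n)))\<^sup>2" by (intro power_mono dle d0)
  moreover have "(2 * d + 1) / (real m + 1) \<le> (2 * d + 1) / (real N + 1)"
   "(2 * d + 1) / (real n + 1) \<le> (2 * d + 1) / (real N + 1)"
   using that d0 by (auto intro!: divide_left_mono)
  ultimately show ?thesis using sq[of m] sq[of n] parallelogram[of "c m" "c n"] by linarith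
 qed
 have "Cauchy c"
 proof (rule CauchyI)
  fix e :: real assume e: "0 < e"
  have "(\<lambda>N. 4 * ((2 * d + 1) * inverse (real (Suc N)))) \<longlonglongrightarrow> 4 * ((2 * d + 1) * 0)"
   by (intro tendsto_intros LIMSEQ_inverse_real_of_nat)
  moreover have "4 * ((2 * d + 1) * 0) < e\<^sup>2" using e by simp
  ultimately have "eventually (\<lambda>N. 4 * ((2 * d + 1) * inverse (real (Suc N))) < e\<^sup>2) sequentially"
   by (rule order_tendstoD(2))
  then obtain N where N: "4 * ((2 * d + 1) * inverse (real (Suc N))) < e\<^sup>2"
   by (auto simp: eventually_sequentially)
  have "norm (c m - c n) < e" if "m \<ge> N" "n \<ge> N" for m n
  proof -
   have "(norm (c m - c n))\<^sup>2 < e\<^sup>2"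
    using dist_sq[OF that] N by (simp add: divide_inverse add.commute)
   then show ?thesis using e by (simp add: power2_less_imp_less)
  qed
  then show "\<exists>M. \<forall>m\<ge>M. \<forall>n\<ge>M. norm (c m - c n) < e" by blast
 qed
 then obtain p where p: "c \<longlonglongrightarrow> p" using Cauchy_convergent convergent_def by blast
 have "p \<in> C" using closed_sequentially[OF assms(1)] c(1) p by blast
 moreover have "norm p \<le> d"
 proof (rule LIMSEQ_le[OF tendsto_norm[OF p]])
  show "(\<lambda>n. d + inverse (real (Suc n))) \<longlonglongrightarrow> d"
   using tendsto_add[OF tendsto_const[of d] LIMSEQ_inverse_real_of_nat] by simp
  show "\<exists>N. \<forall>n\<ge>N. norm (c n) \<le> d + inverse (real (Suc n))"
   using c(2) by (intro exI[of _ 0]) (simp add: divide_inverse add.commute less_imp_le)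
 qed
 ultimately show ?thesis using dle by force
qed

lemma ex_nearest_point:
 fixes C :: "'a::{real_inner,banach} set"
 assumes "closed C" "convex C" "C \<noteq> {}"
 shows "\<exists>p\<in>C. \<forall>c\<in>C. inner (x - p) (c - p) \<le> 0"
proof -
 have "closed ((\<lambda>c. c - x) ` C)" "convex ((\<lambda>c. c - x) ` C)" "(\<lambda>c. c - x) ` C \<noteq> {}"
  using assms by (auto intro: closed_translation_subtract convex_translation_subtract)
 then have "\<exists>p\<in>(\<lambda>c. c - x) ` C. \<forall>c\<in>(\<lambda>c. c - x) ` C. norm p \<le> norm c" by (rule ex_min_norm)
 then obtain p where p: "p \<in> C" "\<forall>c\<in>C. norm (p - x) \<le> norm (c - x)" by blast
 have "inner (x - p) (c - p) \<le> 0" if "c \<in> C" for c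
 proof (rule ccontr)
  assume "\<not> ?thesis"
  then have pos: "inner (x - p) (c - p) > 0" by simp
  then have "c \<noteq> p" by auto
  \<comment> \<open>With this step length the quadratic term eats up at most half of the linear
    decrease, so the distance to \<open>x\<close> would strictly shrink along the segment from
    \<open>p\<close> to \<open>c\<close>.\<close>
  define t where "t = min 1 (inner (x - p) (c - p) / (norm (c - p))\<^sup>2)"
  have t: "0 < t" "t \<le> 1" using pos \<open>c \<noteq> p\<close> by (auto simp: t_def)
  have "t * (norm (c - p))\<^sup>2 \<le> inner (x - p) (c - p)"
   using \<open>c \<noteq> p\<close> by (simp add: t_def min_def field_simps)
  have "p + t *\<^sub>R (c - p) = (1 - t) *\<^sub>R p + t *\<^sub>R c" by (simp add: algebra_simps)
  then have "p + t *\<^sub>R (c - p) \<in> C" using convexD[OF assms(2) p(1) that, of "1 - t" t] t by simp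
  then have "(norm (p - x))\<^sup>2 \<le> (norm (p + t *\<^sub>R (c - p) - x))\<^sup>2"
   using p(2) by (intro power_mono) auto
  also have "\<dots> = (norm (p - x))\<^sup>2 - 2 * t * inner (x - p) (c - p) + t * (t * (norm (c - p))\<^sup>2)"
   by (simp only: power2_norm_eq_inner) (simp add: inner_diff inner_add inner_commute algebra_simps)
  also have "\<dots> \<le> (norm (p - x))\<^sup>2 - 2 * t * inner (x - p) (c - p) + t * inner (x - p) (c - p)"
   using \<open>t * _ \<le> _\<close> t by (intro add_left_mono mult_left_mono) auto
  finally have "t * inner (x - p) (c - p) \<le> 0" by simp
  then show False using t pos by (simp add: mult_le_0_iff)
 qed
 then show ?thesis using p by blast
qed

text \<open>The vector from the nearest point to \<open>x\<close> is the normal of a separating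
  hyperplane. It is applied in \<open>sakai\<close> to a convex set of pairs of vectors.\<close>

lemma convex_separation:
 fixes C :: "'a::{real_inner,banach} set"
 assumes "closed C" "convex C" "C \<noteq> {}" "x \<notin> C"
 obtains d \<delta> where "\<delta> > 0" "\<And>c. c \<in> C \<Longrightarrow> inner d c + \<delta> \<le> inner d x"
proof -
 obtain p where p: "p \<in> C" "\<And>c. c \<in> C \<Longrightarrow> inner (x - p) (c - p) \<le> 0"
  using ex_nearest_point[OF assms(1-3), of x] by blast
 then have "x - p \<noteq> 0" using assms(4) by auto
 show ?thesis
 proof (rule that[of "(norm (x - p))\<^sup>2" "x - p"])
  show "0 < (norm (x - p))\<^sup>2" using \<open>x - p \<noteq> 0\<close> by simp
  fix c assume "c \<in> C"
  then show "inner (x - p) c + (norm (x - p))\<^sup>2 \<le> inner (x - p) x"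
   using p(2)[of c] by (simp add: power2_norm_eq_inner inner_diff inner_commute algebra_simps)
 qed
qed

lemma ex_projection:
 fixes S :: "'a::{real_inner,banach} set"
 assumes "closed S" "subspace S"
 obtains P :: "'a \<Rightarrow>\<^sub>L 'a" where "\<And>x. P x \<in> S" "\<And>x s. s \<in> S \<Longrightarrow> inner (x - P x) s = 0"
proof -
 have "\<exists>p\<in>S. \<forall>s\<in>S. inner (x - p) s = 0" for x
 proof -
  obtain p where p: "p \<in> S" "\<And>c. c \<in> S \<Longrightarrow> inner (x - p) (c - p) \<le> 0"
   using ex_nearest_point[OF assms(1) subspace_imp_convex[OF assms(2)], of x]
    subspace_0[OF assms(2)] by blast
  have "inner (x - p) s = 0" if "s \<in> S" for s
   using p(2)[of "p + s"] p(2)[of "p - s"] p(1) that assms(2)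
   by (auto simp: subspace_add subspace_diff)
  then show ?thesis using p by blast
 qed
 then obtain p where p: "\<And>x. p x \<in> S" "\<And>x s. s \<in> S \<Longrightarrow> inner (x - p x) s = 0" by metis
 have uniq: "q = p x" if "q \<in> S" "\<And>s. s \<in> S \<Longrightarrow> inner (x - q) s = 0" for q x
 proof -
  have "inner (q - p x) (q - p x) = inner (x - p x) (q - p x) - inner (x - q) (q - p x)"
   by (simp add: inner_diff)
  also have "\<dots> = 0" using that p assms(2) by (simp add: subspace_diff)
  finally show ?thesis by simp
 qed
 have "bounded_linear p"
 proof (rule bounded_linear_intro[of _ 1])
  show "p (x + y) = p x + p y" for x y
  proof (rule uniq[symmetric])
   show "p x + p y \<in> S" using p(1) assms(2) by (simp add: subspace_add)
   show "inner (x + y - (p x + p y)) s = 0" if "s \<in> S" for s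
    using p(2)[OF that, of x] p(2)[OF that, of y] by (simp add: inner_diff inner_add)
  qed
  show "p (r *\<^sub>R x) = r *\<^sub>R p x" for r x
  proof (rule uniq[symmetric])
   show "r *\<^sub>R p x \<in> S" using p(1) assms(2) by (simp add: subspace_scale)
   show "inner (r *\<^sub>R x - r *\<^sub>R p x) s = 0" if "s \<in> S" for s
    using p(2)[OF that, of x] by (simp add: inner_diff)
  qed
  show "norm (p x) \<le> norm x * 1" for x
  proof -
   have "inner (p x) (p x) = inner x (p x)" using p(2)[OF p(1), of x x] by (simp add: inner_diff)
   then have "(norm (p x))\<^sup>2 \<le> norm x * norm (p x)"
    using norm_cauchy_schwarz[of x "p x"] by (simp add: power2_norm_eq_inner)
   then show ?thesis by (cases "norm (p x) = 0") (auto simp: power2_eq_square mult_le_cancel_right)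
  qed
 qed
 then obtain P where "\<And>x. app P x = p x" using blinfunI by blast
 then show ?thesis using p that[of P] by simp
qed

text \<open>A vector \<open>w\<close> orthogonal to the closed kernel represents the functional
  after rescaling, because \<open>f x *\<^sub>R w - f w *\<^sub>R x\<close> lies in the
  kernel.\<close>

lemma riesz:
 fixes f :: "'a::{real_inner,banach} \<Rightarrow> real"
 assumes "bounded_linear f"
 shows "\<exists>u. \<forall>x. f x = inner u x"
proof (cases "\<forall>x. f x = 0")
 case True
 then show ?thesis by (intro exI[of _ 0]) auto
next
 case False
 then obtain z where z: "f z \<noteq> 0" by blast
 interpret f: bounded_linear f by fact
 define S where "S = {x. f x = 0}"
 have "closed S" unfolding S_def
  by (intro closed_Collect_eq continuous_intros f.continuous_on)
 moreover have "subspace S" unfolding S_def subspace_def by (auto simp: f.add f.scaleR f.zero)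
 ultimately obtain P :: "'a \<Rightarrow>\<^sub>L 'a" where P: "\<And>x. P x \<in> S" "\<And>x s. s \<in> S \<Longrightarrow> inner (x - P x) s = 0"
  using ex_projection by blast
 define w where "w = z - P z"
 have fw: "f w = f z" using P(1)[of z] by (simp add: w_def f.diff S_def)
 then have w0: "w \<noteq> 0" using z f.zero by auto
 have "f x = inner ((f w / (norm w)\<^sup>2) *\<^sub>R w) x" for x
 proof -
  have "f x *\<^sub>R w - f w *\<^sub>R x \<in> S" by (simp add: S_def f.diff f.scaleR)
  then have "inner w (f x *\<^sub>R w - f w *\<^sub>R x) = 0" using P(2) w_def by blast
  then have "f x * (norm w)\<^sup>2 = f w * inner w x" by (simp add: inner_diff power2_norm_eq_inner)
  then show ?thesis using w0 by (simp add: field_simps)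
 qed
 then show ?thesis by blast
qed

text \<open>Taken with respect to the real inner product, so that it also covers conjugate-linear
  operators such as \<open>modC\<close> and \<open>modJ\<close> and operators between different
  spaces. On \<open>bounded_ops\<close> it agrees with \<open>cadjoint\<close>, see
  \<open>cadjoint_eq\<close>.\<close>

definition adj :: "('a::{real_inner,banach} \<Rightarrow>\<^sub>L 'b::{real_inner,banach}) \<Rightarrow> 'b \<Rightarrow>\<^sub>L 'a" where
 "adj T = (SOME S. \<forall>x y. inner (app S x) y = inner x (app T y))"

lemma adj: "inner (adj T x) y = inner x (T y)"
proof -
 have "\<exists>u. \<forall>y. inner x (T y) = inner u y" for x
  by (rule riesz) (intro bounded_linear_intros)
 then obtain s where s: "\<And>x y. inner x (T y) = inner (s x) y" by metis
 have eqI: "u = v" if "\<And>y. inner u y = inner v y" for u v :: 'a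
  using that[of "u - v"] by (metis inner_diff_left inner_eq_zero_iff right_minus_eq)
 have "bounded_linear s"
 proof (rule bounded_linear_intro[of _ "norm T"])
  show "s (x + y) = s x + s y" for x y by (rule eqI) (simp add: inner_add s[symmetric])
  show "s (r *\<^sub>R x) = r *\<^sub>R s x" for r x by (rule eqI) (simp add: s[symmetric])
  show "norm (s x) \<le> norm x * norm T" for x
  proof -
   have "(norm (s x))\<^sup>2 = inner x (T (s x))" by (simp add: power2_norm_eq_inner s)
   also have "\<dots> \<le> norm x * norm (T (s x))" by (rule norm_cauchy_schwarz)
   also have "\<dots> \<le> norm x * (norm T * norm (s x))"
    by (intro mult_left_mono norm_blinfun norm_ge_zero)
   finally show ?thesis by (cases "s x = 0") (auto simp: power2_eq_square)
  qed
 qed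
 then obtain S where "\<And>x. app S x = s x" using blinfunI by blast
 then have "\<forall>x y. inner (app S x) y = inner x (T y)" using s by simp
 then have "\<forall>x y. inner (adj T x) y = inner x (T y)" unfolding adj_def by (rule someI)
 then show ?thesis by blast
qed

lemma adj': "inner (app T x) y = inner x (adj T y)"
 using adj[of T y x] by (simp add: inner_commute)

lemma inner_eqI: "u = v" if "\<And>y. inner u y = inner v y" for u v :: "'a::real_inner"
 using that[of "u - v"] by (metis inner_diff_left inner_eq_zero_iff right_minus_eq)

lemma adjI:
 fixes T :: "'a::{real_inner,banach} \<Rightarrow>\<^sub>L 'b::{real_inner,banach}" and S :: "'b \<Rightarrow>\<^sub>L 'a"
 assumes "\<And>x y. inner (S x) y = inner x (T y)"
 shows "adj T = S"
 by (rule blinfun_eqI, rule inner_eqI) (simp add: adj assms)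

lemma adj_adj [simp]: "adj (adj T) = T"
 by (rule adjI) (rule adj')

lemma adj_id [simp]: "adj id_blinfun = id_blinfun"
 by (rule adjI) simp

lemma adj_compose: "adj (S o\<^sub>L T) = adj T o\<^sub>L adj S"
 by (rule adjI) (simp add: adj)

lemma adj_add: "adj (S + T) = adj S + adj T"
 by (rule adjI) (simp add: adj blinfun.add_left inner_add)

lemma adj_diff: "adj (S - T) = adj S - adj T"
 by (rule adjI) (simp add: adj blinfun.diff_left inner_diff)

lemma adj_scaleR: "adj (r *\<^sub>R S) = r *\<^sub>R adj S"
 by (rule adjI) (simp add: adj blinfun.scaleR_left)

lemma norm_adj [simp]: "norm (adj T) = norm T"
proof -
 have "norm (adj T) \<le> norm T" for T :: "'c::{real_inner,banach} \<Rightarrow>\<^sub>L 'd::{real_inner,banach}"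
 proof (rule norm_blinfun_bound)
  fix x
  have "(norm (adj T x))\<^sup>2 = inner x (T (adj T x))" by (simp add: power2_norm_eq_inner adj)
  also have "\<dots> \<le> norm x * norm (T (adj T x))" by (rule norm_cauchy_schwarz)
  also have "\<dots> \<le> norm x * (norm T * norm (adj T x))"
   by (intro mult_left_mono norm_blinfun norm_ge_zero)
  finally show "norm (adj T x) \<le> norm T * norm x"
   by (cases "adj T x = 0") (auto simp: power2_eq_square mult.commute)
 qed simp
 from this[of T] this[of "adj T"] show ?thesis by simp
qed

lemma blinfun_eqI_dense:
 fixes S T :: "'a::real_normed_vector \<Rightarrow>\<^sub>L 'b::real_normed_vector"
 assumes "closure D = UNIV" "\<And>x. x \<in> D \<Longrightarrow> S x = T x"
 shows "S = T"
proof -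
 have "closed {x. S x = T x}" by (intro closed_Collect_eq continuous_intros)
 then have "closure D \<subseteq> {x. S x = T x}" using assms(2) by (intro closure_minimal) auto
 then show ?thesis using assms(1) by (intro blinfun_eqI) auto
qed

lemma dense_orthogonal:
 fixes v :: "'a::real_inner"
 assumes "closure D = UNIV" "\<And>x. x \<in> D \<Longrightarrow> inner v x = 0"
 shows "v = 0"
proof -
 have "closed {x. inner v x = 0}" by (intro closed_Collect_eq continuous_intros)
 then have "closure D \<subseteq> {x. inner v x = 0}" using assms(2) by (intro closure_minimal) auto
 then have "inner v v = 0" using assms(1) by blast
 then show ?thesis by simp
qed

lemma subspace_closure:
 fixes S :: "'a::real_normed_vector set"
 assumes "subspace S"
 shows "subspace (closure S)"
 unfolding subspace_def
proof (intro conjI ballI allI)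
 show "0 \<in> closure S" using subspace_0[OF assms] closure_subset by blast
 fix x assume "x \<in> closure S"
 then obtain u where u: "\<And>n. u n \<in> S" "u \<longlonglongrightarrow> x" by (auto simp: closure_sequential)
 have "(\<lambda>n. c *\<^sub>R u n) \<longlonglongrightarrow> c *\<^sub>R x" for c by (intro tendsto_intros u)
 then show "c *\<^sub>R x \<in> closure S" for c
  unfolding closure_sequential using u(1) subspace_scale[OF assms]
  by (intro exI[of _ "\<lambda>n. c *\<^sub>R u n"]) auto
 fix y assume "y \<in> closure S"
 then obtain v where v: "\<And>n. v n \<in> S" "v \<longlonglongrightarrow> y" by (auto simp: closure_sequential)
 have "(\<lambda>n. u n + v n) \<longlonglongrightarrow> x + y" by (intro tendsto_intros u v)
 then show "x + y \<in> closure S"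
  unfolding closure_sequential using u(1) v(1) subspace_add[OF assms]
  by (intro exI[of _ "\<lambda>n. u n + v n"]) auto
qed

lemma closure_subspace_UNIV:
 fixes S :: "'a::{real_inner,banach} set"
 assumes "subspace S" "\<And>v. (\<And>x. x \<in> S \<Longrightarrow> inner v x = 0) \<Longrightarrow> v = 0"
 shows "closure S = UNIV"
proof -
 obtain P :: "'a \<Rightarrow>\<^sub>L 'a" where P: "\<And>x. P x \<in> closure S" "\<And>x s. s \<in> closure S \<Longrightarrow> inner (x - P x) s = 0"
  using ex_projection[OF closed_closure subspace_closure[OF assms(1)]] by blast
 have "x - P x = 0" for x
  by (rule assms(2)) (use P(2) closure_subset in blast)
 then have "x = P x" for x by (metis right_minus_eq)
 then have "x \<in> closure S" for x using P(1)[of x] by simp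
 then show ?thesis by blast
qed

text \<open>Many operators below are prescribed by a relation, such as sending
  \<open>x \<Omega>\<close> to some vector that depends on \<open>x\<close>. A norm bound on a
  linear relation already makes it single-valued, so no separate check of well-definedness occurs
  where this is used.\<close>

lemma extend_graph:
 fixes G :: "('a::real_normed_vector \<times> 'b::banach) set"
 assumes "subspace G" "\<And>x y. (x, y) \<in> G \<Longrightarrow> norm y \<le> c * norm x" "closure (fst ` G) = UNIV"
 obtains T :: "'a \<Rightarrow>\<^sub>L 'b" where "\<And>x y. (x, y) \<in> G \<Longrightarrow> T x = y" "\<And>x. norm (T x) \<le> c * norm x"
proof -
 have bd: "norm y \<le> c * norm x" if "(x, y) \<in> closure G" for x y
 proof -
  have "closed {p::'a \<times> 'b. norm (snd p) \<le> c * norm (fst p)}"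
   by (intro closed_Collect_le continuous_intros)
  then have "closure G \<subseteq> {p. norm (snd p) \<le> c * norm (fst p)}"
   using assms(2) by (intro closure_minimal) auto
  then show ?thesis using that by auto
 qed
 have sub: "subspace (closure G)" using assms(1) by (rule subspace_closure)
 have ex: "\<exists>y. (x, y) \<in> closure G" for x
 proof -
  have "x \<in> closure (fst ` G)" using assms(3) by simp
  then obtain u where u: "\<And>n. u n \<in> fst ` G" "u \<longlonglongrightarrow> x" by (auto simp: closure_sequential)
  then have "\<forall>n. \<exists>y. (u n, y) \<in> G" by force
  then obtain v where v: "\<And>n. (u n, v n) \<in> G" by metis
  have "norm (v m - v n) \<le> c * norm (u m - u n)" for m n
   using assms(2) subspace_diff[OF assms(1) v[of m] v[of n]] by simp
  \<comment> \<open>The constant \<open>c\<close> may be zero or negative;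
    \<open>\<bar>c\<bar> + 1\<close> can be divided by.\<close>
  then have le: "norm (v m - v n) \<le> (\<bar>c\<bar> + 1) * norm (u m - u n)" for m n
   by (smt (verit) mult_right_mono norm_ge_zero)
  have "Cauchy u" using u(2) by (rule LIMSEQ_imp_Cauchy)
  have "Cauchy v"
  proof (rule CauchyI)
   fix e :: real assume "0 < e"
   then have "0 < e / (\<bar>c\<bar> + 1)" by simp
   then obtain M where M: "\<And>m n. m \<ge> M \<Longrightarrow> n \<ge> M \<Longrightarrow> norm (u m - u n) < e / (\<bar>c\<bar> + 1)"
    using CauchyD[OF \<open>Cauchy u\<close>] by blast
   have "norm (v m - v n) < e" if "m \<ge> M" "n \<ge> M" for m n
    using le[of m n] M[OF that] by (smt (verit) mult.commute pos_less_divide_eq)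
   then show "\<exists>M. \<forall>m\<ge>M. \<forall>n\<ge>M. norm (v m - v n) < e" by blast
  qed
  then obtain y where "v \<longlonglongrightarrow> y" using Cauchy_convergent convergent_def by blast
  then have "(\<lambda>n. (u n, v n)) \<longlonglongrightarrow> (x, y)" using u(2) by (intro tendsto_Pair)
  then have "(x, y) \<in> closure G" using v unfolding closure_sequential by (intro exI[of _ "\<lambda>n. (u n, v n)"]) auto
  then show ?thesis by blast
 qed
 then obtain t where t: "\<And>x. (x, t x) \<in> closure G" by metis
 have uniq: "y = t x" if "(x, y) \<in> closure G" for x y
 proof -
  have "(x - x, y - t x) \<in> closure G" using subspace_diff[OF sub that t[of x]] by simp
  then have "norm (y - t x) \<le> c * norm (x - x)" by (rule bd)
  then show ?thesis by simp
 qed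
 have "bounded_linear t"
 proof (rule bounded_linear_intro[of _ c])
  show "t (x + y) = t x + t y" for x y
   using uniq[of "x + y" "t x + t y"] subspace_add[OF sub t[of x] t[of y]] by simp
  show "t (r *\<^sub>R x) = r *\<^sub>R t x" for r x
   using uniq[of "r *\<^sub>R x" "r *\<^sub>R t x"] subspace_scale[OF sub t[of x], of r] by simp
  show "norm (t x) \<le> norm x * c" for x using bd[OF t[of x]] by (simp add: mult.commute)
 qed
 then obtain T where T: "\<And>x. app T x = t x" using blinfunI by blast
 show ?thesis
 proof (rule that)
  show "T x = y" if "(x, y) \<in> G" for x y using uniq[of x y] that closure_subset T by auto
  show "norm (T x) \<le> c * norm x" for x using T bd[OF t[of x]] by simp
 qed
qed

text \<open>The power trick: with \<open>a m = b(\<xi>, C\<^sup>m \<xi>)\<close> for a positive form \<open>b\<close> and an operator \<open>C\<close>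
 symmetric for it, it bounds \<open>C\<close> in the norm of \<open>b\<close> by its growth rate.\<close>

lemma power_trick:
 fixes a :: "nat \<Rightarrow> real"
 assumes "a 0 \<ge> 0" "\<rho> \<ge> 0" "K \<ge> 0"
  and cs: "\<And>m. (a m)\<^sup>2 \<le> a 0 * a (2 * m)"
  and bd: "\<And>m. a m \<le> K * \<rho> ^ m"
 shows "a 1 \<le> \<rho> * a 0"
proof (cases "a 0 = 0")
 case True
 then show ?thesis using cs[of 1] by simp
next
 case False
 then have a0: "a 0 > 0" using assms(1) by simp
 show ?thesis
 proof (rule ccontr)
  assume neg: "\<not> ?thesis"
  then have lt: "\<rho> * a 0 < a 1" by simp
  define q where "q = a 1 / a 0"
  have q: "q > \<rho>" "q > 0" using lt a0 assms(2)
    apply (simp_all add: q_def field_simps)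
   by (smt (verit) mult_nonneg_nonneg)
  \<comment> \<open>Squaring the lower bound and inserting it into \<open>cs\<close> doubles the
    exponent. Along powers of two, \<open>a\<close> thus grows at least like powers of
    \<open>q\<close>, faster than \<open>\<rho>\<close> permits.\<close>
  have ge: "a (2 ^ n) \<ge> a 0 * q ^ (2 ^ n)" for n
  proof (induction n)
   case 0 then show ?case using a0 by (simp add: q_def)
  next
   case (Suc n)
   have "(a 0 * q ^ 2 ^ n)\<^sup>2 \<le> (a (2 ^ n))\<^sup>2" using Suc a0 q by (intro power_mono) auto
   also have "\<dots> \<le> a 0 * a (2 ^ Suc n)" using cs[of "2 ^ n"] by simp
   finally have "a 0 * (a 0 * q ^ (2 ^ Suc n)) \<le> a 0 * a (2 ^ Suc n)"
    by (simp add: power2_eq_square power_mult_distrib power_mult[symmetric] power_add[symmetric] algebra_simps mult_2)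
   then show ?case using a0 by simp
  qed
  show False
  proof (cases "\<rho> = 0")
   case True
   then show ?thesis using bd[of 1] lt by simp
  next
   case False
   then have "\<rho> > 0" using assms(2) by simp
   then have r1: "q / \<rho> > 1" using q by simp
   obtain N where N: "K / a 0 < (q / \<rho>) ^ N" using real_arch_pow[OF r1] by blast
   \<comment> \<open>The growth estimate is available only at powers of two, and
     \<open>2 ^ N\<close> is such an exponent beyond \<open>N\<close>.\<close>
   have "N < 2 ^ N" by (rule less_exp)
   then have "(q / \<rho>) ^ N \<le> (q / \<rho>) ^ (2 ^ N)" using r1 by (intro power_increasing) auto
   then have "K / a 0 < q ^ (2 ^ N) / \<rho> ^ (2 ^ N)" using N by (simp add: power_divide)
   then have "K * \<rho> ^ (2 ^ N) < a 0 * q ^ (2 ^ N)" using a0 \<open>\<rho> > 0\<close> by (simp add: field_simps)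
   then show False using ge[of N] bd[of "2 ^ N"] by linarith
  qed
 qed
qed

section \<open>Continuous functional calculus for operators between 0 and 1\<close>

definition unit_op :: "('a::real_inner \<Rightarrow>\<^sub>L 'a) \<Rightarrow> bool" where
 "unit_op R \<longleftrightarrow> (\<forall>x y. inner (app R x) y = inner x (app R y)) \<and>
   (\<forall>x. 0 \<le> inner x (app R x)) \<and> (\<forall>x. inner x (app R x) \<le> inner x x)"

primrec opow :: "('a::real_normed_vector \<Rightarrow>\<^sub>L 'a) \<Rightarrow> nat \<Rightarrow> 'a \<Rightarrow>\<^sub>L 'a" where
 "opow R 0 = id_blinfun"
| "opow R (Suc n) = R o\<^sub>L opow R n"

lemma blinfun_compose_assoc: "(A o\<^sub>L B) o\<^sub>L C = A o\<^sub>L (B o\<^sub>L C)"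
 by (rule blinfun_eqI) simp

lemma blinfun_compose_id [simp]: "A o\<^sub>L id_blinfun = A" "id_blinfun o\<^sub>L A = A"
 by (auto intro: blinfun_eqI)

lemma blinfun_compose_simps:
 "(A + B) o\<^sub>L C = (A o\<^sub>L C) + (B o\<^sub>L C)" "A o\<^sub>L (D + E) = (A o\<^sub>L D) + (A o\<^sub>L E)"
 "(A - B) o\<^sub>L C = (A o\<^sub>L C) - (B o\<^sub>L C)" "A o\<^sub>L (D - E) = (A o\<^sub>L D) - (A o\<^sub>L E)"
 "(r *\<^sub>R A) o\<^sub>L C = r *\<^sub>R (A o\<^sub>L C)" "A o\<^sub>L (r *\<^sub>R D) = r *\<^sub>R (A o\<^sub>L D)"
 "(- A) o\<^sub>L C = - (A o\<^sub>L C)" "A o\<^sub>L (- D) = - (A o\<^sub>L D)"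
 by (auto intro!: blinfun_eqI simp: blinfun.bilinear_simps)

lemmas blinfun_compose_sum =
 bounded_bilinear.sum_right[OF bounded_bilinear_blinfun_compose]
 bounded_bilinear.sum_left[OF bounded_bilinear_blinfun_compose]

lemma opow_commute:
 assumes "X o\<^sub>L R1 = R2 o\<^sub>L X"
 shows "X o\<^sub>L opow R1 n = opow R2 n o\<^sub>L X"
proof (induction n)
 case (Suc n)
 have "X o\<^sub>L opow R1 (Suc n) = (R2 o\<^sub>L X) o\<^sub>L opow R1 n"
  by (simp add: assms blinfun_compose_assoc[symmetric])
 also have "\<dots> = opow R2 (Suc n) o\<^sub>L X" by (simp add: Suc blinfun_compose_assoc)
 finally show ?case .
qed simp

lemma opow_self: "R o\<^sub>L opow R n = opow R n o\<^sub>L R"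
 by (rule opow_commute) simp

lemma unit_op_compl: "unit_op R \<Longrightarrow> unit_op (id_blinfun - R)"
 by (simp add: unit_op_def blinfun.diff_left inner_diff)

text \<open>For a symmetric operator the quadratic form controls the norm: polarisation bounds
  \<open>inner (T x) y\<close> by the form at \<open>x + y\<close> and at
  \<open>x - y\<close>.\<close>

lemma norm_sym_le:
 fixes T :: "'a::real_inner \<Rightarrow>\<^sub>L 'a"
 assumes sym: "\<And>x y. inner (T x) y = inner x (T y)"
  and bd: "\<And>x. \<bar>inner x (T x)\<bar> \<le> c * (norm x)\<^sup>2" and c0: "c \<ge> 0"
 shows "norm T \<le> c"
proof -
 have le: "2 * inner (T x) y \<le> c * ((norm x)\<^sup>2 + (norm y)\<^sup>2)" for x y
 proof -
  have "4 * inner (T x) y = inner (x + y) (T (x + y)) - inner (x - y) (T (x - y))"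
   using sym[of x y] by (simp add: blinfun.bilinear_simps inner_add inner_diff inner_commute[of y "T x"])
  also have "\<dots> \<le> c * (norm (x + y))\<^sup>2 + c * (norm (x - y))\<^sup>2"
   using bd[of "x + y"] bd[of "x - y"] by linarith
  also have "\<dots> = 2 * (c * ((norm x)\<^sup>2 + (norm y)\<^sup>2))"
   by (simp only: power2_norm_eq_inner) (simp add: inner_add inner_diff inner_commute algebra_simps)
  finally show ?thesis by simp
 qed
 have nle: "norm (T x) \<le> c * norm x" for x
 proof (cases "T x = 0 \<or> x = 0")
  case True
  then show ?thesis using c0 by (auto simp: blinfun.zero_right)
 next
  case False
  \<comment> \<open>The scaling gives \<open>t *\<^sub>R T x\<close> the norm of \<open>x\<close>,
    for which the bound \<open>le\<close> is best.\<close>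
  define t where "t = norm x / norm (T x)"
  have t: "t > 0" "t * norm (T x) = norm x" using False by (auto simp: t_def)
  have "2 * inner (T x) (t *\<^sub>R T x) \<le> c * ((norm x)\<^sup>2 + (norm (t *\<^sub>R T x))\<^sup>2)" by (rule le)
  then have "2 * (t * (norm (T x))\<^sup>2) \<le> c * ((norm x)\<^sup>2 + (norm x)\<^sup>2)"
   using t by (simp add: power2_norm_eq_inner)
  then have "t * norm (T x) * norm (T x) \<le> c * norm x * norm x" by (simp add: power2_eq_square mult.assoc)
  then have "norm x * norm (T x) \<le> norm x * (c * norm x)"
   by (simp only: t(2)) (simp add: mult_ac)
  then show ?thesis using False by (simp add: mult_le_cancel_left)
 qed
 then show ?thesis using c0 by (intro norm_blinfun_bound) auto
qed

text \<open>The Bernstein basis polynomial evaluated at an operator. For \<open>R\<close> between 0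
  and 1 these operators are positive and sum to the identity, which bounds \<open>bern_op\<close> by
  the supremum of the function without spectral theory.\<close>

definition bern :: "('a::real_normed_vector \<Rightarrow>\<^sub>L 'a) \<Rightarrow> nat \<Rightarrow> nat \<Rightarrow> 'a \<Rightarrow>\<^sub>L 'a" where
 "bern R n k = real (n choose k) *\<^sub>R (opow R k o\<^sub>L opow (id_blinfun - R) (n - k))"

definition bern_op :: "('a::real_normed_vector \<Rightarrow>\<^sub>L 'a) \<Rightarrow> nat \<Rightarrow> (real \<Rightarrow> real) \<Rightarrow> 'a \<Rightarrow>\<^sub>L 'a" where
 "bern_op R n f = (\<Sum>k\<le>n. f (real k / real n) *\<^sub>R bern R n k)"

text \<open>Continuous functional calculus as the norm limit of Bernstein polynomials in
  \<open>R\<close>. It is indexed by functions on all of the unit interval, not on the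
  spectrum.\<close>

definition fc :: "('a::real_normed_vector \<Rightarrow>\<^sub>L 'a) \<Rightarrow> (real \<Rightarrow> real) \<Rightarrow> 'a \<Rightarrow>\<^sub>L 'a" where
 "fc R f = lim (\<lambda>n. bern_op R n f)"

lemma opow_sym:
 assumes "\<And>x y. inner (app R x) y = inner x (app R y)"
 shows "inner (opow R n x) y = inner x (opow R n y)"
proof (induction n arbitrary: x y)
 case (Suc n)
 have "inner (opow R (Suc n) x) y = inner x (opow R n (R y))" by (simp add: assms Suc)
 also have "opow R n (R y) = opow R (Suc n) y"
  using arg_cong[OF opow_self[of R n], of "\<lambda>T. app T y"] by simp
 finally show ?case .
qed simp

lemma opow_commutes:
 fixes R :: "'a::real_normed_vector \<Rightarrow>\<^sub>L 'a"
 shows "opow R m (opow (id_blinfun - R) n x) = opow (id_blinfun - R) n (opow R m x)"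
proof -
 have "R o\<^sub>L (id_blinfun - R) = (id_blinfun - R) o\<^sub>L R" by (simp add: blinfun_compose_simps)
 then have "R o\<^sub>L opow (id_blinfun - R) n = opow (id_blinfun - R) n o\<^sub>L R" by (rule opow_commute)
 then have "opow (id_blinfun - R) n o\<^sub>L opow R m = opow R m o\<^sub>L opow (id_blinfun - R) n"
  by (intro opow_commute) simp
 from arg_cong[OF this, of "\<lambda>T. app T x"] show ?thesis by simp
qed

lemma opow_mixed_sym:
 assumes "unit_op R"
 shows "inner (opow R m (opow (id_blinfun - R) n x)) y = inner x (opow R m (opow (id_blinfun - R) n y))"
proof -
 have s: "inner (app R x) y = inner x (app R y)"
  "inner (app (id_blinfun - R) x) y = inner x (app (id_blinfun - R) y)" for x y
  using assms unit_op_compl[OF assms] by (auto simp: unit_op_def)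
 show ?thesis by (simp add: opow_sym[OF s(1)] opow_sym[OF s(2)] opow_commutes)
qed

text \<open>Pairs of equal factors are distributed to the two sides of the inner product until both
  exponents are at most one. The remaining product of \<open>R\<close> and \<open>S = 1 - R\<close>
  is positive because RS = RSR + SRS.\<close>

lemma opow_mixed_pos:
 fixes R :: "'a::real_inner \<Rightarrow>\<^sub>L 'a"
 assumes R: "unit_op R"
 shows "0 \<le> inner x (opow R m (opow (id_blinfun - R) n x))"
proof (induction "m + n" arbitrary: m n x rule: less_induct)
 case less
 define S where "S = id_blinfun - R"
 have S: "unit_op S" unfolding S_def by (rule unit_op_compl[OF R])
 have Rs: "inner (R x) y = inner x (R y)" and Ss: "inner (S x) y = inner x (S y)" for x y
  using R S by (auto simp: unit_op_def)
 have RS: "R (S x) = S (R x)" for x by (simp add: S_def blinfun.bilinear_simps)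
 have Ro: "R (opow R m x) = opow R m (R x)" for m x
  using arg_cong[OF opow_self[of R m], of "\<lambda>T. app T x"] by simp
 have So: "S (opow S m x) = opow S m (S x)" for m x
  using arg_cong[OF opow_self[of S m], of "\<lambda>T. app T x"] by simp
 have c: "opow R m (opow S n x) = opow S n (opow R m x)" for m n x
  unfolding S_def by (rule opow_commutes)
 have RSo: "R (opow S n x) = opow S n (R x)" for n x using c[of 1 n x] by simp
 have SRo: "S (opow R m x) = opow R m (S x)" for m x using c[of m 1 x] by simp
 consider (a) m' where "m = Suc (Suc m')" | (b) n' where "n = Suc (Suc n')" | (c) "m \<le> 1" "n \<le> 1"
 proof (cases "m \<le> 1")
  case False
  then have "m = Suc (Suc (m - 2))" by simp
  then show ?thesis using that(1) by blast
 next
  case m: True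
  show ?thesis
  proof (cases "n \<le> 1")
   case False
   then have "n = Suc (Suc (n - 2))" by simp
   then show ?thesis using that(2) by blast
  qed (use that m in auto)
 qed
 then have "0 \<le> inner x (opow R m (opow S n x))"
 proof cases
  case a
  have "0 \<le> inner (R x) (opow R m' (opow S n (R x)))"
   unfolding S_def by (rule less) (simp add: a)
  then show ?thesis by (simp add: a Rs Ro RSo)
 next
  case b
  have "0 \<le> inner (S x) (opow R m (opow S n' (S x)))"
   using less[of m n' "S x"] by (simp add: b S_def)
  then show ?thesis by (simp add: b Ss So SRo)
 next
  case c
  have R0: "0 \<le> inner x (R x)" and S0: "0 \<le> inner x (S x)" for x using R S by (auto simp: unit_op_def)
  have "inner x (R (S x)) = inner (R x) (S (R x)) + inner (S x) (R (S x))"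
  proof -
   have "inner (R x) (S (R x)) + inner (S x) (R (S x)) = inner x (R (S (R x + S x)))"
    by (simp add: Rs Ss RS blinfun.bilinear_simps inner_add)
   also have "R x + S x = x" by (simp add: S_def blinfun.bilinear_simps)
   finally show ?thesis by simp
  qed
  then have "0 \<le> inner x (R (S x))" using R0[of "S x"] S0[of "R x"] by simp
  then show ?thesis using c R0 S0 by (cases m; cases n) auto
 qed
 then show ?case by (simp add: S_def)
qed

lemma bern_pos: "unit_op R \<Longrightarrow> 0 \<le> inner x (bern R n k x)"
 using opow_mixed_pos[of R x] by (simp add: bern_def blinfun.scaleR_left)

lemma bern_sym: "unit_op R \<Longrightarrow> inner (bern R n k x) y = inner x (bern R n k y)"
 using opow_mixed_sym[of R] by (simp add: bern_def blinfun.scaleR_left)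

lemma bern_0: "bern R n k = 0" if "k > n"
 using that by (simp add: bern_def binomial_eq_0)

text \<open>Multiplication by \<open>R\<close> raises both indices and produces the factor (k +
  1)/(n + 1), which is exactly the node that belongs to the new indices.\<close>

lemma bern_step: "real (Suc k) *\<^sub>R bern R (Suc n) (Suc k) = real (Suc n) *\<^sub>R (R o\<^sub>L bern R n k)"
proof -
 have "real (Suc k) * real (Suc n choose Suc k) = real (Suc n) * real (n choose k)"
  using Suc_times_binomial_eq[of n k] by (metis of_nat_mult mult.commute)
 then show ?thesis
  by (simp add: bern_def blinfun_compose_simps blinfun_compose_assoc mult.commute del: of_nat_Suc binomial_Suc_Suc)
qed

text \<open>Pascal's rule for the operator polynomials.\<close>

lemma bern_Suc:
 "bern R (Suc n) (Suc k) = (R o\<^sub>L bern R n k) + ((id_blinfun - R) o\<^sub>L bern R n (Suc k))"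
proof (cases "k < n")
 case True
 then have eq: "n - k = Suc (n - Suc k)" by simp
 have "(id_blinfun - R) o\<^sub>L (opow R (Suc k) o\<^sub>L opow (id_blinfun - R) (n - Suc k))
   = opow R (Suc k) o\<^sub>L opow (id_blinfun - R) (n - k)"
  unfolding eq by (rule blinfun_eqI) (use opow_commutes[of R "Suc k" 1] in simp)
 then show ?thesis
  by (simp add: bern_def blinfun_compose_simps blinfun_compose_assoc scaleR_add_left eq)
next
 case False
 show ?thesis
 proof (cases "k = n")
  case True
  then show ?thesis by (simp add: bern_def blinfun_compose_simps blinfun_compose_assoc)
 next
  case f: False
  then have "k > n" using False by simp
  then show ?thesis by (simp add: bern_0)
 qed
qed

lemma sum_bern: "(\<Sum>k\<le>n. bern R n k) = id_blinfun"
proof (induction n)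
 case 0
 then show ?case by (simp add: bern_def)
next
 case (Suc n)
 have "(\<Sum>k\<le>Suc n. bern R (Suc n) k) = bern R (Suc n) 0 + (\<Sum>k\<le>n. bern R (Suc n) (Suc k))"
  by (rule sum.atMost_Suc_shift)
 also have "(\<Sum>k\<le>n. bern R (Suc n) (Suc k))
   = (R o\<^sub>L (\<Sum>k\<le>n. bern R n k)) + ((id_blinfun - R) o\<^sub>L (\<Sum>k\<le>n. bern R n (Suc k)))"
  by (simp add: bern_Suc sum.distrib blinfun_compose_sum)
 also have "(\<Sum>k\<le>n. bern R n (Suc k)) = (\<Sum>k\<le>Suc n. bern R n k) - bern R n 0"
  by (subst sum.atMost_Suc_shift) simp
 also have "(\<Sum>k\<le>Suc n. bern R n k) = id_blinfun" using Suc by (simp add: bern_0)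
 finally show ?case using Suc by (simp add: bern_def blinfun_compose_simps)
qed

lemma bern_op_linear:
 "bern_op R n (\<lambda>x. a * f x + b * g x) = a *\<^sub>R bern_op R n f + b *\<^sub>R bern_op R n g"
 by (simp add: bern_op_def scaleR_sum_right sum.distrib scaleR_add_left)

lemma bern_op_const: "bern_op R n (\<lambda>x. c) = c *\<^sub>R id_blinfun"
 by (simp add: bern_op_def scaleR_sum_right[symmetric] sum_bern)

lemma bern_op_sym: "unit_op R \<Longrightarrow> inner (bern_op R n f x) y = inner x (bern_op R n f y)"
 by (simp add: bern_op_def blinfun.sum_left blinfun.scaleR_left inner_sum_left inner_sum_right bern_sym)

lemma nat_frac_01: "k \<le> n \<Longrightarrow> real k / real n \<in> {0..1}"
 by (cases "n = 0") auto

lemma bern_op_mono: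
 assumes "unit_op R" "\<And>x. 0 \<le> x \<Longrightarrow> x \<le> 1 \<Longrightarrow> f x \<le> g x"
 shows "inner x (bern_op R n f x) \<le> inner x (bern_op R n g x)"
 using assms nat_frac_01 by (auto simp: bern_op_def blinfun.sum_left blinfun.scaleR_left inner_sum_right
   intro!: sum_mono mult_right_mono bern_pos)

lemma bern_op_bound:
 assumes "unit_op R" "\<And>x. 0 \<le> x \<Longrightarrow> x \<le> 1 \<Longrightarrow> \<bar>f x\<bar> \<le> c"
 shows "norm (bern_op R n f) \<le> c"
proof (rule norm_sym_le)
 show "c \<ge> 0" using assms(2)[of 0] by simp
 fix x
 have "inner x (bern_op R n f x) \<le> inner x (bern_op R n (\<lambda>x. c) x)"
  using assms by (intro bern_op_mono) fastforce+
 moreover have "inner x (bern_op R n (\<lambda>x. - c) x) \<le> inner x (bern_op R n f x)"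
  using assms by (intro bern_op_mono) fastforce+
 ultimately show "\<bar>inner x (bern_op R n f x)\<bar> \<le> c * (norm x)\<^sup>2"
  by (simp add: bern_op_const blinfun.scaleR_left blinfun.minus_left power2_norm_eq_inner)
qed (simp add: bern_op_sym assms)

lemma bern_op_diff: "bern_op R n (\<lambda>x. f x - g x) = bern_op R n f - bern_op R n g"
 using bern_op_linear[of R n 1 f "-1" g] by simp

text \<open>By \<open>bern_step\<close> both operators are combinations of the same
  \<open>R o\<^sub>L bern R n k\<close>, with \<open>f\<close> evaluated at (k + 1)/(n + 1) and at
  k/n. These nodes differ by at most 1/(n + 1), so uniform continuity makes all coefficients of the
  difference small at once.\<close>

lemma bern_op_times_ident:
 assumes R: "unit_op R" and f: "cont01 f"
 shows "(\<lambda>n. bern_op R (Suc n) (\<lambda>x. x * f x) - (R o\<^sub>L bern_op R n f)) \<longlonglongrightarrow> 0"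
proof (rule LIMSEQ_I)
 fix e :: real assume e: "0 < e"
 have "uniformly_continuous_on {0..1} f" using f by (rule compact_uniformly_continuous) simp
 then obtain d where d: "d > 0" "\<And>x y. x \<in> {0..1} \<Longrightarrow> y \<in> {0..1} \<Longrightarrow> dist y x < d \<Longrightarrow> dist (f y) (f x) < e / 2"
  unfolding uniformly_continuous_on_def using e by (metis half_gt_zero)
 obtain N :: nat where N: "1 / d < real N" using reals_Archimedean2 by blast
 have nR: "norm R \<le> 1"
 proof (rule norm_sym_le)
  show "inner (R x) y = inner x (R y)" for x y using R by (simp add: unit_op_def)
  show "\<bar>inner x (R x)\<bar> \<le> 1 * (norm x)\<^sup>2" for x using R by (simp add: unit_op_def power2_norm_eq_inner)
 qed simp
 have "norm (bern_op R (Suc n) (\<lambda>x. x * f x) - (R o\<^sub>L bern_op R n f)) < e" if n: "n \<ge> Suc N" for n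
 proof -
  have "bern_op R (Suc n) (\<lambda>x. x * f x)
    = (\<Sum>k\<le>n. (f (real (Suc k) / real (Suc n)) / real (Suc n)) *\<^sub>R (real (Suc k) *\<^sub>R bern R (Suc n) (Suc k)))"
   unfolding bern_op_def by (subst sum.atMost_Suc_shift) (simp add: mult.commute del: of_nat_Suc)
  also have "\<dots> = (\<Sum>k\<le>n. f (real (Suc k) / real (Suc n)) *\<^sub>R (R o\<^sub>L bern R n k))"
   unfolding bern_step by (simp del: of_nat_Suc)
  also have "\<dots> = R o\<^sub>L (\<Sum>k\<le>n. f (real (Suc k) / real (Suc n)) *\<^sub>R bern R n k)"
   by (simp add: blinfun_compose_sum blinfun_compose_simps)
  finally have eq: "bern_op R (Suc n) (\<lambda>x. x * f x) - (R o\<^sub>L bern_op R n f)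
   = R o\<^sub>L (\<Sum>k\<le>n. (f (real (Suc k) / real (Suc n)) - f (real k / real n)) *\<^sub>R bern R n k)"
   by (simp add: bern_op_def blinfun_compose_simps(4)[symmetric] sum_subtractf[symmetric] scaleR_diff_left)
  define T where "T = (\<Sum>k\<le>n. (f (real (Suc k) / real (Suc n)) - f (real k / real n)) *\<^sub>R bern R n k)"
  have small: "\<bar>f (real (Suc k) / real (Suc n)) - f (real k / real n)\<bar> \<le> e / 2" if "k \<le> n" for k
  proof -
   have n0: "real n > 0" using n by simp
   have "real (Suc k) / real (Suc n) - real k / real n = (real n - real k) / (real n * real (Suc n))"
    using n0 by (simp add: field_simps)
   moreover have "0 \<le> (real n - real k) / (real n * real (Suc n))" using that n0 by simp
   moreover have "(real n - real k) / (real n * real (Suc n)) \<le> real n / (real n * real (Suc n))"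
    using n0 by (intro divide_right_mono) auto
   moreover have "real n / (real n * real (Suc n)) = 1 / real (Suc n)" using n0 by simp
   moreover have "1 / real (Suc n) < d"
   proof -
    have "1 / d < real (Suc n)" using N n by linarith
    then show ?thesis using d(1) by (simp add: field_simps)
   qed
   ultimately have "dist (real (Suc k) / real (Suc n)) (real k / real n) < d" by (simp add: dist_real_def)
   moreover have "real (Suc k) / real (Suc n) \<in> {0..1}" "real k / real n \<in> {0..1}" using that n0 by auto
   ultimately have "dist (f (real (Suc k) / real (Suc n))) (f (real k / real n)) < e / 2" using d(2) by blast
   then show ?thesis by (simp add: dist_real_def)
  qed
  have "norm T \<le> e / 2"
  proof (rule norm_sym_le)
   show "inner (T x) y = inner x (T y)" for x y
    by (simp add: T_def blinfun.sum_left blinfun.scaleR_left inner_sum_left inner_sum_right bern_sym R)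
   fix x
   have "\<bar>inner x (T x)\<bar> \<le> (\<Sum>k\<le>n. \<bar>(f (real (Suc k) / real (Suc n)) - f (real k / real n)) * inner x (bern R n k x)\<bar>)"
    by (simp add: T_def blinfun.sum_left blinfun.scaleR_left inner_sum_right sum_abs)
   also have "\<dots> \<le> (\<Sum>k\<le>n. (e / 2) * inner x (bern R n k x))"
   proof (rule sum_mono)
    fix k assume "k \<in> {..n}"
    then show "\<bar>(f (real (Suc k) / real (Suc n)) - f (real k / real n)) * inner x (bern R n k x)\<bar>
      \<le> (e / 2) * inner x (bern R n k x)"
     using mult_right_mono[OF small[of k] bern_pos[OF R, of x n k]] bern_pos[OF R, of x n k]
     by (simp only: abs_mult abs_of_nonneg atMost_iff)
   qed
   also have "\<dots> = (e / 2) * inner x ((\<Sum>k\<le>n. bern R n k) x)"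
    by (simp add: sum_distrib_left blinfun.sum_left inner_sum_right)
   finally show "\<bar>inner x (T x)\<bar> \<le> e / 2 * (norm x)\<^sup>2" by (simp add: sum_bern power2_norm_eq_inner)
  qed (use e in simp)
  then have "norm R * norm T \<le> 1 * (e / 2)" using nR by (intro mult_mono) auto
  then have "norm (R o\<^sub>L T) \<le> 1 * (e / 2)" using norm_blinfun_compose[of R T] by linarith
  then show ?thesis using eq e by (simp add: T_def)
 qed
 then show "\<exists>no. \<forall>n\<ge>no. norm (bern_op R (Suc n) (\<lambda>x. x * f x) - (R o\<^sub>L bern_op R n f) - 0) < e" by auto
qed

lemma bern_op_limit_times_ident:
 assumes R: "unit_op R" and f: "cont01 f" and lim: "(\<lambda>n. bern_op R n f) \<longlonglongrightarrow> F"
 shows "(\<lambda>n. bern_op R n (\<lambda>x. x * f x)) \<longlonglongrightarrow> (R o\<^sub>L F)"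
proof -
 have "(\<lambda>n. R o\<^sub>L bern_op R n f) \<longlonglongrightarrow> (R o\<^sub>L F)" by (intro tendsto_intros lim)
 from tendsto_add[OF bern_op_times_ident[OF R f] this]
 have "(\<lambda>n. bern_op R (Suc n) (\<lambda>x. x * f x)) \<longlonglongrightarrow> (R o\<^sub>L F)" by simp
 then show ?thesis by (rule LIMSEQ_imp_Suc)
qed

lemma bern_op_limit_linear:
 assumes "(\<lambda>n. bern_op R n f) \<longlonglongrightarrow> F" "(\<lambda>n. bern_op R n g) \<longlonglongrightarrow> G"
 shows "(\<lambda>n. bern_op R n (\<lambda>x. a * f x + b * g x)) \<longlonglongrightarrow> a *\<^sub>R F + b *\<^sub>R G"
 unfolding bern_op_linear by (intro tendsto_intros assms)

text \<open>Weierstrass approximation packaged as an induction rule: constants, multiplication by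
  the variable and linear combinations produce every Bernstein polynomial, and \<open>limit\<close>
  passes to uniform limits.\<close>

lemma continuous_function_induct [consumes 1, case_names const ident linear limit]:
 fixes f :: "real \<Rightarrow> real"
 assumes f: "cont01 f"
  and const: "\<And>c. P (\<lambda>x. c)"
  and ident: "\<And>g. cont01 g \<Longrightarrow> P g \<Longrightarrow> P (\<lambda>x. x * g x)"
  and linear: "\<And>g h a b. cont01 g \<Longrightarrow> cont01 h \<Longrightarrow> P g \<Longrightarrow> P h \<Longrightarrow> P (\<lambda>x. a * g x + b * h x)"
  and limit: "\<And>g. cont01 g \<Longrightarrow>
   (\<And>e. e > 0 \<Longrightarrow> \<exists>h. cont01 h \<and> P h \<and> (\<forall>x\<in>{0..1}. \<bar>g x - h x\<bar> \<le> e)) \<Longrightarrow> P g"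
 shows "P f"
proof (rule limit[OF f])
 fix e :: real assume "e > 0"
 obtain N where N: "\<And>n x. N \<le> n \<Longrightarrow> x \<in> {0..1} \<Longrightarrow> \<bar>f x - (\<Sum>k\<le>n. f (k / n) * Bernstein n k x)\<bar> < e"
  using Bernstein_Weierstrass[OF f \<open>e > 0\<close>] by blast
 have pw: "P (\<lambda>x. x ^ k)" for k :: nat
 proof (induction k)
  case (Suc k)
  then show ?case using ident[of "\<lambda>x. x ^ k"] by (simp add: continuous_intros)
 qed (simp add: const)
 have pm: "P (\<lambda>x. x ^ k * (1 - x) ^ m)" for k m :: nat
 proof (induction m arbitrary: k)
  case (Suc m)
  have "P (\<lambda>x. 1 * (x ^ k * (1 - x) ^ m) + (- 1) * (x ^ Suc k * (1 - x) ^ m))"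
   by (intro linear Suc continuous_intros)
  then show ?case by (simp add: algebra_simps)
 qed (simp add: pw)
 have ps: "P (\<lambda>x. \<Sum>k<m. c k * Bernstein n k x)" for c m n
 proof (induction m)
  case 0 then show ?case by (simp add: const)
 next
  case (Suc m)
  have "P (\<lambda>x. 1 * (\<Sum>k<m. c k * Bernstein n k x) + (c m * real (n choose m)) * (x ^ m * (1 - x) ^ (n - m)))"
   by (intro linear Suc pm continuous_intros) (auto simp: Bernstein_def intro!: continuous_intros)
  then show ?case by (simp add: Bernstein_def mult.assoc)
 qed
 have "P (\<lambda>x. \<Sum>k\<le>N. f (k / N) * Bernstein N k x)"
  using ps[where c = "\<lambda>k. f (k / N)" and m = "Suc N" and n = N] by (simp add: lessThan_Suc_atMost)
 moreover have "cont01 (\<lambda>x. \<Sum>k\<le>N. f (k / N) * Bernstein N k x)"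
  by (auto simp: Bernstein_def intro!: continuous_intros)
 ultimately show "\<exists>h. cont01 h \<and> P h \<and> (\<forall>x\<in>{0..1}. \<bar>f x - h x\<bar> \<le> e)"
  using N[of N] by (intro exI[of _ "\<lambda>x. \<Sum>k\<le>N. f (k / N) * Bernstein N k x"]) (auto intro: less_imp_le)
qed

text \<open>Meant for identities between expressions linear in a continuous function, with
  \<open>D\<close> the difference of the two sides. The bound by the supremum disposes of the case
  \<open>limit\<close> once and for all.\<close>

lemma continuous_function_vanish:
 fixes D :: "(real \<Rightarrow> real) \<Rightarrow> 'a::real_normed_vector"
 assumes "cont01 f" and const: "\<And>c. D (\<lambda>x. c) = 0"
  and ident: "\<And>g. cont01 g \<Longrightarrow> D g = 0 \<Longrightarrow> D (\<lambda>x. x * g x) = 0"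
  and linear: "\<And>g h a b. cont01 g \<Longrightarrow> cont01 h \<Longrightarrow> D (\<lambda>x. a * g x + b * h x) = a *\<^sub>R D g + b *\<^sub>R D h"
  and bound: "\<And>g e. cont01 g \<Longrightarrow> (\<And>x. x \<in> {0..1} \<Longrightarrow> \<bar>g x\<bar> \<le> e) \<Longrightarrow> norm (D g) \<le> K * e"
 shows "D f = 0"
 using assms(1)
proof (induction rule: continuous_function_induct)
 case (limit g)
 have "norm (D g) \<le> 0 + e" if "e > 0" for e
 proof -
  define d where "d = e / (\<bar>K\<bar> + 1)"
  have d: "d > 0" "(\<bar>K\<bar> + 1) * d = e" using that by (auto simp: d_def add_nonneg_pos)
  obtain h where h: "cont01 h" "D h = 0" "\<And>x. x \<in> {0..1} \<Longrightarrow> \<bar>g x - h x\<bar> \<le> d"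
   using limit(2)[OF d(1)] by auto
  have "norm (D (\<lambda>x. 1 * g x + (- 1) * h x)) \<le> K * d" by (intro bound continuous_intros limit(1) h(1)) (use h(3) in simp)
  moreover have "K * d \<le> (\<bar>K\<bar> + 1) * d" using d(1) by (intro mult_right_mono) auto
  ultimately show ?thesis unfolding linear[OF limit(1) h(1)] h(2) d(2) by simp
 qed
 from field_le_epsilon[OF this] show ?case by simp
qed (simp_all add: const ident linear)

lemma bern_op_convergent:
 fixes R :: "'a::{real_inner,banach} \<Rightarrow>\<^sub>L 'a"
 assumes R: "unit_op R" and f: "cont01 f"
 shows "convergent (\<lambda>n. bern_op R n f)"
 using f
proof (induction rule: continuous_function_induct)
 case (const c)
 then show ?case by (simp add: bern_op_const convergent_const)
next
 case (ident g)
 then show ?case using bern_op_limit_times_ident[OF R] by (meson convergent_def)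
next
 case (linear g h a b)
 then show ?case using bern_op_limit_linear[of R] by (meson convergent_def)
next
 case (limit g)
 show ?case
 proof (rule Cauchy_convergent, rule metric_CauchyI)
  fix e :: real assume "0 < e"
  then obtain h where h: "convergent (\<lambda>n. bern_op R n h)" "\<And>x. x \<in> {0..1} \<Longrightarrow> \<bar>g x - h x\<bar> \<le> e / 4"
   using limit(2)[of "e / 4"] by auto
  obtain M where M: "\<And>m n. m \<ge> M \<Longrightarrow> n \<ge> M \<Longrightarrow> dist (bern_op R m h) (bern_op R n h) < e / 4"
   using metric_CauchyD[OF convergent_Cauchy[OF h(1)], of "e / 4"] \<open>0 < e\<close> by auto
  have d: "dist (bern_op R n g) (bern_op R n h) \<le> e / 4" for n
   unfolding dist_norm bern_op_diff[symmetric] using h(2) by (intro bern_op_bound R) auto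
  have "dist (bern_op R m g) (bern_op R n g) < e" if "m \<ge> M" "n \<ge> M" for m n
   using d[of m] d[of n] M[OF that] \<open>0 < e\<close> dist_triangle[of "bern_op R m g" "bern_op R n g" "bern_op R m h"]
    dist_triangle2[of "bern_op R m h" "bern_op R n g" "bern_op R n h"] by linarith
  then show "\<exists>M. \<forall>m\<ge>M. \<forall>n\<ge>M. dist (bern_op R m g) (bern_op R n g) < e" by blast
 qed
qed

lemma fc_lim:
 fixes R :: "'a::{real_inner,banach} \<Rightarrow>\<^sub>L 'a"
 assumes "unit_op R" "cont01 f"
 shows "(\<lambda>n. bern_op R n f) \<longlonglongrightarrow> fc R f"
 using bern_op_convergent[OF assms] by (simp add: fc_def convergent_LIMSEQ_iff)

section \<open>Algebra, order and norm in the functional calculus\<close>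

context
 fixes R :: "'a::{real_inner,banach} \<Rightarrow>\<^sub>L 'a"
 assumes R: "unit_op R"
begin

lemma fc_linear:
 assumes "cont01 f" "cont01 g"
 shows "fc R (\<lambda>x. a * f x + b * g x) = a *\<^sub>R fc R f + b *\<^sub>R fc R g"
 by (rule LIMSEQ_unique[OF fc_lim[OF R] bern_op_limit_linear[OF fc_lim[OF R] fc_lim[OF R]]])
  (intro continuous_intros assms)+

lemma fc_add:
 "cont01 f \<Longrightarrow> cont01 g \<Longrightarrow> fc R (\<lambda>x. f x + g x) = fc R f + fc R g"
 using fc_linear[of f g 1 1] by simp

lemma fc_diff:
 "cont01 f \<Longrightarrow> cont01 g \<Longrightarrow> fc R (\<lambda>x. f x - g x) = fc R f - fc R g"
 using fc_linear[of f g 1 "-1"] by simp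

lemma fc_cmult: "cont01 f \<Longrightarrow> fc R (\<lambda>x. c * f x) = c *\<^sub>R fc R f"
 using fc_linear[of f f c 0] by simp

lemma fc_const: "fc R (\<lambda>x. c) = c *\<^sub>R id_blinfun"
 using LIMSEQ_unique[OF fc_lim[OF R, of "\<lambda>x. c"]] by (simp add: bern_op_const)

lemma fc_cong: "(\<And>x. x \<in> {0..1} \<Longrightarrow> f x = g x) \<Longrightarrow> fc R f = fc R g"
proof -
 assume "\<And>x. x \<in> {0..1} \<Longrightarrow> f x = g x"
 then have "bern_op R n f = bern_op R n g" for n
  unfolding bern_op_def using nat_frac_01 by (intro sum.cong) auto
 then show ?thesis by (simp add: fc_def)
qed

lemma fc_times_ident: "cont01 f \<Longrightarrow> fc R (\<lambda>x. x * f x) = R o\<^sub>L fc R f"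
 by (rule LIMSEQ_unique[OF fc_lim[OF R] bern_op_limit_times_ident[OF R _ fc_lim[OF R]]])
  (auto intro!: continuous_intros)

lemma fc_ident: "fc R (\<lambda>x. x) = R"
 using fc_times_ident[of "\<lambda>x. 1"] by (simp add: fc_const)

lemma fc_bound:
 assumes "cont01 f" "\<And>x. x \<in> {0..1} \<Longrightarrow> \<bar>f x\<bar> \<le> c"
 shows "norm (fc R f) \<le> c"
 using bern_op_bound[OF R, of f c] assms(2)
 by (intro LIMSEQ_le_const2[OF tendsto_norm[OF fc_lim[OF R assms(1)]]]) auto

lemma fc_mult:
 assumes f: "cont01 f" and g: "cont01 g"
 shows "fc R (\<lambda>x. f x * g x) = fc R f o\<^sub>L fc R g"
proof -
 have "bounded (g ` {0..1})" using g by (intro compact_imp_bounded compact_continuous_image) auto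
 then obtain B where "\<forall>x\<in>{0..1}. \<bar>g x\<bar> \<le> B" by (auto simp: bounded_iff)
 then have B: "x \<in> {0..1} \<Longrightarrow> \<bar>g x\<bar> \<le> B" for x by blast
 define D where "D h = fc R (\<lambda>x. h x * g x) - (fc R h o\<^sub>L fc R g)" for h
 have "D f = 0" using f
 proof (rule continuous_function_vanish[where K = "2 * B"])
  show "D (\<lambda>x. c) = 0" for c by (simp add: D_def g fc_cmult fc_const blinfun_compose_simps)
  show "D (\<lambda>x. x * h x) = 0" if h: "cont01 h" "D h = 0" for h
   using fc_times_ident[OF continuous_on_mult[OF h(1) g]] h
   by (simp add: D_def fc_times_ident blinfun_compose_assoc mult.assoc)
  show "D (\<lambda>x. a * h x + b * k x) = a *\<^sub>R D h + b *\<^sub>R D k" if c: "cont01 h" "cont01 k" for h k a b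
   using fc_linear[OF continuous_on_mult[OF c(1) g] continuous_on_mult[OF c(2) g], of a b]
   by (simp add: D_def fc_linear c blinfun_compose_simps algebra_simps)
  show "norm (D h) \<le> 2 * B * e" if h: "cont01 h" "\<And>x. x \<in> {0..1} \<Longrightarrow> \<bar>h x\<bar> \<le> e" for h e
  proof -
   have e: "0 \<le> e" using h(2)[of 0] by simp
   have "norm (fc R (\<lambda>x. h x * g x)) \<le> e * B"
    by (intro fc_bound continuous_intros h g) (use h(2) B e in \<open>auto simp: abs_mult intro!: mult_mono\<close>)
   moreover have "norm (fc R h) * norm (fc R g) \<le> e * B" by (intro mult_mono fc_bound h g B e) auto
   ultimately show ?thesis using norm_blinfun_compose[of "fc R h" "fc R g"]
     norm_triangle_ineq4[of "fc R (\<lambda>x. h x * g x)" "fc R h o\<^sub>L fc R g"]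
    unfolding D_def mult.assoc mult.commute[of B] by linarith
  qed
 qed
 then show ?thesis by (simp add: D_def)
qed

lemma fc_sym: "cont01 f \<Longrightarrow> inner (fc R f x) y = inner x (fc R f y)"
proof -
 assume f: "cont01 f"
 have "(\<lambda>n. inner (bern_op R n f x) y) \<longlonglongrightarrow> inner (fc R f x) y"
  by (intro tendsto_intros fc_lim R f)
 moreover have "(\<lambda>n. inner x (bern_op R n f y)) \<longlonglongrightarrow> inner x (fc R f y)"
  by (intro tendsto_intros fc_lim R f)
 ultimately show ?thesis by (simp add: bern_op_sym[OF R] LIMSEQ_unique)
qed

lemma adj_fc: "cont01 f \<Longrightarrow> adj (fc R f) = fc R f"
 by (rule adjI) (rule fc_sym)

lemma fc_mono:
 assumes "cont01 f" "cont01 g" "\<And>x. x \<in> {0..1} \<Longrightarrow> f x \<le> g x"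
 shows "inner x (fc R f x) \<le> inner x (fc R g x)"
proof (rule LIMSEQ_le)
 show "(\<lambda>n. inner x (bern_op R n f x)) \<longlonglongrightarrow> inner x (fc R f x)"
  by (intro tendsto_intros fc_lim R assms)
 show "(\<lambda>n. inner x (bern_op R n g x)) \<longlonglongrightarrow> inner x (fc R g x)"
  by (intro tendsto_intros fc_lim R assms)
 show "\<exists>N. \<forall>n\<ge>N. inner x (bern_op R n f x) \<le> inner x (bern_op R n g x)"
  using assms(3) by (auto intro!: bern_op_mono R)
qed

lemma fc_pos:
 assumes "cont01 f" "\<And>x. x \<in> {0..1} \<Longrightarrow> 0 \<le> f x"
 shows "0 \<le> inner x (fc R f x)"
 using fc_mono[of "\<lambda>x. 0" f x] assms by (simp add: fc_const)

lemma fc_compl: "fc R (\<lambda>x. 1 - x) = id_blinfun - R"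
 using fc_diff[of "\<lambda>x. 1" "\<lambda>x. x"] by (simp add: fc_const fc_ident continuous_intros)

lemma fc_eigen:
 assumes v: "R v = c *\<^sub>R v" "c \<in> {0..1}" and f: "cont01 f"
 shows "fc R f v = f c *\<^sub>R v"
proof -
 have "fc R f v - f c *\<^sub>R v = 0" using f
 proof (rule continuous_function_vanish[where K = "2 * norm v"])
  show "norm (fc R h v - h c *\<^sub>R v) \<le> 2 * norm v * e" if h: "cont01 h" "\<And>x. x \<in> {0..1} \<Longrightarrow> \<bar>h x\<bar> \<le> e" for h e
   using norm_triangle_ineq4[of "fc R h v" "h c *\<^sub>R v"] norm_blinfun[of "fc R h" v]
    mult_right_mono[OF fc_bound[OF h] norm_ge_zero[of v]] mult_right_mono[OF h(2)[OF v(2)] norm_ge_zero[of v]]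
   by (simp add: mult.commute[of _ e])
 qed (simp_all add: fc_const fc_linear fc_times_ident blinfun.bilinear_simps v(1) algebra_simps)
 then show ?thesis by simp
qed

end

text \<open>Two operators on two spaces and a merely real-linear \<open>X\<close> are allowed.
  Commutation is the case \<open>R1 = R2\<close>; conjugate-linear operators carrying
  \<open>R\<close> into \<open>1 - R\<close> are covered as well.\<close>

lemma fc_intertwine:
 fixes R1 :: "'a::{real_inner,banach} \<Rightarrow>\<^sub>L 'a" and R2 :: "'b::{real_inner,banach} \<Rightarrow>\<^sub>L 'b" and X :: "'a \<Rightarrow>\<^sub>L 'b"
 assumes "unit_op R1" "unit_op R2" "X o\<^sub>L R1 = R2 o\<^sub>L X" "cont01 f"
 shows "X o\<^sub>L fc R1 f = fc R2 f o\<^sub>L X"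
proof -
 have 2: "X o\<^sub>L (id_blinfun - R1) = (id_blinfun - R2) o\<^sub>L X" using assms(3) by (simp add: blinfun_compose_simps)
 have "X o\<^sub>L bern R1 n k = bern R2 n k o\<^sub>L X" for n k
  using opow_commute[OF assms(3), of k] opow_commute[OF 2, of "n - k"]
  by (simp add: bern_def blinfun_compose_simps) (metis blinfun_compose_assoc)
 then have "X o\<^sub>L bern_op R1 n f = bern_op R2 n f o\<^sub>L X" for n
  by (simp add: bern_op_def blinfun_compose_sum blinfun_compose_simps)
 moreover have "(\<lambda>n. X o\<^sub>L bern_op R1 n f) \<longlonglongrightarrow> (X o\<^sub>L fc R1 f)"
  by (intro tendsto_intros fc_lim assms)
 moreover have "(\<lambda>n. bern_op R2 n f o\<^sub>L X) \<longlonglongrightarrow> (fc R2 f o\<^sub>L X)"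
  by (intro tendsto_intros fc_lim assms)
 ultimately show ?thesis using LIMSEQ_unique by simp
qed

lemma fc_compose:
 fixes X :: "'a::{real_inner,banach} \<Rightarrow>\<^sub>L 'a"
 assumes X: "unit_op X" and f: "cont01 f" "\<And>x. x \<in> {0..1} \<Longrightarrow> f x \<in> {0..1}"
  and g: "cont01 g"
 shows "unit_op (fc X f)" "fc (fc X f) g = fc X (\<lambda>x. g (f x))"
proof -
 show Y: "unit_op (fc X f)"
  unfolding unit_op_def
 proof (intro conjI allI)
  show "inner (fc X f x) y = inner x (fc X f y)" for x y by (rule fc_sym[OF X f(1)])
  show "0 \<le> inner x (fc X f x)" for x by (rule fc_pos[OF X f(1)]) (use f(2) in auto)
  show "inner x (fc X f x) \<le> inner x x" for x
   using fc_mono[OF X f(1), of "\<lambda>x. 1" x] f(2) by (simp add: fc_const[OF X])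
 qed
 have cc: "cont01 (\<lambda>x. h (f x))" if "cont01 h" for h :: "real \<Rightarrow> real"
  by (rule continuous_on_compose2[OF that f(1)]) (use f(2) in auto)
 have "fc (fc X f) g - fc X (\<lambda>x. g (f x)) = 0" using g
 proof (rule continuous_function_vanish[where K = 2])
  show "norm (fc (fc X f) h - fc X (\<lambda>x. h (f x))) \<le> 2 * e"
   if h: "cont01 h" "\<And>x. x \<in> {0..1} \<Longrightarrow> \<bar>h x\<bar> \<le> e" for h e
   using norm_triangle_ineq4[of "fc (fc X f) h" "fc X (\<lambda>x. h (f x))"] fc_bound[OF Y h] fc_bound[OF X cc[OF h(1)] h(2)[OF f(2)]] by simp
 qed (simp_all add: fc_const[OF X] fc_const[OF Y] fc_times_ident[OF Y] fc_mult[OF X f(1) cc] fc_linear[OF Y] fc_linear[OF X cc cc] algebra_simps)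
 then show "fc (fc X f) g = fc X (\<lambda>x. g (f x))" by simp
qed

lemma fc_reflect:
 fixes R :: "'a::{real_inner,banach} \<Rightarrow>\<^sub>L 'a"
 shows "unit_op R \<Longrightarrow> cont01 f \<Longrightarrow> fc (id_blinfun - R) f = fc R (\<lambda>x. f (1 - x))"
 using fc_compose(2)[of R "\<lambda>x. 1 - x" f] by (simp add: fc_compl continuous_intros)

section \<open>Bounded operators on a complex Hilbert space\<close>

lemma scaleC_Complex: "Complex a b *\<^sub>C x = a *\<^sub>R x + b *\<^sub>R (\<i> *\<^sub>C (x::'a::complex_vector))"
proof -
 have "Complex a b = complex_of_real a + complex_of_real b * \<i>" by (simp add: Complex_eq mult.commute)
 then show ?thesis by (simp add: scaleC_add_left scaleR_scaleC scaleC_scaleC)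
qed

lemma scaleC_eq: "c *\<^sub>C x = Re c *\<^sub>R x + Im c *\<^sub>R (\<i> *\<^sub>C (x::'a::complex_vector))"
 using scaleC_Complex[of "Re c" "Im c" x] by simp

lemma scaleC_scaleR_commute: "c *\<^sub>C r *\<^sub>R (x::'a::complex_vector) = r *\<^sub>R c *\<^sub>C x"
 by (simp add: scaleR_scaleC scaleC_scaleC mult.commute)

lemma scaleC_zero [simp]: "c *\<^sub>C (0::'a::complex_vector) = 0"
 using scaleC_add_right[of c "0::'a" 0] by simp

lemma scaleC_minus: "c *\<^sub>C (- x) = - (c *\<^sub>C (x::'a::complex_vector))"
 using scaleC_add_right[of c x "- x"] by (simp add: eq_neg_iff_add_eq_0 add.commute)

lemma scaleC_diff: "c *\<^sub>C (x - y) = c *\<^sub>C x - c *\<^sub>C (y::'a::complex_vector)"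
 using scaleC_add_right[of c x "- y"] by (simp add: scaleC_minus)

lemma scaleC_one [simp]: "1 *\<^sub>C (x::'a::complex_vector) = x"
 using scaleR_scaleC[of 1 x] by simp

lemma scaleC_i_i [simp]: "\<i> *\<^sub>C \<i> *\<^sub>C (x::'a::complex_vector) = - x"
 using scaleR_scaleC[of "-1" x] by (simp add: scaleC_scaleC)

text \<open>The imaginary part is a real inner product too, so complex identities follow from real
  ones used at two vectors. This lets the real adjoint \<open>adj\<close> serve throughout.\<close>

lemma cinner_eq: "cinner x y = Complex (inner x y) (inner (\<i> *\<^sub>C x) y)"
proof (rule complex_eqI)
 have "cinner (\<i> *\<^sub>C x) y = - \<i> * cinner x y"
  using cinner_commute[of "\<i> *\<^sub>C x" y] cinner_commute[of x y] by (simp add: cinner_scaleC_right)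
 then show "Im (cinner x y) = Im (Complex (inner x y) (inner (\<i> *\<^sub>C x) y))"
  by (simp add: inner_Re_cinner)
qed (simp add: inner_Re_cinner)

lemma Re_cinner: "Re (cinner x y) = inner x y"
 by (simp add: inner_Re_cinner)

lemma Im_cinner: "Im (cinner x y) = inner (\<i> *\<^sub>C x) y"
 by (simp add: cinner_eq)

lemma inner_i_i: "inner (\<i> *\<^sub>C x) (\<i> *\<^sub>C y) = inner (x::'a::complex_inner) y"
proof -
 have "cinner (\<i> *\<^sub>C x) (\<i> *\<^sub>C y) = cinner x y"
  using cinner_commute[of "\<i> *\<^sub>C x" "\<i> *\<^sub>C y"] cinner_commute[of x "y"] cinner_commute[of x "\<i> *\<^sub>C y"]
   cinner_commute[of "\<i> *\<^sub>C x" y] cinner_commute[of "\<i> *\<^sub>C y" x]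
  by (simp add: cinner_scaleC_right)
 then show ?thesis by (simp add: inner_Re_cinner)
qed

lemma inner_i_left: "inner (\<i> *\<^sub>C x) y = - inner (x::'a::complex_inner) (\<i> *\<^sub>C y)"
 using inner_i_i[of x "\<i> *\<^sub>C y"] by (simp add: inner_Re_cinner[of _ "- _", symmetric])

lemma inner_i_self [simp]: "inner (\<i> *\<^sub>C x) (x::'a::complex_inner) = 0" "inner x (\<i> *\<^sub>C x) = 0"
 using inner_i_left[of x x] by (simp_all add: inner_commute)

lemma bounded_ops_iff: "T \<in> bounded_ops \<longleftrightarrow> (\<forall>\<xi>. app T (\<i> *\<^sub>C \<xi>) = \<i> *\<^sub>C app T \<xi>)"
proof
 assume *: "\<forall>\<xi>. app T (\<i> *\<^sub>C \<xi>) = \<i> *\<^sub>C app T \<xi>"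
 have "T (c *\<^sub>C \<xi>) = c *\<^sub>C T \<xi>" for c \<xi>
  by (subst (1 2) scaleC_eq[of c]) (simp only: blinfun.bilinear_simps *[rule_format])
 then show "T \<in> bounded_ops" by (simp add: bounded_ops_def)
qed (simp add: bounded_ops_def)

lemma bounded_opsD: "T \<in> bounded_ops \<Longrightarrow> app T (c *\<^sub>C \<xi>) = c *\<^sub>C app T \<xi>"
 by (simp add: bounded_ops_def)

lemma bounded_ops_intros:
 "id_blinfun \<in> bounded_ops" "0 \<in> bounded_ops"
 "S \<in> bounded_ops \<Longrightarrow> T \<in> bounded_ops \<Longrightarrow> S + T \<in> bounded_ops"
 "S \<in> bounded_ops \<Longrightarrow> T \<in> bounded_ops \<Longrightarrow> S - T \<in> bounded_ops"
 "S \<in> bounded_ops \<Longrightarrow> - S \<in> bounded_ops"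
 "S \<in> bounded_ops \<Longrightarrow> r *\<^sub>R S \<in> bounded_ops"
 "S \<in> bounded_ops \<Longrightarrow> c *\<^sub>C S \<in> bounded_ops"
 "S \<in> bounded_ops \<Longrightarrow> T \<in> bounded_ops \<Longrightarrow> S o\<^sub>L T \<in> bounded_ops"
 by (simp_all add: bounded_ops_iff blinfun.bilinear_simps scaleC_add_right scaleC_diff scaleC_minus
   scaleC_scaleR_commute scaleC_blinfun_apply scaleC_scaleC mult.commute[of c])

lemma adj_bounded_ops:
 fixes T :: "'h::complex_hilbert \<Rightarrow>\<^sub>L 'h"
 assumes "T \<in> bounded_ops" shows "adj T \<in> bounded_ops"
 unfolding bounded_ops_iff
proof (rule allI, rule inner_eqI)
 fix \<xi> y
 show "inner (adj T (\<i> *\<^sub>C \<xi>)) y = inner (\<i> *\<^sub>C adj T \<xi>) y"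
  using assms by (simp add: adj inner_i_left bounded_opsD)
qed

lemma cinner_adj:
 fixes T :: "'h::complex_hilbert \<Rightarrow>\<^sub>L 'h"
 assumes "T \<in> bounded_ops"
 shows "cinner (adj T \<eta>) \<xi> = cinner \<eta> (T \<xi>)"
 using adj_bounded_ops[OF assms] by (simp add: cinner_eq adj bounded_opsD[symmetric])

lemma cadjoint_eq:
 fixes T :: "'h::complex_hilbert \<Rightarrow>\<^sub>L 'h"
 assumes "T \<in> bounded_ops"
 shows "cadjoint T = adj T"
 unfolding cadjoint_def
proof (rule the_equality)
 fix S :: "'h \<Rightarrow>\<^sub>L 'h" assume *: "\<forall>\<xi> \<eta>. cinner (app S \<eta>) \<xi> = cinner \<eta> (app T \<xi>)"
 have "inner (S x) y = inner x (T y)" for x y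
  using *[rule_format, of x y] by (simp add: inner_Re_cinner)
 then show "S = adj T" by (rule adjI[symmetric])
qed (simp add: cinner_adj assms)

section \<open>Self-adjoint and positive operators, commutants, square roots\<close>

definition sa :: "('a::real_inner \<Rightarrow>\<^sub>L 'a) \<Rightarrow> bool" where
 "sa T \<longleftrightarrow> (\<forall>x y. inner (app T x) y = inner x (app T y))"

definition pos :: "('a::real_inner \<Rightarrow>\<^sub>L 'a) \<Rightarrow> bool" where
 "pos T \<longleftrightarrow> sa T \<and> (\<forall>x. 0 \<le> inner x (app T x))"

lemma sa_adj: "sa T \<longleftrightarrow> adj T = T"
 unfolding sa_def using adj adjI by metis

lemma sa_intros:
 "sa id_blinfun" "sa S \<Longrightarrow> sa T \<Longrightarrow> sa (S + T)" "sa S \<Longrightarrow> sa T \<Longrightarrow> sa (S - T)" "sa S \<Longrightarrow> sa (r *\<^sub>R S)"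
 by (auto simp: sa_def blinfun.bilinear_simps inner_add inner_diff)

lemma pos_intros:
 "pos id_blinfun" "pos S \<Longrightarrow> pos T \<Longrightarrow> pos (S + T)" "pos S \<Longrightarrow> r \<ge> 0 \<Longrightarrow> pos (r *\<^sub>R S)"
 by (auto simp: pos_def sa_intros blinfun.bilinear_simps inner_add)

lemma pos_adj_compose: "pos (adj T o\<^sub>L T)"
proof -
 have "inner x (adj T (T x)) = inner (T x) (T x)" for x by (simp add: adj')
 then show ?thesis by (auto simp: pos_def sa_adj adj_compose)
qed

text \<open>Complex positivity contains symmetry: the imaginary part of the form vanishes, and
  polarising this with one vector multiplied by \<i> gives the symmetry of \<open>x\<close>.
  Conversely, symmetry and complex linearity make the imaginary part vanish.\<close>

lemma positive_op_iff:
 fixes x :: "'h::complex_hilbert \<Rightarrow>\<^sub>L 'h"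
 assumes "x \<in> bounded_ops"
 shows "positive_op x \<longleftrightarrow> pos x"
proof
 assume p: "positive_op x"
 then have 1: "inner \<xi> (x \<xi>) \<ge> 0" "inner (\<i> *\<^sub>C \<xi>) (x \<xi>) = 0" for \<xi>
  by (auto simp: positive_op_def complex_nonneg_Reals_iff Re_cinner Im_cinner)
 have "inner (\<i> *\<^sub>C \<xi>) (x \<eta>) + inner (\<i> *\<^sub>C \<eta>) (x \<xi>) = 0" for \<xi> \<eta>
  using 1(2)[of "\<xi> + \<eta>"] 1(2)[of \<xi>] 1(2)[of \<eta>]
  by (simp add: scaleC_add_right blinfun.add_right inner_add)
 from this[of "\<i> *\<^sub>C _"] have "inner (x \<xi>) \<eta> = inner \<xi> (x \<eta>)" for \<xi> \<eta>
  using assms by (simp add: bounded_opsD inner_i_i inner_commute)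
 then show "pos x" using 1(1) by (simp add: pos_def sa_def)
next
 assume p: "pos x"
 have "inner (\<i> *\<^sub>C \<xi>) (x \<xi>) = 0" for \<xi>
 proof -
  have "inner (\<i> *\<^sub>C \<xi>) (x \<xi>) = inner (x (\<i> *\<^sub>C \<xi>)) \<xi>" using p by (simp add: pos_def sa_def)
  also have "\<dots> = inner (\<i> *\<^sub>C x \<xi>) \<xi>" using assms by (simp add: bounded_opsD)
  also have "\<dots> = - inner (x \<xi>) (\<i> *\<^sub>C \<xi>)" by (rule inner_i_left)
  also have "\<dots> = - inner (\<i> *\<^sub>C \<xi>) (x \<xi>)" by (simp only: inner_commute)
  finally show ?thesis by simp
 qed
 then show "positive_op x" using p
  by (simp add: positive_op_def pos_def complex_nonneg_Reals_iff Re_cinner Im_cinner)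
qed

lemma commutant_iff: "T \<in> commutant A \<longleftrightarrow> T \<in> bounded_ops \<and> (\<forall>x\<in>A. \<forall>\<xi>. T (app x \<xi>) = x (T \<xi>))"
proof -
 have "T o\<^sub>L x = x o\<^sub>L T \<longleftrightarrow> (\<forall>\<xi>. T (app x \<xi>) = x (T \<xi>))" for x
  by (metis blinfun_apply_blinfun_compose blinfun_eqI)
 then show ?thesis by (simp add: commutant_def)
qed

lemma commutant_bounded: "T \<in> commutant A \<Longrightarrow> T \<in> bounded_ops"
 by (simp add: commutant_def)

lemma commutantD: "T \<in> commutant A \<Longrightarrow> x \<in> A \<Longrightarrow> T (app x \<xi>) = x (T \<xi>)"
 by (simp add: commutant_iff)

lemma commutant_intros:
 assumes "A \<subseteq> bounded_ops"
 shows "id_blinfun \<in> commutant A" "0 \<in> commutant A"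
 "S \<in> commutant A \<Longrightarrow> T \<in> commutant A \<Longrightarrow> S + T \<in> commutant A"
 "S \<in> commutant A \<Longrightarrow> T \<in> commutant A \<Longrightarrow> S - T \<in> commutant A"
 "S \<in> commutant A \<Longrightarrow> - S \<in> commutant A"
 "S \<in> commutant A \<Longrightarrow> r *\<^sub>R S \<in> commutant A"
 "S \<in> commutant A \<Longrightarrow> c *\<^sub>C S \<in> commutant A"
 "S \<in> commutant A \<Longrightarrow> T \<in> commutant A \<Longrightarrow> S o\<^sub>L T \<in> commutant A"
 using assms by (auto simp: commutant_iff bounded_ops_intros blinfun.bilinear_simps scaleC_blinfun_apply
   subset_iff bounded_opsD)

lemma commutant_adj:
 fixes A :: "('h::complex_hilbert \<Rightarrow>\<^sub>L 'h) set"
 assumes "\<And>x. x \<in> A \<Longrightarrow> adj x \<in> A" "T \<in> commutant A"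
 shows "adj T \<in> commutant A"
 unfolding commutant_iff
proof (intro conjI ballI allI)
 show "adj T \<in> bounded_ops" using assms(2) by (simp add: adj_bounded_ops commutant_bounded)
 fix x \<xi> assume "x \<in> A"
 show "adj T (x \<xi>) = x (adj T \<xi>)"
 proof (rule inner_eqI)
 fix y
 have "inner (adj T (x \<xi>)) y = inner \<xi> (adj x (T y))" by (simp add: adj adj')
 also have "\<dots> = inner (x (adj T \<xi>)) y"
  using commutantD[OF assms(2) assms(1)[OF \<open>x \<in> A\<close>]] by (simp add: adj adj')
 finally show "inner (adj T (x \<xi>)) y = inner (x (adj T \<xi>)) y" .
 qed
qed

text \<open>Multiplication by \<i> is one more bounded real-linear operator that commutes with
  \<open>R\<close>, so the complex linearity of \<open>fc R f\<close> comes from the same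
  intertwining argument as its commutation with \<open>A\<close>.\<close>

lemma commutant_fc:
 fixes A :: "('h::complex_hilbert \<Rightarrow>\<^sub>L 'h) set"
 assumes "unit_op R" "R \<in> commutant A" "cont01 f"
 shows "fc R f \<in> commutant A"
proof -
 have c: "fc R f (x \<xi>) = x (fc R f \<xi>)" if "\<And>\<xi>. R (x \<xi>) = x (R \<xi>)" for x :: "'h \<Rightarrow>\<^sub>L 'h" and \<xi>
 proof -
  have "x o\<^sub>L R = R o\<^sub>L x" using that by (intro blinfun_eqI) simp
  from fc_intertwine[OF assms(1) assms(1) this assms(3)]
  have "(x o\<^sub>L fc R f) \<xi> = (fc R f o\<^sub>L x) \<xi>" by simp
  then show ?thesis by simp
 qed
 obtain I :: "'h \<Rightarrow>\<^sub>L 'h" where I: "\<And>\<xi>. I \<xi> = \<i> *\<^sub>C \<xi>" using blinfunI[OF bounded_linear_scaleC] by metis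
 have "fc R f (\<i> *\<^sub>C \<xi>) = \<i> *\<^sub>C fc R f \<xi>" for \<xi>
  using c[of I \<xi>] assms(2) by (simp add: I commutant_iff bounded_opsD)
 then show ?thesis using c assms(2) by (simp add: commutant_iff bounded_ops_iff)
qed

lemma subset_commutant_commutant: "A \<subseteq> bounded_ops \<Longrightarrow> A \<subseteq> commutant (commutant A)"
 by (auto simp: commutant_def)

definition csubspace :: "'a::complex_vector set \<Rightarrow> bool" where
 "csubspace S \<longleftrightarrow> subspace S \<and> (\<forall>x\<in>S. \<i> *\<^sub>C x \<in> S)"

lemma csubspace_closure:
 fixes S :: "'a::complex_inner set"
 assumes "csubspace S" shows "csubspace (closure S)"
proof -
 interpret I: bounded_linear "\<lambda>x::'a. \<i> *\<^sub>C x" by (rule bounded_linear_scaleC)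
 have "\<i> *\<^sub>C x \<in> closure S" if x: "x \<in> closure S" for x
 proof -
  obtain u where u: "\<And>n. u n \<in> S" "u \<longlonglongrightarrow> x" using x by (auto simp: closure_sequential)
  have "(\<lambda>n. \<i> *\<^sub>C u n) \<longlonglongrightarrow> \<i> *\<^sub>C x" by (intro I.tendsto u)
  then show ?thesis unfolding closure_sequential using u(1) assms
   by (intro exI[of _ "\<lambda>n. \<i> *\<^sub>C u n"]) (auto simp: csubspace_def)
 qed
 then show ?thesis using assms by (auto simp: csubspace_def subspace_closure)
qed

text \<open>The projection is characterised by orthogonality of the remainder to \<open>S\<close>.
  An element of \<open>A\<close> preserves this characterisation because it and its adjoint leave
  \<open>S\<close> invariant.\<close>

lemma ex_projection_commutant:
 fixes A :: "('h::complex_hilbert \<Rightarrow>\<^sub>L 'h) set"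
 assumes S: "csubspace S" "closed S" and A: "A \<subseteq> bounded_ops" "\<And>x. x \<in> A \<Longrightarrow> adj x \<in> A"
  and inv: "\<And>x \<xi>. x \<in> A \<Longrightarrow> \<xi> \<in> S \<Longrightarrow> app x \<xi> \<in> S"
 obtains P where "P \<in> commutant A" "\<And>x. P x \<in> S" "\<And>x s. s \<in> S \<Longrightarrow> inner (x - P x) s = 0"
  "\<And>x. x \<in> S \<Longrightarrow> P x = x"
proof -
 obtain P :: "'h \<Rightarrow>\<^sub>L 'h" where P: "\<And>x. P x \<in> S" "\<And>x s. s \<in> S \<Longrightarrow> inner (x - P x) s = 0"
  using ex_projection[OF S(2)] S(1) csubspace_def by blast
 have sub: "subspace S" using S(1) by (simp add: csubspace_def)
 have uniq: "q = P x" if "q \<in> S" "\<And>s. s \<in> S \<Longrightarrow> inner (x - q) s = 0" for q x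
 proof -
  have "inner (q - P x) (q - P x) = inner (x - P x) (q - P x) - inner (x - q) (q - P x)"
   by (simp add: inner_diff)
  also have "\<dots> = 0" using that P sub by (simp add: subspace_diff)
  finally show ?thesis by simp
 qed
 have "P (x \<xi>) = x (P \<xi>)" if "x \<in> A" for x \<xi>
 proof (rule uniq[symmetric])
  show "x (P \<xi>) \<in> S" using inv that P(1) by blast
  fix s assume "s \<in> S"
  then have "inner (\<xi> - P \<xi>) (adj x s) = 0" using inv A(2) that P(2) by blast
  then show "inner (x \<xi> - x (P \<xi>)) s = 0" by (simp add: blinfun.diff_right[symmetric] adj')
 qed
 moreover have "P (\<i> *\<^sub>C \<xi>) = \<i> *\<^sub>C P \<xi>" for \<xi>
 proof (rule uniq[symmetric])
  show "\<i> *\<^sub>C P \<xi> \<in> S" using S(1) P(1) by (simp add: csubspace_def)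
  fix s assume "s \<in> S"
  then have "inner (\<xi> - P \<xi>) (\<i> *\<^sub>C s) = 0" using S(1) P(2) csubspace_def by blast
  then show "inner (\<i> *\<^sub>C \<xi> - \<i> *\<^sub>C P \<xi>) s = 0"
   by (simp add: scaleC_diff[symmetric] inner_i_left)
 qed
 ultimately have "P \<in> commutant A" by (simp add: commutant_iff bounded_ops_iff)
 moreover have "P x = x" if "x \<in> S" for x using uniq[of x x] that by simp
 ultimately show ?thesis using that P by blast
qed

lemma unit_op_scaled:
 assumes "pos x" "norm x \<le> c" "c > 0"
 shows "unit_op ((1 / c) *\<^sub>R x)"
proof -
 have "inner \<xi> (x \<xi>) \<le> c * inner \<xi> \<xi>" for \<xi>
 proof -
  have "inner \<xi> (x \<xi>) \<le> norm \<xi> * norm (x \<xi>)" by (rule norm_cauchy_schwarz)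
  also have "\<dots> \<le> norm \<xi> * (c * norm \<xi>)"
   by (intro mult_left_mono order_trans[OF norm_blinfun mult_right_mono[OF assms(2)]]) auto
  finally show ?thesis by (simp add: power2_norm_eq_inner[symmetric] power2_eq_square mult_ac)
 qed
 then show ?thesis using assms
  by (auto simp: unit_op_def pos_def sa_def blinfun.scaleR_left field_simps)
qed

lemma pos_fc:
 fixes R :: "'a::{real_inner,banach} \<Rightarrow>\<^sub>L 'a"
 shows "unit_op R \<Longrightarrow> cont01 f \<Longrightarrow> (\<And>x. x \<in> {0..1} \<Longrightarrow> 0 \<le> f x) \<Longrightarrow> pos (fc R f)"
 unfolding pos_def sa_def by (intro conjI allI fc_sym fc_pos)

lemma sa_fc:
 fixes R :: "'a::{real_inner,banach} \<Rightarrow>\<^sub>L 'a"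
 shows "unit_op R \<Longrightarrow> cont01 f \<Longrightarrow> sa (fc R f)"
 by (simp add: sa_def fc_sym)

lemma ex_sqrt:
 fixes A :: "('h::complex_hilbert \<Rightarrow>\<^sub>L 'h) set"
 assumes "pos x" "x \<in> commutant A"  "A \<subseteq> bounded_ops"
 obtains s where "pos s" "s \<in> commutant A" "s o\<^sub>L s = x"
proof -
 \<comment> \<open>The added one keeps \<open>c\<close> positive when \<open>x = 0\<close>. The root
   is \<open>sqrt c\<close> times the root of the operator \<open>(1 / c) *\<^sub>R x\<close>, which
   lies between 0 and 1.\<close>
 define c where "c = norm x + 1"
 have c: "c > 0" "norm x \<le> c" by (auto simp: c_def add_nonneg_pos)
 define R where "R = (1 / c) *\<^sub>R x"
 have R: "unit_op R" unfolding R_def by (rule unit_op_scaled[OF assms(1) c(2) c(1)])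
 define s where "s = fc R (\<lambda>t. sqrt c * sqrt t)"
 have cont: "cont01 (\<lambda>t. sqrt c * sqrt t)" by (intro continuous_intros)
 have "s o\<^sub>L s = fc R (\<lambda>t. (sqrt c * sqrt t) * (sqrt c * sqrt t))"
  unfolding s_def by (rule fc_mult[OF R cont cont, symmetric])
 also have "\<dots> = fc R (\<lambda>t. c * t)" using c by (intro fc_cong R) (auto simp: algebra_simps)
 also have "\<dots> = c *\<^sub>R R" using fc_cmult[OF R, of "\<lambda>t. t" c] fc_ident[OF R] by simp
 also have "\<dots> = x" using c by (simp add: R_def)
 finally have "s o\<^sub>L s = x" .
 moreover have "pos s" unfolding s_def using c by (intro pos_fc R cont) auto
 moreover have "s \<in> commutant A" unfolding s_def
  by (intro commutant_fc R cont) (simp add: R_def commutant_intros assms)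
 ultimately show ?thesis using that by blast
qed

section \<open>The commutant of the GNS representation\<close>

abbreviation l2 :: "(nat \<Rightarrow> 'a::real_normed_vector) \<Rightarrow> bool" where
 "l2 f \<equiv> summable (\<lambda>n. (norm (f n))\<^sup>2)"

lemma l2_comparison:
 assumes "l2 f" "l2 g" "\<And>n. norm (h n) \<le> c * ((norm (f n))\<^sup>2 + (norm (g n))\<^sup>2)"
 shows "summable (h :: nat \<Rightarrow> 'a::banach)"
 by (rule summable_comparison_test'[OF summable_mult[OF summable_add[OF assms(1,2)]] assms(3)])

lemma mult_le_sum_squares: "(a::real) * b \<le> a\<^sup>2 + b\<^sup>2"
 using sum_squares_bound[of a b] zero_le_power2[of a] zero_le_power2[of b] by linarith

lemma l2_add: "l2 f \<Longrightarrow> l2 g \<Longrightarrow> l2 (\<lambda>n. f n + g n)"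
proof (rule l2_comparison[where c = 2])
 show "norm ((norm (f n + g n))\<^sup>2) \<le> 2 * ((norm (f n))\<^sup>2 + (norm (g n))\<^sup>2)" for n
  using power_mono[OF norm_triangle_ineq norm_ge_zero, of "f n" "g n" 2] sum_squares_bound[of "norm (f n)" "norm (g n)"]
  by (simp add: power2_sum)
qed

lemma l2_blinfun:
 fixes x :: "'a::real_normed_vector \<Rightarrow>\<^sub>L 'b::real_normed_vector"
 assumes "l2 f"
 shows "l2 (\<lambda>n. x (f n))"
proof (rule summable_comparison_test'[OF summable_mult[OF assms, of "(norm x)\<^sup>2"]])
 show "norm ((norm (x (f n)))\<^sup>2) \<le> (norm x)\<^sup>2 * (norm (f n))\<^sup>2" for n
  using power_mono[OF norm_blinfun[of x "f n"] norm_ge_zero, of 2] by (simp add: power_mult_distrib)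
qed

lemma summable_inner: "l2 f \<Longrightarrow> l2 g \<Longrightarrow> summable (\<lambda>n. inner (f n) (g n))"
proof (rule l2_comparison[where c = 1])
 show "norm (inner (f n) (g n)) \<le> 1 * ((norm (f n))\<^sup>2 + (norm (g n))\<^sup>2)" for n
  using Cauchy_Schwarz_ineq2[of "f n" "g n"] mult_le_sum_squares[of "norm (f n)" "norm (g n)"] by simp
qed

text \<open>Only the real structure of this direct sum is set up. It is the domain of the
  contraction in \<open>intertwiners_separate\<close>, and complex linearity is recovered there for
  the coordinates of the adjoint.\<close>

typedef (overloaded) 'a seq2 = "{f :: nat \<Rightarrow> 'a::real_inner. l2 f}" morphisms coord Seq2
 by (rule exI[of _ "\<lambda>_. 0"]) simp

lemma l2_coord: "l2 (coord x)"
 using coord[of x] by simp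

lemma coord_Seq2: "l2 f \<Longrightarrow> coord (Seq2 f) = f"
 by (simp add: Seq2_inverse)

instantiation seq2 :: (real_inner) real_inner
begin

definition zero_seq2 :: "'a seq2" where "0 = Seq2 (\<lambda>n. 0)"
definition plus_seq2 :: "'a seq2 \<Rightarrow> 'a seq2 \<Rightarrow> 'a seq2" where "x + y = Seq2 (\<lambda>n. coord x n + coord y n)"
definition scaleR_seq2 :: "real \<Rightarrow> 'a seq2 \<Rightarrow> 'a seq2" where "r *\<^sub>R x = Seq2 (\<lambda>n. r *\<^sub>R coord x n)"
definition uminus_seq2 :: "'a seq2 \<Rightarrow> 'a seq2" where "- (x :: 'a seq2) = (-1) *\<^sub>R x"
definition minus_seq2 :: "'a seq2 \<Rightarrow> 'a seq2 \<Rightarrow> 'a seq2" where "x - (y :: 'a seq2) = x + (-1) *\<^sub>R y"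
definition inner_seq2 :: "'a seq2 \<Rightarrow> 'a seq2 \<Rightarrow> real" where "inner x y = (\<Sum>n. inner (coord x n) (coord y n))"
definition norm_seq2 :: "'a seq2 \<Rightarrow> real" where "norm (x :: 'a seq2) = sqrt (inner x x)"
definition sgn_seq2 :: "'a seq2 \<Rightarrow> 'a seq2" where "sgn (x :: 'a seq2) = inverse (norm x) *\<^sub>R x"
definition dist_seq2 :: "'a seq2 \<Rightarrow> 'a seq2 \<Rightarrow> real" where "dist x (y :: 'a seq2) = norm (x - y)"
definition uniformity_seq2 :: "('a seq2 \<times> 'a seq2) filter" where
 "uniformity = (INF e\<in>{0<..}. principal {(x :: 'a seq2, y). dist x y < e})"
definition open_seq2 :: "'a seq2 set \<Rightarrow> bool" where
 "open (U :: 'a seq2 set) \<longleftrightarrow> (\<forall>x\<in>U. eventually (\<lambda>(x', y). x' = x \<longrightarrow> y \<in> U) uniformity)"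

lemma coord_simps [simp]: "coord 0 n = 0" "coord (x + y) n = coord x n + coord y n"
 "coord (r *\<^sub>R x) n = r *\<^sub>R coord x n" "coord (- x) n = - coord x n" "coord (x - y) n = coord x n - coord y n"
proof -
 have s: "coord (r *\<^sub>R x) = (\<lambda>n. r *\<^sub>R coord x n)" for r and x :: "'a seq2"
  unfolding scaleR_seq2_def using l2_coord[of x] by (intro coord_Seq2) (simp add: power_mult_distrib)
 have p: "coord (x + y) = (\<lambda>n. coord x n + coord y n)" for x y :: "'a seq2"
  unfolding plus_seq2_def by (intro coord_Seq2 l2_add l2_coord)
 show "coord 0 n = 0" unfolding zero_seq2_def by (subst coord_Seq2) simp_all
 show "coord (x + y) n = coord x n + coord y n" "coord (r *\<^sub>R x) n = r *\<^sub>R coord x n" "coord (- x) n = - coord x n"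
  "coord (x - y) n = coord x n - coord y n" by (simp_all add: s p uminus_seq2_def minus_seq2_def)
qed

instance
proof
 fix x y z :: "'a seq2" and r s :: real
 have eqI: "x = y" if "\<And>n. coord x n = coord y n" for x y :: "'a seq2" using that by (simp add: coord_inject[symmetric] fun_eq_iff)
 show "x + y + z = x + (y + z)" "x + y = y + x" "0 + x = x" "- x + x = 0" "x - y = x + - y"
  "r *\<^sub>R (x + y) = r *\<^sub>R x + r *\<^sub>R y" "(r + s) *\<^sub>R x = r *\<^sub>R x + s *\<^sub>R x" "r *\<^sub>R s *\<^sub>R x = (r * s) *\<^sub>R x" "1 *\<^sub>R x = x"
  by (rule eqI, simp add: algebra_simps)+
 have s: "summable (\<lambda>n. inner (coord x n) (coord y n))" for x y :: "'a seq2" by (intro summable_inner l2_coord)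
 show "inner x y = inner y x" by (simp add: inner_seq2_def inner_commute)
 show "inner (x + y) z = inner x z + inner y z" by (simp add: inner_seq2_def inner_add_left suminf_add s)
 show "inner (r *\<^sub>R x) y = r * inner x y" by (simp add: inner_seq2_def suminf_mult s)
 show "0 \<le> inner x x" unfolding inner_seq2_def by (intro suminf_nonneg s) simp
 show "inner x x = 0 \<longleftrightarrow> x = 0" unfolding inner_seq2_def suminf_eq_zero_iff[OF s inner_ge_zero] by (auto intro: eqI)
qed (simp_all add: dist_seq2_def sgn_seq2_def uniformity_seq2_def open_seq2_def norm_seq2_def)

end

lemma seq2_eqI: "(\<And>n. coord x n = coord y n) \<Longrightarrow> x = y"
 by (simp add: coord_inject[symmetric] fun_eq_iff)

lemma norm_coord_le: "norm (coord x n) \<le> norm x"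
proof -
 have "inner (coord x n) (coord x n) \<le> inner x x"
  using sum_le_suminf[of "\<lambda>n. inner (coord x n) (coord x n)" "{n}"] by (simp add: inner_seq2_def summable_inner l2_coord)
 then show ?thesis by (simp add: norm_le)
qed

lemma norm_seq2_le:
 assumes "\<And>L. (\<Sum>n<L. (norm (f n))\<^sup>2) \<le> e\<^sup>2" "0 \<le> e"
 shows "l2 f" "norm (Seq2 f) \<le> e"
proof -
 show f: "l2 f" using assms(1) by (intro summableI_nonneg_bounded) auto
 have "(\<Sum>n. (norm (f n))\<^sup>2) \<le> e\<^sup>2" by (rule suminf_le_const[OF f assms(1)])
 then show "norm (Seq2 f) \<le> e"
  unfolding norm_seq2_def inner_seq2_def coord_Seq2[OF f] using assms(2) by (simp add: power2_norm_eq_inner real_le_lsqrt)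
qed

instance seq2 :: ("{real_inner,banach}") banach
proof
 fix X :: "nat \<Rightarrow> 'a seq2" assume X: "Cauchy X"
 have "Cauchy (\<lambda>k. coord (X k) n)" for n
 proof (rule CauchyI)
  fix e :: real assume "0 < e"
  then obtain N where N: "\<And>k m. k \<ge> N \<Longrightarrow> m \<ge> N \<Longrightarrow> norm (X k - X m) < e" using CauchyD[OF X] by blast
  have "norm (coord (X k) n - coord (X m) n) < e" if "k \<ge> N" "m \<ge> N" for k m
   using norm_coord_le[of "X k - X m" n] N[OF that] by simp
  then show "\<exists>N. \<forall>k\<ge>N. \<forall>m\<ge>N. norm (coord (X k) n - coord (X m) n) < e" by blast
 qed
 then have "\<forall>n. \<exists>l. (\<lambda>k. coord (X k) n) \<longlonglongrightarrow> l" using Cauchy_convergent convergent_def by blast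
 then obtain f where f: "\<And>n. (\<lambda>k. coord (X k) n) \<longlonglongrightarrow> f n" by metis
 have *: "\<exists>N. \<forall>k\<ge>N. l2 (\<lambda>n. coord (X k) n - f n) \<and> norm (Seq2 (\<lambda>n. coord (X k) n - f n)) < e" if e: "e > 0" for e
 proof -
  obtain N where N: "\<And>k m. k \<ge> N \<Longrightarrow> m \<ge> N \<Longrightarrow> norm (X k - X m) < e / 2" using CauchyD[OF X half_gt_zero[OF e]] by blast
  have "(\<Sum>n<L. (norm (coord (X k) n - f n))\<^sup>2) \<le> (e / 2)\<^sup>2" if k: "k \<ge> N" for k L
  proof (rule LIMSEQ_le_const2)
   show "(\<lambda>m. \<Sum>n<L. (norm (coord (X k) n - coord (X m) n))\<^sup>2) \<longlonglongrightarrow> (\<Sum>n<L. (norm (coord (X k) n - f n))\<^sup>2)"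
    by (intro tendsto_intros f)
   have "(\<Sum>n<L. (norm (coord (X k) n - coord (X m) n))\<^sup>2) \<le> (e / 2)\<^sup>2" if "m \<ge> N" for m
   proof -
    have "(\<Sum>n<L. (norm (coord (X k) n - coord (X m) n))\<^sup>2) \<le> inner (X k - X m) (X k - X m)"
     using sum_le_suminf[OF summable_inner[OF l2_coord[of "X k - X m"] l2_coord[of "X k - X m"]], of "{..<L}"]
     by (simp add: inner_seq2_def power2_norm_eq_inner)
    also have "\<dots> \<le> (e / 2)\<^sup>2" unfolding power2_norm_eq_inner[symmetric] using N[OF k that] by (intro power_mono) auto
    finally show ?thesis .
   qed
   then show "\<exists>N. \<forall>m\<ge>N. (\<Sum>n<L. (norm (coord (X k) n - coord (X m) n))\<^sup>2) \<le> (e / 2)\<^sup>2" by blast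
  qed
  from norm_seq2_le[OF this] show ?thesis using e by (intro exI[of _ N]) force
 qed
 obtain N where "l2 (\<lambda>n. coord (X N) n - f n)" using *[of 1] by auto
 then have "l2 (\<lambda>n. f n - coord (X N) n)" by (simp add: norm_minus_commute)
 from l2_add[OF this l2_coord[of "X N"]] have "coord (Seq2 f) = f" by (intro coord_Seq2) simp
 then have "X k - Seq2 f = Seq2 (\<lambda>n. coord (X k) n - f n)" if "l2 (\<lambda>n. coord (X k) n - f n)" for k
  using coord_Seq2[OF that] by (intro seq2_eqI) simp
 then have "\<exists>N. \<forall>k\<ge>N. norm (X k - Seq2 f) < e" if "e > 0" for e using *[OF that] by metis
 then have "X \<longlonglongrightarrow> Seq2 f" by (rule LIMSEQ_I)
 then show "convergent X" by (rule convergentI)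
qed

text \<open>The amplification, in tensor notation 1 \<otimes> a.\<close>

definition ampl :: "('a::real_inner \<Rightarrow>\<^sub>L 'a) \<Rightarrow> 'a seq2 \<Rightarrow>\<^sub>L 'a seq2" where
 "ampl a = Blinfun (\<lambda>x. Seq2 (\<lambda>n. a (coord x n)))"

lemma coord_ampl [simp]: "coord (ampl a x) n = a (coord x n)"
proof -
 define A where "A x = Seq2 (\<lambda>n. a (coord x n))" for x
 have A: "coord (A x) n = a (coord x n)" for x n unfolding A_def by (simp add: coord_Seq2 l2_blinfun l2_coord)
 have "bounded_linear A"
 proof (rule bounded_linear_intro[of _ "norm a"])
  show "A (x + y) = A x + A y" "A (r *\<^sub>R x) = r *\<^sub>R A x" for x y r
   by (rule seq2_eqI, simp add: A blinfun.bilinear_simps)+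
  fix x
  have "inner (A x) (A x) \<le> (\<Sum>n. (norm a)\<^sup>2 * inner (coord x n) (coord x n))"
   unfolding inner_seq2_def A
  proof (rule suminf_le)
   show "inner (a (coord x n)) (a (coord x n)) \<le> (norm a)\<^sup>2 * inner (coord x n) (coord x n)" for n
    using power_mono[OF norm_blinfun[of a "coord x n"] norm_ge_zero, of 2]
    by (simp add: power2_norm_eq_inner[symmetric] power_mult_distrib)
  qed (intro summable_inner summable_mult l2_blinfun l2_coord)+
  also have "\<dots> = (norm x * norm a)\<^sup>2"
   by (simp add: suminf_mult summable_inner l2_coord power_mult_distrib power2_norm_eq_inner[of x] inner_seq2_def)
  finally show "norm (A x) \<le> norm x * norm a" unfolding power2_norm_eq_inner[symmetric] by (rule power2_le_imp_le) simp
 qed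
 from bounded_linear_Blinfun_apply[OF this] show ?thesis unfolding ampl_def A_def[symmetric] by (simp add: A)
qed

lemma adj_ampl: "adj (ampl a) = ampl (adj a)"
 by (rule adjI) (simp add: inner_seq2_def adj)

text \<open>The value at \<open>adj y o\<^sub>L y\<close> of the positive normal functional given by
  the vectors \<open>f n\<close>.\<close>

definition sq_sum :: "(nat \<Rightarrow> 'a::real_normed_vector) \<Rightarrow> ('a \<Rightarrow>\<^sub>L 'a) \<Rightarrow> real" where
 "sq_sum f y = (\<Sum>n. (norm (app y (f n)))\<^sup>2)"

lemma sq_sum_nonneg: "l2 f \<Longrightarrow> 0 \<le> sq_sum f y"
 unfolding sq_sum_def by (intro suminf_nonneg l2_blinfun) auto

text \<open>Needed when two sigma-weak conditions are to be expressed by one sequence of vectors: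
  even and odd positions carry the two sequences.\<close>

lemma ex_interleave:
 fixes f g :: "nat \<Rightarrow> 'a::real_normed_vector"
 assumes "l2 f" "l2 g"
 obtains h where "l2 h" "\<And>y. sq_sum h y = sq_sum f y + sq_sum g y"
proof -
 define h where "h n = (if even n then f (n div 2) else g ((n - 1) div 2))" for n
 have "(\<lambda>n. (norm (app y (h n)))\<^sup>2) sums (sq_sum g y + sq_sum f y)" for y :: "'a \<Rightarrow>\<^sub>L 'a"
  using sums_if[OF l2_blinfun[OF assms(2), THEN summable_sums, of y] l2_blinfun[OF assms(1), THEN summable_sums, of y]]
  by (simp add: h_def sq_sum_def if_distrib[of "\<lambda>x. (norm (app y x))\<^sup>2"])
 from this[of id_blinfun] this show ?thesis by (intro that[of h]) (auto simp: sq_sum_def sums_iff add.commute)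
qed

lemma norm_cinner_le: "cmod (cinner a b) \<le> norm a * norm b"
proof (cases "cinner a b = 0")
 case False
 define c where "c = cinner a b"
 have "(cmod c)\<^sup>2 = Re (cinner a (cnj c *\<^sub>C b))"
  by (simp add: cinner_scaleC_right c_def[symmetric] complex_norm_square[symmetric] mult.commute
    del: of_real_power)
 also have "\<dots> \<le> norm a * norm (cnj c *\<^sub>C b)" by (simp add: Re_cinner norm_cauchy_schwarz)
 finally have "cmod c * cmod c \<le> cmod c * (norm a * norm b)"
  by (simp add: norm_scaleC power2_eq_square mult_ac)
 then show ?thesis using False by (simp add: c_def)
qed simp

lemma cinner_scaleR_right: "cinner x (r *\<^sub>R y) = complex_of_real r * cinner x y"
 by (simp add: scaleR_scaleC cinner_scaleC_right)

lemma topspace_sigma_weak: "topspace (sigma_weak M) = M"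
proof -
 have "M \<in> {{x \<in> M. (\<Sum>n. cinner (\<xi> n) (app x (\<eta> n))) \<in> U} | \<xi> \<eta> U. l2 \<xi> \<and> l2 \<eta> \<and> open U}"
  by (intro CollectI exI[of _ "\<lambda>_. 0"] exI[of _ UNIV]) auto
 then show ?thesis unfolding sigma_weak_def topology_generated_by_topspace by blast
qed

section \<open>Normality of the state: domination by square-summable vectors\<close>

locale gns_rep =
 fixes M :: "('h::complex_hilbert \<Rightarrow>\<^sub>L 'h) set"
  and \<phi> :: "'h \<Rightarrow>\<^sub>L 'h \<Rightarrow> complex"
  and \<pi> :: "'h \<Rightarrow>\<^sub>L 'h \<Rightarrow> 'k::complex_hilbert \<Rightarrow>\<^sub>L 'k"
  and \<Omega> :: 'k
 assumes vn: "von_neumann_algebra M"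
  and fns: "faithful_normal_state M \<phi>"
  and gns: "gns_triple M \<phi> \<pi> \<Omega>"
begin

lemma M_bounded: "x \<in> M \<Longrightarrow> x \<in> bounded_ops"
 using vn by (auto simp: von_neumann_algebra_def)

lemma M_eq: "commutant (commutant M) = M"
 using vn by (simp add: von_neumann_algebra_def)

lemma M_adj: "x \<in> M \<Longrightarrow> adj x \<in> M"
 using vn cadjoint_eq[OF M_bounded] by (auto simp: von_neumann_algebra_def)

lemma commutant_M_bounded: "commutant M \<subseteq> bounded_ops"
 by (auto simp: commutant_def)

lemmas M_intros = commutant_intros[OF commutant_M_bounded, unfolded M_eq]

lemma pi_bounded: "x \<in> M \<Longrightarrow> \<pi> x \<in> bounded_ops"
 using gns by (auto simp: gns_triple_def)

lemma pi_add: "x \<in> M \<Longrightarrow> y \<in> M \<Longrightarrow> \<pi> (x + y) = \<pi> x + \<pi> y"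
 using gns by (auto simp: gns_triple_def clinear_on_def)

lemma pi_scaleC: "x \<in> M \<Longrightarrow> \<pi> (c *\<^sub>C x) = c *\<^sub>C \<pi> x"
 using gns by (auto simp: gns_triple_def clinear_on_def)

lemma pi_scaleR: "x \<in> M \<Longrightarrow> \<pi> (r *\<^sub>R x) = r *\<^sub>R \<pi> x"
 by (simp add: scaleR_scaleC pi_scaleC)

lemma pi_minus: "x \<in> M \<Longrightarrow> \<pi> (- x) = - \<pi> x"
 using pi_scaleR[of x "-1"] by simp

lemma pi_diff: "x \<in> M \<Longrightarrow> y \<in> M \<Longrightarrow> \<pi> (x - y) = \<pi> x - \<pi> y"
 using pi_add[of x "- y"] by (simp add: pi_minus M_intros)

lemma pi_id: "\<pi> id_blinfun = id_blinfun"
 using gns by (auto simp: gns_triple_def)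

lemma pi_mult: "x \<in> M \<Longrightarrow> y \<in> M \<Longrightarrow> \<pi> (x o\<^sub>L y) = \<pi> x o\<^sub>L \<pi> y"
 using gns by (auto simp: gns_triple_def)

lemma pi_adj: "x \<in> M \<Longrightarrow> \<pi> (adj x) = adj (\<pi> x)"
 using gns cadjoint_eq[OF M_bounded] cadjoint_eq[OF pi_bounded] by (auto simp: gns_triple_def)

lemma phi_eq: "x \<in> M \<Longrightarrow> \<phi> x = cinner \<Omega> (\<pi> x \<Omega>)"
 using gns by (auto simp: gns_triple_def)

lemma pi_dense: "closure ((\<lambda>x. \<pi> x \<Omega>) ` M) = UNIV"
 using gns by (simp add: gns_triple_def image_def) (simp add: setcompr_eq_image Setcompr_eq_image Bex_def conj_commute)

lemma phi_square: "x \<in> M \<Longrightarrow> \<phi> (adj x o\<^sub>L x) = complex_of_real ((norm (\<pi> x \<Omega>))\<^sup>2)"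
proof -
 assume x: "x \<in> M"
 have "\<phi> (adj x o\<^sub>L x) = cinner \<Omega> (adj (\<pi> x) (\<pi> x \<Omega>))"
  using x by (simp add: phi_eq pi_mult pi_adj M_intros M_adj)
 also have "\<dots> = cinner (\<pi> x \<Omega>) (\<pi> x \<Omega>)"
  using cinner_adj[OF adj_bounded_ops[OF pi_bounded[OF x]], of \<Omega> "\<pi> x \<Omega>"] by simp
 finally show ?thesis by (simp add: cinner_eq power2_norm_eq_inner complex_of_real_def)
qed

lemma pi_separating: "x \<in> M \<Longrightarrow> \<pi> x \<Omega> = 0 \<Longrightarrow> x = 0"
proof -
 assume x: "x \<in> M" "\<pi> x \<Omega> = 0"
 have m: "adj x o\<^sub>L x \<in> M" using x by (intro M_intros M_adj)
 then have eq: "adj x o\<^sub>L x = 0"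
  using fns phi_square[OF x(1)] x(2) positive_op_iff[OF M_bounded[OF m]] pos_adj_compose[of x]
  by (auto simp: faithful_normal_state_def)
 have z: "adj x (x v) = 0" for v
 proof -
  have "adj x (x v) = (adj x o\<^sub>L x) v" by simp
  also have "\<dots> = 0" by (simp only: eq blinfun.zero_left)
  finally show ?thesis .
 qed
 have "inner (x v) (x v) = 0" for v using adj'[of x v "x v"] z by simp
 then show "x = 0" by (intro blinfun_eqI) simp
qed

lemma pi_inj: "x \<in> M \<Longrightarrow> y \<in> M \<Longrightarrow> \<pi> x = \<pi> y \<Longrightarrow> x = y"
 using pi_separating[of "x - y"] by (simp add: pi_diff M_intros)

lemma zero_M: "0 \<in> M" by (simp add: M_intros)

text \<open>Of the whole topology only its behaviour near 0 on elements
  \<open>adj y o\<^sub>L y\<close> is extracted. A subbasic condition is controlled through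
  Cauchy-Schwarz by \<open>sq_sum\<close> of both its sequences, and intersections are handled by
  interleaving.\<close>

lemma sigma_weak_nbhd:
 assumes "generate_topology_on {{x \<in> M. (\<Sum>n. cinner (\<xi> n) (app x (\<eta> n))) \<in> U} | \<xi> \<eta> U. l2 \<xi> \<and> l2 \<eta> \<and> open U} V" "0 \<in> V"
 shows "\<exists>f. l2 f \<and> (\<forall>y\<in>M. sq_sum f y < 1 \<longrightarrow> adj y o\<^sub>L y \<in> V)"
 using assms
proof (induction rule: generate_topology_on.induct)
 case (Int a b)
 then obtain f g where f: "l2 f" "\<forall>y\<in>M. sq_sum f y < 1 \<longrightarrow> adj y o\<^sub>L y \<in> a"
  and g: "l2 g" "\<forall>y\<in>M. sq_sum g y < 1 \<longrightarrow> adj y o\<^sub>L y \<in> b" by auto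
 obtain h where h: "l2 h" "\<And>y. sq_sum h y = sq_sum f y + sq_sum g y" using ex_interleave[OF f(1) g(1)] by blast
 have "adj y o\<^sub>L y \<in> a \<inter> b" if "y \<in> M" "sq_sum h y < 1" for y
  using f(2) g(2) that sq_sum_nonneg[OF f(1), of y] sq_sum_nonneg[OF g(1), of y] unfolding h(2) by force
 then show ?case using h(1) by blast
next
 case (UN K)
 then show ?case by (meson UnionE UnionI)
next
 case (Basis s)
 then obtain \<xi> \<eta> U where s: "s = {x \<in> M. (\<Sum>n. cinner (\<xi> n) (app x (\<eta> n))) \<in> U}" "l2 \<xi>" "l2 \<eta>" "open U"
  by blast
 have "0 \<in> U" using Basis(2) s(1) by (auto simp: cinner_eq zero_complex.code[symmetric])
 then obtain e where e: "e > 0" "ball 0 e \<subseteq> U" using s(4) open_contains_ball by blast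
 obtain h where h: "l2 h" "\<And>y. sq_sum h y = sq_sum \<xi> y + sq_sum \<eta> y" using ex_interleave[OF s(2,3)] by blast
 \<comment> \<open>Dividing the vectors by \<open>sqrt e\<close> normalises the threshold
   \<open>e\<close> to 1, the same for all open sets in the induction.\<close>
 define f where "f n = (1 / sqrt e) *\<^sub>R h n" for n
 have f: "(norm (app y (f n)))\<^sup>2 = (1 / e) * (norm (y (h n)))\<^sup>2" for y n
  using e(1) by (simp add: f_def blinfun.scaleR_right power_mult_distrib power_divide)
 have "l2 f" using summable_mult[OF h(1), of "1 / e"] f[of id_blinfun] by simp
 moreover have "adj y o\<^sub>L y \<in> s" if y: "y \<in> M" "sq_sum f y < 1" for y
 proof -
  have "sq_sum f y = (1 / e) * sq_sum h y" unfolding sq_sum_def f by (intro suminf_mult l2_blinfun h)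
  then have "sq_sum h y < e" using y(2) e(1) by simp
  moreover have ci: "cinner a ((adj y o\<^sub>L y) b) = cinner (y a) (y b)" for a b
   using cinner_adj[OF adj_bounded_ops[OF M_bounded[OF y(1)]], of a "y b"] by simp
  have "cmod (\<Sum>n. cinner (\<xi> n) ((adj y o\<^sub>L y) (\<eta> n))) \<le> (\<Sum>n. (norm (y (\<xi> n)))\<^sup>2 + (norm (y (\<eta> n)))\<^sup>2)"
   unfolding ci by (intro norm_suminf_le order_trans[OF norm_cinner_le mult_le_sum_squares] summable_add l2_blinfun s)
  then have "cmod (\<Sum>n. cinner (\<xi> n) ((adj y o\<^sub>L y) (\<eta> n))) \<le> sq_sum h y"
   unfolding h(2) unfolding sq_sum_def by (simp add: suminf_add l2_blinfun s)
  ultimately show ?thesis using e(2) y(1) by (auto simp: s(1) subset_iff M_intros M_adj)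
 qed
 ultimately show ?case by blast
qed simp

text \<open>Continuity at 0 gives \<phi>(\<open>adj y o\<^sub>L y\<close>) < 1 whenever
  \<open>sq_sum f y < 1\<close>. Both quantities are quadratic in \<open>y\<close>, so rescaling
  \<open>y\<close> turns the implication into an inequality. This takes the place of writing \<phi>
  as a sum of vector functionals.\<close>

lemma dominate: "\<exists>f::nat \<Rightarrow> 'h. l2 f \<and> (\<forall>y\<in>M. (norm (\<pi> y \<Omega>))\<^sup>2 \<le> sq_sum f y)"
proof -
 define U where "U = {x \<in> topspace (sigma_weak M). \<phi> x \<in> ball 0 1}"
 have "continuous_map (sigma_weak M) euclidean \<phi>" using fns by (simp add: faithful_normal_state_def predual_def)
 then have "openin (sigma_weak M) U" unfolding U_def by (rule openin_continuous_map_preimage) simp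
 moreover have "\<phi> 0 = 0" using phi_eq[OF zero_M] pi_scaleR[OF zero_M, of 0] by (simp add: cinner_eq complex_eq_iff)
 then have "0 \<in> U" by (simp add: U_def topspace_sigma_weak zero_M)
 ultimately obtain f where f: "l2 f" "\<forall>y\<in>M. sq_sum f y < 1 \<longrightarrow> adj y o\<^sub>L y \<in> U"
  using sigma_weak_nbhd unfolding sigma_weak_def openin_topology_generated_by_iff by blast
 have "(norm (\<pi> y \<Omega>))\<^sup>2 \<le> sq_sum f y" if y: "y \<in> M" for y
 proof (rule ccontr)
  assume "\<not> ?thesis"
  then have lt: "sq_sum f y < (norm (\<pi> y \<Omega>))\<^sup>2" by simp
  then have n: "0 < norm (\<pi> y \<Omega>)" using sq_sum_nonneg[OF f(1), of y] by (cases "\<pi> y \<Omega> = 0") auto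
  define z where "z = (1 / norm (\<pi> y \<Omega>)) *\<^sub>R y"
  have z: "z \<in> M" unfolding z_def by (intro M_intros y)
  have "sq_sum f z = (\<Sum>n. (1 / norm (\<pi> y \<Omega>))\<^sup>2 * (norm (y (f n)))\<^sup>2)"
   by (simp add: sq_sum_def z_def blinfun.scaleR_left power_divide)
  also have "\<dots> = (1 / norm (\<pi> y \<Omega>))\<^sup>2 * sq_sum f y" unfolding sq_sum_def by (intro suminf_mult l2_blinfun f)
  also have "\<dots> < 1" using lt n by (simp add: power_divide)
  finally have "cmod (\<phi> (adj z o\<^sub>L z)) < 1" using f(2) z by (simp add: U_def)
  moreover have "norm (\<pi> z \<Omega>) = 1" using n by (simp add: z_def pi_scaleR y blinfun.scaleR_left)
  ultimately show False by (simp add: phi_square[OF z])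
 qed
 then show ?thesis using f(1) by blast
qed

end

lemma span_scaling_invariant:
 assumes "v \<in> span B" "\<And>r b. b \<in> B \<Longrightarrow> r *\<^sub>R b \<in> B"
 shows "\<exists>(n::nat) b. (\<forall>i<n. b i \<in> B) \<and> v = (\<Sum>i<n. b i)"
 using assms(1)
proof (induction rule: span_induct_alt)
 case base
 show ?case by (intro exI[of _ 0]) simp
next
 case (step r x y)
 then obtain n :: nat and b where "\<forall>i<n. b i \<in> B" "y = (\<Sum>i<n. b i)" by blast
 then show ?case using assms(2)[OF step(1), of r]
  by (intro exI[of _ "Suc n"] exI[of _ "b(n := r *\<^sub>R x)"]) (auto simp: less_Suc_eq)
qed

section \<open>Intertwiners and the double commutant of the GNS image\<close>

context gns_rep
begin

text \<open>Complex-linear maps that carry \<open>\<pi>\<close> into the given representation. They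
  link the commutants on the two Hilbert spaces.\<close>

definition intertwiner :: "('k \<Rightarrow>\<^sub>L 'h) \<Rightarrow> bool" where
 "intertwiner U \<longleftrightarrow> (\<forall>\<xi>. U (\<i> *\<^sub>C \<xi>) = \<i> *\<^sub>C app U \<xi>) \<and>
   (\<forall>x\<in>M. \<forall>\<xi>. U (\<pi> x \<xi>) = x (app U \<xi>))"

text \<open>By domination, \<open>(y f\<^sub>n) \<mapsto> \<pi>(y) \<Omega>\<close> extends to a contraction from the square-summable sequences,
 vanishing on an orthogonal complement; the coordinates of its adjoint are intertwiners.\<close>

lemma intertwiners_separate:
 assumes null: "\<And>U. intertwiner U \<Longrightarrow> U \<kappa>0 = 0"
 shows "\<kappa>0 = 0"
proof -
 obtain f :: "nat \<Rightarrow> 'h" where f: "l2 f" and dom: "\<And>y. y \<in> M \<Longrightarrow> (norm (\<pi> y \<Omega>))\<^sup>2 \<le> sq_sum f y"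
  using dominate by blast
 define Z where "Z = Seq2 f"
 have Z: "coord Z = f" by (simp add: Z_def coord_Seq2 f)
 \<comment> \<open>Vectors orthogonal to all \<open>ampl z Z\<close> are sent to 0; adding them
   makes the domain of the relation dense.\<close>
 define G where "G = {(ampl y Z + v, \<pi> y \<Omega>) | y v. y \<in> M \<and> (\<forall>z\<in>M. inner v (ampl z Z) = 0)}"
 have GI: "(ampl y Z + v, \<pi> y \<Omega>) \<in> G" if "y \<in> M" "\<And>z. z \<in> M \<Longrightarrow> inner v (ampl z Z) = 0" for y v
  using that unfolding G_def by blast
 have sub: "subspace G"
  unfolding subspace_def
 proof (intro conjI ballI allI)
  have "ampl 0 Z = 0" by (rule seq2_eqI) simp
  then show "0 \<in> G" using GI[OF zero_M, of 0] pi_scaleR[OF zero_M, of 0] by (simp add: zero_prod_def)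
  fix p assume "p \<in> G"
  then obtain y v where p: "p = (ampl y Z + v, \<pi> y \<Omega>)" "y \<in> M" "\<And>z. z \<in> M \<Longrightarrow> inner v (ampl z Z) = 0"
   unfolding G_def by blast
  have "ampl (r *\<^sub>R y) Z = r *\<^sub>R ampl y Z" for r by (rule seq2_eqI) (simp add: blinfun.scaleR_left)
  then show "r *\<^sub>R p \<in> G" for r using GI[of "r *\<^sub>R y" "r *\<^sub>R v"] p
   by (simp add: M_intros pi_scaleR blinfun.scaleR_left scaleR_add_right)
  fix q assume "q \<in> G"
  then obtain x u where q: "q = (ampl x Z + u, \<pi> x \<Omega>)" "x \<in> M" "\<And>z. z \<in> M \<Longrightarrow> inner u (ampl z Z) = 0"
   unfolding G_def by blast
  have "ampl (y + x) Z = ampl y Z + ampl x Z" by (rule seq2_eqI) (simp add: blinfun.add_left)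
  then show "p + q \<in> G" using GI[of "y + x" "v + u"] p q
   by (simp add: M_intros pi_add blinfun.add_left inner_add_left algebra_simps)
 qed
 have bd: "norm k \<le> 1 * norm w" if "(w, k) \<in> G" for w k
 proof -
  obtain y v where y: "w = ampl y Z + v" "k = \<pi> y \<Omega>" "y \<in> M" "inner v (ampl y Z) = 0"
   using \<open>(w, k) \<in> G\<close> unfolding G_def by blast
  have "sq_sum f y = inner (ampl y Z) (ampl y Z)" by (simp add: sq_sum_def inner_seq2_def Z power2_norm_eq_inner)
  also have "\<dots> \<le> inner w w" using y(4) by (simp add: y(1) inner_add inner_commute[of "ampl y Z" v])
  finally have "(norm k)\<^sup>2 \<le> (norm w)\<^sup>2" using dom[OF y(3)] by (simp add: y(2) power2_norm_eq_inner[of w])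
  from power2_le_imp_le[OF this norm_ge_zero] show ?thesis by simp
 qed
 have dense: "closure (fst ` G) = UNIV"
 proof (rule closure_subspace_UNIV)
  show "subspace (fst ` G)" using sub by (intro linear_subspace_image linear_fst)
  fix w assume w: "\<And>x. x \<in> fst ` G \<Longrightarrow> inner w x = 0"
  have "inner w (ampl z Z) = 0" if "z \<in> M" for z using w[OF image_eqI[OF _ GI[OF that, of 0]], of "ampl z Z"] by simp
  moreover have "ampl 0 Z = 0" by (rule seq2_eqI) simp
  ultimately show "w = 0" using w[OF image_eqI[OF _ GI[OF zero_M, of w]], of w] by simp
 qed
 have "\<exists>T :: 'h seq2 \<Rightarrow>\<^sub>L 'k. \<forall>w k. (w, k) \<in> G \<longrightarrow> T w = k"
  by (rule extend_graph[OF sub bd dense]) blast+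
 then obtain T :: "'h seq2 \<Rightarrow>\<^sub>L 'k" where T: "\<And>w k. (w, k) \<in> G \<Longrightarrow> T w = k" by blast
 have "T o\<^sub>L ampl a = \<pi> a o\<^sub>L T" if a: "a \<in> M" for a
 proof (rule blinfun_eqI_dense[OF dense])
  fix w assume "w \<in> fst ` G"
  then obtain y v where y: "w = ampl y Z + v" "y \<in> M" "\<And>z. z \<in> M \<Longrightarrow> inner v (ampl z Z) = 0"
   unfolding G_def by auto
  have c: "ampl (b o\<^sub>L z) Z = ampl b (ampl z Z)" for b z by (rule seq2_eqI) simp
  have "inner (ampl a v) (ampl z Z) = 0" if "z \<in> M" for z
   using y(3)[of "adj a o\<^sub>L z"] a that by (simp add: c adj' adj_ampl M_intros M_adj)
  then have "T (ampl (a o\<^sub>L y) Z + ampl a v) = \<pi> (a o\<^sub>L y) \<Omega>" by (intro T GI M_intros a y)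
  moreover have "T w = \<pi> y \<Omega>" unfolding y(1) by (intro T GI y)
  moreover have "ampl a w = ampl (a o\<^sub>L y) Z + ampl a v" unfolding y(1) c by (rule blinfun.add_right)
  ultimately show "(T o\<^sub>L ampl a) w = (\<pi> a o\<^sub>L T) w" by (simp add: pi_mult a y(2))
 qed
 then have Ta: "T (ampl a w) = \<pi> a (T w)" if "a \<in> M" for a w using that by (metis blinfun_apply_blinfun_compose)
 have T': "adj T (\<pi> a \<kappa>) = ampl a (adj T \<kappa>)" if a: "a \<in> M" for a \<kappa>
  by (rule inner_eqI) (simp add: adj adj' adj_ampl Ta[OF M_adj[OF a]] flip: pi_adj[OF a])
 have "coord (adj T \<kappa>0) n = 0" for n
 proof -
  have "bounded_linear (\<lambda>\<kappa>. coord (adj T \<kappa>) n)"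
   by (rule bounded_linear_intro[of _ "norm (adj T)"])
    (simp_all only: blinfun.bilinear_simps coord_simps mult.commute[of "norm _" "norm (adj T)"] order_trans[OF norm_coord_le norm_blinfun])
  then obtain U where U: "\<And>\<kappa>. app U \<kappa> = coord (adj T \<kappa>) n" using blinfunI by blast
  have "U (\<i> *\<^sub>C \<xi>) = \<i> *\<^sub>C U \<xi>" for \<xi>
   using T'[of "\<i> *\<^sub>C id_blinfun" \<xi>] by (simp add: U M_intros pi_scaleC pi_id scaleC_blinfun_apply)
  then have "intertwiner U" by (simp add: intertwiner_def U T')
  from null[OF this] show ?thesis by (simp add: U)
 qed
 then have "adj T \<kappa>0 = 0" by (intro seq2_eqI) simp
 then have "inner \<kappa>0 (T w) = 0" for w using adj[of T \<kappa>0 w] by simp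
 moreover have "T (ampl y Z + 0) = \<pi> y \<Omega>" if "y \<in> M" for y using that by (intro T GI) simp_all
 ultimately have "inner \<kappa>0 (\<pi> y \<Omega>) = 0" if "y \<in> M" for y using that by metis
 then show ?thesis by (intro dense_orthogonal[OF pi_dense]) auto
qed

lemma adj_intertwiner:
 assumes "intertwiner U" "x \<in> M"
 shows "adj U (x \<eta>) = \<pi> x (adj U \<eta>)"
proof (rule inner_eqI)
 fix y
 have "inner (adj U (x \<eta>)) y = inner \<eta> (adj x (U y))" by (simp add: adj adj')
 also have "adj x (U y) = U (\<pi> (adj x) y)" using assms by (simp add: intertwiner_def M_adj)
 finally show "inner (adj U (x \<eta>)) y = inner (\<pi> x (adj U \<eta>)) y"
  using assms by (simp add: adj adj' pi_adj)
qed

abbreviation N :: "('k \<Rightarrow>\<^sub>L 'k) set" where "N \<equiv> \<pi> ` M"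

text \<open>The left factors make \<open>W\<close> stable under the commutant of \<open>M\<close>,
  so that the projection onto the closed span of the vectors \<open>w \<Omega>\<close> lies in
  \<open>M\<close>.\<close>

definition W :: "('k \<Rightarrow>\<^sub>L 'h) set" where
 "W = {c o\<^sub>L U | c U. c \<in> commutant M \<and> intertwiner U}"

lemma W_commutant:
 assumes "w \<in> W" "w' \<in> W"
 shows "adj w o\<^sub>L w' \<in> commutant N"
proof -
 obtain c U c' U' where w: "w = c o\<^sub>L U" "w' = c' o\<^sub>L U'" "c \<in> commutant M" "c' \<in> commutant M"
  "intertwiner U" "intertwiner U'" using assms by (auto simp: W_def)
 have ci: "(adj w o\<^sub>L w') (\<i> *\<^sub>C \<xi>) = \<i> *\<^sub>C (adj w o\<^sub>L w') \<xi>" for \<xi>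
 proof (rule inner_eqI)
  fix y
  show "inner ((adj w o\<^sub>L w') (\<i> *\<^sub>C \<xi>)) y = inner (\<i> *\<^sub>C (adj w o\<^sub>L w') \<xi>) y"
   using w by (simp add: adj inner_i_left intertwiner_def bounded_opsD[OF commutant_bounded])
 qed
 have "(adj w o\<^sub>L w') (\<pi> x \<xi>) = \<pi> x ((adj w o\<^sub>L w') \<xi>)" if x: "x \<in> M" for x \<xi>
 proof -
  have "adj c \<in> commutant M" by (intro commutant_adj M_adj w)
  then show ?thesis using w x adj_intertwiner[OF w(5) x]
   by (simp add: adj_compose intertwiner_def commutantD[OF _ x])
 qed
 then show ?thesis using ci by (auto simp: commutant_iff bounded_ops_iff)
qed

lemma M_subset: "M \<subseteq> bounded_ops"
 using M_bounded by blast

lemma W_intros: "intertwiner U \<Longrightarrow> U \<in> W" "c \<in> commutant M \<Longrightarrow> w \<in> W \<Longrightarrow> c o\<^sub>L w \<in> W"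
proof -
 show "U \<in> W" if "intertwiner U"
  unfolding W_def using that commutant_intros(1)[OF M_subset] blinfun_compose_id(2)[of U] by (intro CollectI exI[of _ id_blinfun] exI[of _ U]) simp
 assume c: "c \<in> commutant M" and "w \<in> W"
 then obtain c' U where w: "w = c' o\<^sub>L U" "c' \<in> commutant M" "intertwiner U" by (auto simp: W_def)
 then have "c o\<^sub>L w = (c o\<^sub>L c') o\<^sub>L U" "c o\<^sub>L c' \<in> commutant M"
  using c commutant_intros(8)[OF M_subset] by (auto simp: blinfun_compose_assoc)
 then show "c o\<^sub>L w \<in> W" unfolding W_def using w(3) by blast
qed

text \<open>The projection \<open>e\<close> onto the closed span belongs to \<open>M\<close> and
  fixes every \<open>U \<Omega>\<close>. Hence every intertwiner kills
  \<open>\<pi> (id_blinfun - e) \<Omega>\<close>; this vector is therefore 0, and faithfulness of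
  \<phi> gives \<open>e = id_blinfun\<close>.\<close>

lemma W_dense: "closure (span ((\<lambda>w. app w \<Omega>) ` W)) = UNIV"
proof -
 define S where "S = span ((\<lambda>w. app w \<Omega>) ` W)"
 have inv: "c v \<in> S" if c: "c \<in> commutant M" and v: "v \<in> S" for c v
 proof -
  have "c ` S = span (c ` (\<lambda>w. app w \<Omega>) ` W)"
   unfolding S_def by (intro linear_span_image[symmetric] bounded_linear.linear blinfun.bounded_linear_right)
  also have "\<dots> \<subseteq> S" unfolding S_def
   using W_intros(2)[OF c] by (intro span_mono) (force simp: image_iff)
  finally show ?thesis using v by blast
 qed
 have "csubspace S" unfolding csubspace_def
 proof (intro conjI ballI)
  show "subspace S" unfolding S_def by (rule subspace_span)
  fix v assume "v \<in> S"
  then show "\<i> *\<^sub>C v \<in> S"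
   using inv[of "\<i> *\<^sub>C id_blinfun" v] commutant_intros[OF M_subset] by (simp add: scaleC_blinfun_apply)
 qed
 then have cs: "csubspace (closure S)" by (rule csubspace_closure)
 have inv': "c v \<in> closure S" if c: "c \<in> commutant M" and v: "v \<in> closure S" for c v
 proof -
  obtain u where u: "\<And>n. u n \<in> S" "u \<longlonglongrightarrow> v" using v by (auto simp: closure_sequential)
  have "(\<lambda>n. c (u n)) \<longlonglongrightarrow> c v" by (intro tendsto_intros u)
  then show ?thesis unfolding closure_sequential using u(1) inv[OF c]
   by (intro exI[of _ "\<lambda>n. c (u n)"]) auto
 qed
 have "\<exists>e. e \<in> commutant (commutant M) \<and> (\<forall>x. e x \<in> closure S) \<and> (\<forall>x\<in>closure S. app e x = x)"
  by (rule ex_projection_commutant[OF cs closed_closure commutant_M_bounded commutant_adj[OF M_adj] inv']) blast+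
 then obtain e where e: "e \<in> commutant (commutant M)" "\<And>x. e x \<in> closure S"
  "\<And>x. x \<in> closure S \<Longrightarrow> e x = x" by auto
 have eM: "id_blinfun - e \<in> M" using e(1) by (simp add: M_eq M_intros)
 have "U (\<pi> (id_blinfun - e) \<Omega>) = 0" if U: "intertwiner U" for U
 proof -
  have "U \<Omega> \<in> closure S" unfolding S_def
   by (intro closure_subset[THEN subsetD] span_base imageI W_intros U)
  then show ?thesis using U eM e(3) by (simp add: intertwiner_def blinfun.diff_left)
 qed
 then have "\<pi> (id_blinfun - e) \<Omega> = 0" by (rule intertwiners_separate)
 then have "id_blinfun = e" using pi_separating[OF eM] by simp
 then have "x \<in> closure S" for x using e(2)[of x] by (simp flip: \<open>id_blinfun = e\<close>)
 then show ?thesis by (auto simp: S_def)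
qed

lemma N_bounded: "N \<subseteq> bounded_ops"
 using pi_bounded by auto

lemma N_adj: "x \<in> N \<Longrightarrow> adj x \<in> N"
 by (auto simp: pi_adj[symmetric] M_adj)

text \<open>If \<theta> is orthogonal to the orbit, then \<open>U \<theta>\<close> is orthogonal to
  all \<open>w \<Omega>\<close> for each intertwiner \<open>U\<close>, because
  \<open>adj U o\<^sub>L w\<close> is in the commutant. So all \<open>U \<theta>\<close> vanish, and
  intertwiners separate vectors.\<close>

lemma commutant_dense: "closure ((\<lambda>c. app c \<Omega>) ` commutant N) = UNIV"
proof (rule closure_subspace_UNIV)
 show "subspace ((\<lambda>c. app c \<Omega>) ` commutant N)"
  by (intro linear_subspace_image bounded_linear.linear blinfun.bounded_linear_left)
   (simp add: subspace_def commutant_intros[OF N_bounded])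
 fix \<theta> assume z: "\<And>x. x \<in> (\<lambda>c. app c \<Omega>) ` commutant N \<Longrightarrow> inner \<theta> x = 0"
 show "\<theta> = 0"
 proof (rule intertwiners_separate, rule dense_orthogonal[OF W_dense])
  fix U v assume U: "intertwiner U" and "v \<in> span ((\<lambda>w. app w \<Omega>) ` W)"
  from this(2) show "inner (U \<theta>) v = 0"
  proof (induction rule: span_induct_alt)
   case (step r b y)
   then obtain w where w: "w \<in> W" "b = w \<Omega>" by blast
   have "inner \<theta> ((adj U o\<^sub>L w) \<Omega>) = 0" by (intro z imageI W_commutant W_intros U w)
   then show ?case using step w by (simp add: inner_add adj')
  qed simp
 qed
qed

text \<open>For \<open>y\<close> in the double commutant, the candidate \<open>x\<close> with
  \<open>\<pi> x = y\<close> is defined on the original space by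
  \<open>x (w \<xi>) = w (y \<xi>)\<close> for \<open>w\<close> in \<open>W\<close>. The work lies
  in bounding this on sums; \<open>x\<close> then commutes with the commutant of \<open>M\<close> by
  construction, and intertwiners identify \<open>\<pi> x\<close> with \<open>y\<close>.\<close>

lemma bicommutant: "commutant (commutant N) = N"
proof
 show "N \<subseteq> commutant (commutant N)" by (rule subset_commutant_commutant[OF N_bounded])
 show "commutant (commutant N) \<subseteq> N"
 proof
  fix y assume y: "y \<in> commutant (commutant N)"
  define C where "C = adj y o\<^sub>L y"
  have Cc: "C (c \<xi>) = c (C \<xi>)" if "c \<in> commutant N" for c \<xi>
  proof -
   have "adj y \<in> commutant (commutant N)" by (intro commutant_adj y N_adj)
   then show ?thesis using that y by (simp add: C_def commutantD)
  qed
  have Csym: "inner (C a) b = inner a (C b)" for a b by (simp add: C_def adj adj')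
  \<comment> \<open>Inner products of the vectors \<open>w i (\<xi> i)\<close> involve only
    \<open>adj (w i) o\<^sub>L w j\<close>, which lies in the commutant of \<open>N\<close> and so
    commutes with \<open>C\<close>. Hence \<open>C\<close> acts symmetrically for the resulting
    positive form, and the power trick bounds it there by its operator norm.\<close>
  have bound: "norm (\<Sum>i<n. app (w i) (y (\<xi> i))) \<le> norm y * norm (\<Sum>i<n. app (w i) (\<xi> i))"
   if w: "\<And>i. i < n \<Longrightarrow> w i \<in> W" for n :: nat and w \<xi>
  proof -
   define V where "V \<eta> = (\<Sum>i<n. w i (\<eta> i))" for \<eta> :: "nat \<Rightarrow> 'k"
   have VC: "inner (V (\<lambda>i. C (\<eta> i))) (V \<theta>) = inner (V \<eta>) (V (\<lambda>i. C (\<theta> i)))" for \<eta> \<theta>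
   proof -
    have "inner (w i (C (\<eta> i))) (w j (\<theta> j)) = inner (w i (\<eta> i)) (w j (C (\<theta> j)))" if "i < n" "j < n" for i j
     using Cc[OF W_commutant[OF w[OF that(1)] w[OF that(2)]], of "\<theta> j"] Csym[of "\<eta> i"]
     by (simp add: adj')
    then show ?thesis unfolding V_def inner_sum_left inner_sum_right by (intro sum.cong) auto
   qed
   define P where "P m = (\<lambda>i. opow C m (\<xi> i))" for m
   have PS: "P (Suc m) = (\<lambda>i. C (P m i))" for m by (simp add: P_def)
   have move: "inner (V (P k)) (V (P m)) = inner (V (P 0)) (V (P (k + m)))" for k m
   proof (induction k arbitrary: m)
    case (Suc k)
    have "inner (V (P (Suc k))) (V (P m)) = inner (V (P k)) (V (P (Suc m)))" by (simp only: PS VC)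
    then show ?case using Suc by simp
   qed simp
   define a where "a m = inner (V (P 0)) (V (P m))" for m
   have a0: "a 0 = (norm (V \<xi>))\<^sup>2" by (simp add: a_def P_def power2_norm_eq_inner)
   have a1: "a 1 = (norm (V (\<lambda>i. y (\<xi> i))))\<^sup>2"
   proof -
    have "inner (w i (\<xi> i)) (w j (C (\<xi> j))) = inner (w i (y (\<xi> i))) (w j (y (\<xi> j)))" if "i < n" "j < n" for i j
    proof -
     have "y ((adj (w i) o\<^sub>L w j) (y (\<xi> j))) = (adj (w i) o\<^sub>L w j) (y (y (\<xi> j)))"
      by (rule commutantD[OF y W_commutant[OF w[OF that(1)] w[OF that(2)]]])
     moreover have "adj y ((adj (w i) o\<^sub>L w j) (y (\<xi> j))) = (adj (w i) o\<^sub>L w j) (adj y (y (\<xi> j)))"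
      by (rule commutantD[OF commutant_adj[OF _ y] W_commutant[OF w[OF that(1)] w[OF that(2)]]])
       (intro commutant_adj N_adj)
     ultimately show ?thesis by (simp add: adj' C_def)
    qed
    then show ?thesis unfolding a_def P_def V_def power2_norm_eq_inner inner_sum_left inner_sum_right
     by (intro sum.cong) auto
   qed
   have opow_le: "norm (opow C m v) \<le> norm C ^ m * norm v" for m v
   proof (induction m)
    case (Suc m)
    have "norm (C (opow C m v)) \<le> norm C * norm (opow C m v)" by (rule norm_blinfun)
    also have "\<dots> \<le> norm C * (norm C ^ m * norm v)" by (intro mult_left_mono Suc) simp
    finally show ?case by (simp add: mult.assoc)
   qed simp
   have "a 1 \<le> norm C * a 0"
   proof (rule power_trick[where K = "norm (V \<xi>) * (\<Sum>i<n. norm (w i) * norm (\<xi> i))"])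
    show "0 \<le> a 0" by (simp add: a0)
    show "(a m)\<^sup>2 \<le> a 0 * a (2 * m)" for m
     using Cauchy_Schwarz_ineq[of "V (P 0)" "V (P m)"] move[of m m] by (simp add: a_def mult_2)
    show "a m \<le> norm (V \<xi>) * (\<Sum>i<n. norm (w i) * norm (\<xi> i)) * norm C ^ m" for m
    proof -
     have "norm (V (P m)) \<le> (\<Sum>i<n. norm (w i (P m i)))" unfolding V_def by (rule norm_sum)
     also have "\<dots> \<le> (\<Sum>i<n. norm (w i) * (norm C ^ m * norm (\<xi> i)))"
      unfolding P_def by (intro sum_mono order_trans[OF norm_blinfun] mult_left_mono opow_le) simp
     also have "\<dots> = (\<Sum>i<n. norm (w i) * norm (\<xi> i)) * norm C ^ m"
      unfolding sum_distrib_right by (intro sum.cong) (simp_all add: mult_ac)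
     finally have "norm (V (P m)) \<le> (\<Sum>i<n. norm (w i) * norm (\<xi> i)) * norm C ^ m" .
     moreover have "a m \<le> norm (V \<xi>) * norm (V (P m))"
      using norm_cauchy_schwarz[of "V (P 0)" "V (P m)"] by (simp add: a_def P_def)
     moreover from calculation have "norm (V \<xi>) * norm (V (P m))
       \<le> norm (V \<xi>) * ((\<Sum>i<n. norm (w i) * norm (\<xi> i)) * norm C ^ m)"
      by (intro mult_left_mono) auto
     ultimately show ?thesis by (simp add: mult.assoc)
    qed
   qed (auto intro!: mult_nonneg_nonneg sum_nonneg)
   moreover have "norm C \<le> (norm y)\<^sup>2"
    using norm_blinfun_compose[of "adj y" y] by (simp add: C_def power2_eq_square)
   ultimately have "(norm (V (\<lambda>i. y (\<xi> i))))\<^sup>2 \<le> (norm y)\<^sup>2 * (norm (V \<xi>))\<^sup>2"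
    unfolding a0 a1 by (meson mult_right_mono order_trans zero_le_power2)
   then have "(norm (V (\<lambda>i. y (\<xi> i))))\<^sup>2 \<le> (norm y * norm (V \<xi>))\<^sup>2" by (simp add: power_mult_distrib)
   then show ?thesis unfolding V_def by (rule power2_le_imp_le) simp
  qed
  \<comment> \<open>Scalar multiples stay in \<open>B\<close>, so each element of its span is a sum
    without coefficients, to which \<open>bound\<close> applies.\<close>
  define B where "B = {(app w \<xi>, app w (y \<xi>)) | w \<xi>. w \<in> W}"
  have dense: "closure (fst ` span B) = UNIV"
  proof -
   have "(\<lambda>w. app w \<Omega>) ` W \<subseteq> fst ` B" by (force simp: B_def)
   then have "span ((\<lambda>w. app w \<Omega>) ` W) \<subseteq> fst ` span B"
    unfolding linear_span_image[OF linear_fst, symmetric] by (rule span_mono)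
   then show ?thesis using W_dense closure_mono by blast
  qed
  have Bbound: "norm v \<le> norm y * norm u" if "(u, v) \<in> span B" for u v
  proof -
   have sc: "r *\<^sub>R b \<in> B" if b: "b \<in> B" for r b
   proof -
    obtain w \<xi> where "b = (app w \<xi>, app w (y \<xi>))" "w \<in> W" using b unfolding B_def by blast
    then show ?thesis unfolding B_def by (intro CollectI exI[of _ w] exI[of _ "r *\<^sub>R \<xi>"]) (simp add: blinfun.scaleR_right)
   qed
   obtain n :: nat and b where b: "\<forall>i<n. b i \<in> B" "(u, v) = (\<Sum>i<n. b i)" using span_scaling_invariant[OF \<open>(u, v) \<in> span B\<close> sc] by blast
   have "\<forall>i. \<exists>w \<xi>. i < n \<longrightarrow> b i = (app w \<xi>, app w (y \<xi>)) \<and> w \<in> W" using b(1) unfolding B_def by blast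
   then obtain w \<xi> where w: "\<And>i. i < n \<Longrightarrow> b i = (app (w i) (\<xi> i), app (w i) (y (\<xi> i)))" "\<And>i. i < n \<Longrightarrow> w i \<in> W"
    by metis
   have "u = (\<Sum>i<n. fst (b i))" "v = (\<Sum>i<n. snd (b i))" using b(2) by (simp_all add: prod_eq_iff fst_sum snd_sum)
   then show ?thesis using bound[of n w \<xi>] w by simp
  qed
  have "\<exists>x :: 'h \<Rightarrow>\<^sub>L 'h. \<forall>u v. (u, v) \<in> span B \<longrightarrow> x u = v"
   by (rule extend_graph[OF subspace_span Bbound dense]) blast+
  then obtain x :: "'h \<Rightarrow>\<^sub>L 'h" where x: "\<And>u v. (u, v) \<in> span B \<Longrightarrow> x u = v" by blast
  have xw: "x (app w \<xi>) = app w (y \<xi>)" if "w \<in> W" for w \<xi>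
   by (intro x span_base) (use that in \<open>auto simp: B_def\<close>)
  have xc: "x (c v) = c (x v)" if c: "\<And>w. w \<in> W \<Longrightarrow> c o\<^sub>L w \<in> W" for c :: "'h \<Rightarrow>\<^sub>L 'h" and v
  proof -
   have "x o\<^sub>L c = c o\<^sub>L x"
   proof (rule blinfun_eqI_dense[OF W_dense])
    fix v assume "v \<in> span ((\<lambda>w. app w \<Omega>) ` W)"
    then show "(x o\<^sub>L c) v = (c o\<^sub>L x) v"
    proof (induction rule: span_induct_alt)
     case (step r b u)
     then obtain w where w: "w \<in> W" "b = w \<Omega>" by blast
     have "x ((c o\<^sub>L w) \<Omega>) = (c o\<^sub>L w) (y \<Omega>)" by (intro xw c w)
     then show ?case using step w xw[OF w(1)] by (simp add: blinfun.bilinear_simps)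
    qed (simp add: blinfun.zero_right)
   qed
   from arg_cong[OF this, of "\<lambda>T. app T v"] show ?thesis by simp
  qed
  have "x (c v) = c (x v)" if "c \<in> commutant M" for c v using xc W_intros(2) that by blast
  moreover have "x (\<i> *\<^sub>C v) = \<i> *\<^sub>C x v" for v
   using calculation[of "\<i> *\<^sub>C id_blinfun" v] commutant_intros[OF M_subset] by (simp add: scaleC_blinfun_apply)
  ultimately have "x \<in> commutant (commutant M)" by (simp add: commutant_iff bounded_ops_iff)
  then have xM: "x \<in> M" by (simp add: M_eq)
  have "\<pi> x \<xi> - y \<xi> = 0" for \<xi>
  proof (rule intertwiners_separate)
   fix U assume U: "intertwiner U"
   show "U (\<pi> x \<xi> - y \<xi>) = 0"
    using xw[OF W_intros(1)[OF U], of \<xi>] U xM by (simp add: intertwiner_def blinfun.diff_right)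
  qed
  then have "\<pi> x = y" by (intro blinfun_eqI) simp
  then show "y \<in> N" using xM by blast
 qed
qed

end

section \<open>The modular objects\<close>

lemma tendsto_dense:
 fixes T :: "nat \<Rightarrow> 'a::real_normed_vector \<Rightarrow>\<^sub>L 'b::real_normed_vector" and S :: "'a \<Rightarrow>\<^sub>L 'b"
 assumes D: "closure D = UNIV" and bd: "\<And>n. norm (T n) \<le> c"
  and lim: "\<And>x. x \<in> D \<Longrightarrow> (\<lambda>n. T n x) \<longlonglongrightarrow> S x"
 shows "(\<lambda>n. T n x) \<longlonglongrightarrow> S x"
proof (rule LIMSEQ_I)
 fix e :: real assume e: "e > 0"
 define K where "K = c + norm S + 1"
 have c: "c \<ge> 0" using bd[of 0] norm_ge_zero order_trans by blast
 have K: "K > 0" using c by (simp add: K_def add_nonneg_pos)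
 have "x \<in> closure D" using D by simp
 then obtain y where y: "y \<in> D" "dist y x < e / (2 * K)"
  using e K by (meson closure_approachable divide_pos_pos mult_pos_pos zero_less_numeral)
 have "e / 2 > 0" using e by simp
 from LIMSEQ_D[OF lim[OF y(1)] this] obtain N where N: "\<forall>n\<ge>N. norm (T n y - S y) < e / 2" by blast
 have "norm (T n x - S x) < e" if "n \<ge> N" for n
 proof -
  have "T n x - S x = T n (x - y) + (T n y - S y) - S (x - y)" by (simp add: blinfun.diff_right)
  then have "norm (T n x - S x) \<le> norm (T n (x - y) + (T n y - S y)) + norm (S (x - y))"
   by (metis norm_triangle_ineq4)
  also have "norm (T n (x - y) + (T n y - S y)) \<le> norm (T n (x - y)) + norm (T n y - S y)"
   by (rule norm_triangle_ineq)
  also have "norm (T n (x - y)) \<le> c * norm (x - y)"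
   by (rule order_trans[OF norm_blinfun mult_right_mono[OF bd]]) simp
  also have "norm (S (x - y)) \<le> norm S * norm (x - y)" by (rule norm_blinfun)
  finally have "norm (T n x - S x) \<le> (c + norm S) * norm (x - y) + norm (T n y - S y)"
   by (simp add: algebra_simps)
  also have "(c + norm S) * norm (x - y) \<le> K * norm (x - y)" by (intro mult_right_mono) (auto simp: K_def)
  also have "K * norm (x - y) \<le> e / 2"
   using y(2) K by (simp add: dist_norm norm_minus_commute field_simps less_imp_le)
  finally show ?thesis using N that by (smt (verit) field_sum_of_halves)
 qed
 then show "\<exists>no. \<forall>n\<ge>no. norm (T n x - S x) < e" by blast
qed

lemma sa_inj_dense:
 fixes T :: "'a::{real_inner,banach} \<Rightarrow>\<^sub>L 'a"
 assumes "sa T" "\<And>x. T x = 0 \<Longrightarrow> x = 0"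
 shows "closure (range (app T)) = UNIV"
proof (rule closure_subspace_UNIV)
 show "subspace (range (app T))"
  by (intro linear_subspace_image subspace_UNIV bounded_linear.linear blinfun.bounded_linear_right)
 fix v assume "\<And>x. x \<in> range (app T) \<Longrightarrow> inner v x = 0"
 then have "inner v (T (T v)) = 0" by blast
 then have "inner (T v) (T v) = 0" using assms(1) by (simp add: sa_def)
 then show "v = 0" using assms(2) by simp
qed

definition proj :: "'a::{real_inner,banach} set \<Rightarrow> 'a \<Rightarrow>\<^sub>L 'a" where
 "proj S = (SOME P. (\<forall>x. app P x \<in> S) \<and> (\<forall>x. \<forall>s\<in>S. inner (x - P x) s = 0))"

context
 fixes S :: "'a::{real_inner,banach} set"
 assumes S: "closed S" "subspace S"
begin

lemma proj: "proj S x \<in> S" "s \<in> S \<Longrightarrow> inner (x - proj S x) s = 0"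
proof -
 have "\<exists>P. (\<forall>x. app P x \<in> S) \<and> (\<forall>x. \<forall>s\<in>S. inner (x - P x) s = 0)"
  by (rule ex_projection[OF S]) blast
 from someI_ex[OF this] show "proj S x \<in> S" "s \<in> S \<Longrightarrow> inner (x - proj S x) s = 0"
  unfolding proj_def by blast+
qed

lemma proj_unique:
 assumes "q \<in> S" "\<And>s. s \<in> S \<Longrightarrow> inner (x - q) s = 0"
 shows "proj S x = q"
proof -
 have "inner (q - proj S x) (q - proj S x) = inner (x - proj S x) (q - proj S x) - inner (x - q) (q - proj S x)"
  by (simp add: inner_diff)
 also have "\<dots> = 0" using assms proj S by (simp add: subspace_diff)
 finally show ?thesis by simp
qed

lemma proj_fix: "x \<in> S \<Longrightarrow> proj S x = x"
 by (rule proj_unique) auto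

lemma proj_orthogonal: "(\<And>s. s \<in> S \<Longrightarrow> inner x s = 0) \<Longrightarrow> proj S x = 0"
 using subspace_0[OF S(2)] by (intro proj_unique) auto

lemma proj_idem: "proj S (proj S x) = proj S x"
 by (intro proj_fix proj)

lemma proj_sym: "inner (proj S x) y = inner x (proj S y)"
proof -
 have "inner (proj S x) (y - proj S y) = 0" "inner (x - proj S x) (proj S y) = 0"
  using proj(2)[OF proj(1), of y x] proj(2)[OF proj(1), of x y] by (auto simp: inner_commute)
 then show ?thesis by (simp add: inner_diff)
qed

lemma norm_proj_le: "norm (proj S x) \<le> norm x"
proof -
 have "(norm (proj S x))\<^sup>2 = inner (proj S x) x"
  using proj_sym[of "proj S x" x] proj_idem by (simp add: power2_norm_eq_inner)
 also have "\<dots> \<le> norm (proj S x) * norm x" by (rule norm_cauchy_schwarz)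
 finally show ?thesis by (cases "norm (proj S x) = 0") (auto simp: power2_eq_square)
qed

lemma proj_commute:
 assumes "\<And>p q. inner (f p) q = inner p (g q)" "\<And>s. s \<in> S \<Longrightarrow> f s \<in> S" "\<And>s. s \<in> S \<Longrightarrow> g s \<in> S"
 shows "proj S (f x) = f (proj S x)"
proof (rule proj_unique)
 show "f (proj S x) \<in> S" by (intro assms proj)
 fix s assume "s \<in> S"
 then have "inner (x - proj S x) (g s) = 0" by (intro proj assms)
 then show "inner (f x - f (proj S x)) s = 0" by (simp add: inner_diff assms(1))
qed

end

definition tomita_graph :: "('k::complex_hilbert \<Rightarrow>\<^sub>L 'k) set \<Rightarrow> 'k \<Rightarrow> ('k \<times> 'k) set" where
 "tomita_graph A \<Omega> = closure ((\<lambda>x. (app x \<Omega>, adj x \<Omega>)) ` A)"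

text \<open>The projection onto the graph of the Tomita operator \<open>S = J \<Delta>\<^sup>1\<^sup>/\<^sup>2\<close> has the entries
 \<open>R = (1 + \<Delta>)\<^sup>-\<^sup>1\<close> on the diagonal and \<open>C = S R\<close> off the diagonal.\<close>

definition modR :: "('k::complex_hilbert \<Rightarrow>\<^sub>L 'k) set \<Rightarrow> 'k \<Rightarrow> 'k \<Rightarrow>\<^sub>L 'k" where
 "modR A \<Omega> = Blinfun (\<lambda>\<xi>. fst (proj (tomita_graph A \<Omega>) (\<xi>, 0)))"

definition modC :: "('k::complex_hilbert \<Rightarrow>\<^sub>L 'k) set \<Rightarrow> 'k \<Rightarrow> 'k \<Rightarrow>\<^sub>L 'k" where
 "modC A \<Omega> = Blinfun (\<lambda>\<xi>. fst (proj (tomita_graph A \<Omega>) (0, \<xi>)))"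

text \<open>The hypotheses are symmetric in \<open>A\<close> and \<open>A'\<close>, so that every
  result can be used with the two interchanged, through \<open>tomita_swap\<close>.\<close>

locale tomita =
 fixes A A' :: "('k::complex_hilbert \<Rightarrow>\<^sub>L 'k) set" and \<Omega> :: 'k
 assumes comm: "commutant A = A'" "commutant A' = A"
  and adjA: "x \<in> A \<Longrightarrow> adj x \<in> A" and adjA': "x \<in> A' \<Longrightarrow> adj x \<in> A'"
  and denseA: "closure ((\<lambda>x. app x \<Omega>) ` A) = UNIV"
  and denseA': "closure ((\<lambda>x. app x \<Omega>) ` A') = UNIV"
begin

lemma A_sub: "A \<subseteq> bounded_ops" and A'_sub: "A' \<subseteq> bounded_ops"
 using comm by (auto simp: commutant_def)

lemmas A_intros = commutant_intros[OF A'_sub, unfolded comm]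
lemmas A'_intros = commutant_intros[OF A_sub, unfolded comm]

lemma A_comm: "x \<in> A \<Longrightarrow> a \<in> A' \<Longrightarrow> x (app a \<xi>) = a (app x \<xi>)"
 using commutantD[of x A' a \<xi>] comm by simp

lemma A_i: "x \<in> A \<Longrightarrow> x (\<i> *\<^sub>C \<xi>) = \<i> *\<^sub>C app x \<xi>"
 using A_sub by (auto simp: bounded_opsD)

lemma A'_i: "x \<in> A' \<Longrightarrow> x (\<i> *\<^sub>C \<xi>) = \<i> *\<^sub>C app x \<xi>"
 using A'_sub by (auto simp: bounded_opsD)

lemma adj_iC: "adj (\<i> *\<^sub>C x) = - (\<i> *\<^sub>C adj x)" if "x \<in> bounded_ops" for x :: "'k \<Rightarrow>\<^sub>L 'k"
proof (rule adjI)
 fix \<xi> y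
 have "inner (adj x \<xi>) (\<i> *\<^sub>C y) = inner \<xi> (\<i> *\<^sub>C x y)" using that by (simp add: adj bounded_opsD)
 then show "inner ((- (\<i> *\<^sub>C adj x)) \<xi>) y = inner \<xi> ((\<i> *\<^sub>C x) y)"
  by (simp add: blinfun.minus_left scaleC_blinfun_apply inner_i_left)
qed

abbreviation "GS \<equiv> tomita_graph A \<Omega>"
abbreviation "R \<equiv> modR A \<Omega>"
abbreviation "C \<equiv> modC A \<Omega>"

lemma closed_GS: "closed GS" by (simp add: tomita_graph_def)

lemma subspace_A: "subspace A"
 by (simp add: subspace_def A_intros)

lemma subspace_GS: "subspace GS"
 unfolding tomita_graph_def
 by (intro subspace_closure linear_subspace_image linearI subspace_A) (simp_all add: blinfun.bilinear_simps adj_add adj_scaleR)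

lemmas P_facts = proj[OF closed_GS subspace_GS] and P_unique = proj_unique[OF closed_GS subspace_GS]
 and P_fix = proj_fix[OF closed_GS subspace_GS]
 and P_sym = proj_sym[OF closed_GS subspace_GS] and P_commute = proj_commute[OF closed_GS subspace_GS]

lemma GS_base: "x \<in> A \<Longrightarrow> (app x \<Omega>, adj x \<Omega>) \<in> GS"
 unfolding tomita_graph_def by (intro closure_subset[THEN subsetD] imageI)

lemma GS_induct:
 assumes "p \<in> GS" "closed X" "\<And>x. x \<in> A \<Longrightarrow> (app x \<Omega>, adj x \<Omega>) \<in> X"
 shows "p \<in> X"
 using assms closure_minimal[of "(\<lambda>x. (app x \<Omega>, adj x \<Omega>)) ` A" X]
 unfolding tomita_graph_def by blast

lemma GS_swap: "(\<xi>, \<eta>) \<in> GS \<Longrightarrow> (\<eta>, \<xi>) \<in> GS"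
proof -
 assume "(\<xi>, \<eta>) \<in> GS"
 moreover have "closed {p. (snd p, fst p) \<in> GS}"
  by (intro closed_vimage[of GS "\<lambda>p. (snd p, fst p)", unfolded vimage_def] closed_GS continuous_intros)
 ultimately have "(\<xi>, \<eta>) \<in> {p. (snd p, fst p) \<in> GS}"
  by (rule GS_induct) (use GS_base[OF adjA] in simp)
 then show ?thesis by simp
qed

lemma continuous_on_iC: "continuous_on X f \<Longrightarrow> continuous_on X (\<lambda>x. \<i> *\<^sub>C (f x :: 'k))"
 by (rule bounded_linear.continuous_on[OF bounded_linear_scaleC])

lemma GS_i: "(\<xi>, \<eta>) \<in> GS \<Longrightarrow> (\<i> *\<^sub>C \<xi>, - (\<i> *\<^sub>C \<eta>)) \<in> GS"
proof -
 assume "(\<xi>, \<eta>) \<in> GS"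
 moreover have "closed {p. (\<i> *\<^sub>C fst p, - (\<i> *\<^sub>C snd p)) \<in> GS}"
  by (intro closed_vimage[of GS "\<lambda>p. (\<i> *\<^sub>C fst p, - (\<i> *\<^sub>C snd p))", unfolded vimage_def] closed_GS
    continuous_intros continuous_on_iC)
 ultimately have "(\<xi>, \<eta>) \<in> {p. (\<i> *\<^sub>C fst p, - (\<i> *\<^sub>C snd p)) \<in> GS}"
 proof (rule GS_induct)
  fix x assume x: "x \<in> A"
  have "x \<in> bounded_ops" using x A_sub by blast
  then show "(x \<Omega>, adj x \<Omega>) \<in> {p. (\<i> *\<^sub>C fst p, - (\<i> *\<^sub>C snd p)) \<in> GS}"
   using GS_base[OF A_intros(7)[OF x, of \<i>]] by (simp add: adj_iC scaleC_blinfun_apply blinfun.minus_left)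
 qed
 then show ?thesis by simp
qed

lemma GS_orthogonal:
 assumes "(\<xi>, \<eta>) \<in> GS" "a \<in> A'"
 shows "inner \<xi> (app a \<Omega>) = inner \<eta> (adj a \<Omega>)"
proof -
 have "closed {p. inner (fst p) (a \<Omega>) = inner (snd p) (adj a \<Omega>)}"
  by (intro closed_Collect_eq continuous_intros)
 with assms(1) have "(\<xi>, \<eta>) \<in> {p. inner (fst p) (a \<Omega>) = inner (snd p) (adj a \<Omega>)}"
 proof (rule GS_induct)
  fix x assume x: "x \<in> A"
  have "inner (x \<Omega>) (a \<Omega>) = inner \<Omega> (a (adj x \<Omega>))"
   using A_comm[OF adjA[OF x] assms(2)] by (simp add: adj')
  then show "(x \<Omega>, adj x \<Omega>) \<in> {p. inner (fst p) (a \<Omega>) = inner (snd p) (adj a \<Omega>)}"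
   by (simp add: adj' adj inner_commute)
 qed
 then show ?thesis by simp
qed

lemma R_apply: "R \<xi> = fst (proj GS (\<xi>, 0))" and C_apply: "C \<xi> = fst (proj GS (0, \<xi>))"
proof -
 have "bounded_linear (\<lambda>\<xi>. fst (proj GS (\<xi>, 0)))"
  by (intro bounded_linear_compose[OF bounded_linear_fst] bounded_linear_compose[OF blinfun.bounded_linear_right]
    bounded_linear_Pair bounded_linear_ident bounded_linear_zero)
 then show "R \<xi> = fst (proj GS (\<xi>, 0))" by (simp add: modR_def bounded_linear_Blinfun_apply)
 have "bounded_linear (\<lambda>\<xi>. fst (proj GS (0, \<xi>)))"
  by (intro bounded_linear_compose[OF bounded_linear_fst] bounded_linear_compose[OF blinfun.bounded_linear_right]
    bounded_linear_Pair bounded_linear_ident bounded_linear_zero)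
 then show "C \<xi> = fst (proj GS (0, \<xi>))" by (simp add: modC_def bounded_linear_Blinfun_apply)
qed

lemma P_swap: "proj GS (prod.swap p) = prod.swap (proj GS p)"
 by (rule P_commute[where g = prod.swap]) (auto simp: inner_prod_def intro: GS_swap)

text \<open>The Tomita operator is an involution, so its graph is invariant under the exchange of
  coordinates. Therefore the block matrix of the projection has only two distinct entries.\<close>

lemma P_apply: "proj GS (\<xi>, \<eta>) = (R \<xi> + C \<eta>, C \<xi> + R \<eta>)"
proof -
 have "proj GS (\<xi>, \<eta>) = proj GS (\<xi>, 0) + proj GS (0, \<eta>)" by (simp flip: blinfun.add_right)
 moreover have "snd (proj GS (\<xi>, 0)) = C \<xi>" "snd (proj GS (0, \<eta>)) = R \<eta>"
  using P_swap[of "(0, \<xi>)"] P_swap[of "(\<eta>, 0)"] by (simp_all add: R_apply C_apply)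
 ultimately show ?thesis by (simp add: prod_eq_iff R_apply C_apply)
qed

lemma GS_iff: "(\<xi>, \<eta>) \<in> GS \<longleftrightarrow> R \<xi> + C \<eta> = \<xi> \<and> C \<xi> + R \<eta> = \<eta>"
 using P_fix[of "(\<xi>, \<eta>)"] P_facts(1)[of "(\<xi>, \<eta>)"] by (auto simp: P_apply)

lemma R_C_GS: "(R \<xi>, C \<xi>) \<in> GS" "(C \<xi>, R \<xi>) \<in> GS"
 using P_facts(1)[of "(\<xi>, 0)"] P_facts(1)[of "(0, \<xi>)"] by (auto simp: P_apply blinfun.zero_right)

lemma R_sym: "inner (R x) y = inner x (R y)" and C_sym: "inner (C x) y = inner x (C y)"
 using P_sym[of "(x, 0)" "(y, 0)"] P_sym[of "(0, x)" "(y, 0)"]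
 by (simp_all add: P_apply blinfun.zero_right inner_prod_def)

text \<open>The matrix entries of the idempotence of the projection onto the graph.\<close>

lemma RR_CC: "R (R \<xi>) + C (C \<xi>) = R \<xi>" and CR_RC: "C (R \<xi>) + R (C \<xi>) = C \<xi>"
 using R_C_GS[of \<xi>] by (auto simp: GS_iff)

lemma inner_R: "inner \<xi> (R \<xi>) = (norm (R \<xi>))\<^sup>2 + (norm (C \<xi>))\<^sup>2"
proof -
 have "inner \<xi> (R \<xi>) = inner \<xi> (R (R \<xi>)) + inner \<xi> (C (C \<xi>))"
  by (simp add: RR_CC flip: inner_add_right)
 then show ?thesis by (simp add: R_sym[symmetric] C_sym[symmetric] power2_norm_eq_inner)
qed

lemma unit_op_R: "unit_op R"
proof -
 have "inner \<xi> (R \<xi>) \<le> inner \<xi> \<xi>" for \<xi>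
 proof -
  have "(norm (R \<xi>))\<^sup>2 \<le> norm \<xi> * norm (R \<xi>)" using inner_R[of \<xi>] norm_cauchy_schwarz[of \<xi> "R \<xi>"] zero_le_power2[of "norm (C \<xi>)"] by linarith
  then have "norm (R \<xi>) \<le> norm \<xi>" by (cases "norm (R \<xi>) = 0") (auto simp: power2_eq_square)
  then have "norm \<xi> * norm (R \<xi>) \<le> norm \<xi> * norm \<xi>" by (intro mult_left_mono) auto
  then show ?thesis using norm_cauchy_schwarz[of \<xi> "R \<xi>"]
   by (simp add: power2_norm_eq_inner[symmetric] power2_eq_square)
 qed
 then show ?thesis by (simp add: unit_op_def R_sym inner_R)
qed

lemma C_R: "C (R \<xi>) = C \<xi> - R (C \<xi>)"
 using CR_RC[of \<xi>] by (simp add: algebra_simps)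

lemma C_C: "C (C \<xi>) = R (\<xi> - R \<xi>)"
 using RR_CC[of \<xi>] by (simp add: blinfun.diff_right algebra_simps)

lemma R_i: "R (\<i> *\<^sub>C \<xi>) = \<i> *\<^sub>C R \<xi>" and C_i: "C (\<i> *\<^sub>C \<xi>) = - (\<i> *\<^sub>C C \<xi>)"
proof -
 define f where "f p = (\<i> *\<^sub>C fst p, - (\<i> *\<^sub>C snd p))" for p :: "'k \<times> 'k"
 have "proj GS (f p) = f (proj GS p)" for p
 proof (rule P_commute[where g = "\<lambda>p. - f p"])
  show "inner (f p) q = inner p (- f q)" for p q
   by (simp add: f_def inner_prod_def inner_i_left)
  show "f s \<in> GS" if "s \<in> GS" for s using GS_i[of "fst s" "snd s"] that by (simp add: f_def)
  then show "- f s \<in> GS" if "s \<in> GS" for s using that subspace_neg[OF subspace_GS] by blast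
 qed
 from this[of "(\<xi>, 0)"] show "R (\<i> *\<^sub>C \<xi>) = \<i> *\<^sub>C R \<xi>"  "C (\<i> *\<^sub>C \<xi>) = - (\<i> *\<^sub>C C \<xi>)"
  by (simp_all add: f_def P_apply blinfun.zero_right)
qed

text \<open>For a vector in the kernel, \<open>(\<xi>, 0)\<close> is orthogonal to the graph,
  against the density of the orbit of \<open>A\<close>.\<close>

lemma R_inj: "R \<xi> = 0 \<Longrightarrow> \<xi> = 0"
proof -
 assume "R \<xi> = 0"
 then have "proj GS (\<xi>, 0) = 0" using inner_R[of \<xi>] by (simp add: P_apply blinfun.zero_right zero_prod_def)
 then have "inner (\<xi>, 0) (x \<Omega>, adj x \<Omega>) = 0" if "x \<in> A" for x
  using P_facts(2)[OF GS_base[OF that], of "(\<xi>, 0)"] by simp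
 then have "inner \<xi> (x \<Omega>) = 0" if "x \<in> A" for x using that by (simp add: inner_prod_def)
 then show "\<xi> = 0" by (intro dense_orthogonal[OF denseA]) auto
qed

text \<open>Here \<open>(0, \<xi>)\<close> would lie in the graph. The density of the orbit of
  \<open>A'\<close> excludes this; it is the closability of the Tomita operator.\<close>

lemma R_compl_inj: "R \<xi> = \<xi> \<Longrightarrow> \<xi> = 0"
proof -
 assume R: "R \<xi> = \<xi>"
 then have "C \<xi> = 0" using inner_R[of \<xi>] by (simp add: power2_norm_eq_inner)
 then have "(0, \<xi>) \<in> GS" using R_C_GS(2)[of \<xi>] R by simp
 then have "inner \<xi> (adj a \<Omega>) = 0" if "a \<in> A'" for a using GS_orthogonal[OF _ that] by fastforce
 then have "inner \<xi> (a \<Omega>) = 0" if "a \<in> A'" for a using adjA'[OF that] by (metis adj_adj)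
 then show "\<xi> = 0" by (intro dense_orthogonal[OF denseA']) auto
qed

text \<open>The hypothesis says that \<open>(\<zeta>, \<epsilon>)\<close> lies in the graph of the adjoint of the Tomita operator. The
 operator \<open>x \<Omega> \<mapsto> x \<zeta>\<close> is approximated by corners of the projections onto the graphs of its
 multiples \<open>x \<Omega> \<mapsto> t x \<zeta>\<close>, \<open>t \<rightarrow> 0\<close>.\<close>

lemma commutant_graph:
 assumes orth: "\<And>\<xi> \<eta>. (\<xi>, \<eta>) \<in> GS \<Longrightarrow> inner \<xi> \<zeta> = inner \<eta> \<epsilon>"
 shows "(\<zeta>, \<epsilon>) \<in> tomita_graph A' \<Omega>"
proof -
 define B where "B t = (\<lambda>x. (app x \<Omega>, t *\<^sub>R app x \<zeta>)) ` A" for t :: real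
 define H where "H t = closure (B t)" for t
 have sH: "subspace (H t)" for t unfolding H_def B_def
  by (intro subspace_closure linear_subspace_image linearI subspace_A) (simp_all add: blinfun.bilinear_simps scaleR_add_right)
 have cH: "closed (H t)" for t by (simp add: H_def)
 define p where "p t = proj (H t)" for t
 have into: "f s \<in> H t" if s: "s \<in> H t" and f: "continuous_on UNIV f" "\<And>b. b \<in> B t \<Longrightarrow> f b \<in> B t" for f s t
 proof -
  have "closed (f -` H t)" by (intro closed_vimage cH f)
  then have "H t \<subseteq> f -` H t" unfolding H_def using f(2) closure_subset[of "B t"]
   by (intro closure_minimal) auto
  then show ?thesis using s by blast
 qed
 have f_cont: "continuous_on UNIV (\<lambda>q. (app x (fst q), app x (snd q)))" for x :: "'k \<Rightarrow>\<^sub>L 'k"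
  by (intro continuous_intros)
 have p_comm: "p t (x (fst q), x (snd q)) = (x (fst (p t q)), x (snd (p t q)))" if x: "x \<in> A" for x t q
 proof -
  have inv: "(y (fst s), y (snd s)) \<in> H t" if y: "y \<in> A" and s: "s \<in> H t" for y s
  proof (rule into[OF s f_cont])
   fix b assume "b \<in> B t"
   then obtain z where "b = (app z \<Omega>, t *\<^sub>R app z \<zeta>)" "z \<in> A" unfolding B_def by blast
   then show "(y (fst b), y (snd b)) \<in> B t" unfolding B_def using y
    by (intro image_eqI[of _ _ "y o\<^sub>L z"]) (auto simp: A_intros blinfun.scaleR_right)
  qed
  show ?thesis unfolding p_def
   by (rule proj_commute[OF cH sH, where f = "\<lambda>q. (x (fst q), x (snd q))" and g = "\<lambda>q. (adj x (fst q), adj x (snd q))"])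
    (use inv x adjA in \<open>auto simp: inner_prod_def adj'\<close>)
 qed
 have p_i: "p t (\<i> *\<^sub>C fst q, \<i> *\<^sub>C snd q) = (\<i> *\<^sub>C fst (p t q), \<i> *\<^sub>C snd (p t q))" for t q
 proof -
  have inv: "(\<i> *\<^sub>C fst s, \<i> *\<^sub>C snd s) \<in> H t" if s: "s \<in> H t" for s
  proof (rule into[OF s])
   show "continuous_on UNIV (\<lambda>q :: 'k \<times> 'k. (\<i> *\<^sub>C fst q, \<i> *\<^sub>C snd q))"
    by (intro continuous_intros continuous_on_iC)
   fix b assume "b \<in> B t"
   then obtain z where "b = (app z \<Omega>, t *\<^sub>R app z \<zeta>)" "z \<in> A" unfolding B_def by blast
   then show "(\<i> *\<^sub>C fst b, \<i> *\<^sub>C snd b) \<in> B t" unfolding B_def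
    by (intro image_eqI[of _ _ "\<i> *\<^sub>C z"]) (auto simp: A_intros scaleC_blinfun_apply scaleC_scaleR_commute)
  qed
  show ?thesis unfolding p_def
   by (rule proj_commute[OF cH sH, where f = "\<lambda>q. (\<i> *\<^sub>C fst q, \<i> *\<^sub>C snd q)" and g = "\<lambda>q. - (\<i> *\<^sub>C fst q, \<i> *\<^sub>C snd q)"])
    (use inv subspace_neg[OF sH] in \<open>auto simp: inner_prod_def inner_i_left\<close>)
 qed
 have bl: "bounded_linear (\<lambda>\<xi>. fst (p t (\<xi>, 0)))" "bounded_linear (\<lambda>\<xi>. snd (p t (\<xi>, 0)))"
  "bounded_linear (\<lambda>\<xi>. fst (p t (0, \<xi>)))" "bounded_linear (\<lambda>\<xi>. snd (p t (0, \<xi>)))" for t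
  by (intro bounded_linear_compose[OF bounded_linear_fst] bounded_linear_compose[OF bounded_linear_snd]
    bounded_linear_compose[OF blinfun.bounded_linear_right]
    bounded_linear_Pair bounded_linear_ident bounded_linear_zero)+
 define p11 where "p11 t = Blinfun (\<lambda>\<xi>. fst (p t (\<xi>, 0)))" for t
 define p21 where "p21 t = Blinfun (\<lambda>\<xi>. snd (p t (\<xi>, 0)))" for t
 define p12 where "p12 t = Blinfun (\<lambda>\<xi>. fst (p t (0, \<xi>)))" for t
 define p22 where "p22 t = Blinfun (\<lambda>\<xi>. snd (p t (0, \<xi>)))" for t
 note ap = p11_def p21_def p12_def p22_def bl[THEN bounded_linear_Blinfun_apply]
 have p_eq: "p t (\<xi>, \<eta>) = (p11 t \<xi> + p12 t \<eta>, p21 t \<xi> + p22 t \<eta>)" for t \<xi> \<eta>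
 proof -
  have "p t (\<xi>, \<eta>) = p t (\<xi>, 0) + p t (0, \<eta>)" by (simp flip: blinfun.add_right)
  then show ?thesis by (simp add: ap prod_eq_iff)
 qed
 have p_le: "norm (p t q) \<le> norm q" for t q unfolding p_def by (rule norm_proj_le[OF cH sH])
 have n11: "norm (p11 t) \<le> 1" and n21: "norm (p21 t \<xi>) \<le> norm \<xi>" and n12: "norm (p12 t \<xi>) \<le> norm \<xi>" and n22: "norm (p22 t) \<le> 1" for t \<xi>
 proof -
  have fs: "norm (fst q) \<le> norm q" "norm (snd q) \<le> norm q" for q :: "'k \<times> 'k"
   using norm_fst_le[of "fst q" "snd q"] norm_snd_le[of "snd q" "fst q"] by auto
  have "norm (p11 t \<xi>) \<le> 1 * norm \<xi>" "norm (p22 t \<xi>) \<le> 1 * norm \<xi>" for \<xi>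
   using order_trans[OF fs(1) p_le, of t "(\<xi>, 0)"] order_trans[OF fs(2) p_le, of t "(0, \<xi>)"]
   by (simp_all add: ap norm_Pair)
  then show "norm (p11 t) \<le> 1" "norm (p22 t) \<le> 1" by (auto intro!: norm_blinfun_bound)
  show "norm (p21 t \<xi>) \<le> norm \<xi>" "norm (p12 t \<xi>) \<le> norm \<xi>"
   using order_trans[OF fs(2) p_le, of t "(\<xi>, 0)"] order_trans[OF fs(1) p_le, of t "(0, \<xi>)"]
   by (simp_all add: ap norm_Pair)
 qed
 have adj21: "adj (p21 t) = p12 t" for t
 proof (rule adjI)
  show "inner (p12 t x) y = inner x (p21 t y)" for x y
   using proj_sym[OF cH sH, of t "(0, x)" "(y, 0)"] by (simp add: ap p_def[symmetric] inner_prod_def)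
 qed
 have in_A': "p21 t \<in> A'" for t
 proof -
  have "p21 t (x \<xi>) = x (p21 t \<xi>)" if "x \<in> A" for x \<xi>
   using p_comm[OF that, of t "(\<xi>, 0)"] by (simp add: ap blinfun.zero_right)
  moreover have "p21 t (\<i> *\<^sub>C \<xi>) = \<i> *\<^sub>C p21 t \<xi>" for \<xi>
   using p_i[of t "(\<xi>, 0)"] by (simp add: ap)
  ultimately show ?thesis unfolding comm(1)[symmetric] by (simp add: commutant_iff bounded_ops_iff)
 qed
 \<comment> \<open>Two vectors are compared with the graph for the multiple \<open>t\<close>:
   \<open>(\<Omega>, t *\<^sub>R \<zeta>)\<close> lies in it, and
   \<open>(- t *\<^sub>R \<epsilon>, \<Omega>)\<close> is orthogonal to it by \<open>orth\<close>.
   Reading off components gives \<open>e1\<close> to \<open>e4\<close>.\<close>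
 have fixed: "p t (\<Omega>, t *\<^sub>R \<zeta>) = (\<Omega>, t *\<^sub>R \<zeta>)" for t
 proof -
  have "(\<Omega>, t *\<^sub>R \<zeta>) \<in> B t" unfolding B_def using A_intros(1) by (intro image_eqI[of _ _ id_blinfun]) auto
  then have "(\<Omega>, t *\<^sub>R \<zeta>) \<in> H t" unfolding H_def using closure_subset by blast
  then show ?thesis unfolding p_def by (rule proj_fix[OF cH sH])
 qed
 have killed: "p t (- t *\<^sub>R \<epsilon>, \<Omega>) = 0" for t
  unfolding p_def
 proof (rule proj_orthogonal[OF cH sH])
  fix s assume s: "s \<in> H t"
  have "closed {s. inner (- t *\<^sub>R \<epsilon>, \<Omega>) s = 0}" by (intro closed_Collect_eq continuous_intros)
  moreover have "B t \<subseteq> {s. inner (- t *\<^sub>R \<epsilon>, \<Omega>) s = 0}"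
  proof
   fix b assume "b \<in> B t"
   then obtain x where x: "b = (app x \<Omega>, t *\<^sub>R app x \<zeta>)" "x \<in> A" unfolding B_def by blast
   have "inner (adj x \<Omega>) \<zeta> = inner (x \<Omega>) \<epsilon>" by (rule orth[OF GS_swap[OF GS_base[OF x(2)]]])
   then have "inner \<Omega> (x \<zeta>) = inner \<epsilon> (x \<Omega>)" unfolding adj by (simp only: inner_commute)
   then show "b \<in> {s. inner (- t *\<^sub>R \<epsilon>, \<Omega>) s = 0}"
    using x(1) by (simp add: inner_prod_def)
  qed
  ultimately show "inner (- t *\<^sub>R \<epsilon>, \<Omega>) s = 0" using s closure_minimal unfolding H_def by blast
 qed
 have e1: "p11 t \<Omega> = \<Omega> - t *\<^sub>R p12 t \<zeta>" and e2: "p21 t \<Omega> = t *\<^sub>R (\<zeta> - p22 t \<zeta>)"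
  and e3: "p12 t \<Omega> = t *\<^sub>R p11 t \<epsilon>" and e4: "p22 t \<Omega> = t *\<^sub>R p21 t \<epsilon>" for t
  using fixed[of t] killed[of t] by (auto simp: p_eq blinfun.bilinear_simps algebra_simps eq_neg_iff_add_eq_0 zero_prod_def)
 define t where "t n = inverse (real (Suc n))" for n
 have t0: "t n > 0" for n by (simp add: t_def)
 have t_lim: "t \<longlonglongrightarrow> 0" unfolding t_def by (rule LIMSEQ_inverse_real_of_nat)
 have null: "(\<lambda>n. t n *\<^sub>R v n) \<longlonglongrightarrow> 0" if "\<And>n. norm (v n) \<le> c" for v :: "nat \<Rightarrow> 'k" and c
 proof (rule Lim_null_comparison)
  show "eventually (\<lambda>n. norm (t n *\<^sub>R v n) \<le> t n * c) sequentially"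
   using that t0 by (auto intro!: always_eventually mult_left_mono simp: less_imp_le abs_of_pos)
  show "(\<lambda>n. t n * c) \<longlonglongrightarrow> 0" using tendsto_mult[OF t_lim tendsto_const[of c]] by simp
 qed
 have comm_corner: "p11 t (app x \<xi>) = x (p11 t \<xi>)" "p22 t (x \<xi>) = x (p22 t \<xi>)" if "x \<in> A" for x \<xi> t
  using p_comm[OF that, of t "(\<xi>, 0)"] p_comm[OF that, of t "(0, \<xi>)"] by (simp_all add: ap blinfun.zero_right)
 \<comment> \<open>Both diagonal corners are contractions commuting with \<open>A\<close>, so their
   strong limits are determined at \<Omega>, where \<open>e1\<close> and \<open>e4\<close> show
   errors of order \<open>t\<close>.\<close>
 have l11: "(\<lambda>n. p11 (t n) v) \<longlonglongrightarrow> id_blinfun v" for v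
 proof (rule tendsto_dense[OF denseA n11])
  fix u assume "u \<in> (\<lambda>x. app x \<Omega>) ` A"
  then obtain x where x: "u = app x \<Omega>" "x \<in> A" by blast
  have "(\<lambda>n. \<Omega> - t n *\<^sub>R p12 (t n) \<zeta>) \<longlonglongrightarrow> \<Omega> - 0" by (intro tendsto_intros null[OF n12])
  then have "(\<lambda>n. x (p11 (t n) \<Omega>)) \<longlonglongrightarrow> x (\<Omega> - 0)" by (intro blinfun.tendsto tendsto_const) (simp add: e1)
  then show "(\<lambda>n. p11 (t n) u) \<longlonglongrightarrow> id_blinfun u" using x by (simp add: comm_corner)
 qed
 have l22: "(\<lambda>n. p22 (t n) v) \<longlonglongrightarrow> (0 :: 'k \<Rightarrow>\<^sub>L 'k) v" for v
 proof (rule tendsto_dense[OF denseA n22])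
  fix u assume "u \<in> (\<lambda>x. app x \<Omega>) ` A"
  then obtain x where x: "u = app x \<Omega>" "x \<in> A" by blast
  have "(\<lambda>n. x (p22 (t n) \<Omega>)) \<longlonglongrightarrow> x 0" unfolding e4 by (intro blinfun.tendsto tendsto_const null[OF n21])
  then show "(\<lambda>n. p22 (t n) u) \<longlonglongrightarrow> (0 :: 'k \<Rightarrow>\<^sub>L 'k) u" using x by (simp add: comm_corner blinfun.zero_right)
 qed
 \<comment> \<open>Division by \<open>t\<close> turns \<open>e2\<close> and \<open>e3\<close> into
   formulas for \<open>a n \<Omega>\<close> and \<open>adj (a n) \<Omega>\<close> whose limits are
   \<zeta> and \<epsilon>.\<close>
 define a where "a n = (1 / t n) *\<^sub>R p21 (t n)" for n
 have "a n \<in> A'" for n unfolding a_def by (intro A'_intros in_A')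
 moreover have "a n \<Omega> = \<zeta> - p22 (t n) \<zeta>" for n using t0[of n] by (simp add: a_def blinfun.scaleR_left e2)
 moreover have "adj (a n) \<Omega> = p11 (t n) \<epsilon>" for n
  using t0[of n] by (simp add: a_def adj_scaleR adj21 blinfun.scaleR_left e3)
 moreover have "(\<lambda>n. (\<zeta> - p22 (t n) \<zeta>, p11 (t n) \<epsilon>)) \<longlonglongrightarrow> (\<zeta> - (0 :: 'k \<Rightarrow>\<^sub>L 'k) \<zeta>, id_blinfun \<epsilon>)"
  by (intro tendsto_Pair tendsto_diff tendsto_const l11 l22)
 ultimately have "(\<lambda>n. (a n \<Omega>, adj (a n) \<Omega>)) \<longlonglongrightarrow> (\<zeta>, \<epsilon>)" "\<And>n. a n \<in> A'" by simp_all
 then show ?thesis unfolding tomita_graph_def closure_sequential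
  by (intro exI[of _ "\<lambda>n. (a n \<Omega>, adj (a n) \<Omega>)"]) auto
qed

lemma tomita_swap: "tomita A' A \<Omega>"
 by unfold_locales (auto simp: comm adjA adjA' denseA denseA')

text \<open>By \<open>commutant_graph\<close> the graph for \<open>A'\<close> is, up to a change of
  sign in one coordinate, the orthogonal complement of the graph for \<open>A\<close>. Its
  projection thus has \<open>1 - R\<close> on the diagonal, and off the diagonal the two signs
  cancel and leave \<open>C\<close>.\<close>

lemma modR_swap: "modR A' \<Omega> = id_blinfun - R" and modC_swap: "modC A' \<Omega> = C"
proof -
 interpret s: tomita A' A \<Omega> by (rule tomita_swap)
 have orth': "inner \<xi> \<zeta> = inner \<eta> \<epsilon>" if "(\<xi>, \<eta>) \<in> GS" "(\<zeta>, \<epsilon>) \<in> tomita_graph A' \<Omega>" for \<xi> \<eta> \<zeta> \<epsilon>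
 proof -
  have "closed {q. inner \<xi> (fst q) = inner \<eta> (snd q)}" by (intro closed_Collect_eq continuous_intros)
  with that(2) have "(\<zeta>, \<epsilon>) \<in> {q. inner \<xi> (fst q) = inner \<eta> (snd q)}"
   by (rule s.GS_induct) (use GS_orthogonal[OF that(1)] in simp)
  then show ?thesis by simp
 qed
 have key: "proj (tomita_graph A' \<Omega>) (\<xi>, \<eta>) = (\<xi> - R \<xi> + C \<eta>, C \<xi> + \<eta> - R \<eta>)" for \<xi> \<eta>
 proof (rule s.P_unique)
  show "(\<xi> - R \<xi> + C \<eta>, C \<xi> + \<eta> - R \<eta>) \<in> tomita_graph A' \<Omega>"
  proof (rule commutant_graph)
   fix u v assume uv: "(u, v) \<in> GS"
   have "inner ((\<xi>, - \<eta>) - proj GS (\<xi>, - \<eta>)) (u, v) = 0" by (rule P_facts(2)[OF uv])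
   then show "inner u (\<xi> - R \<xi> + C \<eta>) = inner v (C \<xi> + \<eta> - R \<eta>)"
    by (simp add: P_apply inner_prod_def blinfun.minus_right inner_add inner_diff inner_commute)
  qed
  fix q assume "q \<in> tomita_graph A' \<Omega>"
  then have q: "(fst q, snd q) \<in> tomita_graph A' \<Omega>" by simp
  have "(R \<xi> - C \<eta>, C \<xi> - R \<eta>) \<in> GS" using P_facts(1)[of "(\<xi>, - \<eta>)"] by (simp add: P_apply blinfun.minus_right)
  from orth'[OF this q] show "inner ((\<xi>, \<eta>) - (\<xi> - R \<xi> + C \<eta>, C \<xi> + \<eta> - R \<eta>)) q = 0"
   by (simp add: inner_prod_def inner_add inner_diff)
 qed
 have k: "fst (proj (tomita_graph A' \<Omega>) (\<xi>, 0)) = \<xi> - R \<xi>" "fst (proj (tomita_graph A' \<Omega>) (0, \<xi>)) = C \<xi>" for \<xi>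
  by (simp_all add: key blinfun.zero_right)
 show "modR A' \<Omega> = id_blinfun - R" "modC A' \<Omega> = C"
  by (auto intro!: blinfun_eqI simp: s.R_apply s.C_apply k blinfun.diff_left)
qed

end

text \<open>In terms of the modular operator this is \<Delta>^(1/2) (1 + \<Delta>)^(-1), the modulus
  of \<open>modC\<close>.\<close>

definition modQ :: "('k::complex_hilbert \<Rightarrow>\<^sub>L 'k) set \<Rightarrow> 'k \<Rightarrow> 'k \<Rightarrow>\<^sub>L 'k" where
 "modQ A \<Omega> = fc (modR A \<Omega>) (\<lambda>r. sqrt (r * (1 - r)))"

text \<open>The modular conjugation, obtained as the conjugate-linear isometry in the polar
  decomposition of \<open>modC\<close>. Under the assumptions of \<open>tomita\<close>,
  \<open>modQ\<close> has dense range, so the choice is unique.\<close>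

definition modJ :: "('k::complex_hilbert \<Rightarrow>\<^sub>L 'k) set \<Rightarrow> 'k \<Rightarrow> 'k \<Rightarrow>\<^sub>L 'k" where
 "modJ A \<Omega> = (SOME J. \<forall>\<xi>. app J (modQ A \<Omega> \<xi>) = modC A \<Omega> \<xi>)"

lemma continuous_on_reflect:
 fixes f :: "real \<Rightarrow> real"
 shows "cont01 f \<Longrightarrow> cont01 (\<lambda>x. f (1 - x))"
 by (rule continuous_on_compose2) (auto intro!: continuous_intros)

section \<open>The modular conjugation from the polar decomposition C = J Q\<close>

context tomita
begin

abbreviation "Q \<equiv> modQ A \<Omega>"
abbreviation "J \<equiv> modJ A \<Omega>"

lemma sqrt_cont: "cont01 (\<lambda>r::real. sqrt (r * (1 - r)))"
 by (intro continuous_intros)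

lemma fc_fc: "cont01 f \<Longrightarrow> cont01 g \<Longrightarrow> fc R f (fc R g \<xi>) = fc R (\<lambda>x. f x * g x) \<xi>"
 by (simp add: fc_mult[OF unit_op_R])

lemma Q_Q: "Q (Q \<xi>) = R (\<xi> - R \<xi>)"
proof -
 have "Q (Q \<xi>) = fc R (\<lambda>r. r * (1 - r)) \<xi>"
  unfolding modQ_def by (subst fc_fc[OF sqrt_cont sqrt_cont])
   (auto intro!: arg_cong[of _ _ "\<lambda>T. app T \<xi>"] fc_cong[OF unit_op_R] simp: real_sqrt_mult_self)
 also have "\<dots> = R ((id_blinfun - R) \<xi>)"
  using fc_times_ident[OF unit_op_R, of "\<lambda>r. 1 - r"] fc_compl[OF unit_op_R] by (simp add: continuous_intros)
 finally show ?thesis by (simp add: blinfun.diff_left)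
qed

lemma sa_Q: "sa Q"
 unfolding modQ_def by (rule sa_fc[OF unit_op_R sqrt_cont])

lemma Q_sym: "inner (Q x) y = inner x (Q y)"
 using sa_Q by (simp add: sa_def)

lemma Q_inj: "Q \<xi> = 0 \<Longrightarrow> \<xi> = 0"
 using Q_Q[of \<xi>] R_inj[of "\<xi> - R \<xi>"] R_compl_inj[of \<xi>] by (auto simp: blinfun.zero_right)

lemma Q_dense: "closure (range (app Q)) = UNIV"
 by (rule sa_inj_dense[OF sa_Q Q_inj])

lemma norm_C: "norm (C \<xi>) = norm (Q \<xi>)"
proof -
 have "inner (C \<xi>) (C \<xi>) = inner (Q \<xi>) (Q \<xi>)" by (simp add: C_sym Q_sym C_C Q_Q)
 then show ?thesis by (simp add: norm_eq_sqrt_inner)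
qed

lemma J_Q: "J (Q \<xi>) = C \<xi>"
proof -
 define G where "G = range (\<lambda>\<xi>. (Q \<xi>, C \<xi>))"
 have sub: "subspace G" unfolding G_def
  by (intro linear_subspace_image linearI subspace_UNIV) (simp_all add: blinfun.bilinear_simps)
 have bd: "norm y \<le> 1 * norm x" if "(x, y) \<in> G" for x y using that by (auto simp: G_def norm_C)
 have dense: "closure (fst ` G) = UNIV" using Q_dense by (simp add: G_def image_image)
 have "\<exists>J. \<forall>\<xi>. app J (Q \<xi>) = C \<xi>"
 proof (rule extend_graph[OF sub bd dense])
  fix T :: "'k \<Rightarrow>\<^sub>L 'k" assume "\<And>x y. (x, y) \<in> G \<Longrightarrow> T x = y"
  then have "\<forall>\<xi>. T (Q \<xi>) = C \<xi>" by (auto simp: G_def)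
  then show ?thesis by blast
 qed
 then show ?thesis unfolding modJ_def by (rule someI2_ex) blast
qed

text \<open>\<open>C\<close> carries \<open>R\<close> into \<open>1 - R\<close>, the bounded form of
  the inversion of \<Delta> by the modular conjugation.\<close>

lemma C_fc: "cont01 f \<Longrightarrow> C (fc R f \<xi>) = fc R (\<lambda>r. f (1 - r)) (C \<xi>)"
proof -
 assume f: "cont01 f"
 have "C o\<^sub>L R = (id_blinfun - R) o\<^sub>L C" by (rule blinfun_eqI) (simp add: C_R blinfun.diff_left)
 from fc_intertwine[OF unit_op_R unit_op_compl[OF unit_op_R] this f]
 have "(C o\<^sub>L fc R f) \<xi> = (fc (id_blinfun - R) f o\<^sub>L C) \<xi>" by simp
 then show ?thesis by (simp add: fc_reflect[OF unit_op_R f])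
qed

lemma C_Q: "C (Q \<xi>) = Q (C \<xi>)"
 unfolding modQ_def C_fc[OF sqrt_cont] by (simp add: mult.commute)

lemma Q_J: "Q (J \<xi>) = C \<xi>"
proof -
 have "Q o\<^sub>L J = C"
  by (rule blinfun_eqI_dense[OF Q_dense]) (auto simp: J_Q C_Q)
 then show ?thesis by (metis blinfun_apply_blinfun_compose)
qed

lemma J_J: "J (J \<xi>) = \<xi>"
proof -
 have "Q (J (J \<xi>) - \<xi>) = 0"
 proof -
  have "Q (Q (J (J \<xi>))) = Q (C (J \<xi>))" by (simp add: Q_J)
  also have "\<dots> = C (C \<xi>)" by (simp add: C_Q[symmetric] Q_J)
  finally have "Q (Q (J (J \<xi>) - \<xi>)) = 0" by (simp add: C_C Q_Q blinfun.diff_right)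
  then show ?thesis by (rule Q_inj)
 qed
 then show ?thesis using Q_inj by force
qed

lemma norm_J: "norm (J \<xi>) = norm \<xi>"
proof -
 have "closed {\<xi>. norm (J \<xi>) = norm \<xi>}" by (intro closed_Collect_eq continuous_intros)
 moreover have "range (app Q) \<subseteq> {\<xi>. norm (J \<xi>) = norm \<xi>}" by (auto simp: J_Q norm_C)
 ultimately have "closure (range (app Q)) \<subseteq> {\<xi>. norm (J \<xi>) = norm \<xi>}" by (intro closure_minimal)
 then show ?thesis using Q_dense by auto
qed

lemma inner_J_J: "inner (J \<xi>) (J \<eta>) = inner \<xi> \<eta>"
proof -
 have n: "inner (J u) (J u) = inner u u" for u using norm_J[of u] by (simp add: norm_eq_sqrt_inner)
 show ?thesis using n[of "\<xi> + \<eta>"] n[of \<xi>] n[of \<eta>]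
  by (simp add: blinfun.add_right inner_add inner_commute)
qed

lemma J_sym: "inner (J \<xi>) \<eta> = inner \<xi> (J \<eta>)"
 using inner_J_J[of \<xi> "J \<eta>"] by (simp add: J_J)

lemma adj_J: "adj J = J"
 by (rule adjI) (rule J_sym)

lemma J_i: "J (\<i> *\<^sub>C \<xi>) = - (\<i> *\<^sub>C J \<xi>)"
proof -
 have Qi: "Q (\<i> *\<^sub>C \<xi>) = \<i> *\<^sub>C Q \<xi>" for \<xi>
 proof -
  have "R \<in> commutant {}" by (simp add: commutant_iff bounded_ops_iff R_i)
  then have "Q \<in> commutant {}" unfolding modQ_def by (intro commutant_fc unit_op_R sqrt_cont)
  then show ?thesis by (simp add: commutant_iff bounded_opsD)
 qed
 have "Q (J (\<i> *\<^sub>C \<xi>) + \<i> *\<^sub>C J \<xi>) = 0" by (simp add: blinfun.add_right Q_J Qi C_i)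
 then have "J (\<i> *\<^sub>C \<xi>) + \<i> *\<^sub>C J \<xi> = 0" by (rule Q_inj)
 then show ?thesis by (simp add: eq_neg_iff_add_eq_0)
qed

lemma J_R: "J (R \<xi>) = J \<xi> - R (J \<xi>)"
proof -
 have QR: "Q (R \<xi>) = R (Q \<xi>)" for \<xi>
  using fc_fc[OF sqrt_cont continuous_on_id, of \<xi>] fc_fc[OF continuous_on_id sqrt_cont, of \<xi>]
  by (simp add: modQ_def fc_ident[OF unit_op_R] mult.commute)
 have "Q (J (R \<xi>) - (J \<xi> - R (J \<xi>))) = 0" by (simp add: blinfun.diff_right Q_J QR C_R)
 then show ?thesis using Q_inj by force
qed

lemma J_fc: "cont01 f \<Longrightarrow> J (fc R f \<xi>) = fc R (\<lambda>r. f (1 - r)) (J \<xi>)"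
proof -
 assume f: "cont01 f"
 have "J o\<^sub>L R = (id_blinfun - R) o\<^sub>L J" by (rule blinfun_eqI) (simp add: J_R blinfun.diff_left)
 from fc_intertwine[OF unit_op_R unit_op_compl[OF unit_op_R] this f]
 have "(J o\<^sub>L fc R f) \<xi> = (fc (id_blinfun - R) f o\<^sub>L J) \<xi>" by simp
 then show ?thesis by (simp add: fc_reflect[OF unit_op_R f])
qed

lemma modQ_swap: "modQ A' \<Omega> = Q"
 using fc_reflect[OF unit_op_R sqrt_cont] by (simp add: modQ_def modR_swap mult.commute)

lemma modJ_swap: "modJ A' \<Omega> = J"
 by (simp add: modJ_def modQ_swap modC_swap)

lemma A_vec: "x \<in> A \<Longrightarrow> R (x \<Omega>) + C (adj x \<Omega>) = x \<Omega>"
 using GS_base[of x] by (simp add: GS_iff)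

lemma A'_vec: "a \<in> A' \<Longrightarrow> C (adj a \<Omega>) = R (a \<Omega>)"
proof -
 assume a: "a \<in> A'"
 interpret s: tomita A' A \<Omega> by (rule tomita_swap)
 show ?thesis using s.A_vec[OF a] by (simp add: modR_swap modC_swap blinfun.diff_left algebra_simps)
qed

section \<open>Sakai's Radon-Nikodym theorem with a parameter\<close>

lemma GS_dual: "(u, v) \<in> GS \<Longrightarrow> inner v (C \<theta>) = inner u (\<theta> - R \<theta>)"
proof -
 assume "(u, v) \<in> GS"
 then have "C v = u - R u" by (simp add: GS_iff algebra_simps)
 then show ?thesis by (simp add: C_sym[symmetric] inner_diff R_sym)
qed

text \<open>These are the left bounded vectors. The operator that sends \<open>b \<Omega>\<close> to
  \<open>b \<xi>\<close> commutes with \<open>A'\<close> and hence belongs to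
  \<open>A\<close>.\<close>

lemma left_bounded:
 assumes bd: "\<And>b. b \<in> A' \<Longrightarrow> norm (app b \<xi>) \<le> c * norm (app b \<Omega>)" and c: "c \<ge> 0"
 shows "\<exists>k\<in>A. app k \<Omega> = \<xi> \<and> norm k \<le> c"
proof -
 define G where "G = (\<lambda>b. (app b \<Omega>, app b \<xi>)) ` A'"
 have "\<exists>k :: 'k \<Rightarrow>\<^sub>L 'k. (\<forall>u v. (u, v) \<in> G \<longrightarrow> app k u = v) \<and> norm k \<le> c"
 proof (rule extend_graph[of G c])
  interpret s: tomita A' A \<Omega> by (rule tomita_swap)
  show "subspace G" unfolding G_def
   by (intro linear_subspace_image linearI s.subspace_A) (simp_all add: blinfun.bilinear_simps)
  show "norm y \<le> c * norm x" if "(x, y) \<in> G" for x y using that bd by (auto simp: G_def)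
  show "closure (fst ` G) = UNIV" using denseA' by (simp add: G_def image_image)
  fix T :: "'k \<Rightarrow>\<^sub>L 'k" assume "\<And>x y. (x, y) \<in> G \<Longrightarrow> T x = y" "\<And>x. norm (T x) \<le> c * norm x"
  then show ?thesis using c norm_blinfun_bound by blast
 qed
 then obtain k :: "'k \<Rightarrow>\<^sub>L 'k" where "\<And>u v. (u, v) \<in> G \<Longrightarrow> app k u = v" and nk: "norm k \<le> c" by blast
 then have k: "k (b \<Omega>) = b \<xi>" if "b \<in> A'" for b using that by (auto simp: G_def)
 have kb: "k (b v) = b (k v)" if "b \<in> A'" for b v
 proof -
  have "k o\<^sub>L b = b o\<^sub>L k"
  proof (rule blinfun_eqI_dense[OF denseA'])
   fix u assume "u \<in> (\<lambda>x. app x \<Omega>) ` A'"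
   then obtain d where d: "u = app d \<Omega>" "d \<in> A'" by blast
   show "(k o\<^sub>L b) u = (b o\<^sub>L k) u"
    using k[OF A'_intros(8)[OF that d(2)]] k[OF d(2)] d(1) by simp
  qed
  then show ?thesis by (metis blinfun_apply_blinfun_compose)
 qed
 have "k (\<i> *\<^sub>C v) = \<i> *\<^sub>C k v" for v
  using kb[of "\<i> *\<^sub>C id_blinfun" v] A'_intros by (simp add: scaleC_blinfun_apply)
 then have "k \<in> A" using kb by (simp add: comm(2)[symmetric] commutant_iff bounded_ops_iff)
 moreover have "k \<Omega> = \<xi>" using k[OF A'_intros(1)] by simp
 ultimately show ?thesis using nk by blast
qed

text \<open>With a uniform bound on the operators, limits of pairs
  \<open>(k \<Omega>, adj k \<Omega>)\<close> are again such pairs. A ball of \<open>A\<close> thus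
  becomes a norm closed convex set in a Hilbert space, ready for separation.\<close>

lemma A_ball_closed:
 assumes k: "\<And>n. k n \<in> A" "\<And>n. norm (k n) \<le> c" and lim: "(\<lambda>n. app (k n) \<Omega>) \<longlonglongrightarrow> \<xi>" "(\<lambda>n. adj (k n) \<Omega>) \<longlonglongrightarrow> \<eta>"
 shows "\<exists>k\<in>A. norm k \<le> c \<and> app k \<Omega> = \<xi> \<and> adj k \<Omega> = \<eta>"
proof -
 have kb: "k n (b \<Omega>) = b (k n \<Omega>)" if "b \<in> A'" for n b using A_comm[OF k(1) that] by simp
 have "norm (b \<xi>) \<le> c * norm (b \<Omega>)" if b: "b \<in> A'" for b
 proof (rule LIMSEQ_le_const2)
  show "(\<lambda>n. norm (k n (b \<Omega>))) \<longlonglongrightarrow> norm (b \<xi>)" unfolding kb[OF b] by (intro tendsto_intros lim)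
  show "\<exists>N. \<forall>n\<ge>N. norm (k n (b \<Omega>)) \<le> c * norm (b \<Omega>)"
   using order_trans[OF norm_blinfun mult_right_mono[OF k(2)]] by (intro exI[of _ 0]) simp
 qed
 moreover have "c \<ge> 0" using k(2)[of 0] norm_ge_zero order_trans by blast
 ultimately obtain x where x: "x \<in> A" "x \<Omega> = \<xi>" "norm x \<le> c" using left_bounded by blast
 have "inner (adj x \<Omega> - \<eta>) v = 0" if v: "v \<in> (\<lambda>x. app x \<Omega>) ` A'" for v
 proof -
  obtain b where b: "v = app b \<Omega>" "b \<in> A'" using v by blast
  have "(\<lambda>n. inner (adj (k n) \<Omega>) v) \<longlonglongrightarrow> inner \<eta> v" by (intro tendsto_intros lim)
  moreover have "inner (adj (k n) \<Omega>) v = inner \<Omega> (b (k n \<Omega>))" for n by (simp add: adj b kb)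
  moreover have "(\<lambda>n. inner \<Omega> (b (k n \<Omega>))) \<longlonglongrightarrow> inner \<Omega> (b \<xi>)" by (intro tendsto_intros lim)
  ultimately have "inner \<eta> v = inner \<Omega> (b \<xi>)" using LIMSEQ_unique by simp
  then show ?thesis using A_comm[OF x(1) b(2), of \<Omega>] by (simp add: inner_diff adj b x(2))
 qed
 then have "adj x \<Omega> - \<eta> = 0" by (rule dense_orthogonal[OF denseA'])
 then show ?thesis using x by auto
qed

text \<open>For a polar decomposition x = u|x| the choice k = r u would do. Here u is replaced by
  \<open>x\<close> times the inverse square root of \<open>adj x o\<^sub>L x + \<epsilon>\<close>,
  at the price of the term with \<open>sqrt \<epsilon>\<close>. The radius \<open>r\<close> is the
  one at which the inequality of arithmetic and geometric means, with weight \<mu>, absorbs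
  \<open>norm a\<close>.\<close>

lemma sakai_polar:
 assumes x: "x \<in> A" and a: "a \<in> A'" and \<mu>: "\<mu> > 0" and \<epsilon>: "\<epsilon> > 0"
 defines "r \<equiv> norm a / (2 * sqrt \<mu>)"
 shows "\<exists>k\<in>A. norm k \<le> r \<and>
  inner (app x \<Omega>) (app a \<Omega>) \<le> \<mu> * inner (x \<Omega>) (app k \<Omega>) + inner (adj x \<Omega>) (adj k \<Omega>) + r * \<mu> * sqrt \<epsilon> * (norm \<Omega>)\<^sup>2"
proof -
 define c where "c = (norm x)\<^sup>2 + 1"
 have c: "c > 0" by (simp add: c_def add_nonneg_pos)
 define X where "X = (1 / c) *\<^sub>R (adj x o\<^sub>L x)"
 have "norm (adj x o\<^sub>L x) \<le> c"
  using norm_blinfun_compose[of "adj x" x] by (simp add: c_def power2_eq_square)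
 then have X: "unit_op X" unfolding X_def by (intro unit_op_scaled pos_adj_compose c)
 have XA: "X \<in> A" unfolding X_def by (intro A_intros adjA x)
 have XX: "adj x (x v) = c *\<^sub>R X v" for v using c by (simp add: X_def blinfun.scaleR_left)
 \<comment> \<open>Because of the scaling by \<open>c\<close>, \<open>fc X (f s)\<close> is the
   power with exponent \<open>s\<close> of \<open>adj x o\<^sub>L x + \<epsilon>\<close>.\<close>
 define f where "f s t = (c * t + \<epsilon>) powr s" for s t
 have arg_pos: "0 < c * t + \<epsilon>" if "t \<in> {0..1}" for t using that c \<epsilon> by (simp add: add_nonneg_pos)
 have cont: "cont01 (f s)" for s
  unfolding f_def by (intro continuous_intros) (use arg_pos in force)
 have ff: "fc X (f s) (fc X (f s') v) = fc X (f (s + s')) v" for s s' v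
 proof -
  have "fc X (f s) o\<^sub>L fc X (f s') = fc X (\<lambda>t. f s t * f s' t)" by (rule fc_mult[OF X cont cont, symmetric])
  also have "\<dots> = fc X (f (s + s'))" using arg_pos by (intro fc_cong X) (simp add: f_def powr_add)
  finally show ?thesis by (metis blinfun_apply_blinfun_compose)
 qed
 have f0: "fc X (f 0) v = v" for v
 proof -
  have "fc X (f 0) = fc X (\<lambda>t. 1)" using arg_pos by (intro fc_cong X) (force simp: f_def)
  then show ?thesis by (simp add: fc_const[OF X])
 qed
 have fsym: "inner (fc X (f s) u) v = inner u (fc X (f s) v)" for s u v by (rule fc_sym[OF X cont])
 have Xf: "X (fc X (f s) v) = fc X (\<lambda>t. t * f s t) v" for s v
  using fc_times_ident[OF X cont[of s]] by simp
 have fA: "fc X (f s) \<in> A" for s unfolding comm(2)[symmetric]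
  by (rule commutant_fc[OF X _ cont]) (simp add: comm XA)
 define k where "k = r *\<^sub>R (x o\<^sub>L fc X (f (- 1 / 2)))"
 have r: "r \<ge> 0" using \<mu> by (simp add: r_def)
 have kA: "k \<in> A" unfolding k_def by (intro A_intros x fA)
 have "norm (x (fc X (f (- 1 / 2)) v)) \<le> 1 * norm v" for v
 proof -
  have "(norm (x (fc X (f (- 1 / 2)) v)))\<^sup>2 = c * inner (fc X (f (- 1 / 2)) v) (X (fc X (f (- 1 / 2)) v))"
   by (simp add: power2_norm_eq_inner adj' XX)
  also have "inner (fc X (f (- 1 / 2)) v) (X (fc X (f (- 1 / 2)) v)) = inner v (X (fc X (f (- 1)) v))"
  proof -
   have "fc X (f (- 1 / 2)) (X w) = X (fc X (f (- 1 / 2)) w)" for w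
    using fc_mult[OF X cont[of "- 1 / 2"] continuous_on_id] fc_mult[OF X continuous_on_id cont[of "- 1 / 2"]]
    by (simp add: fc_ident[OF X] mult.commute) (metis blinfun_apply_blinfun_compose)
   then show ?thesis by (simp add: fsym ff)
  qed
  also have "c * inner v (X (fc X (f (- 1)) v)) = inner v (fc X (\<lambda>t. c * (t * f (- 1) t)) v)"
   using fc_cmult[OF X, of "\<lambda>t. t * f (- 1) t" c] cont[of "- 1"]
   by (simp add: Xf blinfun.scaleR_left continuous_intros)
  also have "\<dots> \<le> inner v (fc X (\<lambda>t. 1) v)"
  proof (rule fc_mono[OF X])
   show "cont01 (\<lambda>t. c * (t * f (- 1) t))" by (intro continuous_intros cont)
   fix t :: real assume t: "t \<in> {0..1}"
   show "c * (t * f (- 1) t) \<le> 1"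
    using arg_pos[OF t] \<epsilon> by (simp add: f_def powr_minus field_simps)
  qed simp
  finally have "(norm (x (fc X (f (- 1 / 2)) v)))\<^sup>2 \<le> (norm v)\<^sup>2" by (simp add: fc_const[OF X] power2_norm_eq_inner)
  from power2_le_imp_le[OF this norm_ge_zero] show ?thesis by simp
 qed
 then have "norm (x o\<^sub>L fc X (f (- 1 / 2))) \<le> 1" by (intro norm_blinfun_bound) auto
 then have kr: "norm k \<le> r" using r by (simp add: k_def mult_left_le)
 define \<alpha> where "\<alpha> = norm (fc X (f (- 1 / 4)) (adj x \<Omega>))"
 define \<beta> where "\<beta> = norm (fc X (f (1 / 4)) \<Omega>)"
 have 1: "inner (adj x \<Omega>) (adj k \<Omega>) = r * \<alpha>\<^sup>2"
 proof -
  have "adj k \<Omega> = r *\<^sub>R fc X (f (- 1 / 2)) (adj x \<Omega>)"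
   by (simp add: k_def adj_scaleR adj_compose adj_fc[OF X cont] blinfun.scaleR_left)
  moreover have "\<alpha>\<^sup>2 = inner (adj x \<Omega>) (fc X (f (- 1 / 2)) (adj x \<Omega>))"
   by (simp add: \<alpha>_def power2_norm_eq_inner fsym ff)
  ultimately show ?thesis by simp
 qed
 \<comment> \<open>Rests on \<open>sqrt (\<tau> + \<epsilon>) - sqrt \<epsilon> \<le> \<tau> / sqrt
   (\<tau> + \<epsilon>)\<close> for \<open>\<tau> = c * t\<close>.\<close>
 have 2: "inner (x \<Omega>) (k \<Omega>) \<ge> r * (\<beta>\<^sup>2 - sqrt \<epsilon> * (norm \<Omega>)\<^sup>2)"
 proof -
  have "inner (x \<Omega>) (k \<Omega>) = r * (c * inner \<Omega> (X (fc X (f (- 1 / 2)) \<Omega>)))"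
   by (simp add: k_def blinfun.scaleR_left adj' XX)
  also have "c * inner \<Omega> (X (fc X (f (- 1 / 2)) \<Omega>)) = inner \<Omega> (fc X (\<lambda>t. c * (t * f (- 1 / 2) t)) \<Omega>)"
   using fc_cmult[OF X, of "\<lambda>t. t * f (- 1 / 2) t" c] cont[of "- 1 / 2"]
   by (simp add: Xf blinfun.scaleR_left continuous_intros)
  finally have eq: "inner (x \<Omega>) (k \<Omega>) = r * inner \<Omega> (fc X (\<lambda>t. c * (t * f (- 1 / 2) t)) \<Omega>)" .
  have "inner \<Omega> (fc X (\<lambda>t. f (1 / 2) t - sqrt \<epsilon>) \<Omega>) \<le> inner \<Omega> (fc X (\<lambda>t. c * (t * f (- 1 / 2) t)) \<Omega>)"
  proof (rule fc_mono[OF X])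
   show "cont01 (\<lambda>t. c * (t * f (- 1 / 2) t))" "cont01 (\<lambda>t. f (1 / 2) t - sqrt \<epsilon>)"
    by (intro continuous_intros cont)+
   fix t :: real assume t: "t \<in> {0..1}"
   have s: "f (1 / 2) t = sqrt (c * t + \<epsilon>)" "f (- 1 / 2) t = 1 / sqrt (c * t + \<epsilon>)"
    using arg_pos[OF t] by (simp_all add: f_def powr_half_sqrt powr_minus_divide)
   have sp: "sqrt (c * t + \<epsilon>) > 0" using arg_pos[OF t] by simp
   have "sqrt \<epsilon> \<le> sqrt (c * t + \<epsilon>)" using t c by simp
   then have "sqrt \<epsilon> * sqrt \<epsilon> \<le> sqrt \<epsilon> * sqrt (c * t + \<epsilon>)" using \<epsilon> by (intro mult_left_mono) auto
   then have "\<epsilon> \<le> sqrt \<epsilon> * sqrt (c * t + \<epsilon>)" using \<epsilon> by simp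
   moreover have "sqrt (c * t + \<epsilon>) * sqrt (c * t + \<epsilon>) = c * t + \<epsilon>" using arg_pos[OF t] by simp
   ultimately have "(sqrt (c * t + \<epsilon>) - sqrt \<epsilon>) * sqrt (c * t + \<epsilon>) \<le> c * t" by (simp add: algebra_simps)
   then show "f (1 / 2) t - sqrt \<epsilon> \<le> c * (t * f (- 1 / 2) t)"
    unfolding s using sp by (simp add: pos_le_divide_eq)
  qed
  moreover have "inner \<Omega> (fc X (\<lambda>t. f (1 / 2) t - sqrt \<epsilon>) \<Omega>) = \<beta>\<^sup>2 - sqrt \<epsilon> * (norm \<Omega>)\<^sup>2"
   using fc_diff[OF X cont[of "1 / 2"], of "\<lambda>t. sqrt \<epsilon>"]
   by (simp add: fc_const[OF X] \<beta>_def power2_norm_eq_inner fsym ff blinfun.bilinear_simps inner_diff)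
  ultimately show ?thesis unfolding eq using r by (intro mult_left_mono) auto
 qed
 \<comment> \<open>The identity is split into the powers with exponents -1/4 and 1/4. Since
   \<open>a\<close> commutes with them, one power can be placed on each of the two vectors.\<close>
 have 3: "inner (x \<Omega>) (a \<Omega>) \<le> norm a * \<alpha> * \<beta>"
 proof -
  have "inner (x \<Omega>) (a \<Omega>) = inner (x (fc X (f (- 1 / 4)) (fc X (f (1 / 4)) \<Omega>))) (a \<Omega>)" by (simp add: ff f0)
  also have "\<dots> = inner (fc X (f (1 / 4)) \<Omega>) (fc X (f (- 1 / 4)) (adj x (a \<Omega>)))" by (simp only: adj'[of x] fsym)
  also have "fc X (f (- 1 / 4)) (adj x (a \<Omega>)) = a (fc X (f (- 1 / 4)) (adj x \<Omega>))"
   by (simp add: A_comm[OF adjA[OF x] a] A_comm[OF fA a])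
  also have "inner (fc X (f (1 / 4)) \<Omega>) (a (fc X (f (- 1 / 4)) (adj x \<Omega>))) \<le> \<beta> * norm (a (fc X (f (- 1 / 4)) (adj x \<Omega>)))"
   unfolding \<beta>_def by (rule norm_cauchy_schwarz)
  also have "\<dots> \<le> \<beta> * (norm a * \<alpha>)" unfolding \<alpha>_def by (intro mult_left_mono norm_blinfun) (simp add: \<beta>_def)
  finally show ?thesis by (simp add: mult_ac)
 qed
 have "norm a * \<alpha> * \<beta> \<le> \<mu> * (r * \<beta>\<^sup>2) + r * \<alpha>\<^sup>2"
 proof -
  have "0 \<le> r * (sqrt \<mu> * \<beta> - \<alpha>)\<^sup>2" using r by simp
  also have "\<dots> = \<mu> * (r * \<beta>\<^sup>2) + r * \<alpha>\<^sup>2 - (2 * sqrt \<mu> * r) * \<alpha> * \<beta>"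
   using \<mu> by (simp add: power2_eq_square algebra_simps)
  also have "2 * sqrt \<mu> * r = norm a" using \<mu> by (simp add: r_def)
  finally show ?thesis by simp
 qed
 moreover have "\<mu> * inner (x \<Omega>) (k \<Omega>) \<ge> \<mu> * (r * (\<beta>\<^sup>2 - sqrt \<epsilon> * (norm \<Omega>)\<^sup>2))"
  using 2 \<mu> by (intro mult_left_mono) auto
 ultimately have "inner (app x \<Omega>) (app a \<Omega>) \<le> \<mu> * inner (x \<Omega>) (app k \<Omega>) + inner (adj x \<Omega>) (adj k \<Omega>) + r * \<mu> * sqrt \<epsilon> * (norm \<Omega>)\<^sup>2"
  using 1 3 by (simp add: algebra_simps)
 then show ?thesis using kA kr by blast
qed

text \<open>In terms of the modular operator this is (1 + \<Delta>)(\<Delta> + \<mu>)^(-1); composed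
  with \<open>R\<close> it becomes the resolvent (\<Delta> + \<mu>)^(-1).\<close>

definition resolv :: "real \<Rightarrow> 'k \<Rightarrow>\<^sub>L 'k" where
 "resolv \<mu> = fc R (\<lambda>r. 1 / (1 - r + \<mu> * r))"

lemma resolv_den: "0 < \<mu> \<Longrightarrow> r \<in> {0..1} \<Longrightarrow> 0 < 1 - r + \<mu> * (r::real)"
 by (cases "r = 1") (auto simp: add_pos_nonneg)

lemma resolv_cont: "0 < \<mu> \<Longrightarrow> cont01 (\<lambda>r::real. 1 / (1 - r + \<mu> * r))"
 by (intro continuous_intros) (use resolv_den in fastforce)

lemma fc_R: "cont01 f \<Longrightarrow> fc R f (R \<xi>) = R (fc R f \<xi>)"
 using fc_fc[of f "\<lambda>x. x" \<xi>] fc_fc[of "\<lambda>x. x" f \<xi>] by (simp add: fc_ident[OF unit_op_R] mult.commute continuous_intros)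

lemma resolv_R: "0 < \<mu> \<Longrightarrow> resolv \<mu> (R \<xi>) = R (resolv \<mu> \<xi>)"
 unfolding resolv_def by (rule fc_R[OF resolv_cont])

lemma resolv_inverse:
 assumes "0 < \<mu>"
 shows "resolv \<mu> \<xi> - R (resolv \<mu> \<xi>) + \<mu> *\<^sub>R R (resolv \<mu> \<xi>) = \<xi>"
proof -
 let ?f = "\<lambda>r. 1 / (1 - r + \<mu> * r)"
 have c: "cont01 ?f" by (rule resolv_cont[OF assms])
 have "\<xi> = fc R (\<lambda>r. 1) \<xi>" by (simp add: fc_const[OF unit_op_R])
 also have "fc R (\<lambda>r. 1) = fc R (\<lambda>r. ?f r + (\<mu> - 1) * (r * ?f r))"
 proof (rule fc_cong[OF unit_op_R])
  fix r :: real assume r: "r \<in> {0..1}"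
  have "?f r + (\<mu> - 1) * (r * ?f r) = (1 - r + \<mu> * r) / (1 - r + \<mu> * r)"
   unfolding times_divide_eq_right add_divide_distrib[symmetric] by (rule arg_cong[of _ _ "\<lambda>t. t / _"]) (simp add: algebra_simps)
  then show "1 = ?f r + (\<mu> - 1) * (r * ?f r)" using resolv_den[OF assms r] by simp
 qed
 also have "\<dots> = resolv \<mu> + (\<mu> - 1) *\<^sub>R (R o\<^sub>L resolv \<mu>)"
 proof -
  have c': "cont01 (\<lambda>r. r * ?f r)" by (intro continuous_on_mult continuous_on_id c)
  show ?thesis
   unfolding resolv_def fc_times_ident[OF unit_op_R c, symmetric] fc_cmult[OF unit_op_R c', symmetric]
   by (intro fc_add unit_op_R c c' continuous_on_mult_left)
 qed
 finally show ?thesis by (simp add: blinfun.bilinear_simps algebra_simps)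
qed

lemma C_resolv: "0 < \<mu> \<Longrightarrow> C (resolv \<mu> \<xi>) = fc R (\<lambda>r. 1 / (r + \<mu> * (1 - r))) (C \<xi>)"
 unfolding resolv_def by (subst C_fc[OF resolv_cont]) auto

text \<open>Riesz representation on the Tomita graph for the equivalent inner product with weight
  \<mu> on the first coordinate. The solution is explicit: \<open>\<xi> = resolv \<mu> p\<close>,
  and \<eta> arises from \<open>q\<close> by the reflected function of \<open>R\<close>.\<close>

lemma sakai_functional:
 assumes p: "(p, q) \<in> GS" and \<mu>: "0 < \<mu>"
 shows "\<exists>\<xi> \<eta>. (\<xi>, \<eta>) \<in> GS \<and>
  (\<forall>u v. (u, v) \<in> GS \<longrightarrow> inner p u + inner q v = \<mu> * inner \<xi> u + inner \<eta> v)"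
proof (intro exI conjI allI impI)
 let ?g = "\<lambda>r::real. 1 / (r + \<mu> * (1 - r))"
 let ?M' = "fc R ?g"
 have cg: "cont01 ?g" using continuous_on_reflect[OF resolv_cont[OF \<mu>]] by simp
 define \<xi> where "\<xi> = resolv \<mu> p"
 define \<eta> where "\<eta> = ?M' q"
 have C1: "C q = p - R p" and C2: "C p = q - R q" using p by (auto simp: GS_iff algebra_simps)
 have C\<eta>: "C \<eta> = \<xi> - R \<xi>"
  unfolding \<eta>_def by (subst C_fc[OF cg]) (simp add: C1 \<xi>_def resolv_def[symmetric] blinfun.diff_right resolv_R[OF \<mu>] add.commute)
 have C\<xi>: "C \<xi> = \<eta> - R \<eta>"
  unfolding \<xi>_def C_resolv[OF \<mu>] C2 by (simp add: \<eta>_def blinfun.diff_right fc_R[OF cg])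
 show GS: "(\<xi>, \<eta>) \<in> GS" by (simp add: GS_iff C\<eta> C\<xi>)
 have ip: "p = \<xi> - R \<xi> + \<mu> *\<^sub>R R \<xi>" unfolding \<xi>_def resolv_inverse[OF \<mu>] ..
 have iq: "q = R \<eta> + \<mu> *\<^sub>R (\<eta> - R \<eta>)"
 proof -
  have "C q = C (R \<eta> + \<mu> *\<^sub>R (\<eta> - R \<eta>))"
   by (simp add: C1 blinfun.bilinear_simps C_R C\<eta> ip resolv_R algebra_simps)
  moreover have "C v = 0 \<Longrightarrow> v = 0" for v using norm_C[of v] Q_inj[of v] by simp
  ultimately show ?thesis by (metis blinfun.diff_right eq_iff_diff_eq_0)
 qed
 fix u v assume uv: "(u, v) \<in> GS"
 have Cuv: "C v = u - R u" "C u = v - R v" using uv by (auto simp: GS_iff algebra_simps)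
 have "inner (C \<eta>) u = inner \<eta> (v - R v)" by (simp add: C_sym Cuv)
 also have "\<dots> = inner (C \<xi>) v" by (simp add: C\<xi> inner_diff R_sym)
 finally have "inner (\<xi> - R \<xi>) u = inner (\<eta> - R \<eta>) v" by (simp add: C\<eta> C\<xi>)
 then have "(\<mu> - 1) * inner (\<xi> - R \<xi>) u = (\<mu> - 1) * inner (\<eta> - R \<eta>) v" by simp
 then show "inner p u + inner q v = \<mu> * inner \<xi> u + inner \<eta> v"
  unfolding ip iq by (simp add: inner_diff inner_add algebra_simps)
qed

text \<open>It says that (\<Delta> + \<mu>)^(-1) a \<Omega> has the form \<open>k \<Omega>\<close>
  with \<open>k\<close> in \<open>A\<close>. If not, the corresponding pair is strictly separated
  from the pairs of the ball of radius \<open>r\<close>. The separating functional comes from a pair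
  in the graph; approximating that pair by \<open>(x \<Omega>, adj x \<Omega>)\<close>,
  \<open>sakai_polar\<close> finds an element of the ball that violates the separation.\<close>

lemma sakai:
 assumes a: "a \<in> A'" and \<mu>: "0 < \<mu>"
 shows "\<exists>k\<in>A. norm k \<le> norm a / (2 * sqrt \<mu>) \<and> app k \<Omega> = resolv \<mu> (R (a \<Omega>)) \<and>
  adj k \<Omega> = C (resolv \<mu> (a \<Omega>))"
proof (rule ccontr)
 assume contra: "\<not> ?thesis"
 define r where "r = norm a / (2 * sqrt \<mu>)"
 define B where "B = {k \<in> A. norm k \<le> r}"
 define K where "K = (\<lambda>k. (app k \<Omega>, adj k \<Omega>)) ` B"
 define \<theta> where "\<theta> = resolv \<mu> (a \<Omega>)"
 have r: "r \<ge> 0" using \<mu> by (simp add: r_def)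
 have s0: "(R \<theta>, C \<theta>) \<notin> K"
  using contra unfolding K_def B_def r_def \<theta>_def by (auto simp: resolv_R[OF \<mu>])
 have "closed K"
  unfolding closed_sequential_limits
 proof (intro allI impI)
  fix f l assume f: "(\<forall>n. f n \<in> K) \<and> f \<longlonglongrightarrow> l"
  then have "\<forall>n. \<exists>k. k \<in> B \<and> f n = (app k \<Omega>, adj k \<Omega>)" unfolding K_def by blast
  from choice[OF this] obtain k where k: "\<forall>n. k n \<in> B \<and> f n = (app (k n) \<Omega>, adj (k n) \<Omega>)" by (rule exE)
  have "(\<lambda>n. app (k n) \<Omega>) \<longlonglongrightarrow> fst l" "(\<lambda>n. adj (k n) \<Omega>) \<longlonglongrightarrow> snd l"
   using tendsto_fst[of f l sequentially] tendsto_snd[of f l sequentially] f k by auto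
  from A_ball_closed[OF _ _ this, of r] k obtain x where "x \<in> A" "norm x \<le> r" "app x \<Omega> = fst l" "adj x \<Omega> = snd l"
   unfolding B_def by blast
  then show "l \<in> K" unfolding K_def B_def by (intro image_eqI[of _ _ x]) (auto simp: prod_eq_iff)
 qed
 moreover have "convex K"
  unfolding convex_def
 proof (intro ballI allI impI)
  fix p q u v assume p: "p \<in> K" and q: "q \<in> K" and uv: "0 \<le> u" "0 \<le> v" "u + v = (1::real)"
  obtain x where x: "x \<in> B" "p = (app x \<Omega>, adj x \<Omega>)" using p unfolding K_def by blast
  obtain y where y: "y \<in> B" "q = (app y \<Omega>, adj y \<Omega>)" using q unfolding K_def by blast
  have "norm (u *\<^sub>R x + v *\<^sub>R y) \<le> u * norm x + v * norm y"
   using norm_triangle_ineq[of "u *\<^sub>R x" "v *\<^sub>R y"] uv by simp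
  also have "\<dots> \<le> u * r + v * r" using x y uv unfolding B_def by (intro add_mono mult_left_mono) auto
  also have "\<dots> = r" using uv by (simp flip: distrib_right)
  finally have "u *\<^sub>R x + v *\<^sub>R y \<in> B" using x y unfolding B_def by (simp add: A_intros)
  then show "u *\<^sub>R p + v *\<^sub>R q \<in> K" unfolding K_def
   by (rule rev_image_eqI) (simp add: x y blinfun.bilinear_simps adj_add adj_scaleR)
 qed
 moreover have "K \<noteq> {}" using r A_intros(2) unfolding K_def B_def by (auto intro!: exI[of _ 0])
 ultimately obtain d \<delta> where \<delta>: "\<delta> > 0" and sep: "\<And>c. c \<in> K \<Longrightarrow> inner d c + \<delta> \<le> inner d (R \<theta>, C \<theta>)"
  using convex_separation[OF _ _ _ s0] by blast
 \<comment> \<open>Only values on the graph matter, so the separating vector \<open>d\<close> may be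
   replaced by its projection onto the graph.\<close>
 define p q where "p = fst (proj GS d)" and "q = snd (proj GS d)"
 have pq: "(p, q) \<in> GS" using P_facts(1)[of d] by (simp add: p_def q_def)
 have dpq: "inner d (u, v) = inner p u + inner q v" if "(u, v) \<in> GS" for u v
  using P_facts(2)[OF that, of d] by (simp add: inner_diff p_def q_def inner_prod_def)
 obtain \<xi> \<eta> where GS: "(\<xi>, \<eta>) \<in> GS"
  and f: "\<And>u v. (u, v) \<in> GS \<Longrightarrow> inner p u + inner q v = \<mu> * inner \<xi> u + inner \<eta> v"
  using sakai_functional[OF pq \<mu>] by blast
 have "inner d (R \<theta>, C \<theta>) = inner \<xi> (a \<Omega>)"
 proof -
  have "inner d (R \<theta>, C \<theta>) = \<mu> * inner \<xi> (R \<theta>) + inner \<eta> (C \<theta>)" by (simp only: dpq[OF R_C_GS(1)] f[OF R_C_GS(1)])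
  also have "\<dots> = inner \<xi> (\<theta> - R \<theta> + \<mu> *\<^sub>R R \<theta>)" by (simp add: GS_dual[OF GS] inner_add)
  finally show ?thesis by (simp only: \<theta>_def resolv_inverse[OF \<mu>])
 qed
 moreover have "inner d (k \<Omega>, adj k \<Omega>) = \<mu> * inner \<xi> (k \<Omega>) + inner \<eta> (adj k \<Omega>)" if "k \<in> B" for k :: "'k \<Rightarrow>\<^sub>L 'k"
 proof -
  have kG: "(k \<Omega>, adj k \<Omega>) \<in> GS" using that B_def GS_base by simp
  show ?thesis by (simp only: dpq[OF kG] f[OF kG])
 qed
 ultimately have sep': "\<mu> * inner \<xi> (k \<Omega>) + inner \<eta> (adj k \<Omega>) + \<delta> \<le> inner \<xi> (a \<Omega>)" if "k \<in> B" for k :: "'k \<Rightarrow>\<^sub>L 'k"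
  using sep[of "(k \<Omega>, adj k \<Omega>)"] that unfolding K_def by simp
 \<comment> \<open>\<open>b1\<close> measures the effect of replacing \<xi> and \<eta> by vectors of
   \<open>x\<close>, \<open>b2\<close> that of the regularisation; each is made to cost at most a
   third of \<delta>. The added ones keep the denominators positive.\<close>
 define b1 where "b1 = norm (a \<Omega>) + (\<mu> + 1) * (r * norm \<Omega>) + 1"
 define b2 where "b2 = r * \<mu> * (norm \<Omega>)\<^sup>2 + 1"
 have b: "b1 > 0" "b2 > 0" using r \<mu> by (auto simp: b1_def b2_def intro!: add_nonneg_pos add_nonneg_nonneg)
 define e where "e = \<delta> / (3 * b1)"
 define \<epsilon> where "\<epsilon> = (\<delta> / (3 * b2))\<^sup>2"
 have e: "e > 0" "\<epsilon> > 0" using \<delta> b by (auto simp: e_def \<epsilon>_def)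
 have "\<exists>y\<in>(\<lambda>x. (app x \<Omega>, adj x \<Omega>)) ` A. dist (\<xi>, \<eta>) y < e"
  by (rule closure_approachableD) (use GS e in \<open>auto simp: tomita_graph_def\<close>)
 then obtain x where x: "x \<in> A" "dist (\<xi>, \<eta>) (app x \<Omega>, adj x \<Omega>) < e" by (rule bexE) auto
 have nx: "norm (\<xi> - x \<Omega>) \<le> e" "norm (\<eta> - adj x \<Omega>) \<le> e"
  using x(2) dist_fst_le[of "(\<xi>, \<eta>)" "(app x \<Omega>, adj x \<Omega>)"] dist_snd_le[of "(\<xi>, \<eta>)" "(app x \<Omega>, adj x \<Omega>)"]
  by (simp_all add: dist_norm)
 from sakai_polar[OF x(1) a \<mu> e(2)] obtain k where k: "k \<in> A" "norm k \<le> r"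
  and k3: "inner (x \<Omega>) (a \<Omega>) \<le> \<mu> * inner (x \<Omega>) (app k \<Omega>) + inner (adj x \<Omega>) (adj k \<Omega>) + r * \<mu> * sqrt \<epsilon> * (norm \<Omega>)\<^sup>2"
  unfolding r_def by blast
 have kn: "norm (k \<Omega>) \<le> r * norm \<Omega>" "norm (adj k \<Omega>) \<le> r * norm \<Omega>"
  using order_trans[OF norm_blinfun mult_right_mono[OF k(2)]] order_trans[OF norm_blinfun mult_right_mono, of "adj k" r \<Omega>] k(2) by auto
 have h: "\<bar>inner (\<xi> - x \<Omega>) (a \<Omega>)\<bar> \<le> e * norm (a \<Omega>)" "\<bar>inner (\<xi> - x \<Omega>) (k \<Omega>)\<bar> \<le> e * (r * norm \<Omega>)"
  "\<bar>inner (\<eta> - adj x \<Omega>) (adj k \<Omega>)\<bar> \<le> e * (r * norm \<Omega>)"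
  by (rule order_trans[OF Cauchy_Schwarz_ineq2], intro mult_mono nx kn order_refl; use e in simp)+
 have "\<delta> \<le> inner \<xi> (a \<Omega>) - \<mu> * inner \<xi> (k \<Omega>) - inner \<eta> (adj k \<Omega>)" using sep'[of k] k B_def by simp
 also have "\<dots> = inner (x \<Omega>) (a \<Omega>) - \<mu> * inner (x \<Omega>) (k \<Omega>) - inner (adj x \<Omega>) (adj k \<Omega>)
   + inner (\<xi> - x \<Omega>) (a \<Omega>) - \<mu> * inner (\<xi> - x \<Omega>) (k \<Omega>) - inner (\<eta> - adj x \<Omega>) (adj k \<Omega>)"
  by (simp add: inner_diff algebra_simps)
 also have "\<dots> \<le> r * \<mu> * sqrt \<epsilon> * (norm \<Omega>)\<^sup>2 + e * norm (a \<Omega>) + \<mu> * (e * (r * norm \<Omega>)) + e * (r * norm \<Omega>)"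
 proof -
  have "- (\<mu> * inner (\<xi> - x \<Omega>) (k \<Omega>)) \<le> \<mu> * (e * (r * norm \<Omega>))"
   using h(2) \<mu> mult_left_mono[of "- inner (\<xi> - x \<Omega>) (k \<Omega>)" "e * (r * norm \<Omega>)" \<mu>] by simp
  then show ?thesis using k3 h(1,3) by linarith
 qed
 also have "\<dots> = (b2 - 1) * (\<delta> / (3 * b2)) + (b1 - 1) * e"
  using \<delta> b by (simp add: b1_def b2_def \<epsilon>_def algebra_simps)
 also have "\<dots> \<le> b2 * (\<delta> / (3 * b2)) + b1 * e"
  using e \<delta> b by (intro add_mono mult_right_mono) auto
 also have "\<dots> = 2 * \<delta> / 3" using b by (simp add: e_def)
 finally show False using \<delta> by simp
qed

text \<open>With \<open>C = J Q\<close> and B = J (\<open>adj a\<close>) J this is the Sylvester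
  equation Q B Q = (1 - R) k R + \<mu> R k (1 - R) in weak form. It is verified for vectors in the
  orbit of \<open>A'\<close>, where \<open>C \<theta>\<close> comes from an element of
  \<open>A\<close>, and extended by continuity in one argument at a time.\<close>

lemma sakai_identity:
 assumes a: "a \<in> A'" and \<mu>: "0 < \<mu>" and k: "k \<in> A" "app k \<Omega> = resolv \<mu> (R (a \<Omega>))"
  "adj k \<Omega> = C (resolv \<mu> (a \<Omega>))"
 shows "inner (a (C \<theta>1)) (C \<theta>2) = inner (k (R \<theta>2)) (\<theta>1 - R \<theta>1) + \<mu> * inner (k (\<theta>2 - R \<theta>2)) (R \<theta>1)"
proof -
 have base: "inner (a (C \<theta>1)) (C \<theta>2) = inner (k (R \<theta>2)) (\<theta>1 - R \<theta>1) + \<mu> * inner (k (\<theta>2 - R \<theta>2)) (R \<theta>1)"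
  if \<theta>1: "\<theta>1 \<in> (\<lambda>x. app x \<Omega>) ` A'" and \<theta>2: "\<theta>2 \<in> (\<lambda>x. app x \<Omega>) ` A'" for \<theta>1 \<theta>2
 proof -
  have res1: "resolv 1 v = v" for v using resolv_inverse[of 1 v] by simp
  \<comment> \<open>At \<mu> = 1 the function \<open>resolv\<close> is the identity, so
    \<open>sakai\<close> turns \<open>b\<close> into an element \<open>l\<close> of \<open>A\<close>
    with \<open>l \<Omega> = R (b \<Omega>)\<close>; \<open>y\<close> is its adjoint.\<close>
  have ex: "\<exists>y\<in>A. app y \<Omega> = C \<theta> \<and> adj y \<Omega> = R \<theta>" if \<theta>: "\<theta> \<in> (\<lambda>x. app x \<Omega>) ` A'" for \<theta>
  proof -
   obtain b where b: "b \<in> A'" "\<theta> = app b \<Omega>" using \<theta> by blast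
   obtain l where "l \<in> A" "app l \<Omega> = R \<theta>" "adj l \<Omega> = C \<theta>"
    using sakai[OF b(1), of 1] b(2) by (auto simp: res1)
   then show ?thesis by (intro bexI[of _ "adj l"]) (auto simp: adjA)
  qed
  obtain y1 where y1: "y1 \<in> A" "app y1 \<Omega> = C \<theta>1" "adj y1 \<Omega> = R \<theta>1" using ex[OF \<theta>1] by blast
  obtain y2 where y2: "y2 \<in> A" "app y2 \<Omega> = C \<theta>2" "adj y2 \<Omega> = R \<theta>2" using ex[OF \<theta>2] by blast
  define x where "x = adj y1 o\<^sub>L y2"
  have xA: "x \<in> A" unfolding x_def by (intro A_intros adjA y1 y2)
  define \<theta> where "\<theta> = resolv \<mu> (a \<Omega>)"
  have k\<Omega>: "k \<Omega> = R \<theta>" "adj k \<Omega> = C \<theta>" using k(2,3) by (simp_all add: \<theta>_def resolv_R[OF \<mu>])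
  have "inner (a (C \<theta>1)) (C \<theta>2) = inner (y1 (a \<Omega>)) (y2 \<Omega>)"
   using A_comm[OF y1(1) a, of \<Omega>] y1 y2 by simp
  also have "\<dots> = inner (x \<Omega>) (a \<Omega>)"
   by (simp only: x_def blinfun_apply_blinfun_compose adj inner_commute[of "y1 (a \<Omega>)"])
  also have "\<dots> = inner (x \<Omega>) (\<theta> - R \<theta> + \<mu> *\<^sub>R R \<theta>)" by (simp only: \<theta>_def resolv_inverse[OF \<mu>])
  also have "\<dots> = inner (adj x \<Omega>) (C \<theta>) + \<mu> * inner (x \<Omega>) (R \<theta>)"
   using GS_dual[OF GS_base[OF xA], of \<theta>] by (simp add: inner_add)
  also have "inner (adj x \<Omega>) (C \<theta>) = inner (k (R \<theta>2)) (\<theta>1 - R \<theta>1)"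
  proof -
   define z where "z = k o\<^sub>L adj y2"
   have "z \<in> A" unfolding z_def by (intro A_intros adjA k y2)
   have "inner (adj x \<Omega>) (C \<theta>) = inner (C \<theta>1) (adj z \<Omega>)"
    by (simp add: x_def z_def adj_compose adj k\<Omega> y1)
   also have "\<dots> = inner (z \<Omega>) (\<theta>1 - R \<theta>1)" using GS_dual[OF GS_base[OF \<open>z \<in> A\<close>], of \<theta>1] by (simp add: inner_commute)
   finally show ?thesis by (simp add: z_def y2)
  qed
  also have "inner (x \<Omega>) (R \<theta>) = inner (k (\<theta>2 - R \<theta>2)) (R \<theta>1)"
  proof -
   define z where "z = y1 o\<^sub>L k"
   have "z \<in> A" unfolding z_def by (intro A_intros k y1)
   have "inner (x \<Omega>) (R \<theta>) = inner (z \<Omega>) (C \<theta>2)"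
    by (simp only: x_def z_def blinfun_apply_blinfun_compose adj k\<Omega> y2 inner_commute[of "y1 (R \<theta>)"])
   also have "\<dots> = inner (adj z \<Omega>) (\<theta>2 - R \<theta>2)" using GS_dual[OF GS_swap[OF GS_base[OF \<open>z \<in> A\<close>]], of \<theta>2] by simp
   finally show ?thesis
    by (simp only: z_def adj_compose blinfun_apply_blinfun_compose adj y1 inner_commute[of "k (\<theta>2 - R \<theta>2)"])
  qed
  finally show ?thesis .
 qed
 have step: "inner (a (C \<theta>1)) (C \<theta>2) = inner (k (R \<theta>2)) (\<theta>1 - R \<theta>1) + \<mu> * inner (k (\<theta>2 - R \<theta>2)) (R \<theta>1)"
  if \<theta>2: "\<theta>2 \<in> (\<lambda>x. app x \<Omega>) ` A'" for \<theta>1 \<theta>2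
 proof -
  have cl: "closed {\<theta>1. inner (a (C \<theta>1)) (C \<theta>2) = inner (k (R \<theta>2)) (\<theta>1 - R \<theta>1) + \<mu> * inner (k (\<theta>2 - R \<theta>2)) (R \<theta>1)}"
   by (intro closed_Collect_eq continuous_intros)
  have "(\<lambda>x. app x \<Omega>) ` A' \<subseteq> {\<theta>1. inner (a (C \<theta>1)) (C \<theta>2) = inner (k (R \<theta>2)) (\<theta>1 - R \<theta>1) + \<mu> * inner (k (\<theta>2 - R \<theta>2)) (R \<theta>1)}"
   by (intro subsetI CollectI base \<theta>2)
  from closure_minimal[OF this cl] show ?thesis unfolding denseA' by (auto simp only: mem_Collect_eq)
 qed
 have cl: "closed {\<theta>2. inner (a (C \<theta>1)) (C \<theta>2) = inner (k (R \<theta>2)) (\<theta>1 - R \<theta>1) + \<mu> * inner (k (\<theta>2 - R \<theta>2)) (R \<theta>1)}"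
  by (intro closed_Collect_eq continuous_intros)
 have "(\<lambda>x. app x \<Omega>) ` A' \<subseteq> {\<theta>2. inner (a (C \<theta>1)) (C \<theta>2) = inner (k (R \<theta>2)) (\<theta>1 - R \<theta>1) + \<mu> * inner (k (\<theta>2 - R \<theta>2)) (R \<theta>1)}"
  by (intro subsetI CollectI step)
 from closure_minimal[OF this cl] show ?thesis unfolding denseA' by (auto simp only: mem_Collect_eq)
qed

end

section \<open>Tomita's theorem\<close>

lemma arctan_diff_bounds:
 assumes "0 \<le> x" "x \<le> (y::real)"
 shows "(y - x) / (1 + y\<^sup>2) \<le> arctan y - arctan x" "arctan y - arctan x \<le> (y - x) / (1 + x\<^sup>2)"
proof -
 have "(y - x) / (1 + y\<^sup>2) \<le> arctan y - arctan x \<and> arctan y - arctan x \<le> (y - x) / (1 + x\<^sup>2)"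
 proof (cases "x = y")
  case False
  then have "x < y" using assms by simp
  then obtain z where z: "x < z" "z < y" "arctan y - arctan x = (y - x) * inverse (1 + z\<^sup>2)"
   using MVT2[of x y arctan "\<lambda>z. inverse (1 + z\<^sup>2)"] DERIV_arctan by blast
  have "x\<^sup>2 \<le> z\<^sup>2" "z\<^sup>2 \<le> y\<^sup>2" using z assms by (auto intro!: power_mono)
  moreover have "1 + x\<^sup>2 > 0" by (simp add: add_pos_nonneg)
  ultimately show ?thesis unfolding z(3) divide_inverse using \<open>x < y\<close>
   by (intro conjI mult_left_mono le_imp_inverse_le) auto
 qed simp
 then show "(y - x) / (1 + y\<^sup>2) \<le> arctan y - arctan x" "arctan y - arctan x \<le> (y - x) / (1 + x\<^sup>2)" by auto
qed

text \<open>Riemann sums with step \<open>h\<close> of the derivative of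
  \<open>2 * arctan (\<rho> * s)\<close>. The integrand decreases, so the sum stays below the
  integral; the two error terms come from the tail beyond \<open>n * h\<close> and from the first
  interval.\<close>

lemma sum_arctan_bound:
 assumes "\<rho> > 0" "h > 0" "n > 0"
 shows "(\<Sum>l=1..n. 2 * h * \<rho> / (1 + \<rho>\<^sup>2 * (real l * h)\<^sup>2)) \<le> pi"
  and "\<bar>(\<Sum>l=1..n. 2 * h * \<rho> / (1 + \<rho>\<^sup>2 * (real l * h)\<^sup>2)) - pi\<bar> \<le> 2 / (real n * h * \<rho>) + 2 * h * \<rho>"
proof -
 define s where "s m = (\<Sum>l=1..m. 2 * h * \<rho> / (1 + \<rho>\<^sup>2 * (real l * h)\<^sup>2))" for m
 have sq: "\<rho>\<^sup>2 * (real l * h)\<^sup>2 = (\<rho> * (real l * h))\<^sup>2" for l by (simp add: power_mult_distrib)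
 have up: "s m \<le> 2 * arctan (\<rho> * (real m * h))" for m
 proof (induction m)
  case (Suc m)
  have "(\<rho> * (real (Suc m) * h) - \<rho> * (real m * h)) / (1 + (\<rho> * (real (Suc m) * h))\<^sup>2)
    \<le> arctan (\<rho> * (real (Suc m) * h)) - arctan (\<rho> * (real m * h))"
   using assms by (intro arctan_diff_bounds mult_left_mono mult_right_mono mult_nonneg_nonneg) auto
  moreover have "\<rho> * (real (Suc m) * h) - \<rho> * (real m * h) = h * \<rho>" by (simp add: algebra_simps)
  moreover have "s (Suc m) = s m + 2 * (h * \<rho> / (1 + (\<rho> * (real (Suc m) * h))\<^sup>2))"
   by (simp add: s_def sq del: of_nat_Suc)
  ultimately show ?case using Suc by simp
 qed (simp add: s_def)
 have low: "2 * arctan (\<rho> * (real (Suc m) * h)) - 2 * arctan (\<rho> * h) \<le> s m" for m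
 proof (induction m)
  case (Suc m)
  have e: "\<rho> * (real (Suc (Suc m)) * h) - \<rho> * (real (Suc m) * h) = h * \<rho>" by (simp add: algebra_simps)
  have "arctan (\<rho> * (real (Suc (Suc m)) * h)) - arctan (\<rho> * (real (Suc m) * h))
    \<le> (\<rho> * (real (Suc (Suc m)) * h) - \<rho> * (real (Suc m) * h)) / (1 + (\<rho> * (real (Suc m) * h))\<^sup>2)"
   using assms by (intro arctan_diff_bounds mult_left_mono mult_right_mono mult_nonneg_nonneg) auto
  moreover have "s (Suc m) = s m + 2 * (h * \<rho> / (1 + (\<rho> * (real (Suc m) * h))\<^sup>2))"
   by (simp add: s_def sq del: of_nat_Suc)
  ultimately show ?case using Suc unfolding e by linarith
 qed (simp add: s_def)
 have "arctan (\<rho> * (real n * h)) < pi / 2" by (rule arctan_ubound)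
 then have 1: "s n \<le> pi" using up[of n] by linarith
 then show "(\<Sum>l=1..n. 2 * h * \<rho> / (1 + \<rho>\<^sup>2 * (real l * h)\<^sup>2)) \<le> pi" unfolding s_def .
 have pos: "\<rho> * (real n * h) > 0" using assms by simp
 have "arctan (1 / (\<rho> * (real n * h))) \<le> 1 / (\<rho> * (real n * h))"
  using arctan_diff_bounds(2)[of 0 "1 / (\<rho> * (real n * h))"] pos by simp
 then have "arctan (\<rho> * (real n * h)) \<ge> pi / 2 - 1 / (\<rho> * (real n * h))"
  using arctan_inverse[OF pos] unfolding inverse_eq_divide by linarith
 moreover have "arctan (\<rho> * (real n * h)) \<le> arctan (\<rho> * (real (Suc n) * h))"
  using assms by (intro arctan_monotone' mult_left_mono mult_right_mono) auto
 moreover have "arctan (\<rho> * h) \<le> \<rho> * h" using arctan_diff_bounds(2)[of 0 "\<rho> * h"] assms by simp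
 ultimately have "s n \<ge> pi - 2 * (1 / (\<rho> * (real n * h))) - 2 * (\<rho> * h)" using low[of n] by linarith
 moreover have "2 * (1 / (\<rho> * (real n * h))) = 2 / (real n * h * \<rho>)" "2 * (\<rho> * h) = 2 * h * \<rho>" by (simp_all add: mult_ac)
 ultimately have 2: "s n \<ge> pi - 2 / (real n * h * \<rho>) - 2 * h * \<rho>" by (simp only:)
 have "0 \<le> 2 / (real n * h * \<rho>) + 2 * h * \<rho>" using assms by simp
 then show "\<bar>(\<Sum>l=1..n. 2 * h * \<rho> / (1 + \<rho>\<^sup>2 * (real l * h)\<^sup>2)) - pi\<bar> \<le> 2 / (real n * h * \<rho>) + 2 * h * \<rho>"
  using 1 2 unfolding s_def[symmetric] by linarith
qed

lemma harmonic_sum_le: "n > 0 \<Longrightarrow> (\<Sum>l=1..n. 1 / real l) \<le> 1 + ln (real n)"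
proof (induction n rule: nat_induct_non_zero)
 case (Suc n)
 have "ln (real n / real (Suc n)) \<le> real n / real (Suc n) - 1" using Suc by (intro ln_le_minus_one) auto
 also have "\<dots> = - (1 / real (Suc n))" by (simp add: field_simps)
 finally have "1 / real (Suc n) \<le> ln (real (Suc n)) - ln (real n)" using Suc by (simp add: ln_div)
 then show ?case using Suc by simp
qed simp

definition ramp :: "real \<Rightarrow> real" where "ramp t = max 0 (min 1 t)"
text \<open>A ramp rising from (i - 1)/N to i/N. The two exceptional cases make the differences
  \<open>tent N i\<close> with \<open>1 \<le> i < N\<close> a partition of unity on the whole
  interval, while the nodes i/N stay away from 0 and 1, where the estimates could not divide by y(1
  - y).\<close>

definition cutoff :: "nat \<Rightarrow> nat \<Rightarrow> real \<Rightarrow> real" where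
 "cutoff N i x = (if i \<le> 1 then 1 else if N \<le> i then 0 else ramp (real N * x - real i + 1))"
definition tent :: "nat \<Rightarrow> nat \<Rightarrow> real \<Rightarrow> real" where
 "tent N i x = cutoff N i x - cutoff N (Suc i) x"

lemma tent_cont: "continuous_on X (tent N i)"
proof -
 have "continuous_on X (cutoff N i)" for i
  unfolding cutoff_def ramp_def by (cases "i \<le> 1"; cases "N \<le> i") (auto intro!: continuous_intros)
 then show ?thesis unfolding tent_def by (intro continuous_on_diff)
qed

lemma tent_bounds: "i \<in> {1..<N} \<Longrightarrow> 0 \<le> tent N i x" "i \<in> {1..<N} \<Longrightarrow> tent N i x \<le> 1"
 by (auto simp: tent_def cutoff_def ramp_def)

lemma tent_support:
 assumes "i \<in> {1..<N}" "x \<in> {0..1}"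
 shows "tent N i x = 0 \<or> \<bar>x - real i / real N\<bar> \<le> 1 / real N"
proof -
 have "x - real i / real N = (real N * x - real i) / real N" using assms by (simp add: field_simps)
 then have "\<bar>x - real i / real N\<bar> = \<bar>real N * x - real i\<bar> / real N" by simp
 moreover have "real N * x \<le> real N" "0 \<le> real N * x" using assms by (auto simp: mult_left_le)
 moreover from this have "N \<le> Suc i \<Longrightarrow> real N * x \<le> real i + 1" by linarith
 ultimately show ?thesis using assms(1) unfolding tent_def cutoff_def ramp_def
  by (cases "i = 1"; cases "N \<le> Suc i") (auto simp: max_def min_def intro!: divide_right_mono)
qed

lemma sum_tent: "2 \<le> N \<Longrightarrow> (\<Sum>i\<in>{1..<N}. tent N i x) = 1"
 using sum_Suc_diff'[of 1 N "\<lambda>i. - cutoff N i x"] by (simp add: tent_def cutoff_def)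

lemma band_scalar:
 assumes N: "2 \<le> N" "1 \<le> i" "i < N" and x: "x \<in> {0..1}" "\<bar>x - real i / real N\<bar> \<le> 1 / real N"
 defines "p \<equiv> real i / real N * (1 - real i / real N)"
 shows "x * (1 - x) \<le> 3 * p" "sqrt (x * (1 - x)) \<le> 2 * sqrt p"
  "\<bar>sqrt (x * (1 - x)) - sqrt p\<bar> \<le> 1 / (real N * sqrt p)"
proof -
 define y where "y = real i / real N"
 have y: "0 < y" "y < 1" using N by (auto simp: y_def)
 have p: "p > 0" unfolding p_def y_def[symmetric] using y by simp
 \<comment> \<open>For inner nodes (i - 1)(N - 1 - i) is nonnegative, which yields
   \<open>1 / N \<le> 2 * p\<close>. Within a band of radius 1/N, x(1 - x) is therefore at most a
   fixed multiple of \<open>p\<close>.\<close>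
 have "real N * real i - real i * real i \<ge> real N - 1"
 proof -
  have "0 \<le> (real i - 1) * (real N - 1 - real i)" using N by (intro mult_nonneg_nonneg) auto
  then show ?thesis by (simp add: algebra_simps)
 qed
 moreover have "p * (real N * real N) = real N * real i - real i * real i" using N by (simp add: p_def field_simps)
 ultimately have "p * (real N * real N) \<ge> real N / 2" using N by simp
 then have pN: "1 / real N \<le> 2 * p" using N by (simp add: field_simps)
 have d: "\<bar>x * (1 - x) - p\<bar> \<le> 1 / real N"
 proof -
  have "x * (1 - x) - p = (x - y) * (1 - x - y)" by (simp add: p_def y_def algebra_simps)
  then have "\<bar>x * (1 - x) - p\<bar> = \<bar>x - y\<bar> * \<bar>1 - x - y\<bar>" by (simp add: abs_mult)
  also have "\<dots> \<le> 1 / real N * 1" using x y unfolding y_def[symmetric] by (intro mult_mono) auto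
  finally show ?thesis by simp
 qed
 then show 3: "x * (1 - x) \<le> 3 * p" using pN by linarith
 have "sqrt (x * (1 - x)) \<le> sqrt (4 * p)" using 3 p by simp
 also have "\<dots> = 2 * sqrt p" by (simp add: real_sqrt_mult)
 finally show "sqrt (x * (1 - x)) \<le> 2 * sqrt p" .
 have "\<bar>sqrt (x * (1 - x)) - sqrt p\<bar> * sqrt p \<le> \<bar>sqrt (x * (1 - x)) - sqrt p\<bar> * (sqrt (x * (1 - x)) + sqrt p)"
  using x p by (intro mult_left_mono) auto
 also have "\<dots> = \<bar>(sqrt (x * (1 - x)) - sqrt p) * (sqrt (x * (1 - x)) + sqrt p)\<bar>"
  using x p by (simp add: abs_mult)
 also have "(sqrt (x * (1 - x)) - sqrt p) * (sqrt (x * (1 - x)) + sqrt p) = x * (1 - x) - p"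
 proof -
  have "sqrt (x * (1 - x)) * sqrt (x * (1 - x)) = x * (1 - x)" "sqrt p * sqrt p = p"
   unfolding real_sqrt_mult_self using x p by auto
  then show ?thesis using square_diff_square_factored[of "sqrt (x * (1 - x))" "sqrt p"] by (simp only: mult.commute)
 qed
 finally have "\<bar>sqrt (x * (1 - x)) - sqrt p\<bar> * sqrt p \<le> 1 / real N" using d by simp
 then show "\<bar>sqrt (x * (1 - x)) - sqrt p\<bar> \<le> 1 / (real N * sqrt p)" using p N by (simp add: field_simps)
qed

text \<open>A spectral value r of \<open>R\<close> corresponds to the value (1 - r)/r of \<Delta>,
  so \<open>w\<close> is the value of \<Delta> for \<open>y\<close> divided by that for
  \<open>r\<close>. In terms of its square root the summand is the one of
  \<open>sum_arctan_bound\<close>.\<close>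

lemma kernel_summand:
 assumes y: "0 < y" "y < 1" and r: "0 < r" "r < (1::real)"
 defines "w \<equiv> r * (1 - y) / ((1 - r) * y)"
 shows "2 * h * (sqrt (r * (1 - r)) / ((1 - r) * y + (real l * h)\<^sup>2 * (r * (1 - y)))) =
  1 / sqrt (y * (1 - y)) * (2 * h * sqrt w / (1 + (sqrt w)\<^sup>2 * (real l * h)\<^sup>2))"
proof -
 define \<rho> where "\<rho> = sqrt w"
 have w: "w > 0" using r y by (simp add: w_def)
 have \<rho>: "\<rho> > 0" "\<rho>\<^sup>2 = w" using w by (auto simp: \<rho>_def)
 define q where "q = sqrt (y * (1 - y))"
 have q: "q > 0" "q * q = y * (1 - y)" using y by (auto simp: q_def)
 have \<rho>q: "\<rho> * q = sqrt (r * (1 - r)) * (1 - y) / (1 - r)"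
 proof -
  have "\<rho> * q = sqrt (w * (y * (1 - y)))" by (simp add: \<rho>_def q_def real_sqrt_mult)
  also have "w * (y * (1 - y)) = (r * (1 - r)) * ((1 - y) / (1 - r))\<^sup>2"
  proof -
   have "r * z / (s * y) * (y * z) = (r * s) * (z / s)\<^sup>2" if "s \<noteq> 0" for s z
    using that y by (simp add: field_simps power2_eq_square)
   from this[of "1 - r" "1 - y"] show ?thesis using r by (simp add: w_def)
  qed
  also have "sqrt \<dots> = sqrt (r * (1 - r)) * ((1 - y) / (1 - r))" using r y by (simp only: real_sqrt_mult real_sqrt_abs) simp
  finally show ?thesis by simp
 qed
 have "2 * h * (sqrt (r * (1 - r)) / ((1 - r) * y + (real l * h)\<^sup>2 * (r * (1 - y)))) =
  1 / q * (2 * h * \<rho> / (1 + \<rho>\<^sup>2 * (real l * h)\<^sup>2))"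
 proof -
  have d: "(1 - r) * y + (real l * h)\<^sup>2 * (r * (1 - y)) = ((1 - r) * y) * (1 + w * (real l * h)\<^sup>2)"
   using r y by (simp add: w_def field_simps)
  have e: "sqrt (r * (1 - r)) / ((1 - r) * y) = \<rho> / q"
  proof -
   have canc: "S * z / t / (y * z) = S / (t * y)" if "z \<noteq> 0" "t \<noteq> 0" for S z t :: real
    using that y by (simp add: field_simps)
   have "\<rho> / q = \<rho> * q / (q * q)" using q(1) by simp
   also have "\<dots> = sqrt (r * (1 - r)) / ((1 - r) * y)"
    unfolding q(2) \<rho>q by (rule canc) (use y r in auto)
   finally show ?thesis ..
  qed
  have g: "2 * h * (S / (D * W)) = 1 / q * (2 * h * \<rho> / W)" if "S / D = \<rho> / q" for S D W
  proof -
   have "2 * h * (S / (D * W)) = 2 * h * (S / D) / W" by simp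
   then show ?thesis by (simp add: that)
  qed
  show ?thesis unfolding \<rho>(2) d by (rule g[OF e])
 qed
 then show ?thesis unfolding \<rho>_def q_def .
qed

lemma kernel_sum_le:
 assumes y: "0 < y" "y < 1" and r: "r \<in> {0..1::real}" and h: "0 < h" "0 < n"
 shows "(\<Sum>l=1..n. 2 * h * (sqrt (r * (1 - r)) / ((1 - r) * y + (real l * h)\<^sup>2 * (r * (1 - y))))) \<le> pi / sqrt (y * (1 - y))"
proof (cases "r = 0 \<or> r = 1")
 case False
 then have r: "0 < r" "r < 1" using r by auto
 then have "0 < sqrt (r * (1 - y) / ((1 - r) * y))" using y by simp
 from sum_arctan_bound(1)[OF this h] have "1 / sqrt (y * (1 - y)) * (\<Sum>l=1..n. 2 * h * sqrt (r * (1 - y) / ((1 - r) * y)) / (1 + (sqrt (r * (1 - y) / ((1 - r) * y)))\<^sup>2 * (real l * h)\<^sup>2))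
  \<le> 1 / sqrt (y * (1 - y)) * pi" using y by (intro mult_left_mono) auto
 then show ?thesis unfolding kernel_summand[OF y r] sum_distrib_left[symmetric] by simp
qed (use y in auto)

text \<open>The errors of the Riemann sum contain the root of \<open>w\<close> and its inverse,
  which explode as \<open>r\<close> approaches 1 or 0. The weight r(1 - r) compensates this, up to a
  factor \<open>sqrt N\<close> due to the distance of \<open>y\<close> from the ends.\<close>

lemma kernel_sum_scalar:
 assumes y: "0 < y" "y < 1" "1 / real N \<le> y" "y \<le> 1 - 1 / real N" and N: "0 < N" and h: "0 < h" "0 < n" and r: "r \<in> {0..1::real}"
 shows "\<bar>(\<Sum>l=1..n. 2 * h * (sqrt (r * (1 - r)) / ((1 - r) * y + (real l * h)\<^sup>2 * (r * (1 - y))))) - pi / sqrt (y * (1 - y))\<bar> * (r * (1 - r))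
  \<le> 1 / sqrt (y * (1 - y)) * (sqrt (real N) * (2 / (real n * h) + 2 * h))"
proof (cases "r = 0 \<or> r = 1")
 case True
 then show ?thesis using y h by (auto intro!: mult_nonneg_nonneg add_nonneg_nonneg)
next
 case False
 then have r: "0 < r" "r < 1" using r by auto
 define w where "w = r * (1 - y) / ((1 - r) * y)"
 define \<rho> where "\<rho> = sqrt w"
 have w: "w > 0" using r y by (simp add: w_def)
 have \<rho>: "\<rho> > 0" "\<rho>\<^sup>2 = w" using w by (auto simp: \<rho>_def)
 define q where "q = sqrt (y * (1 - y))"
 have q: "q > 0" using y by (auto simp: q_def)
 note summand = kernel_summand[OF y(1,2) r, folded w_def, folded \<rho>_def q_def]
 have b1: "\<rho> * (r * (1 - r)) \<le> sqrt (real N)"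
 proof (rule real_le_rsqrt)
  have "(1 - y) / y \<le> real N" using y N by (simp add: field_simps)
  have "(\<rho> * (r * (1 - r)))\<^sup>2 = (r ^ 3 * (1 - r)) * ((1 - y) / y)"
  proof -
   have "r * z / (s * y) * (r * s)\<^sup>2 = r ^ 3 * s * (z / y)" if "s \<noteq> 0" for s z
    using that y by (simp add: field_simps power2_eq_square power3_eq_cube)
   from this[of "1 - r" "1 - y"] show ?thesis using r unfolding power_mult_distrib[of \<rho>] \<rho>(2) w_def by simp
  qed
  also have "\<dots> \<le> (1 * 1) * real N" using r y N \<open>(1 - y) / y \<le> real N\<close>
   by (intro mult_mono power_le_one) auto
  finally show "(\<rho> * (r * (1 - r)))\<^sup>2 \<le> real N" by simp
 qed
 have b2: "1 / \<rho> * (r * (1 - r)) \<le> sqrt (real N)"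
 proof (rule real_le_rsqrt)
  have "y / (1 - y) \<le> real N" using y N by (simp add: field_simps)
  have "(1 / \<rho> * (r * (1 - r)))\<^sup>2 = ((1 - r) ^ 3 * r) * (y / (1 - y))"
  proof -
   have "(r * s)\<^sup>2 / (r * z / (s * y)) = s ^ 3 * r * (y / z)" if "s \<noteq> 0" "z \<noteq> 0" for s z
    using that y r by (simp add: field_simps power2_eq_square power3_eq_cube)
   from this[of "1 - r" "1 - y"] show ?thesis
    using r y unfolding power_mult_distrib[of "1 / \<rho>"] power_divide \<rho>(2) w_def by (simp add: mult_ac)
  qed
  also have "\<dots> \<le> (1 * 1) * real N" using r y N \<open>y / (1 - y) \<le> real N\<close>
   by (intro mult_mono power_le_one) auto
  finally show "(1 / \<rho> * (r * (1 - r)))\<^sup>2 \<le> real N" by simp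
 qed
 define s where "s = (\<Sum>l=1..n. 2 * h * \<rho> / (1 + \<rho>\<^sup>2 * (real l * h)\<^sup>2))"
 have "\<bar>s - pi\<bar> * (r * (1 - r)) \<le> (2 / (real n * h * \<rho>) + 2 * h * \<rho>) * (r * (1 - r))"
  unfolding s_def using r \<rho> h by (intro mult_right_mono sum_arctan_bound(2)) auto
 also have "\<dots> = (2 / (real n * h)) * (1 / \<rho> * (r * (1 - r))) + 2 * h * (\<rho> * (r * (1 - r)))"
 proof -
  have "(2 / (real n * h * \<rho>) + 2 * h * \<rho>) * X = (2 / (real n * h)) * (1 / \<rho> * X) + 2 * h * (\<rho> * X)" for X
   by (simp add: algebra_simps)
  then show ?thesis .
 qed
 also have "\<dots> \<le> (2 / (real n * h)) * sqrt (real N) + 2 * h * sqrt (real N)"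
  using h by (intro add_mono mult_left_mono b1 b2) auto
 finally have "1 / q * (\<bar>s - pi\<bar> * (r * (1 - r))) \<le> 1 / q * (sqrt (real N) * (2 / (real n * h) + 2 * h))"
  using q by (intro mult_left_mono) (auto simp: algebra_simps)
 moreover have "1 / q * \<bar>s - pi\<bar> = \<bar>1 / q * s - pi / q\<bar>"
  using q by (simp add: abs_divide flip: diff_divide_distrib)
 ultimately show ?thesis unfolding summand sum_distrib_left[symmetric] q_def[symmetric] s_def[symmetric]
  by (simp only: mult.assoc[symmetric])
qed

text \<open>Riemann sums of \<open>\<integral>\<^sub>0\<^sup>\<infinity> 2 k(s\<^sup>2) ds\<close>. In a spectral basis of \<open>\<Delta>\<close>, with \<open>t\<close> a quotient of two
 eigenvalues, the solution \<open>k(\<mu>)\<close> of the Sylvester equation with right-hand side \<open>B\<close> has the entries of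
 \<open>B\<close> multiplied by \<open>\<surd>t / (t + \<mu>)\<close>, and \<open>\<integral>\<^sub>0\<^sup>\<infinity> 2 \<surd>t / (t + s\<^sup>2) ds = \<pi>\<close> for all \<open>t\<close>.\<close>

definition sylvester_sum :: "(real \<Rightarrow> 'a::real_normed_vector \<Rightarrow>\<^sub>L 'a) \<Rightarrow> nat \<Rightarrow> 'a \<Rightarrow>\<^sub>L 'a" where
 "sylvester_sum k N = (\<Sum>l=1..N ^ 4. (2 / real N ^ 2) *\<^sub>R k ((real l * (1 / real N ^ 2))\<^sup>2))"

section \<open>Averages of the solutions of the Sylvester equation\<close>

context
 fixes R :: "'a::{real_inner,banach} \<Rightarrow>\<^sub>L 'a"
 assumes R: "unit_op R"
begin

lemma fc_apply_mult: "cont01 f \<Longrightarrow> cont01 g \<Longrightarrow> fc R f (fc R g \<xi>) = fc R (\<lambda>x. f x * g x) \<xi>"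
 by (simp add: fc_mult[OF R])

lemma norm_fc_mono:
 assumes "cont01 f" "cont01 g" "\<And>x. x \<in> {0..1} \<Longrightarrow> \<bar>f x\<bar> \<le> \<bar>g x\<bar>"
 shows "norm (fc R f \<xi>) \<le> norm (fc R g \<xi>)"
proof -
 have e: "(norm (fc R h \<xi>))\<^sup>2 = inner \<xi> (fc R (\<lambda>x. h x * h x) \<xi>)" if "cont01 h" for h
  using that by (simp add: power2_norm_eq_inner fc_sym[OF R] fc_apply_mult)
 have "(norm (fc R f \<xi>))\<^sup>2 \<le> (norm (fc R g \<xi>))\<^sup>2"
  unfolding e[OF assms(1)] e[OF assms(2)]
 proof (rule fc_mono[OF R])
  fix x :: real assume "x \<in> {0..1}"
  from assms(3)[OF this] have "\<bar>f x\<bar> * \<bar>f x\<bar> \<le> \<bar>g x\<bar> * \<bar>g x\<bar>" by (intro mult_mono) auto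
  then show "f x * f x \<le> g x * g x" by simp
 qed (intro continuous_on_mult assms)+
 then show ?thesis by (rule power2_le_imp_le) simp
qed

lemma norm_fc_le:
 assumes "cont01 f" "\<And>x. x \<in> {0..1} \<Longrightarrow> \<bar>f x\<bar> \<le> c"
 shows "norm (fc R f \<xi>) \<le> c * norm \<xi>"
 by (rule order_trans[OF norm_blinfun mult_right_mono[OF fc_bound[OF R assms]]]) auto

lemma fc_sum: "(\<And>i. i \<in> I \<Longrightarrow> cont01 (f i)) \<Longrightarrow> fc R (\<lambda>x. \<Sum>i\<in>I. f i x) = (\<Sum>i\<in>I. fc R (f i))"
proof (induction I rule: infinite_finite_induct)
 case (insert i I)
 then have "fc R (\<lambda>x. f i x + (\<Sum>i\<in>I. f i x)) = fc R (f i) + fc R (\<lambda>x. \<Sum>i\<in>I. f i x)"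
  by (intro fc_add[OF R] continuous_on_sum) auto
 then show ?case using insert by simp
qed (simp_all add: fc_const[OF R])

text \<open>The tents sum to 1 and their squares lie below them, so the square norms of the pieces
  add up to at most that of \<xi>; Cauchy-Schwarz over the bands then costs the factor
  \<open>sqrt N\<close>.\<close>

lemma sum_norm_tent_le:
 assumes N: "2 \<le> N"
 shows "(\<Sum>i\<in>{1..<N}. norm (fc R (tent N i) \<xi>)) \<le> sqrt (real N) * norm \<xi>"
proof -
 have "fc R (\<lambda>x. \<Sum>i\<in>{1..<N}. tent N i x) = fc R (\<lambda>x. 1)" by (simp only: sum_tent[OF N])
 then have one: "(\<Sum>i\<in>{1..<N}. fc R (tent N i) \<xi>) = \<xi>"
  by (simp add: fc_sum tent_cont fc_const[OF R] flip: blinfun.sum_left)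
 have "(norm (fc R (tent N i) \<xi>))\<^sup>2 \<le> inner \<xi> (fc R (tent N i) \<xi>)" if i: "i \<in> {1..<N}" for i
 proof -
  have "(norm (fc R (tent N i) \<xi>))\<^sup>2 = inner \<xi> (fc R (\<lambda>x. tent N i x * tent N i x) \<xi>)"
   by (simp add: power2_norm_eq_inner fc_sym[OF R] fc_apply_mult tent_cont)
  also have "\<dots> \<le> inner \<xi> (fc R (tent N i) \<xi>)"
   using tent_bounds[OF i] by (intro fc_mono[OF R] continuous_on_mult tent_cont) (auto simp: mult_left_le)
  finally show ?thesis .
 qed
 then have "(\<Sum>i\<in>{1..<N}. (norm (fc R (tent N i) \<xi>))\<^sup>2) \<le> (\<Sum>i\<in>{1..<N}. inner \<xi> (fc R (tent N i) \<xi>))" by (rule sum_mono)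
 also have "\<dots> = (norm \<xi>)\<^sup>2" by (simp only: one power2_norm_eq_inner inner_sum_right[symmetric])
 finally have le: "(\<Sum>i\<in>{1..<N}. (norm (fc R (tent N i) \<xi>))\<^sup>2) \<le> (norm \<xi>)\<^sup>2" .
 have "(\<Sum>i\<in>{1..<N}. norm (fc R (tent N i) \<xi>))\<^sup>2 \<le> (\<Sum>i\<in>{1..<N}. (norm (fc R (tent N i) \<xi>))\<^sup>2) * card {1..<N}"
  by (rule sum_squared_le_sum_of_squares)
 also have "\<dots> \<le> (norm \<xi>)\<^sup>2 * real N" by (intro mult_mono le) auto
 also have "\<dots> = (sqrt (real N) * norm \<xi>)\<^sup>2" by (simp add: power_mult_distrib mult.commute)
 finally show ?thesis by (rule power2_le_imp_le) simp
qed

lemma fc_ident_mult: "cont01 f \<Longrightarrow> R (fc R f \<xi>) = fc R (\<lambda>x. x * f x) \<xi>"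
 by (simp add: fc_times_ident[OF R])

lemma fc_compl_mult: "cont01 f \<Longrightarrow> fc R f \<xi> - R (fc R f \<xi>) = fc R (\<lambda>x. (1 - x) * f x) \<xi>"
proof -
 assume f: "cont01 f"
 have "fc R (\<lambda>x. (1 - x) * f x) = fc R (\<lambda>x. f x - x * f x)" by (intro fc_cong[OF R]) (simp add: algebra_simps)
 also have "\<dots> = fc R f - fc R (\<lambda>x. x * f x)" by (intro fc_diff[OF R] continuous_intros f)
 finally show ?thesis by (simp add: fc_times_ident[OF R f] blinfun.diff_left)
qed

context
 fixes k :: "real \<Rightarrow> 'a \<Rightarrow>\<^sub>L 'a" and B :: "'a \<Rightarrow>\<^sub>L 'a" and c :: real
 assumes kc: "\<And>\<mu>. 0 < \<mu> \<Longrightarrow> norm (k \<mu>) \<le> c / sqrt \<mu>"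
  and id: "\<And>\<mu> \<theta>1 \<theta>2. 0 < \<mu> \<Longrightarrow>
   inner (fc R (\<lambda>r. sqrt (r * (1 - r))) \<theta>1) (B (fc R (\<lambda>r. sqrt (r * (1 - r))) \<theta>2)) =
   inner (\<theta>1 - R \<theta>1) (k \<mu> (R \<theta>2)) + \<mu> * inner (R \<theta>1) (k \<mu> (\<theta>2 - R \<theta>2))"
begin

lemma sylvester_c: "0 \<le> c"
 using order_trans[OF norm_ge_zero kc[of 1]] by simp

text \<open>Were \<theta> an eigenvector of \<open>R\<close> for \<open>y\<close>, the equation
  \<open>id\<close> would determine \<open>k \<mu> \<theta>\<close>: only the function
  \<open>h\<close> of \<open>R\<close> remains on the left vector, and dividing by it isolates
  \<open>inner \<xi> (k \<mu> \<theta>)\<close>. The bound accounts for the defect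
  \<open>R \<theta> - y *\<^sub>R \<theta>\<close>.\<close>

lemma sylvester_almost_eigen:
 assumes y: "0 < y" "y < 1" and \<mu>: "0 < \<mu>"
 defines "h \<equiv> \<lambda>r. (1 - r) * y + \<mu> * (r * (1 - y))"
 shows "\<bar>inner (fc R (\<lambda>r. sqrt (r * (1 - r)) / h r) \<xi>) (B (fc R (\<lambda>r. sqrt (r * (1 - r))) \<theta>)) - inner \<xi> (k \<mu> \<theta>)\<bar>
  \<le> 1 / (y * (1 - y)) * norm \<xi> * (c / sqrt \<mu> * norm (R \<theta> - y *\<^sub>R \<theta>))"
proof -
 have hpos: "h r > 0" if "r \<in> {0..1}" for r
  unfolding h_def using that y \<mu> by (cases "r = 1") (auto intro!: add_pos_nonneg)
 have ch: "cont01 (\<lambda>r. 1 / h r)"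
 proof (intro continuous_on_divide continuous_on_const ballI)
  show "cont01 h" unfolding h_def by (intro continuous_intros)
  show "h r \<noteq> 0" if "r \<in> {0..1}" for r using hpos[OF that] by simp
 qed
 have cq: "cont01 (\<lambda>r::real. sqrt (r * (1 - r)))" by (intro continuous_intros)
 define \<theta>1 where "\<theta>1 = fc R (\<lambda>r. 1 / h r) \<xi>"
 define e where "e = R \<theta> - y *\<^sub>R \<theta>"
 have R\<theta>: "R \<theta> = y *\<^sub>R \<theta> + e" "\<theta> - R \<theta> = (1 - y) *\<^sub>R \<theta> - e" by (simp_all add: e_def algebra_simps)
 have q: "fc R (\<lambda>r. sqrt (r * (1 - r)) / h r) \<xi> = fc R (\<lambda>r. sqrt (r * (1 - r))) \<theta>1"
  unfolding \<theta>1_def fc_apply_mult[OF cq ch] by simp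
 define g where "g = (\<lambda>r. (1 - r) * (1 / h r) - \<mu> * (r * (1 / h r)))"
 have cg: "cont01 g" unfolding g_def by (intro continuous_intros ch)
 have 1: "(\<theta>1 - R \<theta>1) - \<mu> *\<^sub>R R \<theta>1 = fc R g \<xi>"
 proof -
  have "fc R g = fc R (\<lambda>r. (1 - r) * (1 / h r)) - fc R (\<lambda>r. \<mu> * (r * (1 / h r)))"
   unfolding g_def by (intro fc_diff[OF R] continuous_intros ch)
  then show ?thesis unfolding \<theta>1_def fc_compl_mult[OF ch] unfolding fc_ident_mult[OF ch]
   by (simp only: fc_cmult[OF R continuous_on_mult[OF continuous_on_id ch]] blinfun.bilinear_simps)
 qed
 have 2: "y *\<^sub>R (\<theta>1 - R \<theta>1) + (\<mu> * (1 - y)) *\<^sub>R R \<theta>1 = \<xi>"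
 proof -
  have "y *\<^sub>R (\<theta>1 - R \<theta>1) + (\<mu> * (1 - y)) *\<^sub>R R \<theta>1
   = (y *\<^sub>R fc R (\<lambda>r. (1 - r) * (1 / h r)) + (\<mu> * (1 - y)) *\<^sub>R fc R (\<lambda>r. r * (1 / h r))) \<xi>"
   unfolding \<theta>1_def fc_compl_mult[OF ch] unfolding fc_ident_mult[OF ch] by (simp only: blinfun.bilinear_simps)
  also have "y *\<^sub>R fc R (\<lambda>r. (1 - r) * (1 / h r)) + (\<mu> * (1 - y)) *\<^sub>R fc R (\<lambda>r. r * (1 / h r))
   = fc R (\<lambda>r. y * ((1 - r) * (1 / h r)) + (\<mu> * (1 - y)) * (r * (1 / h r)))"
  proof -
   have c: "cont01 (\<lambda>r. (1 - r) * (1 / h r))" "cont01 (\<lambda>r. r * (1 / h r))"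
    by (intro continuous_intros ch)+
   show ?thesis by (rule fc_linear[OF R c, symmetric])
  qed
  also have "fc R (\<lambda>r. y * ((1 - r) * (1 / h r)) + (\<mu> * (1 - y)) * (r * (1 / h r))) = fc R (\<lambda>r. 1)"
  proof (rule fc_cong[OF R])
   fix r :: real assume "r \<in> {0..1}"
   have "y * ((1 - r) * t) + (\<mu> * (1 - y)) * (r * t) = h r * t" for t
    by (simp add: h_def algebra_simps)
   from this[of "1 / h r"] show "y * ((1 - r) * (1 / h r)) + (\<mu> * (1 - y)) * (r * (1 / h r)) = 1"
    using hpos[OF \<open>r \<in> {0..1}\<close>] by simp
  qed
  finally show ?thesis by (simp add: fc_const[OF R])
 qed
 have "inner (fc R (\<lambda>r. sqrt (r * (1 - r)) / h r) \<xi>) (B (fc R (\<lambda>r. sqrt (r * (1 - r))) \<theta>))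
  = inner (\<theta>1 - R \<theta>1) (k \<mu> (y *\<^sub>R \<theta> + e)) + \<mu> * inner (R \<theta>1) (k \<mu> ((1 - y) *\<^sub>R \<theta> - e))"
  unfolding q id[OF \<mu>] R\<theta>(2) unfolding R\<theta>(1) ..
 also have "\<dots> = inner (y *\<^sub>R (\<theta>1 - R \<theta>1) + (\<mu> * (1 - y)) *\<^sub>R R \<theta>1) (k \<mu> \<theta>)
   + inner ((\<theta>1 - R \<theta>1) - \<mu> *\<^sub>R R \<theta>1) (k \<mu> e)"
  by (simp add: blinfun.bilinear_simps inner_add inner_diff algebra_simps)
 finally have eq: "inner (fc R (\<lambda>r. sqrt (r * (1 - r)) / h r) \<xi>) (B (fc R (\<lambda>r. sqrt (r * (1 - r))) \<theta>)) - inner \<xi> (k \<mu> \<theta>)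
  = inner (fc R g \<xi>) (k \<mu> e)" unfolding 1 2 by simp
 have "\<bar>g r\<bar> \<le> 1 / (y * (1 - y))" if r: "r \<in> {0..1}" for r
 proof -
  have "\<bar>(1 - r) - \<mu> * r\<bar> * (y * (1 - y)) \<le> ((1 - r) + \<mu> * r) * (y * (1 - y))"
   using r y \<mu> by (intro mult_right_mono) (auto simp: abs_if)
  also have "\<dots> \<le> h r"
  proof -
   have "((1 - r) * y) * (1 - y) \<le> ((1 - r) * y) * 1" "(\<mu> * (r * (1 - y))) * y \<le> (\<mu> * (r * (1 - y))) * 1"
    by (rule mult_left_mono; use r y \<mu> in simp)+
   then show ?thesis by (simp add: h_def algebra_simps)
  qed
  finally have "\<bar>(1 - r) - \<mu> * r\<bar> / h r \<le> 1 / (y * (1 - y))"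
   using hpos[OF r] y by (simp add: field_simps)
  moreover have "\<bar>g r\<bar> = \<bar>(1 - r) - \<mu> * r\<bar> / h r"
   using hpos[OF r] by (simp add: g_def abs_divide flip: diff_divide_distrib)
  ultimately show ?thesis by simp
 qed
 then have n1: "norm (fc R g \<xi>) \<le> 1 / (y * (1 - y)) * norm \<xi>" by (rule norm_fc_le[OF cg])
 have n2: "norm (k \<mu> e) \<le> c / sqrt \<mu> * norm e"
  by (rule order_trans[OF norm_blinfun mult_right_mono[OF kc[OF \<mu>]]]) simp
 have "\<bar>inner (fc R g \<xi>) (k \<mu> e)\<bar> \<le> norm (fc R g \<xi>) * norm (k \<mu> e)" by (rule Cauchy_Schwarz_ineq2)
 also have "\<dots> \<le> 1 / (y * (1 - y)) * norm \<xi> * (c / sqrt \<mu> * norm e)"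
  using n1 n2 y by (intro mult_mono) auto
 finally show ?thesis unfolding eq e_def .
qed

text \<open>On a band \<theta> is nearly an eigenvector. Three errors add up: \<open>A1\<close> from
  replacing \<open>k\<close> by the scalar kernel, which brings in the harmonic sum;
  \<open>A2\<close> from replacing the Riemann sum by its limit pi / sqrt(p); \<open>A3\<close> from
  replacing \<open>Q\<close> by \<open>sqrt p\<close> on \<theta>. The weights x(1 - x) in \<theta>
  and \<xi> compensate the denominators in \<open>p\<close> and tame the Riemann sums.\<close>

lemma sylvester_band:
 fixes \<zeta> \<xi>0 :: 'a
 assumes N: "2 \<le> N" "1 \<le> i" "i < N" and h: "0 < h" "0 < n"
 defines "\<theta> \<equiv> fc R (\<lambda>x. tent N i x * (x * (1 - x))) \<zeta>" and "\<xi> \<equiv> fc R (\<lambda>x. x * (1 - x)) \<xi>0"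
 shows "\<bar>(\<Sum>l=1..n. 2 * h * inner \<xi> (k ((real l * h)\<^sup>2) \<theta>)) - pi * inner \<xi> (B \<theta>)\<bar>
  \<le> (6 * c / real N * (\<Sum>l=1..n. 1 / real l) + 6 * norm B * (sqrt (real N) * (2 / (real n * h) + 2 * h)) + 12 * norm B / real N)
   * (norm \<xi>0 * norm (fc R (tent N i) \<zeta>))"
proof -
 have i: "i \<in> {1..<N}" using N by simp
 define y where "y = real i / real N"
 have y: "0 < y" "y < 1" "1 / real N \<le> y" "y \<le> 1 - 1 / real N" using N by (auto simp: y_def field_simps)
 define p where "p = y * (1 - y)"
 have p: "0 < p" "p \<le> 1" using y by (auto simp: p_def intro!: mult_le_one)
 have sp: "0 < sqrt p" "sqrt p * sqrt p = p" using p by auto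
 define v where "v = norm (fc R (tent N i) \<zeta>)"
 have v: "0 \<le> v" by (simp add: v_def)
 define Q where "Q = (\<lambda>r::real. sqrt (r * (1 - r)))"
 have cQ: "cont01 Q" unfolding Q_def by (intro continuous_intros)
 define g where "g = (\<lambda>x. tent N i x * (x * (1 - x)))"
 have cg: "cont01 g" unfolding g_def by (intro continuous_intros tent_cont)
 define f where "f = (\<lambda>x::real. x * (1 - x))"
 have cf: "cont01 f" unfolding f_def by (intro continuous_intros)
 have \<theta>: "\<theta> = fc R g \<zeta>" by (simp add: \<theta>_def g_def)
 have \<xi>: "\<xi> = fc R f \<xi>0" by (simp add: \<xi>_def f_def)
 have n\<xi>: "norm \<xi> \<le> norm \<xi>0"
 proof -
  have "\<bar>f x\<bar> \<le> 1" if "x \<in> {0..1}" for x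
   using that mult_le_one[of x "1 - x"] by (auto simp: f_def abs_mult)
  from norm_fc_le[OF cf this, of \<xi>0] show ?thesis unfolding \<xi> by simp
 qed
 \<comment> \<open>Norms are compared through domination of functions by a multiple of the tent;
   since \<open>u\<close> vanishes where the tent does, only the band has to be inspected.\<close>
 have bound: "norm (fc R u \<zeta>) \<le> K * v"
  if u: "cont01 u" "0 \<le> K"
   "\<And>x. x \<in> {0..1} \<Longrightarrow> \<bar>x - real i / real N\<bar> \<le> 1 / real N \<Longrightarrow> \<bar>u x\<bar> \<le> K * tent N i x"
   "\<And>x. tent N i x = 0 \<Longrightarrow> u x = 0" for u K
 proof -
  have "norm (fc R u \<zeta>) \<le> norm (fc R (\<lambda>x. K * tent N i x) \<zeta>)"
  proof (rule norm_fc_mono[OF u(1)])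
   show "cont01 (\<lambda>x. K * tent N i x)" by (intro continuous_intros tent_cont)
   fix x :: real assume x: "x \<in> {0..1}"
   have "\<bar>u x\<bar> \<le> K * tent N i x" using tent_support[of i N x] x u(3)[OF x] u(4)[of x] N by (cases "tent N i x = 0") auto
   then show "\<bar>u x\<bar> \<le> \<bar>K * tent N i x\<bar>" by simp
  qed
  then show ?thesis using u(2) by (simp add: fc_cmult[OF R tent_cont] blinfun.scaleR_left v_def)
 qed
 note bs = band_scalar[OF N, folded y_def, folded p_def]
 have g_le: "\<bar>g x\<bar> \<le> 3 * p * tent N i x" if "x \<in> {0..1}" "\<bar>x - real i / real N\<bar> \<le> 1 / real N" for x
 proof -
  have "tent N i x * (x * (1 - x)) \<le> tent N i x * (3 * p)"
   using that by (intro mult_left_mono bs(1) tent_bounds[OF i]) (auto simp: y_def)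
  moreover have "\<bar>g x\<bar> = tent N i x * (x * (1 - x))"
   using that tent_bounds(1)[OF i, of x] by (simp add: g_def abs_mult)
  ultimately show ?thesis by (simp add: mult_ac)
 qed
 have e: "norm (R \<theta> - y *\<^sub>R \<theta>) \<le> 3 * p / real N * v"
 proof -
  have "R \<theta> - y *\<^sub>R \<theta> = (fc R (\<lambda>x. 1 * (x * g x) + (- y) * g x)) \<zeta>"
   unfolding \<theta> fc_ident_mult[OF cg]
   by (subst fc_linear[OF R]) (auto intro!: continuous_intros cg simp: blinfun.bilinear_simps)
  also have "norm \<dots> \<le> 3 * p / real N * v"
  proof (rule bound)
   show "cont01 (\<lambda>x. 1 * (x * g x) + - y * g x)" by (intro continuous_intros cg)
   show "0 \<le> 3 * p / real N" using p by simp
   fix x :: real assume x: "x \<in> {0..1}" "\<bar>x - real i / real N\<bar> \<le> 1 / real N"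
   have "\<bar>1 * (x * g x) + - y * g x\<bar> = \<bar>x - y\<bar> * \<bar>g x\<bar>" by (simp add: abs_mult[symmetric] left_diff_distrib)
   also have "\<dots> \<le> 1 / real N * (3 * p * tent N i x)" using x g_le[OF x] unfolding y_def[symmetric] by (intro mult_mono) auto
   finally show "\<bar>1 * (x * g x) + - y * g x\<bar> \<le> 3 * p / real N * tent N i x" by simp
  qed (simp add: g_def)
  finally show ?thesis .
 qed
 have Q\<theta>: "fc R Q \<theta> = fc R (\<lambda>x. Q x * g x) \<zeta>" unfolding \<theta> by (rule fc_apply_mult[OF cQ cg])
 have nQ: "norm (fc R Q \<theta>) \<le> 6 * sqrt p * v"
  unfolding Q\<theta>
 proof (rule bound)
  show "cont01 (\<lambda>x. Q x * g x)" by (intro continuous_intros cQ cg)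
  show "0 \<le> 6 * sqrt p" using p by simp
  fix x :: real assume x: "x \<in> {0..1}" "\<bar>x - real i / real N\<bar> \<le> 1 / real N"
  have "\<bar>Q x * g x\<bar> \<le> (2 * sqrt p) * (3 * p * tent N i x)"
   unfolding abs_mult using bs(2)[OF x(1)] x g_le[OF x] p(1) unfolding y_def[symmetric] Q_def by (intro mult_mono) auto
  also have "\<dots> \<le> 6 * sqrt p * tent N i x"
   using mult_right_mono[OF p(2), of "6 * sqrt p * tent N i x"] p tent_bounds(1)[OF i, of x] by (simp add: mult_ac)
  finally show "\<bar>Q x * g x\<bar> \<le> 6 * sqrt p * tent N i x" .
 qed (simp add: g_def)
 have nQ': "norm (fc R Q \<theta> - sqrt p *\<^sub>R \<theta>) \<le> 3 * sqrt p / real N * v"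
 proof -
  have "fc R Q \<theta> - sqrt p *\<^sub>R \<theta> = (fc R (\<lambda>x. 1 * (Q x * g x) + (- sqrt p) * g x)) \<zeta>"
   unfolding Q\<theta> unfolding \<theta>
   by (subst fc_linear[OF R]) (auto intro!: continuous_intros cQ cg simp: blinfun.bilinear_simps)
  also have "norm \<dots> \<le> 3 * sqrt p / real N * v"
  proof (rule bound)
   show "cont01 (\<lambda>x. 1 * (Q x * g x) + - sqrt p * g x)" by (intro continuous_intros cQ cg)
   show "0 \<le> 3 * sqrt p / real N" using p by simp
   fix x :: real assume x: "x \<in> {0..1}" "\<bar>x - real i / real N\<bar> \<le> 1 / real N"
   have "\<bar>1 * (Q x * g x) + - sqrt p * g x\<bar> = \<bar>Q x - sqrt p\<bar> * \<bar>g x\<bar>" by (simp add: abs_mult[symmetric] left_diff_distrib)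
   also have "\<dots> \<le> 1 / (real N * sqrt p) * (3 * p * tent N i x)"
    using bs(3)[OF x(1)] x g_le[OF x] p unfolding y_def[symmetric] Q_def by (intro mult_mono) auto
   also have "\<dots> = 3 * (sqrt p * sqrt p) / (real N * sqrt p) * tent N i x" using p(1) by simp
   also have "\<dots> = 3 * sqrt p / real N * tent N i x"
   proof -
    have "3 * (s * s) / (M * s) * t = 3 * s / M * t" if "s > 0" for s M t :: real using that by simp
    then show ?thesis using sp(1) by blast
   qed
   finally show "\<bar>1 * (Q x * g x) + - sqrt p * g x\<bar> \<le> 3 * sqrt p / real N * tent N i x" .
  qed (simp add: g_def)
  finally show ?thesis .
 qed
 define H where "H l r = (1 - r) * y + (real l * h)\<^sup>2 * (r * (1 - y))" for l r
 have Hpos: "0 < H l r" if "r \<in> {0..1}" "1 \<le> l" for r l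
  unfolding H_def using that y h by (cases "r = 1") (auto intro!: add_pos_nonneg)
 have cH: "cont01 (\<lambda>r. Q r / H l r)" if "1 \<le> l" for l
 proof (intro continuous_on_divide cQ ballI)
  show "cont01 (H l)" unfolding H_def by (intro continuous_intros)
  show "H l r \<noteq> 0" if "r \<in> {0..1}" for r using Hpos[OF that \<open>1 \<le> l\<close>] by simp
 qed
 define F where "F r = (\<Sum>l=1..n. 2 * h * (Q r / H l r))" for r
 have cF: "cont01 F" unfolding F_def by (intro continuous_on_sum continuous_on_mult_left cH) auto
 have F\<xi>: "fc R F \<xi> = (\<Sum>l=1..n. (2 * h) *\<^sub>R fc R (\<lambda>r. Q r / H l r) \<xi>)"
 proof -
  have "fc R F = (\<Sum>l=1..n. fc R (\<lambda>r. 2 * h * (Q r / H l r)))"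
   unfolding F_def by (intro fc_sum continuous_on_mult_left cH) auto
  also have "\<dots> = (\<Sum>l=1..n. (2 * h) *\<^sub>R fc R (\<lambda>r. Q r / H l r))" by (intro sum.cong fc_cmult[OF R cH]) auto
  finally show ?thesis by (simp add: blinfun.sum_left blinfun.scaleR_left)
 qed
 have A1: "\<bar>inner (fc R F \<xi>) (B (fc R Q \<theta>)) - (\<Sum>l=1..n. 2 * h * inner \<xi> (k ((real l * h)\<^sup>2) \<theta>))\<bar>
  \<le> 6 * c / real N * (\<Sum>l=1..n. 1 / real l) * (norm \<xi>0 * v)"
 proof -
  have "inner (fc R F \<xi>) (B (fc R Q \<theta>)) - (\<Sum>l=1..n. 2 * h * inner \<xi> (k ((real l * h)\<^sup>2) \<theta>)) =
   (\<Sum>l=1..n. 2 * h * (inner (fc R (\<lambda>r. Q r / H l r) \<xi>) (B (fc R Q \<theta>)) - inner \<xi> (k ((real l * h)\<^sup>2) \<theta>)))"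
   unfolding F\<xi> by (simp add: inner_sum_left right_diff_distrib sum_subtractf)
  also have "\<bar>\<dots>\<bar> \<le> (\<Sum>l=1..n. \<bar>2 * h * (inner (fc R (\<lambda>r. Q r / H l r) \<xi>) (B (fc R Q \<theta>)) - inner \<xi> (k ((real l * h)\<^sup>2) \<theta>))\<bar>)"
   by (rule sum_abs)
  also have "\<dots> \<le> (\<Sum>l=1..n. 6 * c / real N * (norm \<xi>0 * v) * (1 / real l))"
  proof (rule sum_mono)
   fix l assume "l \<in> {1..n}"
   then have l: "1 \<le> l" "0 < real l * h" using h by auto
   have "\<bar>inner (fc R (\<lambda>r. Q r / H l r) \<xi>) (B (fc R Q \<theta>)) - inner \<xi> (k ((real l * h)\<^sup>2) \<theta>)\<bar>
    \<le> 1 / p * norm \<xi> * (c / sqrt ((real l * h)\<^sup>2) * norm (R \<theta> - y *\<^sub>R \<theta>))"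
    unfolding Q_def H_def p_def by (rule sylvester_almost_eigen) (use y l h in auto)
   \<comment> \<open>The factor \<open>p\<close> in the bound \<open>e\<close> cancels
     \<open>1 / p\<close>, so the error does not deteriorate for nodes close to 0 or 1.\<close>
   also have "\<dots> \<le> 1 / p * norm \<xi>0 * (c / (real l * h) * (3 * p / real N * v))"
    using sylvester_c p l n\<xi> e v by (intro mult_mono) auto
   also have "\<dots> = 3 * c / real N * (norm \<xi>0 * v) * (1 / (real l * h))" using p by (simp add: mult_ac)
   finally have "2 * h * \<bar>inner (fc R (\<lambda>r. Q r / H l r) \<xi>) (B (fc R Q \<theta>)) - inner \<xi> (k ((real l * h)\<^sup>2) \<theta>)\<bar>
    \<le> 2 * h * (3 * c / real N * (norm \<xi>0 * v) * (1 / (real l * h)))" using h by (intro mult_left_mono) auto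
   also have "\<dots> = 6 * c / real N * (norm \<xi>0 * v) * (1 / real l)" using h by simp
   finally show "\<bar>2 * h * (inner (fc R (\<lambda>r. Q r / H l r) \<xi>) (B (fc R Q \<theta>)) - inner \<xi> (k ((real l * h)\<^sup>2) \<theta>))\<bar>
    \<le> 6 * c / real N * (norm \<xi>0 * v) * (1 / real l)" using h by (simp add: abs_mult)
  qed
  also have "\<dots> = 6 * c / real N * (\<Sum>l=1..n. 1 / real l) * (norm \<xi>0 * v)" unfolding sum_distrib_left[symmetric] by (simp only: mult_ac)
  finally show ?thesis .
 qed
 have A2: "\<bar>inner (fc R F \<xi> - (pi / sqrt p) *\<^sub>R \<xi>) (B (fc R Q \<theta>))\<bar>
  \<le> 6 * norm B * (sqrt (real N) * (2 / (real n * h) + 2 * h)) * (norm \<xi>0 * v)"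
 proof -
  define E where "E = sqrt (real N) * (2 / (real n * h) + 2 * h)"
  have E: "0 \<le> E" using h by (simp add: E_def)
  have "fc R F \<xi> - (pi / sqrt p) *\<^sub>R \<xi> = fc R (\<lambda>x. 1 * (F x * f x) + (- (pi / sqrt p)) * f x) \<xi>0"
   unfolding \<xi> fc_apply_mult[OF cF cf]
   by (subst fc_linear[OF R]) (auto intro!: continuous_intros cF cf simp: blinfun.bilinear_simps)
  also have "norm \<dots> \<le> 1 / sqrt p * E * norm \<xi>0"
  proof (rule norm_fc_le)
   show "cont01 (\<lambda>x. 1 * (F x * f x) + - (pi / sqrt p) * f x)" by (intro continuous_intros cF cf)
   fix x :: real assume x: "x \<in> {0..1}"
   have "1 * (F x * f x) + - (pi / sqrt p) * f x = (F x - pi / sqrt p) * f x" by (simp add: left_diff_distrib)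
   then have "\<bar>1 * (F x * f x) + - (pi / sqrt p) * f x\<bar> = \<bar>F x - pi / sqrt p\<bar> * f x"
    using x by (simp add: abs_mult f_def)
   also have "\<dots> \<le> 1 / sqrt p * E" unfolding E_def F_def H_def Q_def f_def p_def
    by (rule kernel_sum_scalar) (use y N h x in auto)
   finally show "\<bar>1 * (F x * f x) + - (pi / sqrt p) * f x\<bar> \<le> 1 / sqrt p * E" .
  qed
  finally have 1: "norm (fc R F \<xi> - (pi / sqrt p) *\<^sub>R \<xi>) \<le> 1 / sqrt p * E * norm \<xi>0" .
  have 2: "norm (B (fc R Q \<theta>)) \<le> norm B * (6 * sqrt p * v)" by (rule order_trans[OF norm_blinfun mult_left_mono[OF nQ]]) simp
  have "\<bar>inner (fc R F \<xi> - (pi / sqrt p) *\<^sub>R \<xi>) (B (fc R Q \<theta>))\<bar> \<le> (1 / sqrt p * E * norm \<xi>0) * (norm B * (6 * sqrt p * v))"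
   using 1 2 E sp by (intro order_trans[OF Cauchy_Schwarz_ineq2] mult_mono) auto
  also have "\<dots> = 6 * norm B * E * (norm \<xi>0 * v)" using sp(1) by simp
  finally show ?thesis unfolding E_def .
 qed
 have A3: "\<bar>(pi / sqrt p) * inner \<xi> (B (fc R Q \<theta> - sqrt p *\<^sub>R \<theta>))\<bar> \<le> 12 * norm B / real N * (norm \<xi>0 * v)"
 proof -
  have "norm (B (fc R Q \<theta> - sqrt p *\<^sub>R \<theta>)) \<le> norm B * (3 * sqrt p / real N * v)"
   by (rule order_trans[OF norm_blinfun mult_left_mono[OF nQ']]) simp
  then have "\<bar>inner \<xi> (B (fc R Q \<theta> - sqrt p *\<^sub>R \<theta>))\<bar> \<le> norm \<xi>0 * (norm B * (3 * sqrt p / real N * v))"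
   using n\<xi> by (intro order_trans[OF Cauchy_Schwarz_ineq2] mult_mono) auto
  then have "(pi / sqrt p) * \<bar>inner \<xi> (B (fc R Q \<theta> - sqrt p *\<^sub>R \<theta>))\<bar> \<le> (pi / sqrt p) * (norm \<xi>0 * (norm B * (3 * sqrt p / real N * v)))"
   using p by (intro mult_left_mono) auto
  also have "\<dots> = 3 * pi * (norm B / real N * (norm \<xi>0 * v))" using sp(1) by simp
  also have "\<dots> \<le> 12 * (norm B / real N * (norm \<xi>0 * v))" using pi_less_4 v by (intro mult_right_mono) auto
  finally show ?thesis using p by (simp add: abs_mult)
 qed
 have "inner (fc R F \<xi>) (B (fc R Q \<theta>)) - pi * inner \<xi> (B \<theta>) =
  inner (fc R F \<xi> - (pi / sqrt p) *\<^sub>R \<xi>) (B (fc R Q \<theta>)) + (pi / sqrt p) * inner \<xi> (B (fc R Q \<theta> - sqrt p *\<^sub>R \<theta>))"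
  using sp(1) by (simp add: inner_diff blinfun.bilinear_simps right_diff_distrib)
 then have "\<bar>(\<Sum>l=1..n. 2 * h * inner \<xi> (k ((real l * h)\<^sup>2) \<theta>)) - pi * inner \<xi> (B \<theta>)\<bar> \<le>
  6 * c / real N * (\<Sum>l=1..n. 1 / real l) * (norm \<xi>0 * v) + 6 * norm B * (sqrt (real N) * (2 / (real n * h) + 2 * h)) * (norm \<xi>0 * v)
  + 12 * norm B / real N * (norm \<xi>0 * v)" using A1 A2 A3 by linarith
 then show ?thesis unfolding v_def by (simp only: distrib_right)
qed

text \<open>After cutting \<eta> into bands, the previous estimate contributes a factor of order log
  N / N, and the norms of the pieces add up to at most \<open>sqrt N * norm \<eta>\<close>. The
  total error is of order log N / sqrt N.\<close>

lemma sylvester_limit: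
 "(\<lambda>N. inner (fc R (\<lambda>x. x * (1 - x)) \<xi>) (sylvester_sum k N (fc R (\<lambda>x. x * (1 - x)) \<eta>)))
  \<longlonglongrightarrow> pi * inner (fc R (\<lambda>x. x * (1 - x)) \<xi>) (B (fc R (\<lambda>x. x * (1 - x)) \<eta>))"
proof -
 define f where "f = (\<lambda>x::real. x * (1 - x))"
 define X where "X = fc R f \<xi>"
 define Y where "Y = fc R f \<eta>"
 define b where "b N = (6 * c * (1 + 4 * ln (real N)) + 36 * norm B) / real N * (norm \<xi> * (sqrt (real N) * norm \<eta>))" for N
 have "norm (inner X (sylvester_sum k N Y) - pi * inner X (B Y)) \<le> b N" if N: "2 \<le> N" for N
 proof -
  \<comment> \<open>Step N^(-2) and \<open>N ^ 4\<close> nodes give the range N^2, so mesh and tail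
    errors are both of order N^(-2).\<close>
  define h where "h = 1 / real N ^ 2"
  define n where "n = N ^ 4"
  have h: "0 < h" and n: "0 < n" and nh: "real n * h = real N ^ 2" using N by (auto simp: h_def n_def field_simps power4_eq_xxxx power2_eq_square)
  define E where "E = 6 * c / real N * (\<Sum>l=1..n. 1 / real l) + 6 * norm B * (sqrt (real N) * (2 / (real n * h) + 2 * h)) + 12 * norm B / real N"
  have E: "0 \<le> E" unfolding E_def using sylvester_c h by (intro add_nonneg_nonneg mult_nonneg_nonneg sum_nonneg) auto
  have Eb: "E \<le> (6 * c * (1 + 4 * ln (real N)) + 36 * norm B) / real N"
  proof -
   have "(\<Sum>l=1..n. 1 / real l) \<le> 1 + 4 * ln (real N)"
    using harmonic_sum_le[OF n] N by (simp add: n_def ln_realpow)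
   then have 1: "6 * c / real N * (\<Sum>l=1..n. 1 / real l) \<le> 6 * c / real N * (1 + 4 * ln (real N))"
    using sylvester_c by (intro mult_left_mono) auto
   have "sqrt (real N) * (2 / (real n * h) + 2 * h) = sqrt (real N) * 4 / (real N * real N)"
    unfolding nh by (simp add: h_def power2_eq_square)
   also have "\<dots> \<le> real N * 4 / (real N * real N)"
    using N by (intro divide_right_mono mult_right_mono) (auto simp: real_le_lsqrt power2_eq_square)
   also have "\<dots> = 4 / real N" using N by simp
   finally have "6 * norm B * (sqrt (real N) * (2 / (real n * h) + 2 * h)) \<le> 6 * norm B * (4 / real N)"
    by (intro mult_left_mono) auto
   with 1 show ?thesis unfolding E_def by (simp add: add_divide_distrib)
  qed
  define D where "D \<theta> = (\<Sum>l=1..n. 2 * h * inner X (k ((real l * h)\<^sup>2) \<theta>)) - pi * inner X (B \<theta>)" for \<theta>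
  define \<theta> where "\<theta> i = fc R (\<lambda>x. tent N i x * (x * (1 - x))) \<eta>" for i
  have "(\<Sum>i\<in>{1..<N}. \<theta> i) = fc R (\<lambda>x. \<Sum>i\<in>{1..<N}. tent N i x * (x * (1 - x))) \<eta>"
   unfolding \<theta>_def by (subst fc_sum) (auto intro!: continuous_intros tent_cont simp: blinfun.sum_left)
  then have Y: "Y = (\<Sum>i\<in>{1..<N}. \<theta> i)" by (simp only: Y_def f_def sum_distrib_right[symmetric] sum_tent[OF N] mult_1)
  have "inner X (sylvester_sum k N Y) - pi * inner X (B Y) = D Y"
   by (simp add: D_def sylvester_sum_def h_def n_def blinfun.sum_left blinfun.scaleR_left inner_sum_right)
  also have "\<dots> = (\<Sum>i\<in>{1..<N}. D (\<theta> i))"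
   unfolding D_def Y sum_subtractf blinfun.sum_right inner_sum_right sum_distrib_left by (subst sum.swap) simp
  also have "norm \<dots> \<le> (\<Sum>i\<in>{1..<N}. E * (norm \<xi> * norm (fc R (tent N i) \<eta>)))"
   unfolding D_def E_def X_def f_def \<theta>_def
   by (intro sum_norm_le, subst real_norm_def, rule sylvester_band) (use N h n in auto)
  also have "\<dots> = E * (norm \<xi> * (\<Sum>i\<in>{1..<N}. norm (fc R (tent N i) \<eta>)))" by (simp only: sum_distrib_left)
  also have "\<dots> \<le> b N" unfolding b_def
   by (intro mult_mono Eb mult_left_mono sum_norm_tent_le N mult_nonneg_nonneg sum_nonneg order_trans[OF E Eb]) auto
  finally show ?thesis .
 qed
 then have ev: "eventually (\<lambda>N. norm (inner X (sylvester_sum k N Y) - pi * inner X (B Y)) \<le> b N) sequentially"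
  by (intro eventually_sequentiallyI[of 2])
 have "(\<lambda>N. ln (real N) / real N powr (1 / 2)) \<longlonglongrightarrow> 0"
  using lim_ln_over_power[of "1 / 2"] by simp
 then have l1: "(\<lambda>N. ln (real N) / sqrt (real N)) \<longlonglongrightarrow> 0"
  by (rule Lim_transform_eventually) (auto simp: powr_half_sqrt)
 have l2: "(\<lambda>N. 1 / sqrt (real N)) \<longlonglongrightarrow> 0"
  by (intro tendsto_divide_0[OF tendsto_const] filterlim_at_top_imp_at_infinity filterlim_compose[OF sqrt_at_top filterlim_real_sequentially])
 have "(\<lambda>N. (24 * c * (ln (real N) / sqrt (real N)) + (6 * c + 36 * norm B) * (1 / sqrt (real N))) * (norm \<xi> * norm \<eta>))
  \<longlonglongrightarrow> (24 * c * 0 + (6 * c + 36 * norm B) * 0) * (norm \<xi> * norm \<eta>)"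
  by (intro tendsto_intros l1 l2)
 moreover have "(24 * c * (ln (real N) / sqrt (real N)) + (6 * c + 36 * norm B) * (1 / sqrt (real N))) * (norm \<xi> * norm \<eta>) = b N" for N
 proof -
  have "u / real N * (x * (sqrt (real N) * y)) = u / sqrt (real N) * (x * y)" for u x y
   by (cases "N = 0") (simp_all add: divide_simps)
  then show ?thesis unfolding b_def by (simp only:) (simp add: algebra_simps add_divide_distrib)
 qed
 ultimately have "b \<longlonglongrightarrow> 0" by simp
 then have "(\<lambda>N. inner X (sylvester_sum k N Y) - pi * inner X (B Y)) \<longlonglongrightarrow> 0" by (rule Lim_null_comparison[OF ev])
 then show ?thesis unfolding X_def Y_def f_def by (simp add: LIM_zero_iff)
qed

end

end

lemma adj_zero [simp]: "adj (0 :: 'a::{real_inner,banach} \<Rightarrow>\<^sub>L 'b::{real_inner,banach}) = 0"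
 by (rule adjI) simp

lemma adj_sum: "adj (\<Sum>l\<in>I. g l) = (\<Sum>l\<in>I. adj (g l))"
 by (induction I rule: infinite_finite_induct) (auto simp: adj_add)

section \<open>From the averages to the modular conjugation\<close>

context tomita
begin

abbreviation "W \<equiv> (\<lambda>x::real. x * (1 - x))"

lemma W_cont: "cont01 W"
 by (intro continuous_intros)

lemma fc_W: "fc R W \<xi> = R (\<xi> - R \<xi>)"
proof -
 have "fc R W = R o\<^sub>L fc R (\<lambda>x. 1 - x)" by (intro fc_times_ident[OF unit_op_R] continuous_intros)
 then show ?thesis by (simp add: fc_compl[OF unit_op_R] blinfun.diff_left)
qed

lemma fc_W_dense: "closure (range (app (fc R W))) = UNIV"
proof (rule sa_inj_dense)
 show "sa (fc R W)" by (rule sa_fc[OF unit_op_R W_cont])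
 show "\<xi> = 0" if "fc R W \<xi> = 0" for \<xi>
  using R_inj[of "\<xi> - R \<xi>"] R_compl_inj[of \<xi>] that by (simp add: fc_W)
qed

text \<open>Because \<open>adj k \<Omega> = C (resolv \<mu> (a \<Omega>))\<close>, the adjoint of
  the average of the Sakai elements sends \<Omega> to \<open>J\<close> of this function of
  \<open>R\<close> at \<open>a \<Omega>\<close>. It is again a Riemann sum of an integral with value
  pi.\<close>

definition tomita_kernel :: "nat \<Rightarrow> real \<Rightarrow> real" where
 "tomita_kernel N r = (\<Sum>l=1..N ^ 4. (2 / real N ^ 2) * (sqrt (r * (1 - r)) * (1 / (1 - r + (real l * (1 / real N ^ 2))\<^sup>2 * r))))"

text \<open>The earlier kernel at the node 1/2, halved; this node is the eigenvalue of
  \<open>R\<close> at \<Omega>.\<close>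

lemma tomita_kernel_half:
 "tomita_kernel N r = (\<Sum>l=1..N ^ 4. 2 * (1 / real N ^ 2) * (sqrt (r * (1 - r)) / ((1 - r) * (1 / 2) + (real l * (1 / real N ^ 2))\<^sup>2 * (r * (1 - 1 / 2))))) / 2"
proof -
 have "s / ((1 - r) * (1 / 2) + t * (r * (1 - 1 / 2))) = 2 * (s * (1 / (1 - r + t * r)))" for s t :: real
 proof -
  have e: "(1 - r) * (1 / 2) + t * (r * (1 - 1 / 2)) = (1 - r + t * r) / 2" by (simp add: field_simps)
  show ?thesis unfolding e by simp
 qed
 then show ?thesis unfolding tomita_kernel_def sum_divide_distrib by simp
qed

lemma tomita_kernel_cont: "cont01 (tomita_kernel N)"
proof (cases "N = 0")
 case False
 then show ?thesis unfolding tomita_kernel_def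
  by (intro continuous_on_sum continuous_on_mult_left continuous_on_mult sqrt_cont resolv_cont) auto
qed (simp add: tomita_kernel_def)

lemma tomita_kernel_bound:
 assumes "r \<in> {0..1}"
 shows "\<bar>tomita_kernel N r\<bar> \<le> pi"
proof (cases "N = 0")
 case False
 have "0 \<le> tomita_kernel N r" unfolding tomita_kernel_def
  using assms by (intro sum_nonneg mult_nonneg_nonneg) auto
 moreover have "tomita_kernel N r \<le> pi"
  using kernel_sum_le[of "1 / 2" r "1 / real N ^ 2" "N ^ 4"] assms False
  unfolding tomita_kernel_half by (simp add: real_sqrt_divide)
 ultimately show ?thesis by simp
qed (simp add: tomita_kernel_def)

lemma tomita_kernel_approx:
 assumes "r \<in> {0..1}" "0 < N"
 shows "\<bar>(tomita_kernel N r - pi) * W r\<bar> \<le> sqrt 2 * 4 * (1 / real N ^ 2)"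
proof -
 define s where "s = (\<Sum>l=1..N ^ 4. 2 * (1 / real N ^ 2) * (sqrt (r * (1 - r)) / ((1 - r) * (1 / 2) + (real l * (1 / real N ^ 2))\<^sup>2 * (r * (1 - 1 / 2)))))"
 have n: "real (N ^ 4) * (1 / real N ^ 2) = real N ^ 2" using assms(2) by (simp add: field_simps power4_eq_xxxx power2_eq_square)
 have q: "sqrt (1 / 2 * (1 - 1 / 2)) = (1 / 2 :: real)" by (simp add: real_sqrt_divide)
 have "\<bar>s - pi / (1 / 2)\<bar> * (r * (1 - r)) \<le> 1 / (1 / 2) * (sqrt (real 2) * (2 / (real N ^ 2) + 2 * (1 / real N ^ 2)))"
  using kernel_sum_scalar[of "1 / 2" 2 "1 / real N ^ 2" "N ^ 4" r] assms unfolding s_def[symmetric] n q by simp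
 moreover have "\<bar>(tomita_kernel N r - pi) * W r\<bar> = \<bar>s - pi / (1 / 2)\<bar> * (r * (1 - r)) / 2"
 proof -
  have "(tomita_kernel N r - pi) * W r = (s - pi / (1 / 2)) * W r / 2"
  proof -
   have "(s / 2 - pi) * w = (s - pi / (1 / 2)) * w / 2" for w by (simp add: algebra_simps)
   then show ?thesis unfolding tomita_kernel_half s_def[symmetric] .
  qed
  moreover have "\<bar>(s - pi / (1 / 2)) * w / 2\<bar> = \<bar>s - pi / (1 / 2)\<bar> * w / 2" if "0 \<le> w" for w
   using that by (simp add: abs_mult)
  moreover have "0 \<le> W r" using assms(1) by simp
  ultimately show ?thesis by (simp only:)
 qed
 ultimately show ?thesis by simp
qed

lemma tomita_kernel_limit: "(\<lambda>N. fc R (tomita_kernel N) \<xi>) \<longlonglongrightarrow> pi *\<^sub>R \<xi>"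
proof -
 have "(\<lambda>N. fc R (tomita_kernel N) \<xi>) \<longlonglongrightarrow> (pi *\<^sub>R id_blinfun) \<xi>"
 proof (rule tendsto_dense[OF fc_W_dense, where c = pi])
  show "norm (fc R (tomita_kernel N)) \<le> pi" for N
   by (rule fc_bound[OF unit_op_R tomita_kernel_cont tomita_kernel_bound])
  fix v assume "v \<in> range (app (fc R W))"
  then obtain u where u: "v = fc R W u" by blast
  have "(\<lambda>N. fc R (tomita_kernel N) v - pi *\<^sub>R v) \<longlonglongrightarrow> 0"
  proof (rule Lim_null_comparison)
   show "eventually (\<lambda>N. norm (fc R (tomita_kernel N) v - pi *\<^sub>R v) \<le> sqrt 2 * 4 * (1 / real N ^ 2) * norm u) sequentially"
   proof (rule eventually_sequentiallyI[of 1])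
    fix N :: nat assume N: "1 \<le> N"
    have "fc R (\<lambda>x. 1 * (tomita_kernel N x * W x) + (- pi) * W x) = 1 *\<^sub>R fc R (\<lambda>x. tomita_kernel N x * W x) + (- pi) *\<^sub>R fc R W"
     by (intro fc_linear[OF unit_op_R] continuous_intros tomita_kernel_cont)
    then have "fc R (tomita_kernel N) v - pi *\<^sub>R v = fc R (\<lambda>x. 1 * (tomita_kernel N x * W x) + (- pi) * W x) u"
     unfolding u fc_fc[OF tomita_kernel_cont W_cont] by (simp add: blinfun.bilinear_simps)
    also have "norm \<dots> \<le> sqrt 2 * 4 * (1 / real N ^ 2) * norm u"
    proof (rule norm_fc_le[OF unit_op_R])
     show "cont01 (\<lambda>x. 1 * (tomita_kernel N x * W x) + - pi * W x)"
      by (intro continuous_intros tomita_kernel_cont)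
     fix x :: real assume x: "x \<in> {0..1}"
     have "1 * (tomita_kernel N x * W x) + - pi * W x = (tomita_kernel N x - pi) * W x" by (simp add: left_diff_distrib)
     then show "\<bar>1 * (tomita_kernel N x * W x) + - pi * W x\<bar> \<le> sqrt 2 * 4 * (1 / real N ^ 2)"
      using tomita_kernel_approx[OF x] N by simp
    qed
    finally show "norm (fc R (tomita_kernel N) v - pi *\<^sub>R v) \<le> sqrt 2 * 4 * (1 / real N ^ 2) * norm u" .
   qed
   have l: "(\<lambda>N. 1 / real N) \<longlonglongrightarrow> 0" by (rule lim_1_over_n)
   have "(\<lambda>N. sqrt 2 * 4 * (1 / real N * (1 / real N)) * norm u) \<longlonglongrightarrow> sqrt 2 * 4 * (0 * 0) * norm u"
    by (intro tendsto_intros l)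
   then show "(\<lambda>N. sqrt 2 * 4 * (1 / real N ^ 2) * norm u) \<longlonglongrightarrow> 0" by (simp add: power2_eq_square)
  qed
  then show "(\<lambda>N. fc R (tomita_kernel N) v) \<longlonglongrightarrow> (pi *\<^sub>R id_blinfun) v"
   by (simp add: LIM_zero_iff blinfun.scaleR_left)
 qed
 then show ?thesis by (simp add: blinfun.scaleR_left)
qed

text \<open>The averages \<open>S N\<close> lie in \<open>A\<close> and so commute with
  \<open>d\<close>. On the range of \<open>fc R W\<close> they tend weakly to pi times
  \<open>B\<close>, while their adjoints send \<Omega> to vectors tending to pi times
  \<open>J (a \<Omega>)\<close>. Computing the limit of \<open>inner (d \<Omega>) (S N v)\<close> in
  these two ways gives the identity.\<close>

lemma modular_conjugation_W:
 assumes a: "a \<in> A'" and d: "d \<in> A'" "app d \<Omega> = fc R W \<xi>"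
 shows "J (a (J (d \<Omega>))) = d (J (app a \<Omega>))"
proof -
 have "\<forall>\<mu>. \<exists>k. 0 < \<mu> \<longrightarrow> k \<in> A \<and> norm k \<le> norm a / (2 * sqrt \<mu>) \<and> app k \<Omega> = resolv \<mu> (R (a \<Omega>)) \<and>
  adj k \<Omega> = C (resolv \<mu> (a \<Omega>))" using sakai[OF a] by blast
 from choice[OF this] obtain k where "\<forall>\<mu>. 0 < \<mu> \<longrightarrow> k \<mu> \<in> A \<and> norm (k \<mu>) \<le> norm a / (2 * sqrt \<mu>) \<and>
  app (k \<mu>) \<Omega> = resolv \<mu> (R (a \<Omega>)) \<and> adj (k \<mu>) \<Omega> = C (resolv \<mu> (a \<Omega>))" by (rule exE)
 then have k: "k \<mu> \<in> A" "norm (k \<mu>) \<le> norm a / (2 * sqrt \<mu>)" "app (k \<mu>) \<Omega> = resolv \<mu> (R (a \<Omega>))"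
  "adj (k \<mu>) \<Omega> = C (resolv \<mu> (a \<Omega>))" if "0 < \<mu>" for \<mu> using that by auto
 define B where "B = J o\<^sub>L adj a o\<^sub>L J"
 have adjB: "adj B v = J (a (J v))" for v by (simp add: B_def adj_compose adj_J)
 have kc: "norm (k \<mu>) \<le> (norm a / 2) / sqrt \<mu>" if "0 < \<mu>" for \<mu> using k(2)[OF that] by simp
 have id: "inner (fc R (\<lambda>r. sqrt (r * (1 - r))) \<theta>1) (B (fc R (\<lambda>r. sqrt (r * (1 - r))) \<theta>2)) =
   inner (\<theta>1 - R \<theta>1) (k \<mu> (R \<theta>2)) + \<mu> * inner (R \<theta>1) (k \<mu> (\<theta>2 - R \<theta>2))" if \<mu>: "0 < \<mu>" for \<mu> \<theta>1 \<theta>2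
 proof -
  have "inner (Q \<theta>1) (B (Q \<theta>2)) = inner (a (C \<theta>1)) (C \<theta>2)"
   by (simp add: B_def J_sym[symmetric] J_Q adj'[of a])
  also have "\<dots> = inner (k \<mu> (R \<theta>2)) (\<theta>1 - R \<theta>1) + \<mu> * inner (k \<mu> (\<theta>2 - R \<theta>2)) (R \<theta>1)"
   by (rule sakai_identity[OF a \<mu> k(1,3,4)[OF \<mu>]])
  finally show ?thesis unfolding modQ_def by (simp only: inner_commute)
 qed
 define S where "S = sylvester_sum k"
 have S: "S N \<in> A" for N
 proof (cases "N = 0")
  case False
  have sumA: "(\<Sum>l\<in>I. g l) \<in> A" if "\<And>l. l \<in> I \<Longrightarrow> g l \<in> A" for g :: "nat \<Rightarrow> 'k \<Rightarrow>\<^sub>L 'k" and I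
   using that by (induction I rule: infinite_finite_induct) (auto intro: A_intros)
  show ?thesis unfolding S_def sylvester_sum_def
   by (intro sumA A_intros k) (use False in auto)
 qed (simp add: S_def sylvester_sum_def A_intros)
 have SJ: "adj (S N) \<Omega> = J (fc R (tomita_kernel N) (a \<Omega>))" for N
 proof (cases "N = 0")
  case False
  have t: "(2 / real N ^ 2) *\<^sub>R adj (k ((real l * (1 / real N ^ 2))\<^sup>2)) \<Omega>
   = J (fc R (\<lambda>r. (2 / real N ^ 2) * (sqrt (r * (1 - r)) * (1 / (1 - r + (real l * (1 / real N ^ 2))\<^sup>2 * r)))) (a \<Omega>))"
   if l: "l \<in> {1..N ^ 4}" for l
  proof -
   define \<mu> where "\<mu> = (real l * (1 / real N ^ 2))\<^sup>2"
   have \<mu>: "0 < \<mu>" using l False by (simp add: \<mu>_def)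
   have "(2 / real N ^ 2) *\<^sub>R adj (k \<mu>) \<Omega> = J ((2 / real N ^ 2) *\<^sub>R Q (resolv \<mu> (a \<Omega>)))"
    by (simp add: k(4)[OF \<mu>] J_Q[symmetric] blinfun.scaleR_right)
   also have "(2 / real N ^ 2) *\<^sub>R Q (resolv \<mu> (a \<Omega>)) = ((2 / real N ^ 2) *\<^sub>R fc R (\<lambda>r. sqrt (r * (1 - r)) * (1 / (1 - r + \<mu> * r)))) (a \<Omega>)"
    unfolding modQ_def resolv_def fc_fc[OF sqrt_cont resolv_cont[OF \<mu>]] by (simp add: blinfun.scaleR_left)
   also have "(2 / real N ^ 2) *\<^sub>R fc R (\<lambda>r. sqrt (r * (1 - r)) * (1 / (1 - r + \<mu> * r))) =
    fc R (\<lambda>r. (2 / real N ^ 2) * (sqrt (r * (1 - r)) * (1 / (1 - r + \<mu> * r))))"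
    by (intro fc_cmult[OF unit_op_R, symmetric] continuous_on_mult sqrt_cont resolv_cont \<mu>)
   finally show ?thesis unfolding \<mu>_def .
  qed
  have "adj (S N) \<Omega> = (\<Sum>l=1..N ^ 4. (2 / real N ^ 2) *\<^sub>R adj (k ((real l * (1 / real N ^ 2))\<^sup>2)) \<Omega>)"
   unfolding S_def sylvester_sum_def adj_sum adj_scaleR by (simp add: blinfun.sum_left blinfun.scaleR_left)
  also have "\<dots> = (\<Sum>l=1..N ^ 4. J (fc R (\<lambda>r. (2 / real N ^ 2) * (sqrt (r * (1 - r)) * (1 / (1 - r + (real l * (1 / real N ^ 2))\<^sup>2 * r)))) (a \<Omega>)))"
   by (intro sum.cong t) auto
  also have "\<dots> = J ((\<Sum>l=1..N ^ 4. fc R (\<lambda>r. (2 / real N ^ 2) * (sqrt (r * (1 - r)) * (1 / (1 - r + (real l * (1 / real N ^ 2))\<^sup>2 * r))))) (a \<Omega>))"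
   by (simp only: blinfun.sum_right blinfun.sum_left)
  also have "(\<Sum>l=1..N ^ 4. fc R (\<lambda>r. (2 / real N ^ 2) * (sqrt (r * (1 - r)) * (1 / (1 - r + (real l * (1 / real N ^ 2))\<^sup>2 * r)))))
   = fc R (tomita_kernel N)"
   unfolding tomita_kernel_def
   by (intro fc_sum[OF unit_op_R, symmetric] continuous_on_mult_left continuous_on_mult sqrt_cont resolv_cont) (use False in auto)
  finally show ?thesis .
 next
  case True
  have "tomita_kernel 0 = (\<lambda>r. 0)" by (rule ext) (simp add: tomita_kernel_def)
  then show ?thesis using True by (simp add: S_def sylvester_sum_def fc_const[OF unit_op_R] blinfun.zero_right)
 qed
 have "inner (adj B (d \<Omega>) - d (J (a \<Omega>))) v = 0" if v: "v \<in> range (app (fc R W))" for v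
 proof -
  obtain \<eta> where \<eta>: "v = fc R W \<eta>" using v by blast
  have "(\<lambda>N. inner (fc R W \<xi>) (S N v)) \<longlonglongrightarrow> pi * inner (fc R W \<xi>) (B v)"
   unfolding \<eta> S_def by (rule sylvester_limit[OF unit_op_R kc id])
  moreover have "inner (fc R W \<xi>) (S N v) = inner (d (J (fc R (tomita_kernel N) (a \<Omega>)))) v" for N
   using A_comm[OF adjA[OF S] d(1), of N \<Omega>] by (simp add: d(2)[symmetric] adj[symmetric] SJ)
  moreover have "(\<lambda>N. inner (d (J (fc R (tomita_kernel N) (a \<Omega>)))) v) \<longlonglongrightarrow> inner (d (J (pi *\<^sub>R a \<Omega>))) v"
   by (intro tendsto_intros tomita_kernel_limit)
  ultimately have "pi * inner (fc R W \<xi>) (B v) = inner (d (J (pi *\<^sub>R a \<Omega>))) v" using LIMSEQ_unique by simp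
  then have "inner (fc R W \<xi>) (B v) = inner (d (J (a \<Omega>))) v" by (simp add: blinfun.scaleR_right)
  then show ?thesis by (simp add: inner_diff adj d(2))
 qed
 then have "adj B (d \<Omega>) - d (J (a \<Omega>)) = 0" by (rule dense_orthogonal[OF fc_W_dense])
 then show ?thesis by (simp add: adjB)
qed

text \<open>The restricted identity applies to the elements \<open>e\<close> obtained from
  \<open>b\<close> by using \<open>sakai\<close> twice, with e \<Omega> = R (1 - R) b \<Omega>.
  Tested against all \<open>b\<close>, it says that \<open>(u, v)\<close> lies in the Tomita graph,
  and the orthogonality relation of that graph to the pairs of \<open>A'\<close> gives the identity
  for every \<open>d\<close>.\<close>

lemma modular_conjugation_A':
 assumes a: "a \<in> A'" and d: "d \<in> A'"
 shows "J (a (J (d \<Omega>))) = d (J (app a \<Omega>))"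
proof -
 interpret s: tomita A' A \<Omega> by (rule tomita_swap)
 have res1: "resolv 1 v = v" "s.resolv 1 v = v" for v using resolv_inverse[of 1 v] s.resolv_inverse[of 1 v] by simp_all
 define B where "B = J o\<^sub>L a o\<^sub>L J"
 have "inner (B (d \<Omega>) - d (J (a \<Omega>))) w = 0" if w: "w \<in> (\<lambda>x. app x \<Omega>) ` A" for w
 proof -
  obtain y where y: "y \<in> A" "w = app y \<Omega>" using w by blast
  define u where "u = adj B w"
  define v where "v = adj y (J (a \<Omega>))"
  have base: "inner u (fc R W (b \<Omega>)) = inner v (C (R (b \<Omega>)))" if b: "b \<in> A'" for b
  proof -
   obtain l where l: "l \<in> A" "app l \<Omega> = R (b \<Omega>)" "adj l \<Omega> = C (b \<Omega>)"
    using sakai[OF b, of 1] by (auto simp: res1)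
   obtain e where e: "e \<in> A'" "app e \<Omega> = l \<Omega> - R (l \<Omega>)" "adj e \<Omega> = C (l \<Omega>)"
    using s.sakai[OF l(1), of 1] by (auto simp: res1 modR_swap modC_swap blinfun.diff_left)
   have eW: "e \<Omega> = fc R W (b \<Omega>)" using e(2) l(2) by (simp add: fc_W blinfun.diff_right)
   have "inner u (fc R W (b \<Omega>)) = inner w (B (e \<Omega>))" by (simp add: u_def adj eW)
   also have "\<dots> = inner (y \<Omega>) (e (J (a \<Omega>)))"
    using modular_conjugation_W[OF a e(1) eW] by (simp add: B_def y(2))
   also have "\<dots> = inner (adj e (y \<Omega>)) (J (a \<Omega>))" by (simp add: adj)
   also have "adj e (y \<Omega>) = y (adj e \<Omega>)" using A_comm[OF y(1) adjA'[OF e(1)]] by simp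
   also have "inner (y (adj e \<Omega>)) (J (a \<Omega>)) = inner v (adj e \<Omega>)"
    by (simp only: v_def adj inner_commute[of "y (adj e \<Omega>)"])
   finally show ?thesis by (simp add: e(3) l(2))
  qed
  have R1: "inner u (fc R W \<tau>) = inner v (C (R \<tau>))" for \<tau>
  proof -
   have cl: "closed {\<tau>. inner u (fc R W \<tau>) = inner v (C (R \<tau>))}" by (intro closed_Collect_eq continuous_intros)
   have "(\<lambda>x. app x \<Omega>) ` A' \<subseteq> {\<tau>. inner u (fc R W \<tau>) = inner v (C (R \<tau>))}" using base by auto
   from closure_minimal[OF this cl] show ?thesis unfolding denseA' by auto
  qed
  \<comment> \<open>Cancelling the injective \<open>R\<close> here and once more below yields the
    two equations that characterise membership of \<open>(u, v)\<close> in the graph.\<close>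
  have "R (u - R u - C v) = 0"
  proof (rule inner_eqI)
   fix \<tau>
   have "inner (R (u - R u - C v)) \<tau> = inner u (fc R W \<tau>) - inner v (C (R \<tau>))"
    by (simp add: fc_W R_sym inner_diff C_sym blinfun.diff_right)
   then show "inner (R (u - R u - C v)) \<tau> = inner 0 \<tau>" by (simp add: R1)
  qed
  then have 1: "C v = u - R u" using R_inj[of "u - R u - C v"] by simp
  have "R (C u - (v - R v)) = 0"
  proof -
   have "R (v - R v) = C (C v)" by (simp add: C_C)
   also have "\<dots> = R (C u)" unfolding 1 by (simp add: blinfun.diff_right C_R)
   finally show ?thesis by (simp add: blinfun.diff_right)
  qed
  then have 2: "C u = v - R v" using R_inj[of "C u - (v - R v)"] by simp
  have d1: "d \<Omega> = d \<Omega> - R (d \<Omega>) + C (adj d \<Omega>)" using A'_vec[OF d] by simp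
  have d2: "adj d \<Omega> = C (d \<Omega>) + (adj d \<Omega> - R (adj d \<Omega>))" using A'_vec[OF adjA'[OF d]] by simp
  have "inner u (d \<Omega>) = inner (u - R u) (d \<Omega>) + inner (C u) (adj d \<Omega>)"
   by (subst d1) (simp add: inner_diff inner_add R_sym C_sym)
  also have "\<dots> = inner v (C (d \<Omega>)) + inner v (adj d \<Omega> - R (adj d \<Omega>))"
   unfolding 1[symmetric] 2 by (simp add: inner_diff R_sym C_sym)
  also have "\<dots> = inner v (adj d \<Omega>)" by (subst (2) d2) (simp add: inner_add inner_diff)
  finally have "inner u (d \<Omega>) = inner v (adj d \<Omega>)" .
  moreover have "inner u (d \<Omega>) = inner (B (d \<Omega>)) w" unfolding u_def adj by (rule inner_commute)
  moreover have "inner v (adj d \<Omega>) = inner (d (J (a \<Omega>))) w"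
  proof -
   have "inner v (adj d \<Omega>) = inner (J (a \<Omega>)) (y (adj d \<Omega>))" by (simp add: v_def adj)
   also have "y (adj d \<Omega>) = adj d w" using A_comm[OF y(1) adjA'[OF d]] by (simp add: y(2))
   finally show ?thesis by (simp add: adj')
  qed
  ultimately show ?thesis by (simp add: inner_diff)
 qed
 then have "B (d \<Omega>) - d (J (a \<Omega>)) = 0" by (rule dense_orthogonal[OF denseA])
 then show ?thesis by (simp add: B_def)
qed

text \<open>The identity for the product of \<open>d\<close> and \<open>e\<close> and for
  \<open>e\<close> alone gives J a J d e \<Omega> = d e J a \<Omega> = d J a J e \<Omega>, so J a J
  commutes with \<open>d\<close> on a dense set.\<close>

lemma J_A'_J: "a \<in> A' \<Longrightarrow> J o\<^sub>L a o\<^sub>L J \<in> A"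
proof -
 assume a: "a \<in> A'"
 define B where "B = J o\<^sub>L a o\<^sub>L J"
 have "B o\<^sub>L d = d o\<^sub>L B" if d: "d \<in> A'" for d
 proof (rule blinfun_eqI_dense[OF denseA'])
  fix u assume "u \<in> (\<lambda>x. app x \<Omega>) ` A'"
  then obtain e where e: "u = app e \<Omega>" "e \<in> A'" by blast
  show "(B o\<^sub>L d) u = (d o\<^sub>L B) u"
   using modular_conjugation_A'[OF a A'_intros(8)[OF d e(2)]] modular_conjugation_A'[OF a e(2)] by (simp add: B_def e(1))
 qed
 then have "B (d v) = d (B v)" if "d \<in> A'" for d v using that by (metis blinfun_apply_blinfun_compose)
 moreover have "B (\<i> *\<^sub>C v) = \<i> *\<^sub>C B v" for v by (simp add: B_def J_i A'_i[OF a] blinfun.minus_right)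
 ultimately show ?thesis unfolding comm(2)[symmetric] B_def by (simp add: commutant_iff bounded_ops_iff)
qed

lemma J_A_J: "a \<in> A \<Longrightarrow> J o\<^sub>L a o\<^sub>L J \<in> A'"
proof -
 interpret s: tomita A' A \<Omega> by (rule tomita_swap)
 show "a \<in> A \<Longrightarrow> J o\<^sub>L a o\<^sub>L J \<in> A'" using s.J_A'_J[of a] by (simp only: modJ_swap)
qed

end

section \<open>Roots of the modular operator\<close>

text \<open>The graph of the possibly unbounded quotient g(X)/f(X). The modular operator (1 - R)/R
  and its root have this form, which makes powers and adjoints accessible to the bounded
  calculus.\<close>

definition op_graph :: "('a::real_normed_vector \<Rightarrow>\<^sub>L 'a) \<Rightarrow> (real \<Rightarrow> real) \<Rightarrow> (real \<Rightarrow> real) \<Rightarrow> ('a \<times> 'a) set" where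
 "op_graph X f g = {(fc X f \<theta>, fc X g \<theta>) |\<theta>. True}"

context
 fixes X :: "'a::{real_inner,banach} \<Rightarrow>\<^sub>L 'a"
 assumes X: "unit_op X"
begin

text \<open>As \<open>f\<close> and \<open>g\<close> have no common zero,
  \<open>D = 1 / (f\<^sup>2 + g\<^sup>2)\<close> is continuous, and \<psi> is \<open>D\<close>
  applied to g \<theta> + f \<theta>'. Such a common parameter is what both the composition of
  graphs and the computation of adjoints require.\<close>

lemma op_graph_join:
 assumes c: "cont01 f" "cont01 g" and nz: "\<And>x. x \<in> {0..1} \<Longrightarrow> f x \<noteq> 0 \<or> g x \<noteq> 0"
  and eq: "fc X f \<theta> = fc X g \<theta>'"
 shows "\<exists>\<psi>. \<theta> = fc X g \<psi> \<and> \<theta>' = fc X f \<psi>"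
proof -
 define D where "D = (\<lambda>x. 1 / (f x * f x + g x * g x))"
 have pos: "f x * f x + g x * g x > 0" if "x \<in> {0..1}" for x
  using nz[OF that] not_sum_squares_lt_zero[of "f x" "g x"] sum_squares_eq_zero_iff[of "f x" "g x"] by (auto simp: less_le)
 have D: "cont01 D" unfolding D_def by (intro continuous_intros c) (use pos in force)
 note cm = continuous_on_mult
 have one: "fc X (\<lambda>x. D x * (f x * f x) + D x * (g x * g x)) v = v" for v
 proof -
  have "fc X (\<lambda>x. D x * (f x * f x) + D x * (g x * g x)) = fc X (\<lambda>x. 1)"
  proof (rule fc_cong[OF X])
   fix x :: real assume "x \<in> {0..1}"
   have "D x * (f x * f x) + D x * (g x * g x) = D x * (f x * f x + g x * g x)" by (simp add: distrib_left)
   moreover have "1 / t * t = 1" if "0 < t" for t :: real using that by simp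
   ultimately show "D x * (f x * f x) + D x * (g x * g x) = 1" using pos[OF \<open>x \<in> {0..1}\<close>] unfolding D_def by metis
  qed
  then show ?thesis by (simp add: fc_const[OF X])
 qed
 have split: "v = fc X D (fc X f (fc X f v)) + fc X D (fc X g (fc X g v))" for v
  using one[of v] by (simp add: fc_add[OF X] fc_mult[OF X] cm c D blinfun.add_left)
 have comm: "fc X u (fc X w v) = fc X w (fc X u v)" if "cont01 u" "cont01 w" for u w v
  using fc_mult[OF X that] fc_mult[OF X that(2,1)] by (simp add: mult.commute) (metis blinfun_apply_blinfun_compose)
 define \<psi> where "\<psi> = fc X D (fc X g \<theta> + fc X f \<theta>')"
 have "fc X g \<psi> = fc X D (fc X g (fc X g \<theta>)) + fc X D (fc X f (fc X g \<theta>'))"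
  unfolding \<psi>_def comm[OF c(2) D] by (simp add: blinfun.add_right comm[OF c(2) c(1)])
 also have "\<dots> = \<theta>" unfolding eq[symmetric] by (subst add.commute) (rule split[symmetric])
 finally have 1: "\<theta> = fc X g \<psi>" ..
 have "fc X f \<psi> = fc X D (fc X g (fc X f \<theta>)) + fc X D (fc X f (fc X f \<theta>'))"
  unfolding \<psi>_def comm[OF c(1) D] by (simp add: blinfun.add_right comm[OF c(1) c(2)])
 also have "\<dots> = \<theta>'" unfolding eq by (subst add.commute) (rule split[symmetric])
 finally have "\<theta>' = fc X f \<psi>" ..
 with 1 show ?thesis by blast
qed

lemma op_graph_comp:
 assumes c: "cont01 f1" "cont01 g1" "cont01 f2" "cont01 g2"
  and nz: "\<And>x. x \<in> {0..1} \<Longrightarrow> g1 x \<noteq> 0 \<or> f2 x \<noteq> 0"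
 shows "op_graph X f1 g1 O op_graph X f2 g2 = op_graph X (\<lambda>x. f1 x * f2 x) (\<lambda>x. g1 x * g2 x)"
proof (rule set_eqI)
 fix p :: "'a \<times> 'a"
 obtain u v where p: "p = (u, v)" by (cases p)
 have 1: "p \<in> op_graph X (\<lambda>x. f1 x * f2 x) (\<lambda>x. g1 x * g2 x)" if "p \<in> op_graph X f1 g1 O op_graph X f2 g2"
 proof -
  from that obtain \<theta> \<theta>' where t: "u = fc X f1 \<theta>" "fc X g1 \<theta> = fc X f2 \<theta>'" "v = fc X g2 \<theta>'"
   unfolding op_graph_def p by auto
  obtain \<psi> where "\<theta> = fc X f2 \<psi>" "\<theta>' = fc X g1 \<psi>" using op_graph_join[OF c(2,3) nz t(2)] by blast
  then have "u = fc X (\<lambda>x. f1 x * f2 x) \<psi>" "v = fc X (\<lambda>x. g1 x * g2 x) \<psi>"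
   using t by (simp_all add: fc_mult[OF X] c mult.commute[of "g1 _"])
  then show ?thesis unfolding op_graph_def p by blast
 qed
 have 2: "p \<in> op_graph X f1 g1 O op_graph X f2 g2" if "p \<in> op_graph X (\<lambda>x. f1 x * f2 x) (\<lambda>x. g1 x * g2 x)"
 proof -
  from that obtain \<psi> where "u = fc X (\<lambda>x. f1 x * f2 x) \<psi>" "v = fc X (\<lambda>x. g2 x * g1 x) \<psi>"
   unfolding op_graph_def p by (auto simp: mult.commute)
  then have t: "u = fc X f1 (fc X f2 \<psi>)" "v = fc X g2 (fc X g1 \<psi>)" by (simp_all add: fc_mult[OF X] c)
  have "fc X g1 (fc X f2 \<psi>) = fc X f2 (fc X g1 \<psi>)"
   using fc_mult[OF X c(2,3)] fc_mult[OF X c(3,2)] by (simp add: mult.commute) (metis blinfun_apply_blinfun_compose)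
  then show ?thesis unfolding op_graph_def p using t by (intro relcompI[of u "fc X f2 (fc X g1 \<psi>)"]) auto
 qed
 show "p \<in> op_graph X f1 g1 O op_graph X f2 g2 \<longleftrightarrow> p \<in> op_graph X (\<lambda>x. f1 x * f2 x) (\<lambda>x. g1 x * g2 x)"
  using 1 2 by blast
qed

lemma op_graph_cong:
 "(\<And>x. x \<in> {0..1} \<Longrightarrow> f x = f' x) \<Longrightarrow> (\<And>x. x \<in> {0..1} \<Longrightarrow> g x = g' x) \<Longrightarrow> op_graph X f g = op_graph X f' g'"
 unfolding op_graph_def using fc_cong[OF X, of f f'] fc_cong[OF X, of g g'] by simp

lemma op_graph_power4:
 assumes c: "cont01 f" "cont01 g" and nz: "\<And>x. x \<in> {0..1} \<Longrightarrow> f x \<noteq> 0 \<or> g x \<noteq> 0"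
 shows "op_graph X f g ^^ 4 = op_graph X (\<lambda>x. f x ^ 4) (\<lambda>x. g x ^ 4)"
proof -
 have nz': "g x \<noteq> 0 \<or> f x \<noteq> 0" if "x \<in> {0..1}" for x using nz[OF that] by blast
 have 2: "op_graph X f g O op_graph X f g = op_graph X (\<lambda>x. f x * f x) (\<lambda>x. g x * g x)"
  by (rule op_graph_comp[OF c c nz'])
 have "op_graph X f g ^^ 4 = (op_graph X f g O op_graph X f g) O (op_graph X f g O op_graph X f g)"
  by (simp add: numeral_eq_Suc O_assoc)
 also have "\<dots> = op_graph X (\<lambda>x. (f x * f x) * (f x * f x)) (\<lambda>x. (g x * g x) * (g x * g x))"
  unfolding 2 by (intro op_graph_comp continuous_on_mult c) (use nz' in auto)
 finally show ?thesis by (simp add: power4_eq_xxxx mult.assoc)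
qed

lemma op_graph_scale:
 assumes c: "cont01 f" "cont01 g" "cont01 u" and nz: "\<And>x. x \<in> {0..1} \<Longrightarrow> u x \<noteq> 0"
 shows "op_graph X (\<lambda>x. f x * u x) (\<lambda>x. g x * u x) = op_graph X f g"
proof -
 have cv: "cont01 (\<lambda>x. 1 / u x)" by (intro continuous_intros c) (use nz in auto)
 have inv: "fc X u (fc X (\<lambda>x. 1 / u x) v) = v" for v
 proof -
  have "fc X u o\<^sub>L fc X (\<lambda>x. 1 / u x) = fc X (\<lambda>x. u x * (1 / u x))" by (rule fc_mult[OF X c(3) cv, symmetric])
  also have "\<dots> = fc X (\<lambda>x. 1)" by (intro fc_cong[OF X]) (use nz in auto)
  finally show ?thesis by (simp add: fc_const[OF X]) (metis blinfun_apply_blinfun_compose blinfun_apply_id_blinfun id_apply scaleR_one fc_const[OF X])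
 qed
 have "op_graph X (\<lambda>x. f x * u x) (\<lambda>x. g x * u x) = {(fc X f (fc X u \<theta>), fc X g (fc X u \<theta>)) |\<theta>. True}"
  by (simp add: op_graph_def fc_mult[OF X] c)
 also have "\<dots> = op_graph X f g"
 proof (rule set_eqI)
  fix p
  have "p \<in> {(fc X f (fc X u \<theta>), fc X g (fc X u \<theta>)) |\<theta>. True}" if "p \<in> op_graph X f g"
  proof -
   from that obtain v where "p = (fc X f v, fc X g v)" unfolding op_graph_def by blast
   then have "p = (fc X f (fc X u (fc X (\<lambda>x. 1 / u x) v)), fc X g (fc X u (fc X (\<lambda>x. 1 / u x) v)))" by (simp only: inv)
   then show ?thesis by blast
  qed
  then show "p \<in> {(fc X f (fc X u \<theta>), fc X g (fc X u \<theta>)) |\<theta>. True} \<longleftrightarrow> p \<in> op_graph X f g"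
   unfolding op_graph_def by blast
 qed
 finally show ?thesis .
qed

end

lemma op_graph_positive_selfadjoint:
 fixes X :: "'k::complex_hilbert \<Rightarrow>\<^sub>L 'k"
 assumes X: "unit_op X" "X \<in> bounded_ops" and c: "cont01 f" "cont01 g"
  and nn: "\<And>x. x \<in> {0..1} \<Longrightarrow> 0 \<le> f x" "\<And>x. x \<in> {0..1} \<Longrightarrow> 0 \<le> g x"
  and nz: "\<And>x. x \<in> {0..1} \<Longrightarrow> f x \<noteq> 0 \<or> g x \<noteq> 0" and inj: "\<And>v. fc X f v = 0 \<Longrightarrow> v = 0"
 shows "positive_selfadjoint (op_graph X f g)"
proof -
 have b: "fc X h \<in> bounded_ops" if "cont01 h" for h
 proof -
  have "X \<in> commutant {}" using X(2) by (simp add: commutant_iff)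
  from commutant_fc[OF X(1) this that] show ?thesis by (simp add: commutant_iff)
 qed
 have csym: "cinner (fc X h u) v = cinner u (fc X h v)" if "cont01 h" for h u v
  using b[OF that] fc_sym[OF X(1) that] by (simp add: cinner_eq bounded_opsD[symmetric])
 show ?thesis
  unfolding positive_selfadjoint_def
 proof (intro conjI)
  show "single_valued (op_graph X f g)"
  proof (rule single_valuedI)
   fix u v w assume "(u, v) \<in> op_graph X f g" "(u, w) \<in> op_graph X f g"
   then obtain \<theta> \<theta>' where t: "u = fc X f \<theta>" "v = fc X g \<theta>" "u = fc X f \<theta>'" "w = fc X g \<theta>'" unfolding op_graph_def by blast
   then have "fc X f (\<theta> - \<theta>') = 0" by (simp add: blinfun.diff_right)
   then show "v = w" using inj[of "\<theta> - \<theta>'"] t by simp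
  qed
  have "Domain (op_graph X f g) = range (app (fc X f))" unfolding op_graph_def by auto
  then show "closure (Domain (op_graph X f g)) = UNIV" using sa_inj_dense[OF sa_fc[OF X(1) c(1)] inj] by simp
  show "graph_adjoint (op_graph X f g) = op_graph X f g"
  proof (rule set_eqI)
   fix p :: "'k \<times> 'k"
   obtain u v where p: "p = (u, v)" by (cases p)
   have "p \<in> graph_adjoint (op_graph X f g) \<longleftrightarrow> (\<forall>\<theta>. cinner (fc X g \<theta>) u = cinner (fc X f \<theta>) v)"
    unfolding graph_adjoint_def op_graph_def p by blast
   also have "\<dots> \<longleftrightarrow> fc X g u = fc X f v"
   proof
    assume "\<forall>\<theta>. cinner (fc X g \<theta>) u = cinner (fc X f \<theta>) v"
    then have "inner \<theta> (fc X g u) = inner \<theta> (fc X f v)" for \<theta>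
     by (simp add: csym c Re_cinner[symmetric])
    then have "inner (fc X g u) \<theta> = inner (fc X f v) \<theta>" for \<theta>
     by (simp add: inner_commute[of _ \<theta>])
    then show "fc X g u = fc X f v" by (rule inner_eqI)
   qed (simp add: csym c)
   also have "\<dots> \<longleftrightarrow> p \<in> op_graph X f g"
   proof
    assume eq: "fc X g u = fc X f v"
    have nz': "g x \<noteq> 0 \<or> f x \<noteq> 0" if "x \<in> {0..1}" for x using nz[OF that] by blast
    show "p \<in> op_graph X f g" using op_graph_join[OF X(1) c(2,1) nz' eq] unfolding op_graph_def p by blast
   next
    assume "p \<in> op_graph X f g"
    then obtain \<theta> where "u = fc X f \<theta>" "v = fc X g \<theta>" unfolding op_graph_def p by blast
    then show "fc X g u = fc X f v"
     using fc_mult[OF X(1) c] fc_mult[OF X(1) c(2,1)] by (simp add: mult.commute) (metis blinfun_apply_blinfun_compose)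
   qed
   finally show "p \<in> graph_adjoint (op_graph X f g) \<longleftrightarrow> p \<in> op_graph X f g" .
  qed
  show "\<forall>(\<xi>, \<eta>)\<in>op_graph X f g. cinner \<xi> \<eta> \<in> \<real>\<^sub>\<ge>\<^sub>0"
  proof -
   have cm: "cont01 (\<lambda>x. f x * g x)" by (intro continuous_on_mult c)
   have "cinner (fc X f \<theta>) (fc X g \<theta>) = cinner \<theta> (fc X (\<lambda>x. f x * g x) \<theta>)" for \<theta>
    by (simp add: csym c fc_mult[OF X(1)])
   moreover have "positive_op (fc X (\<lambda>x. f x * g x))"
    unfolding positive_op_iff[OF b[OF cm]] using nn by (intro pos_fc[OF X(1) cm]) auto
   ultimately show ?thesis unfolding op_graph_def positive_op_def by auto
  qed
 qed
qed

text \<open>The parameter X is (1 + B)^(-1): positivity of \<open>B\<close> makes it a contraction,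
  and self-adjointness makes its domain dense and the graph closed.\<close>

lemma positive_selfadjoint_op_graph:
 fixes B :: "('k::complex_hilbert \<times> 'k) set"
 assumes B: "positive_selfadjoint B"
 shows "\<exists>X. unit_op X \<and> B = op_graph X (\<lambda>x. x) (\<lambda>x. 1 - x)"
proof -
 have mem: "(\<eta>, \<zeta>) \<in> B \<longleftrightarrow> (\<forall>\<xi> \<xi>'. (\<xi>, \<xi>') \<in> B \<longrightarrow> cinner \<xi>' \<eta> = cinner \<xi> \<zeta>)" for \<eta> \<zeta>
 proof -
  have "graph_adjoint B = B" using B unfolding positive_selfadjoint_def by (elim conjE)
  then have "(\<eta>, \<zeta>) \<in> B \<longleftrightarrow> (\<eta>, \<zeta>) \<in> graph_adjoint B" by simp
  then show ?thesis unfolding graph_adjoint_def by auto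
 qed
 note memI = mem[THEN iffD2, rule_format] and memD = mem[THEN iffD1, rule_format]
 have pos: "0 \<le> inner \<xi> \<eta>" if "(\<xi>, \<eta>) \<in> B" for \<xi> \<eta>
  using B that unfolding positive_selfadjoint_def by (auto simp: complex_nonneg_Reals_iff Re_cinner)
 have sv: "v = w" if "(u, v) \<in> B" "(u, w) \<in> B" for u v w
  using B that unfolding positive_selfadjoint_def by (auto dest: single_valuedD)
 have sym: "inner \<xi>' \<eta> = inner \<xi> \<eta>'" if "(\<xi>, \<xi>') \<in> B" "(\<eta>, \<eta>') \<in> B" for \<xi> \<xi>' \<eta> \<eta>'
 proof -
  have "cinner \<xi>' \<eta> = cinner \<xi> \<eta>'" by (rule memD[OF that(2,1)])
  then show ?thesis by (simp add: Re_cinner[symmetric])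
 qed
 have lin: "(\<xi> + \<eta>, \<xi>' + \<eta>') \<in> B" if "(\<xi>, \<xi>') \<in> B" "(\<eta>, \<eta>') \<in> B" for \<xi> \<xi>' \<eta> \<eta>'
  by (rule memI) (simp add: cinner_add_right memD[OF that(1)] memD[OF that(2)])
 have scC: "(c *\<^sub>C \<xi>, c *\<^sub>C \<xi>') \<in> B" if "(\<xi>, \<xi>') \<in> B" for \<xi> \<xi>' c
  by (rule memI) (simp add: cinner_scaleC_right memD[OF that])
 then have sc: "(r *\<^sub>R \<xi>, r *\<^sub>R \<xi>') \<in> B" if "(\<xi>, \<xi>') \<in> B" for \<xi> \<xi>' r
  using that by (simp add: scaleR_scaleC)
 have zero: "(0, 0) \<in> B"
 proof -
  have "cinner x (0::'k) = 0" for x by (simp add: cinner_eq complex_eq_iff)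
  then show ?thesis by (intro memI) simp
 qed
 have closedB: "closed B"
 proof -
  have "B = {q. \<forall>p. p \<in> B \<longrightarrow> inner (snd p) (fst q) = inner (fst p) (snd q) \<and> inner (\<i> *\<^sub>C snd p) (fst q) = inner (\<i> *\<^sub>C fst p) (snd q)}" (is "B = ?S")
  proof (rule set_eqI)
   show "q \<in> B \<longleftrightarrow> q \<in> ?S" for q
    using mem[of "fst q" "snd q"] by (simp only: prod.collapse mem_Collect_eq split_paired_All cinner_eq complex.inject fst_conv snd_conv)
  qed
  also have "closed ?S"
   by (intro closed_Collect_all closed_Collect_imp closed_Collect_conj closed_Collect_eq continuous_intros) simp
  finally show ?thesis .
 qed
 define G where "G = (\<lambda>(\<xi>, \<eta>). (\<xi> + \<eta>, \<xi>)) ` B"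
 have GI: "(\<xi> + \<eta>, \<xi>) \<in> G" if "(\<xi>, \<eta>) \<in> B" for \<xi> \<eta> using that unfolding G_def by force
 have "subspace B" unfolding subspace_def using zero lin sc by (auto simp: zero_prod_def)
 then have sG: "subspace G" unfolding G_def
  by (intro linear_subspace_image linearI) (auto simp: scaleR_add_right)
 have bd: "norm y \<le> 1 * norm x" if xy: "(x, y) \<in> G" for x y
 proof -
  obtain \<eta> where e: "x = y + \<eta>" "(y, \<eta>) \<in> B" using xy unfolding G_def by auto
  have "(norm y)\<^sup>2 \<le> (norm x)\<^sup>2" using pos[OF e(2)] unfolding e(1)
   by (simp add: power2_norm_eq_inner inner_add inner_commute)
  from power2_le_imp_le[OF this norm_ge_zero] show ?thesis by simp
 qed
 have dense: "closure (fst ` G) = UNIV"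
 proof (rule closure_subspace_UNIV)
  show "subspace (fst ` G)" by (intro linear_subspace_image sG linear_fst)
  fix v assume v: "\<And>x. x \<in> fst ` G \<Longrightarrow> inner v x = 0"
  have v0: "inner v (\<xi> + \<eta>) = 0" if "(\<xi>, \<eta>) \<in> B" for \<xi> \<eta> using v[of "\<xi> + \<eta>"] GI[OF that] by force
  \<comment> \<open>A vector orthogonal to the range of 1 + B satisfies the adjoint relation with
    value \<open>- v\<close>; positivity of \<open>B\<close> then forces it to vanish.\<close>
  have "(v, - v) \<in> B"
  proof (rule memI)
   fix \<xi> \<eta> assume e: "(\<xi>, \<eta>) \<in> B"
   have "inner v (\<xi> + \<eta>) = 0" "inner v (\<i> *\<^sub>C \<xi> + \<i> *\<^sub>C \<eta>) = 0" using v0[OF e] v0[OF scC[OF e, of \<i>]] by auto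
   then show "cinner \<eta> v = cinner \<xi> (- v)" by (simp add: cinner_eq inner_add inner_commute algebra_simps)
  qed
  from pos[OF this] have "\<not> 0 < inner v v" by (simp only: inner_minus_right neg_0_le_iff_le not_less)
  then show "v = 0" using inner_gt_zero_iff[of v] by blast
 qed
 have "\<exists>X :: 'k \<Rightarrow>\<^sub>L 'k. \<forall>x y. (x, y) \<in> G \<longrightarrow> app X x = y"
 proof (rule extend_graph[OF sG bd dense])
  fix T :: "'k \<Rightarrow>\<^sub>L 'k" assume "\<And>x y. (x, y) \<in> G \<Longrightarrow> T x = y"
  then show ?thesis by blast
 qed
 then obtain X :: "'k \<Rightarrow>\<^sub>L 'k" where XG: "\<And>x y. (x, y) \<in> G \<Longrightarrow> app X x = y" by blast
 have XB: "X (\<xi> + \<eta>) = \<xi>" if "(\<xi>, \<eta>) \<in> B" for \<xi> \<eta> by (rule XG[OF GI[OF that]])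
 have inB: "(X \<theta>, \<theta> - X \<theta>) \<in> B" for \<theta>
 proof -
  have "closed {\<theta>. (X \<theta>, \<theta> - X \<theta>) \<in> B}"
   by (intro closed_vimage[of B "\<lambda>\<theta>. (X \<theta>, \<theta> - X \<theta>)", unfolded vimage_def] closedB continuous_intros)
  moreover have "fst ` G \<subseteq> {\<theta>. (X \<theta>, \<theta> - X \<theta>) \<in> B}" using XB by (auto simp: G_def)
  ultimately have "closure (fst ` G) \<subseteq> {\<theta>. (X \<theta>, \<theta> - X \<theta>) \<in> B}" by (intro closure_minimal)
  then show ?thesis unfolding dense by blast
 qed
 have U: "unit_op X"
  unfolding unit_op_def
 proof (intro conjI allI)
  show "inner (X x) y = inner x (X y)" for x y
   using sym[OF inB[of x] inB[of y]] by (simp add: inner_diff)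
  show "0 \<le> inner x (X x)" for x
   using pos[OF inB[of x]] inner_ge_zero[of "X x"] unfolding inner_diff_right inner_commute[of "X x" x] by linarith
  show "inner x (X x) \<le> inner x x" for x
   using pos[OF inB[of x]] inner_ge_zero[of "x - X x"]
   unfolding inner_diff_right inner_diff_left inner_commute[of "X x" x] by linarith
 qed
 have "B = {(X \<theta>, \<theta> - X \<theta>) |\<theta>. True}"
 proof (rule set_eqI)
  fix p :: "'k \<times> 'k"
  obtain \<xi> \<eta> where p: "p = (\<xi>, \<eta>)" by (cases p)
  have "p = (X (\<xi> + \<eta>), (\<xi> + \<eta>) - X (\<xi> + \<eta>))" if "p \<in> B" using XB[of \<xi> \<eta>] that p by simp
  then show "p \<in> B \<longleftrightarrow> p \<in> {(X \<theta>, \<theta> - X \<theta>) |\<theta>. True}" using inB by blast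
 qed
 also have "\<dots> = op_graph X (\<lambda>x. x) (\<lambda>x. 1 - x)"
  by (simp add: op_graph_def fc_ident[OF U] fc_compl[OF U] blinfun.diff_left)
 finally show ?thesis using U by blast
qed

text \<open>The root is the quotient of the fourth roots of 1 - r and r. For uniqueness, a
  competitor is written as B = (1 - X)/X; comparing \<open>B ^^ 4\<close> with (1 - R)/R gives R =
  h(X) for h(x) = x^4 / (x^4 + (1 - x)^4), and the inverse function \<open>k\<close> recovers X,
  hence B, from R.\<close>

lemma positive_root_op_graph:
 fixes R :: "'k::complex_hilbert \<Rightarrow>\<^sub>L 'k"
 assumes R: "unit_op R" "R \<in> bounded_ops" and inj: "\<And>v. R v = 0 \<Longrightarrow> v = 0"
 shows "positive_root 4 {(R \<theta>, \<theta> - R \<theta>) |\<theta>. True} = op_graph R (\<lambda>x. sqrt (sqrt x)) (\<lambda>x. sqrt (sqrt (1 - x)))"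
proof -
 define a :: "real \<Rightarrow> real" where "a = (\<lambda>x. sqrt (sqrt x))"
 define b :: "real \<Rightarrow> real" where "b = (\<lambda>x. sqrt (sqrt (1 - x)))"
 have c: "cont01 a" "cont01 b" unfolding a_def b_def by (intro continuous_intros)+
 have p4: "t ^ 4 = (t\<^sup>2)\<^sup>2" for t :: real by simp
 have a4: "a x ^ 4 = x" "b x ^ 4 = 1 - x" if "x \<in> {0..1}" for x
  using that unfolding p4 a_def b_def by (simp_all del: power2_eq_square)
 have nz: "a x \<noteq> 0 \<or> b x \<noteq> 0" if "x \<in> {0..1}" for x using that by (auto simp: a_def b_def)
 have \<Delta>: "{(R \<theta>, \<theta> - R \<theta>) |\<theta>. True} = op_graph R (\<lambda>x. x) (\<lambda>x. 1 - x)"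
  by (simp add: op_graph_def fc_ident[OF R(1)] fc_compl[OF R(1)] blinfun.diff_left)
 have power: "op_graph R a b ^^ 4 = {(R \<theta>, \<theta> - R \<theta>) |\<theta>. True}"
 proof -
  have "op_graph R a b ^^ 4 = op_graph R (\<lambda>x. a x ^ 4) (\<lambda>x. b x ^ 4)"
   by (rule op_graph_power4[OF R(1) c]) (use nz in blast)
  also have "\<dots> = op_graph R (\<lambda>x. x) (\<lambda>x. 1 - x)" by (rule op_graph_cong[OF R(1)]) (simp_all add: a4)
  finally show ?thesis unfolding \<Delta> .
 qed
 have ainj: "v = 0" if "fc R a v = 0" for v
 proof (rule inj)
  have "R = fc R (\<lambda>x. (a x * a x * a x) * a x)"
  proof -
   have "fc R (\<lambda>x. x) = fc R (\<lambda>x. (a x * a x * a x) * a x)"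
    using a4 by (intro fc_cong[OF R(1)]) (simp add: power4_eq_xxxx)
   then show ?thesis by (simp only: fc_ident[OF R(1)])
  qed
  also have "\<dots> = fc R (\<lambda>x. a x * a x * a x) o\<^sub>L fc R a" by (intro fc_mult[OF R(1)] continuous_on_mult c)
  finally have "R v = fc R (\<lambda>x. a x * a x * a x) (fc R a v)" by (metis blinfun_apply_blinfun_compose)
  then show "R v = 0" using that by (simp add: blinfun.zero_right)
 qed
 have psa: "positive_selfadjoint (op_graph R a b)"
  by (rule op_graph_positive_selfadjoint[OF R c _ _ nz ainj]) (auto simp: a_def b_def)
 have uniq: "B = op_graph R a b" if B: "positive_selfadjoint B" "B ^^ 4 = {(R \<theta>, \<theta> - R \<theta>) |\<theta>. True}" for B
 proof -
  obtain X where X: "unit_op X" "B = op_graph X (\<lambda>x. x) (\<lambda>x. 1 - x)" using positive_selfadjoint_op_graph[OF B(1)] by blast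
  have "B ^^ 4 = op_graph X (\<lambda>x. x ^ 4) (\<lambda>x. (1 - x) ^ 4)"
   unfolding X(2) by (intro op_graph_power4[OF X(1)] continuous_intros) auto
  then have sub: "op_graph X (\<lambda>x. x ^ 4) (\<lambda>x. (1 - x) ^ 4) \<subseteq> {(R \<theta>, \<theta> - R \<theta>) |\<theta>. True}" using B(2) by simp
  define Z where "Z = (\<lambda>x::real. x ^ 4 + (1 - x) ^ 4)"
  have Zpos: "0 < Z x" for x
  proof -
   have "0 \<le> x ^ 4" "0 \<le> (1 - x) ^ 4" by simp_all
   moreover have "x ^ 4 = 0 \<Longrightarrow> (1 - x) ^ 4 \<noteq> 0" by simp
   ultimately show ?thesis unfolding Z_def by linarith
  qed
  have "cont01 Z" unfolding Z_def by (intro continuous_intros)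
  moreover have nz0: "Z x \<noteq> 0" for x using Zpos[of x] by simp
  ultimately have "cont01 (\<lambda>x. 1 / Z x)"
   by (intro continuous_on_divide continuous_on_const) auto
  then have cZ: "cont01 Z" "cont01 (\<lambda>x. 1 / Z x)"
   using \<open>cont01 Z\<close> by simp_all
  have c4: "cont01 (\<lambda>x::real. x ^ 4)" "cont01 (\<lambda>x::real. (1 - x) ^ 4)" by (intro continuous_intros)+
  have RX: "fc X (\<lambda>x. x ^ 4) v = R (fc X Z v)" for v
  proof -
   have "(fc X (\<lambda>x. x ^ 4) v, fc X (\<lambda>x. (1 - x) ^ 4) v) \<in> {(R \<theta>, \<theta> - R \<theta>) |\<theta>. True}"
    using sub unfolding op_graph_def by blast
   then obtain \<theta> where t: "fc X (\<lambda>x. x ^ 4) v = R \<theta>" "fc X (\<lambda>x. (1 - x) ^ 4) v = \<theta> - R \<theta>" by blast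
   have "fc X Z v = fc X (\<lambda>x. x ^ 4) v + fc X (\<lambda>x. (1 - x) ^ 4) v"
    unfolding Z_def fc_add[OF X(1) c4] by (simp add: blinfun.add_left)
   then have "fc X Z v = \<theta>" using t by simp
   then show ?thesis using t(1) by simp
  qed
  define h where "h = (\<lambda>x. x ^ 4 * (1 / Z x))"
  have ch: "cont01 h" unfolding h_def by (intro continuous_on_mult c4 cZ)
  have h01: "h x \<in> {0..1}" for x using Zpos[of x] by (simp add: h_def Z_def field_simps)
  have Rh: "R = fc X h"
  proof (rule blinfun_eqI)
   fix v
   have "fc X Z (fc X (\<lambda>x. 1 / Z x) v) = v"
   proof -
    have "fc X Z o\<^sub>L fc X (\<lambda>x. 1 / Z x) = fc X (\<lambda>x. Z x * (1 / Z x))" by (rule fc_mult[OF X(1) cZ, symmetric])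
    also have "\<dots> = fc X (\<lambda>x. 1)" using nz0 by (intro fc_cong[OF X(1)]) simp
    finally have "fc X Z o\<^sub>L fc X (\<lambda>x. 1 / Z x) = id_blinfun" by (simp add: fc_const[OF X(1)])
    then show ?thesis by (metis blinfun_apply_blinfun_compose blinfun_apply_id_blinfun id_apply)
   qed
   then have "R v = fc X (\<lambda>x. x ^ 4) (fc X (\<lambda>x. 1 / Z x) v)" by (simp add: RX)
   then show "R v = fc X h v" unfolding h_def fc_mult[OF X(1) c4(1) cZ(2)] by simp
  qed
  define s where "s = (\<lambda>x. a x + b x)"
  have s: "0 < s x" if "x \<in> {0..1}" for x
  proof -
   have "0 \<le> a x" "0 \<le> b x" using that by (auto simp: a_def b_def)
   then show ?thesis using nz[OF that] by (auto simp: s_def)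
  qed
  have cs: "cont01 (\<lambda>x. 1 / s x)" unfolding s_def
  proof (intro continuous_intros c ballI)
   show "a x + b x \<noteq> 0" if "x \<in> {0..1}" for x using s[OF that] by (simp add: s_def)
  qed
  define k where "k = (\<lambda>x. a x * (1 / s x))"
  have ck: "cont01 k" unfolding k_def by (intro continuous_on_mult c cs)
  have k01: "k x \<in> {0..1}" if "x \<in> {0..1}" for x
  proof -
   have "0 \<le> a x" "0 \<le> b x" using that by (auto simp: a_def b_def)
   then show ?thesis using s[OF that] by (simp add: k_def s_def)
  qed
  have kh: "k (h x) = x" if "x \<in> {0..1}" for x
  proof -
   define z where "z = sqrt (sqrt (Z x))"
   have z: "z > 0" using Zpos[of x] by (simp add: z_def)
   have r: "sqrt (sqrt (t ^ 4)) = t" if "0 \<le> t" for t :: real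
   proof -
    have "t ^ 4 = (t\<^sup>2)\<^sup>2" by simp
    then show ?thesis using that by (simp only: real_sqrt_abs) simp
   qed
   have "a (h x) = x / z" using r[of x] that by (simp add: a_def h_def real_sqrt_mult real_sqrt_divide z_def)
   moreover have "1 - h x = (1 - x) ^ 4 * (1 / Z x)" using Zpos[of x] by (simp add: h_def Z_def field_simps)
   then have "b (h x) = (1 - x) / z" using r[of "1 - x"] that by (simp add: b_def real_sqrt_mult real_sqrt_divide z_def)
   ultimately show ?thesis using z by (simp add: k_def s_def flip: add_divide_distrib)
  qed
  have "fc X (\<lambda>x. x) = fc X (\<lambda>x. k (h x))" by (intro fc_cong[OF X(1)]) (simp add: kh)
  then have "X = fc X (\<lambda>x. k (h x))" by (simp only: fc_ident[OF X(1)])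
  also have "\<dots> = fc (fc X h) k" by (rule fc_compose(2)[OF X(1) ch h01 ck, symmetric])
  also have "\<dots> = fc R k" by (simp only: Rh)
  finally have Xk: "X = fc R k" .
  have "B = op_graph R k (\<lambda>x. 1 - k x)"
  proof -
   have cc: "cont01 (\<lambda>x::real. x)" "cont01 (\<lambda>x::real. 1 - x)" by (intro continuous_intros)+
   have 1: "fc X (\<lambda>x. x) = fc R k" unfolding Xk by (rule fc_compose(2)[OF R(1) ck k01 cc(1)])
   have 2: "fc X (\<lambda>x. 1 - x) = fc R (\<lambda>x. 1 - k x)" unfolding Xk by (rule fc_compose(2)[OF R(1) ck k01 cc(2)])
   show ?thesis unfolding X(2) op_graph_def 1 2 by (rule refl)
  qed
  also have "\<dots> = op_graph R (\<lambda>x. a x * (1 / s x)) (\<lambda>x. b x * (1 / s x))"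
  proof (rule op_graph_cong[OF R(1)])
   fix x :: real assume "x \<in> {0..1}"
   from s[OF this] show "1 - k x = b x * (1 / s x)" by (simp add: k_def s_def field_simps)
  qed (simp add: k_def)
  also have "\<dots> = op_graph R a b" by (rule op_graph_scale[OF R(1) c cs]) (use s in force)
  finally show ?thesis .
 qed
 show ?thesis unfolding positive_root_def a_def[symmetric] b_def[symmetric]
  by (rule the_equality) (intro conjI psa power, elim conjE, rule uniq)
qed

section \<open>The symmetric embedding in terms of bounded operators\<close>

context tomita
begin

lemma R_bounded: "R \<in> bounded_ops"
 by (simp add: bounded_ops_iff R_i)

lemma fc_R_bounded: "cont01 f \<Longrightarrow> fc R f \<in> bounded_ops"
proof -
 assume f: "cont01 f"
 have "R \<in> commutant {}" using R_bounded by (simp add: commutant_iff)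
 from commutant_fc[OF unit_op_R this f] show ?thesis by (simp add: commutant_iff)
qed

lemma graph_antiadjoint_iff: "(\<eta>, \<zeta>) \<in> graph_antiadjoint GS \<longleftrightarrow> R \<zeta> = C \<eta> \<and> C \<zeta> = R \<eta>"
proof -
 have "(\<eta>, \<zeta>) \<in> graph_antiadjoint GS \<longleftrightarrow> (\<forall>\<xi> \<xi>'. (\<xi>, \<xi>') \<in> GS \<longrightarrow> inner (\<zeta>, - \<eta>) (\<xi>, \<xi>') = 0)"
 proof
  assume h: "(\<eta>, \<zeta>) \<in> graph_antiadjoint GS"
  show "\<forall>\<xi> \<xi>'. (\<xi>, \<xi>') \<in> GS \<longrightarrow> inner (\<zeta>, - \<eta>) (\<xi>, \<xi>') = 0"
  proof (intro allI impI)
   fix \<xi> \<xi>' assume "(\<xi>, \<xi>') \<in> GS"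
   then have "cinner \<xi>' \<eta> = cinner \<zeta> \<xi>" using h unfolding graph_antiadjoint_def by blast
   then have "inner \<xi>' \<eta> = inner \<zeta> \<xi>" by (simp add: Re_cinner[symmetric])
   then show "inner (\<zeta>, - \<eta>) (\<xi>, \<xi>') = 0" by (simp add: inner_prod_def inner_commute)
  qed
 next
  assume h: "\<forall>\<xi> \<xi>'. (\<xi>, \<xi>') \<in> GS \<longrightarrow> inner (\<zeta>, - \<eta>) (\<xi>, \<xi>') = 0"
  have "cinner \<xi>' \<eta> = cinner \<zeta> \<xi>" if g: "(\<xi>, \<xi>') \<in> GS" for \<xi> \<xi>'
  proof -
   have 1: "inner \<zeta> \<xi> = inner \<eta> \<xi>'" using h[rule_format, OF g] by (simp add: inner_prod_def)
   have 2: "inner \<zeta> (\<i> *\<^sub>C \<xi>) = - inner \<eta> (\<i> *\<^sub>C \<xi>')" using h[rule_format, OF GS_i[OF g]] by (simp add: inner_prod_def)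
   show ?thesis using 1 2 by (simp add: cinner_eq inner_i_left[of \<zeta>] inner_commute[of _ \<eta>])
  qed
  then show "(\<eta>, \<zeta>) \<in> graph_antiadjoint GS" unfolding graph_antiadjoint_def by blast
 qed
 also have "\<dots> \<longleftrightarrow> proj GS (\<zeta>, - \<eta>) = 0"
 proof
  assume h: "\<forall>\<xi> \<xi>'. (\<xi>, \<xi>') \<in> GS \<longrightarrow> inner (\<zeta>, - \<eta>) (\<xi>, \<xi>') = 0"
  show "proj GS (\<zeta>, - \<eta>) = 0"
  proof (rule P_unique)
   show "0 \<in> GS" by (rule subspace_0[OF subspace_GS])
   show "inner ((\<zeta>, - \<eta>) - 0) s = 0" if "s \<in> GS" for s using h[rule_format, of "fst s" "snd s"] that by simp
  qed
 next
  assume h: "proj GS (\<zeta>, - \<eta>) = 0"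
  show "\<forall>\<xi> \<xi>'. (\<xi>, \<xi>') \<in> GS \<longrightarrow> inner (\<zeta>, - \<eta>) (\<xi>, \<xi>') = 0"
   using P_facts(2)[of _ "(\<zeta>, - \<eta>)", unfolded h diff_zero] by blast
 qed
 also have "\<dots> \<longleftrightarrow> R \<zeta> = C \<eta> \<and> C \<zeta> = R \<eta>" by (simp add: P_apply blinfun.minus_right zero_prod_def)
 finally show ?thesis .
qed

text \<open>The modular operator is (1 - R)/R. The vector between the two factors is
  \<open>C \<theta>\<close>, the image of \<open>R \<theta>\<close> under the Tomita
  operator.\<close>

lemma modular_graph: "GS O graph_antiadjoint GS = {(R \<theta>, \<theta> - R \<theta>) |\<theta>. True}"
proof (rule set_eqI)
 fix p :: "'k \<times> 'k"
 obtain \<xi> \<zeta> where p: "p = (\<xi>, \<zeta>)" by (cases p)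
 have 1: "p \<in> {(R \<theta>, \<theta> - R \<theta>) |\<theta>. True}" if h: "p \<in> GS O graph_antiadjoint GS"
 proof -
  obtain \<eta> where e: "(\<xi>, \<eta>) \<in> GS" "(\<eta>, \<zeta>) \<in> graph_antiadjoint GS" using h p by auto
  have "C \<eta> = \<xi> - R \<xi>" using e(1) by (simp add: GS_iff algebra_simps)
  then have "R (\<zeta> + \<xi>) = \<xi>" using e(2) by (simp add: graph_antiadjoint_iff blinfun.add_right)
  then show ?thesis unfolding p by (intro CollectI exI[of _ "\<zeta> + \<xi>"]) simp
 qed
 have 2: "p \<in> GS O graph_antiadjoint GS" if h: "p \<in> {(R \<theta>, \<theta> - R \<theta>) |\<theta>. True}"
 proof -
  obtain \<theta> where t: "\<xi> = R \<theta>" "\<zeta> = \<theta> - R \<theta>" using h p by auto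
  have "(R \<theta>, C \<theta>) \<in> GS" by (rule R_C_GS)
  moreover have "(C \<theta>, \<theta> - R \<theta>) \<in> graph_antiadjoint GS"
   by (simp add: graph_antiadjoint_iff C_C blinfun.diff_right C_R)
  ultimately show ?thesis unfolding p t by (rule relcompI)
 qed
 show "p \<in> GS O graph_antiadjoint GS \<longleftrightarrow> p \<in> {(R \<theta>, \<theta> - R \<theta>) |\<theta>. True}" using 1 2 by blast
qed

definition half :: "'k \<Rightarrow>\<^sub>L 'k" where "half = fc R sqrt"
definition half' :: "'k \<Rightarrow>\<^sub>L 'k" where "half' = fc R (\<lambda>r. sqrt (1 - r))"

lemma half_cont: "cont01 sqrt" "cont01 (\<lambda>r::real. sqrt (1 - r))"
 by (intro continuous_intros)+

lemma half_half: "half (half v) = R v" and half'_half': "half' (half' v) = v - R v" and half_half': "half (half' v) = Q v"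
 and half'_half: "half' (half v) = Q v"
proof -
 have "fc R (\<lambda>r. sqrt r * sqrt r) = fc R (\<lambda>r. r)" by (intro fc_cong[OF unit_op_R]) auto
 then show "half (half v) = R v" unfolding half_def fc_fc[OF half_cont(1,1)] by (simp add: fc_ident[OF unit_op_R])
 have "fc R (\<lambda>r. sqrt (1 - r) * sqrt (1 - r)) = fc R (\<lambda>r. 1 - r)" by (intro fc_cong[OF unit_op_R]) auto
 then show "half' (half' v) = v - R v" unfolding half'_def fc_fc[OF half_cont(2,2)] by (simp add: fc_compl[OF unit_op_R] blinfun.diff_left)
 show "half (half' v) = Q v" unfolding half_def half'_def fc_fc[OF half_cont] by (simp add: modQ_def real_sqrt_mult)
 show "half' (half v) = Q v" unfolding half_def half'_def fc_fc[OF half_cont(2,1)] by (simp add: modQ_def real_sqrt_mult mult.commute)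
qed

lemma half_sym: "inner (half u) v = inner u (half v)" "inner (half' u) v = inner u (half' v)"
 unfolding half_def half'_def by (rule fc_sym[OF unit_op_R half_cont(1)], rule fc_sym[OF unit_op_R half_cont(2)])

lemma J_half: "J (half v) = half' (J v)" "J (half' v) = half (J v)"
 unfolding half_def half'_def J_fc[OF half_cont(1)] J_fc[OF half_cont(2)] by simp_all

lemma half_i: "half (\<i> *\<^sub>C v) = \<i> *\<^sub>C half v" "half' (\<i> *\<^sub>C v) = \<i> *\<^sub>C half' v"
 using fc_R_bounded[OF half_cont(1)] fc_R_bounded[OF half_cont(2)] by (simp_all add: half_def half'_def bounded_ops_iff)

text \<open>A bounded expression for (1 + \<Delta>)^(1/2) x \<Omega>, in which
  \<open>J (adj x \<Omega>)\<close> stands for \<Delta>^(1/2) x \<Omega>.\<close>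

definition kms_vec :: "('k \<Rightarrow>\<^sub>L 'k) \<Rightarrow> 'k" where
 "kms_vec x = half (x \<Omega>) + half' (J (adj x \<Omega>))"

lemma half_kms_vec: "x \<in> A \<Longrightarrow> half (kms_vec x) = app x \<Omega>"
 using A_vec[of x] by (simp add: kms_vec_def blinfun.add_right half_half half_half' Q_J)

lemma half'_kms_vec: "x \<in> A \<Longrightarrow> half' (kms_vec x) = J (adj x \<Omega>)"
proof -
 assume x: "x \<in> A"
 have "J (R (adj x \<Omega>) + C (x \<Omega>)) = J (adj x \<Omega>)" using A_vec[OF adjA[OF x]] by simp
 then have "J (adj x \<Omega>) = J (adj x \<Omega>) - R (J (adj x \<Omega>)) + Q (x \<Omega>)"
  by (simp add: blinfun.add_right J_R J_Q[symmetric] J_J)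
 then show ?thesis by (simp add: kms_vec_def blinfun.add_right half'_half half'_half')
qed

lemma quarter_cont: "cont01 (\<lambda>r::real. sqrt (sqrt (r * (1 - r))))"
 by (intro continuous_intros)

text \<open>This is \<Delta>^(1/4) x \<Omega>, since the function of \<open>R\<close> is
  \<Delta>^(1/4) (1 + \<Delta>)^(-1/2).\<close>

definition iota :: "('k \<Rightarrow>\<^sub>L 'k) \<Rightarrow> 'k" where
 "iota x = fc R (\<lambda>r. sqrt (sqrt (r * (1 - r)))) (kms_vec x)"

text \<open>The real inner product of the embedded elements, by \<open>inner_iota\<close>, in a form
  that contains no roots of \<Delta>.\<close>

definition kms_form :: "('k \<Rightarrow>\<^sub>L 'k) \<Rightarrow> ('k \<Rightarrow>\<^sub>L 'k) \<Rightarrow> real" where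
 "kms_form x y = inner (x \<Omega>) (J (adj y \<Omega>))"

lemma inner_iota: "x \<in> A \<Longrightarrow> y \<in> A \<Longrightarrow> inner (iota x) (iota y) = kms_form x y"
proof -
 assume x: "x \<in> A" and y: "y \<in> A"
 have "inner (iota x) (iota y) = inner (kms_vec x) (fc R (\<lambda>r. sqrt (sqrt (r * (1 - r))) * sqrt (sqrt (r * (1 - r)))) (kms_vec y))"
  unfolding iota_def fc_sym[OF unit_op_R quarter_cont] fc_fc[OF quarter_cont quarter_cont] ..
 also have "fc R (\<lambda>r. sqrt (sqrt (r * (1 - r))) * sqrt (sqrt (r * (1 - r)))) = Q"
  unfolding modQ_def by (intro fc_cong[OF unit_op_R]) auto
 also have "inner (kms_vec x) (Q (kms_vec y)) = inner (half (kms_vec x)) (half' (kms_vec y))"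
  by (simp add: half_sym half_half')
 finally show ?thesis by (simp add: half_kms_vec[OF x] half'_kms_vec[OF y] kms_form_def)
qed

lemma kms_vec_linear: "kms_vec (x + y) = kms_vec x + kms_vec y" "kms_vec (r *\<^sub>R x) = r *\<^sub>R kms_vec x"
 by (simp_all add: kms_vec_def adj_add adj_scaleR blinfun.bilinear_simps algebra_simps)

lemma iota_add: "iota (x + y) = iota x + iota y" and iota_scaleR: "iota (r *\<^sub>R x) = r *\<^sub>R iota x"
 by (simp_all add: iota_def kms_vec_linear blinfun.bilinear_simps)

lemma iota_diff: "iota (x - y) = iota x - iota y"
 using iota_add[of x "(- 1) *\<^sub>R y"] iota_scaleR[of "- 1" y] by simp

lemma iota_i: "x \<in> A \<Longrightarrow> iota (\<i> *\<^sub>C x) = \<i> *\<^sub>C iota x"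
proof -
 assume x: "x \<in> A"
 have "x \<in> bounded_ops" using x A_sub by blast
 then have "kms_vec (\<i> *\<^sub>C x) = \<i> *\<^sub>C kms_vec x"
  by (simp add: kms_vec_def adj_iC scaleC_blinfun_apply blinfun.minus_left blinfun.minus_right J_i half_i scaleC_add_right scaleC_minus)
 then show ?thesis using fc_R_bounded[OF quarter_cont] by (simp add: iota_def bounded_ops_iff)
qed

lemma iota_scaleC: "x \<in> A \<Longrightarrow> iota (c *\<^sub>C x) = c *\<^sub>C iota x"
 by (subst (1 2) scaleC_eq) (simp add: iota_add iota_scaleR iota_i)

text \<open>The Tomita operator fixes \<Omega>, so \<Delta> \<Omega> = \<Omega>, which for
  \<open>R\<close> means the eigenvalue 1/2.\<close>

lemma R_Omega: "R \<Omega> = (1 / 2) *\<^sub>R \<Omega>" and J_Omega: "J \<Omega> = \<Omega>"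
proof -
 have 1: "C \<Omega> = R \<Omega>" using A'_vec[OF A'_intros(1)] by simp
 have "R \<Omega> + C \<Omega> = \<Omega>" using A_vec[OF A_intros(1)] by simp
 then have "2 *\<^sub>R R \<Omega> = \<Omega>" using 1 by (simp add: scaleR_2)
 then have "(1 / 2) *\<^sub>R (2 *\<^sub>R R \<Omega>) = (1 / 2) *\<^sub>R \<Omega>" by simp
 then show R: "R \<Omega> = (1 / 2) *\<^sub>R \<Omega>" by simp
 have "Q \<Omega> = (1 / 2) *\<^sub>R \<Omega>"
  unfolding modQ_def using fc_eigen[OF unit_op_R R _ sqrt_cont] by (simp add: real_sqrt_divide)
 then have "J ((1 / 2) *\<^sub>R \<Omega>) = (1 / 2) *\<^sub>R \<Omega>" using J_Q[of \<Omega>] 1 R by simp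
 then show "J \<Omega> = \<Omega>" by (simp add: blinfun.scaleR_right)
qed

lemma iota_one: "iota id_blinfun = \<Omega>"
proof -
 have h: "half \<Omega> = sqrt (1 / 2) *\<^sub>R \<Omega>" "half' \<Omega> = sqrt (1 - 1 / 2) *\<^sub>R \<Omega>"
  unfolding half_def half'_def using fc_eigen[OF unit_op_R R_Omega] half_cont by auto
 have q: "fc R (\<lambda>r. sqrt (sqrt (r * (1 - r)))) \<Omega> = sqrt (sqrt (1 / 2 * (1 - 1 / 2))) *\<^sub>R \<Omega>"
  by (rule fc_eigen[OF unit_op_R R_Omega]) (use quarter_cont in auto)
 have "sqrt (1 / 2 * (1 - 1 / 2)) = (1 / 2 :: real)" by (simp add: real_sqrt_divide)
 then have e1: "sqrt (sqrt (1 / 2 * (1 - 1 / 2))) = sqrt (1 / 2)" by (rule arg_cong)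
 have kv: "kms_vec id_blinfun = (2 * sqrt (1 / 2)) *\<^sub>R \<Omega>"
  by (simp add: kms_vec_def J_Omega h flip: scaleR_add_left)
 have e2: "2 * sqrt (1 / 2) * sqrt (1 / 2) = (1 :: real)" by (simp only: mult.assoc real_sqrt_mult_self)
 show ?thesis unfolding iota_def kv blinfun.scaleR_right q e1 scaleR_scaleR e2 by (rule scaleR_one)
qed

lemma inner_Omega_iota: "x \<in> A \<Longrightarrow> inner \<Omega> (iota x) = inner \<Omega> (app x \<Omega>)"
proof -
 assume x: "x \<in> A"
 have "inner \<Omega> (iota x) = kms_form id_blinfun x" using inner_iota[OF A_intros(1) x] by (simp add: iota_one)
 also have "\<dots> = inner (J \<Omega>) (adj x \<Omega>)" by (simp add: kms_form_def J_sym)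
 finally show ?thesis by (simp add: J_Omega inner_commute[of \<Omega> "adj x \<Omega>"] adj)
qed

lemma cinner_Omega_iota: "x \<in> A \<Longrightarrow> cinner \<Omega> (iota x) = cinner \<Omega> (app x \<Omega>)"
 using inner_Omega_iota[of x] inner_Omega_iota[OF A_intros(7)[of x \<i>]]
 by (simp add: cinner_eq inner_i_left iota_i scaleC_blinfun_apply)

lemma iota_subspace: "subspace (iota ` A)"
 by (intro linear_subspace_image linearI subspace_A) (simp_all add: iota_add iota_scaleR)

lemma half_inj: "half v = 0 \<Longrightarrow> v = 0"
 using half_half[of v] R_inj[of v] by (simp add: blinfun.zero_right)

lemma iota_dense: "closure (iota ` A) = UNIV"
proof (rule closure_subspace_UNIV[OF iota_subspace])
 fix v assume v: "\<And>u. u \<in> iota ` A \<Longrightarrow> inner v u = 0"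
 define w where "w = fc R (\<lambda>r. sqrt (sqrt (r * (1 - r)))) v"
 have w: "inner w (kms_vec x) = 0" if "x \<in> A" for x
  using v[of "iota x"] that by (simp add: iota_def w_def fc_sym[OF unit_op_R quarter_cont])
 \<comment> \<open>The pair is orthogonal to the graph; on the other hand, the computation below
   shows that the first coordinate of its projection is \<open>half w\<close> itself.\<close>
 have "proj GS (half w, half (J w)) = 0"
 proof (rule P_unique)
  show "0 \<in> GS" by (rule subspace_0[OF subspace_GS])
  fix s assume "s \<in> GS"
  moreover have "closed {s. inner ((half w, half (J w)) - 0) s = 0}" by (intro closed_Collect_eq continuous_intros)
  ultimately have "s \<in> {s. inner ((half w, half (J w)) - 0) s = 0}"
  proof (rule GS_induct)
   fix x assume x: "x \<in> A"
   have "inner (half w) (x \<Omega>) + inner (half (J w)) (adj x \<Omega>) = inner w (kms_vec x)"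
    by (simp add: kms_vec_def inner_add half_sym J_half[symmetric] J_sym)
   then show "(app x \<Omega>, adj x \<Omega>) \<in> {s. inner ((half w, half (J w)) - 0) s = 0}"
    using w[OF x] by (simp add: inner_prod_def)
  qed
  then show "inner ((half w, half (J w)) - 0) s = 0" by simp
 qed
 then have "R (half w) + C (half (J w)) = 0" by (simp add: P_apply zero_prod_def)
 moreover have "C (half (J w)) = half w - R (half w)"
 proof -
  have "C (half (J w)) = Q (J (half (J w)))" by (simp add: Q_J)
  also have "\<dots> = half (half' (half' w))" by (simp add: J_half J_J half_half')
  also have "\<dots> = half w - half (half (half w))" by (simp add: half'_half' blinfun.diff_right half_half)
  finally show ?thesis by (simp only: half_half[symmetric])
 qed
 ultimately have "half w = 0" by simp
 then have "w = 0" by (rule half_inj)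
 have "Q v = 0"
 proof -
  have "fc R (\<lambda>r. sqrt (sqrt (r * (1 - r))) * sqrt (sqrt (r * (1 - r)))) = Q"
   unfolding modQ_def by (intro fc_cong[OF unit_op_R]) auto
  then have "Q v = fc R (\<lambda>r. sqrt (sqrt (r * (1 - r)))) w"
   unfolding w_def fc_fc[OF quarter_cont quarter_cont] by simp
  then show ?thesis by (simp add: \<open>w = 0\<close> blinfun.zero_right)
 qed
 then show "v = 0" by (rule Q_inj)
qed

lemma root_embedding:
 assumes x: "x \<in> A"
 shows "graph_app (positive_root 4 (GS O graph_antiadjoint GS)) (app x \<Omega>) = iota x"
proof -
 define a :: "real \<Rightarrow> real" where "a = (\<lambda>x. sqrt (sqrt x))"
 define b :: "real \<Rightarrow> real" where "b = (\<lambda>x. sqrt (sqrt (1 - x)))"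
 have c: "cont01 a" "cont01 b" unfolding a_def b_def by (intro continuous_intros)+
 have root: "positive_root 4 (GS O graph_antiadjoint GS) = op_graph R a b"
  unfolding modular_graph a_def b_def by (rule positive_root_op_graph[OF unit_op_R R_bounded R_inj])
 have aa: "fc R a (fc R a v) = half v" for v
 proof -
  have "fc R (\<lambda>x. a x * a x) = half" unfolding half_def a_def by (intro fc_cong[OF unit_op_R]) auto
  then show ?thesis unfolding fc_fc[OF c(1,1)] by simp
 qed
 have x1: "x \<Omega> = fc R a (fc R a (kms_vec x))" unfolding aa by (rule half_kms_vec[OF x, symmetric])
 have x2: "iota x = fc R b (fc R a (kms_vec x))"
  unfolding iota_def fc_fc[OF c(2,1)] by (simp add: a_def b_def real_sqrt_mult mult.commute)
 show ?thesis unfolding graph_app_def root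
 proof (rule the_equality)
  show "(x \<Omega>, iota x) \<in> op_graph R a b" unfolding op_graph_def using x1 x2 by blast
  fix \<eta> assume "(x \<Omega>, \<eta>) \<in> op_graph R a b"
  then obtain \<theta> where t: "x \<Omega> = fc R a \<theta>" "\<eta> = fc R b \<theta>" unfolding op_graph_def by blast
  have "fc R a (\<theta> - fc R a (kms_vec x)) = 0" using t(1) x1 by (simp add: blinfun.diff_right)
  then have "half (\<theta> - fc R a (kms_vec x)) = 0" unfolding aa[symmetric] by (simp add: blinfun.zero_right)
  then show "\<eta> = iota x" using half_inj[of "\<theta> - fc R a (kms_vec x)"] t(2) x2 by simp
 qed
qed

end

section \<open>Transfer to the GNS data\<close>

context gns_rep
begin

lemma tomita_N: "tomita N (commutant N) \<Omega>"
proof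
 show "commutant N = commutant N" by (rule refl)
 show "commutant (commutant N) = N" by (rule bicommutant)
 show "adj x \<in> N" if "x \<in> N" for x by (rule N_adj[OF that])
 show "adj x \<in> commutant N" if "x \<in> commutant N" for x
  by (rule commutant_adj[OF N_adj that])
 show "closure ((\<lambda>x. app x \<Omega>) ` N) = UNIV" using pi_dense by (simp add: image_image)
 show "closure ((\<lambda>c. app c \<Omega>) ` commutant N) = UNIV" by (rule commutant_dense)
qed

sublocale T: tomita N "commutant N" \<Omega>
 by (rule tomita_N)

lemma kms_embedding_eq: "x \<in> M \<Longrightarrow> kms_embedding M \<pi> \<Omega> x = T.iota (\<pi> x)"
proof -
 assume x: "x \<in> M"
 have "{(app (\<pi> x) \<Omega>, app (\<pi> (cadjoint x)) \<Omega>) | x. x \<in> M} = (\<lambda>x. (app x \<Omega>, adj x \<Omega>)) ` N"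
  by (force simp: cadjoint_eq[OF M_bounded] pi_adj)
 then have "tomita_op M \<pi> \<Omega> = tomita_graph N \<Omega>" by (simp add: tomita_op_def tomita_graph_def)
 then show ?thesis using T.root_embedding[of "\<pi> x"] x by (simp add: kms_embedding_def modular_op_def)
qed


end

section \<open>Correcting a map to a contractive one\<close>

lemma norm_le_one_iff: "norm (T :: 'a::real_normed_vector \<Rightarrow>\<^sub>L 'b::real_normed_vector) \<le> 1 \<longleftrightarrow> (\<forall>v. norm (T v) \<le> norm v)"
proof
 assume "norm T \<le> 1"
 then show "\<forall>v. norm (T v) \<le> norm v" using order_trans[OF norm_blinfun mult_right_mono[of "norm T" 1]] by fastforce
next
 assume "\<forall>v. norm (T v) \<le> norm v"
 then show "norm T \<le> 1" by (intro norm_blinfun_bound) auto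
qed

text \<open>The operator is \<open>1 / t\<close> times \<open>adj e o\<^sub>L e\<close> for
  \<open>e = t *\<^sub>R c - id_blinfun\<close>. It bounds \<open>c + adj c\<close> by an expression
  quadratic in \<open>c\<close>.\<close>

lemma pos_square_bound:
 fixes c :: "'a::{real_inner,banach} \<Rightarrow>\<^sub>L 'a"
 assumes t: "0 < t"
 shows "pos (t *\<^sub>R (adj c o\<^sub>L c) + (1 / t) *\<^sub>R id_blinfun - (c + adj c))"
proof -
 have "t *\<^sub>R (adj c o\<^sub>L c) + (1 / t) *\<^sub>R id_blinfun - (c + adj c)
  = (1 / t) *\<^sub>R (adj (t *\<^sub>R c - id_blinfun) o\<^sub>L (t *\<^sub>R c - id_blinfun))"
  using t by (intro blinfun_eqI) (simp add: adj_diff adj_scaleR blinfun.bilinear_simps algebra_simps)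
 also have "pos \<dots>" using t by (intro pos_intros pos_adj_compose) auto
 finally show ?thesis .
qed

context tomita
begin

lemma A_eqI:
 assumes "x \<in> A" "y \<in> A" "app x \<Omega> = app y \<Omega>"
 shows "x = y"
proof (rule blinfun_eqI_dense[OF denseA'])
 fix u assume "u \<in> (\<lambda>x. app x \<Omega>) ` A'"
 then obtain b where "u = app b \<Omega>" "b \<in> A'" by blast
 then show "x u = y u" using assms A_comm by simp
qed

lemma fc_A:
 assumes "X \<in> A" "unit_op X" "cont01 f"
 shows "fc X f \<in> A"
 unfolding comm(2)[symmetric] by (rule commutant_fc[OF assms(2) _ assms(3)]) (use assms(1) comm in simp)

text \<open>Both vectors are functions of \<open>R\<close> at \<open>kms_vec g\<close>: (1 - r)
  sqrt(r) on the left, the fourth root of r(1 - r) on the right, and the former is the smaller one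
  on the unit interval.\<close>

lemma norm_iota_ge:
 assumes g: "g \<in> A" "sa g"
 shows "norm (g \<Omega> - R (g \<Omega>)) \<le> norm (iota g)"
proof -
 define f where "f = (\<lambda>r::real. (1 - r) * sqrt r)"
 have cf: "cont01 f" unfolding f_def by (intro continuous_intros)
 have "g \<Omega> - R (g \<Omega>) = fc R (\<lambda>r. 1 - r) (half (kms_vec g))"
  by (simp add: half_kms_vec[OF g(1)] fc_compl[OF unit_op_R] blinfun.diff_left)
 also have "\<dots> = fc R f (kms_vec g)"
  unfolding half_def f_def by (subst fc_fc) (auto intro!: continuous_intros)
 also have "norm \<dots> \<le> norm (iota g)"
  unfolding iota_def
 proof (rule norm_fc_mono[OF unit_op_R cf quarter_cont])
  fix r :: real assume r: "r \<in> {0..1}"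
  have le: "t \<le> sqrt t" if "0 \<le> t" "t \<le> 1" for t :: real
  proof -
   have "t * t \<le> t * 1" using that by (intro mult_left_mono) auto
   then show ?thesis using that by (intro real_le_rsqrt) (simp add: power2_eq_square)
  qed
  have l1: "1 - r \<le> sqrt (1 - r)" by (rule le) (use r in auto)
  have l2: "sqrt (1 - r) \<le> sqrt (sqrt (1 - r))" by (rule le) (use r in auto)
  have l3: "sqrt r \<le> sqrt (sqrt r)" by (rule le) (use r in auto)
  have "(1 - r) * sqrt r \<le> sqrt (sqrt (1 - r)) * sqrt (sqrt r)"
   by (rule mult_mono[OF order_trans[OF l1 l2] l3]) (use r in auto)
  then show "\<bar>f r\<bar> \<le> \<bar>sqrt (sqrt (r * (1 - r)))\<bar>" using r by (simp add: f_def real_sqrt_mult mult.commute abs_mult)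
 qed
 finally show ?thesis .
qed

text \<open>The vectors \<open>((1 - R) g \<Omega>, R g \<Omega>)\<close> lie in the Tomita graph, so \<open>g\<close> is approximately
 \<open>c + c\<^sup>*\<close> with \<open>c \<Omega>\<close> as small as the symmetric embedding of \<open>g\<close>.\<close>

lemma small_majorant:
 assumes g: "g \<in> A" "sa g" and \<delta>: "norm (iota g) < \<delta>" and \<Omega>: "norm \<Omega> = 1"
 shows "\<exists>y\<in>A. pos y \<and> pos (y - g) \<and> inner \<Omega> (app y \<Omega>) \<le> 8 * \<delta>"
proof -
 define \<epsilon> where "\<epsilon> = \<delta> - norm (iota g)"
 have \<epsilon>: "0 < \<epsilon>" and \<delta>0: "0 < \<delta>" "\<epsilon> \<le> \<delta>" using \<delta> norm_ge_zero[of "iota g"] unfolding \<epsilon>_def by linarith+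
 have gg: "adj g = g" using g(2) by (simp add: sa_adj)
 have Cg: "C (g \<Omega>) = g \<Omega> - R (g \<Omega>)" using A_vec[OF g(1)] by (simp add: gg algebra_simps)
 have "(g \<Omega> - R (g \<Omega>), R (g \<Omega>)) \<in> GS"
  by (simp add: GS_iff blinfun.diff_right C_R Cg)
 then have "\<exists>p\<in>(\<lambda>x. (app x \<Omega>, adj x \<Omega>)) ` A. dist (g \<Omega> - R (g \<Omega>), R (g \<Omega>)) p < \<epsilon>"
  unfolding tomita_graph_def by (rule closure_approachableD) (rule \<epsilon>)
 then obtain c where c: "c \<in> A" "dist (g \<Omega> - R (g \<Omega>), R (g \<Omega>)) (app c \<Omega>, adj c \<Omega>) < \<epsilon>" by (rule bexE) auto
 have d: "norm (g \<Omega> - R (g \<Omega>) - c \<Omega>) \<le> \<epsilon>" "norm (R (g \<Omega>) - adj c \<Omega>) \<le> \<epsilon>"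
  using c(2) dist_fst_le[of "(g \<Omega> - R (g \<Omega>), R (g \<Omega>))" "(app c \<Omega>, adj c \<Omega>)"]
   dist_snd_le[of "(g \<Omega> - R (g \<Omega>), R (g \<Omega>))" "(app c \<Omega>, adj c \<Omega>)"]
  by (simp_all add: dist_norm)
 have nc: "norm (c \<Omega>) \<le> \<delta>"
 proof -
  have "norm (c \<Omega>) \<le> norm (g \<Omega> - R (g \<Omega>)) + norm (g \<Omega> - R (g \<Omega>) - c \<Omega>)"
   using norm_triangle_ineq4[of "g \<Omega> - R (g \<Omega>)" "g \<Omega> - R (g \<Omega>) - c \<Omega>"] by simp
  then show ?thesis using d(1) norm_iota_ge[OF g] unfolding \<epsilon>_def by linarith
 qed
 \<comment> \<open>The remainder is self-adjoint with a small vector \<open>r \<Omega>\<close>;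
   halving it gives it the same shape \<open>e + adj e\<close> as the main part.\<close>
 define r where "r = g - (c + adj c)"
 define e where "e = (1 / 2) *\<^sub>R r"
 have rA: "r \<in> A" unfolding r_def by (intro A_intros adjA g c)
 have eA: "e \<in> A" unfolding e_def by (intro A_intros rA)
 have re: "e + adj e = r"
  by (simp add: e_def r_def adj_scaleR adj_diff adj_add gg add.commute[of "adj c"] flip: scaleR_add_left)
 have "r \<Omega> = (g \<Omega> - R (g \<Omega>) - c \<Omega>) + (R (g \<Omega>) - adj c \<Omega>)" by (simp add: r_def blinfun.bilinear_simps)
 then have "norm (r \<Omega>) \<le> 2 * \<epsilon>" using norm_triangle_ineq[of "g \<Omega> - R (g \<Omega>) - c \<Omega>" "R (g \<Omega>) - adj c \<Omega>"] d by simp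
 then have ne: "norm (e \<Omega>) \<le> \<delta>" using \<delta>0 by (simp add: e_def blinfun.scaleR_left)
 \<comment> \<open>By \<open>pos_square_bound\<close> with \<open>t = 1 / \<delta>\<close>,
   \<open>m x\<close> dominates \<open>x + adj x\<close>. For
   \<open>norm (x \<Omega>) \<le> \<delta>\<close> each of its two terms contributes at most
   \<delta> at \<Omega>.\<close>
 define m where "m x = (1 / \<delta>) *\<^sub>R (adj x o\<^sub>L x) + (1 / (1 / \<delta>)) *\<^sub>R id_blinfun" for x :: "'k \<Rightarrow>\<^sub>L 'k"
 have mA: "m x \<in> A" if "x \<in> A" for x unfolding m_def by (intro A_intros adjA that)
 have mp: "pos (m x)" for x unfolding m_def using \<delta>0 by (intro pos_intros pos_adj_compose) auto
 have mq: "pos (m x - (x + adj x))" for x unfolding m_def using \<delta>0 by (intro pos_square_bound) auto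
 have m\<Omega>: "inner \<Omega> (m x \<Omega>) \<le> 2 * \<delta>" if "norm (app x \<Omega>) \<le> \<delta>" for x
 proof -
  have "inner \<Omega> (adj x (x \<Omega>)) = (norm (x \<Omega>))\<^sup>2" by (simp add: adj' power2_norm_eq_inner)
  then have "inner \<Omega> (m x \<Omega>) = (norm (x \<Omega>))\<^sup>2 / \<delta> + \<delta>"
   using \<Omega> by (simp add: m_def blinfun.bilinear_simps inner_add power2_norm_eq_inner[symmetric])
  also have "(norm (x \<Omega>))\<^sup>2 / \<delta> \<le> \<delta>\<^sup>2 / \<delta>" using that \<delta>0 by (intro divide_right_mono power_mono) auto
  also have "\<delta>\<^sup>2 / \<delta> = \<delta>" using \<delta>0 by (simp add: power2_eq_square)
  finally show ?thesis by simp
 qed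
 define y where "y = m c + m e"
 have "y - g = (m c - (c + adj c)) + (m e - (e + adj e))" unfolding re by (simp add: y_def r_def)
 then have "pos (y - g)" by (simp add: pos_intros mq)
 moreover have "pos y" unfolding y_def by (intro pos_intros mp)
 moreover have "y \<in> A" unfolding y_def by (intro A_intros mA c eA)
 moreover have "inner \<Omega> (y \<Omega>) \<le> 8 * \<delta>"
  using m\<Omega>[OF nc] m\<Omega>[OF ne] \<delta>0 by (simp add: y_def blinfun.add_left inner_add)
 ultimately show ?thesis by blast
qed

lemma C_J: "C (J v) = Q v" and J_C: "J (C v) = Q v"
 by (simp_all add: J_Q[symmetric] J_J Q_J)

text \<open>This is \<open>sakai\<close> at \<mu> = 1 for the element J y J of the commutant.
  Self-adjointness of \<open>Y\<close> holds because \<open>Y \<Omega>\<close> and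
  \<open>adj Y \<Omega>\<close> are both \<open>Q (y \<Omega>)\<close>; positivity, because the
  negative part of \<open>Y\<close>, inserted into the relation, has to vanish.\<close>

lemma half_sakai:
 assumes y: "y \<in> A" "pos y"
 shows "\<exists>Y\<in>A. pos Y \<and> app Y \<Omega> = Q (y \<Omega>) \<and>
  (\<forall>X\<in>A. sa X \<longrightarrow> inner (app X \<Omega>) (J (y \<Omega>)) = 2 * inner (X \<Omega>) (app Y \<Omega>))"
proof -
 define a where "a = J o\<^sub>L y o\<^sub>L J"
 have aA: "a \<in> A'" unfolding a_def by (rule J_A_J[OF y(1)])
 have a\<Omega>: "a \<Omega> = J (y \<Omega>)" by (simp add: a_def J_Omega)
 have apos: "0 \<le> inner v (a v)" for v using y(2) by (simp add: a_def J_sym[symmetric] pos_def)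
 have yy: "adj y = y" using y(2) by (simp add: pos_def sa_adj)
 have res1: "resolv 1 v = v" for v using resolv_inverse[of 1 v] by simp
 obtain Y where Y: "Y \<in> A" "app Y \<Omega> = R (a \<Omega>)" "adj Y \<Omega> = C (a \<Omega>)"
  using sakai[OF aA, of 1] by (auto simp: res1)
 have Y2: "adj Y \<Omega> = Q (y \<Omega>)" by (simp add: Y(3) a\<Omega> C_J)
 have "C (y \<Omega>) = y \<Omega> - R (y \<Omega>)" using A_vec[OF y(1)] by (simp add: yy algebra_simps)
 then have "R (J (y \<Omega>)) = J (C (y \<Omega>))" by (simp add: blinfun.diff_right J_R)
 then have Y1: "Y \<Omega> = Q (y \<Omega>)" by (simp add: Y(2) a\<Omega> J_C)
 have saY: "adj Y = Y" by (rule A_eqI[OF adjA[OF Y(1)] Y(1)]) (simp add: Y1 Y2)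
 have rel: "inner (X \<Omega>) (a \<Omega>) = 2 * inner (X \<Omega>) (Y \<Omega>)" if X: "X \<in> A" "sa X" for X
 proof -
  have "adj X = X" using X(2) by (simp add: sa_adj)
  then have "inner (X \<Omega>) (C (a \<Omega>)) = inner (X \<Omega>) (a \<Omega> - R (a \<Omega>))" using GS_dual[OF GS_base[OF X(1)]] by simp
  then show ?thesis using saY by (simp add: Y(2,3)[symmetric] inner_diff)
 qed
 have "pos Y"
 proof -
  define s where "s = norm Y + 1"
  have s: "0 < s" by (simp add: s_def add_nonneg_pos)
  \<comment> \<open>An affine rescaling takes \<open>Y\<close> to an operator between 0 and 1 and
    the value 0 to 1/2; with \<open>f\<close> below, \<open>fc Z f\<close> is the negative part of
    \<open>Y\<close> divided by \<open>2 * s\<close>.\<close>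
  define Z where "Z = (1 / (2 * s)) *\<^sub>R (Y + s *\<^sub>R id_blinfun)"
  have Ybd: "\<bar>inner v (Y v)\<bar> \<le> s * inner v v" for v
  proof -
   have "\<bar>inner v (Y v)\<bar> \<le> norm v * (norm Y * norm v)"
    by (rule order_trans[OF Cauchy_Schwarz_ineq2 mult_left_mono[OF norm_blinfun]]) simp
   also have "\<dots> \<le> norm v * (s * norm v)" by (intro mult_left_mono mult_right_mono) (auto simp: s_def)
   also have "\<dots> = s * inner v v" by (simp add: power2_norm_eq_inner[symmetric] power2_eq_square)
   finally show ?thesis .
  qed
  have saY': "inner (Y u) v = inner u (Y v)" for u v using adj[of Y u v] saY by simp
  have ZU: "unit_op Z"
   unfolding unit_op_def
  proof (intro conjI allI)
   show "inner (Z u) v = inner u (Z v)" for u v by (simp add: Z_def blinfun.bilinear_simps inner_add saY')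
   show "0 \<le> inner v (Z v)" for v
    using Ybd[of v] s by (simp add: Z_def blinfun.bilinear_simps inner_add abs_le_iff)
   show "inner v (Z v) \<le> inner v v" for v
    using Ybd[of v] s by (simp add: Z_def blinfun.bilinear_simps inner_add abs_le_iff field_simps)
  qed
  have ZA: "Z \<in> A" unfolding Z_def by (intro A_intros Y)
  define f where "f x = max 0 (1 / 2 - x)" for x :: real
  have cf: "cont01 f" "cont01 (\<lambda>x. sqrt (f x))" unfolding f_def by (intro continuous_intros)+
  define X where "X = fc Z f"
  define S where "S = fc Z (\<lambda>x. sqrt (f x))"
  have XA: "X \<in> A" and SA: "S \<in> A" unfolding X_def S_def by (rule fc_A[OF ZA ZU cf(1)], rule fc_A[OF ZA ZU cf(2)])
  have Xsa: "sa X" unfolding X_def by (rule sa_fc[OF ZU cf(1)])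
  have Ssym: "inner (S u) v = inner u (S v)" for u v unfolding S_def by (rule fc_sym[OF ZU cf(2)])
  have SS: "S (S v) = X v" for v
  proof -
   have "fc Z (\<lambda>x. sqrt (f x) * sqrt (f x)) = X" unfolding X_def by (intro fc_cong[OF ZU]) (simp add: f_def)
   then show ?thesis unfolding S_def fc_apply_mult[OF ZU cf(2,2)] by simp
  qed
  \<comment> \<open>Positivity of \<open>a\<close> makes the functional nonnegative at
    \<open>X\<close>, but X Y = - 2 s X X turns the same value into a negative multiple of the
    square norm of \<open>X \<Omega>\<close>.\<close>
  have "0 \<le> inner (S \<Omega>) (a (S \<Omega>))" by (rule apos)
  also have "\<dots> = inner (X \<Omega>) (a \<Omega>)" using A_comm[OF SA aA, of \<Omega>] by (simp add: Ssym SS[symmetric])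
  also have "\<dots> = 2 * inner \<Omega> (X (Y \<Omega>))" using rel[OF XA Xsa] Xsa by (simp add: sa_def)
  also have "X (Y \<Omega>) = - ((2 * s) *\<^sub>R X (X \<Omega>))"
  proof -
   have "Y \<Omega> = (2 * s) *\<^sub>R (Z \<Omega> - (1 / 2) *\<^sub>R \<Omega>)" using s by (simp add: Z_def blinfun.bilinear_simps algebra_simps)
   moreover have "X (Z \<Omega> - (1 / 2) *\<^sub>R \<Omega>) = - X (X \<Omega>)"
   proof -
    have c1: "cont01 (\<lambda>x::real. x - 1 / 2)" by (intro continuous_intros)
    have "Z \<Omega> - (1 / 2) *\<^sub>R \<Omega> = fc Z (\<lambda>x. x - 1 / 2) \<Omega>"
     using fc_diff[OF ZU continuous_on_id continuous_on_const, of "1 / 2"]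
     by (simp add: fc_ident[OF ZU] fc_const[OF ZU] blinfun.bilinear_simps)
    then have "X (Z \<Omega> - (1 / 2) *\<^sub>R \<Omega>) = fc Z (\<lambda>x. f x * (x - 1 / 2)) \<Omega>"
     unfolding X_def by (simp add: fc_apply_mult[OF ZU cf(1) c1])
    also have "fc Z (\<lambda>x. f x * (x - 1 / 2)) = fc Z (\<lambda>x. (- 1) * (f x * f x))"
     by (intro fc_cong[OF ZU]) (auto simp: f_def max_def algebra_simps)
    also have "\<dots> = (- 1) *\<^sub>R fc Z (\<lambda>x. f x * f x)" by (intro fc_cmult[OF ZU] continuous_on_mult cf)
    finally show ?thesis unfolding X_def by (simp add: fc_apply_mult[OF ZU cf(1,1)] blinfun.minus_left)
   qed
   ultimately show ?thesis by (simp add: blinfun.scaleR_right)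
  qed
  also have "2 * inner \<Omega> (- ((2 * s) *\<^sub>R X (X \<Omega>))) = - (4 * s * (norm (X \<Omega>))\<^sup>2)"
   using Xsa by (simp add: sa_def power2_norm_eq_inner)
  finally have "(norm (X \<Omega>))\<^sup>2 \<le> 0" using s by (simp add: mult_le_0_iff)
  then have "X \<Omega> = 0" by simp
  then have X0: "X = 0" using A_eqI[OF XA A_intros(2)] by simp
  have pY: "0 \<le> inner v (Y v)" for v
  proof -
   have "inner v (fc Z (\<lambda>x. 1 / 2 - x) v) \<le> inner v (fc Z f v)"
    by (intro fc_mono[OF ZU] cf continuous_intros) (simp add: f_def)
   also have "\<dots> = 0" using X0 by (simp add: X_def)
   also have "fc Z (\<lambda>x. 1 / 2 - x) = (1 / 2) *\<^sub>R id_blinfun - Z"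
    using fc_diff[OF ZU continuous_on_const continuous_on_id, of "1 / 2"] by (simp add: fc_ident[OF ZU] fc_const[OF ZU])
   finally have "inner v v / 2 \<le> inner v (Z v)" by (simp add: blinfun.bilinear_simps inner_diff)
   also have "\<dots> = inner v (Y v) / (2 * s) + inner v v / 2" using s by (simp add: Z_def blinfun.bilinear_simps inner_add add_divide_distrib)
   finally show ?thesis using s by (simp add: zero_le_divide_iff)
  qed
  show ?thesis unfolding pos_def using pY saY by (simp add: sa_adj)
 qed
 then show ?thesis using Y(1) Y1 rel unfolding a\<Omega> by blast
qed

text \<open>The element \<open>v\<close> is (1 + Y)^(-1), built as a function of the rescaled
  \<open>Y\<close>. The last estimate is (1 - 1/(1 + t))^2 \<le> t for nonnegative t.\<close>

lemma resolvent:
 assumes Y: "Y \<in> A" "pos Y"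
 shows "\<exists>v\<in>A. sa v \<and> norm v \<le> 1 \<and> (\<forall>u. app v (u + Y u) = u) \<and> (\<forall>u. v u + Y (v u) = u) \<and>
  (norm (v \<Omega> - \<Omega>))\<^sup>2 \<le> inner \<Omega> (Y \<Omega>)"
proof -
 define s where "s = norm Y + 1"
 have s: "0 < s" "norm Y \<le> s" by (auto simp: s_def add_nonneg_pos)
 define Z where "Z = (1 / s) *\<^sub>R Y"
 have ZU: "unit_op Z" unfolding Z_def by (rule unit_op_scaled[OF Y(2) s(2) s(1)])
 have ZA: "Z \<in> A" unfolding Z_def by (intro A_intros Y)
 have YZ: "Y u = s *\<^sub>R Z u" for u using s by (simp add: Z_def blinfun.scaleR_left)
 define f where "f x = 1 / (1 + s * x)" for x :: real
 have fpos: "0 < 1 + s * x" if "x \<in> {0..1}" for x using that s by (auto intro!: add_pos_nonneg)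
 have cf: "cont01 f" unfolding f_def
 proof (intro continuous_intros ballI)
  show "1 + s * x \<noteq> 0" if "x \<in> {0..1}" for x using fpos[OF that] by simp
 qed
 define v where "v = fc Z f"
 have vA: "v \<in> A" unfolding v_def by (rule fc_A[OF ZA ZU cf])
 have sav: "sa v" unfolding v_def by (rule sa_fc[OF ZU cf])
 have f1: "\<bar>f x\<bar> \<le> 1" if "x \<in> {0..1}" for x using that s fpos[OF that] by (auto simp: f_def)
 have nv: "norm v \<le> 1" unfolding v_def by (rule fc_bound[OF ZU cf f1])
 have vZ: "v (Z u) = Z (v u)" for u
  unfolding v_def using fc_apply_mult[OF ZU cf continuous_on_id] fc_apply_mult[OF ZU continuous_on_id cf]
  by (simp add: fc_ident[OF ZU] mult.commute)
 have inv: "v u + Y (v u) = u" for u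
 proof -
  have "v u + Y (v u) = (1 *\<^sub>R fc Z f + s *\<^sub>R fc Z (\<lambda>x. x * f x)) u"
   unfolding YZ v_def fc_ident_mult[OF ZU cf] by (simp add: blinfun.bilinear_simps)
  also have "1 *\<^sub>R fc Z f + s *\<^sub>R fc Z (\<lambda>x. x * f x) = fc Z (\<lambda>x. 1 * f x + s * (x * f x))"
   by (intro fc_linear[OF ZU, symmetric] continuous_intros cf)
  also have "\<dots> = fc Z (\<lambda>x. 1)"
  proof (rule fc_cong[OF ZU])
   fix x :: real assume "x \<in> {0..1}"
   have "1 * f x + s * (x * f x) = (1 + s * x) * f x" by (simp add: algebra_simps)
   then show "1 * f x + s * (x * f x) = 1" using fpos[OF \<open>x \<in> {0..1}\<close>] by (simp add: f_def)
  qed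
  finally show ?thesis by (simp add: fc_const[OF ZU])
 qed
 have inv': "v (u + Y u) = u" for u using inv[of u] by (simp add: YZ blinfun.bilinear_simps vZ)
 have "(norm (v \<Omega> - \<Omega>))\<^sup>2 \<le> inner \<Omega> (Y \<Omega>)"
 proof -
  define g where "g x = f x - 1" for x
  have cg: "cont01 g" unfolding g_def by (intro continuous_intros cf)
  have "v \<Omega> - \<Omega> = fc Z g \<Omega>"
   unfolding g_def fc_diff[OF ZU cf continuous_on_const] by (simp add: v_def fc_const[OF ZU] blinfun.bilinear_simps)
  then have "(norm (v \<Omega> - \<Omega>))\<^sup>2 = inner \<Omega> (fc Z (\<lambda>x. g x * g x) \<Omega>)"
   by (simp add: power2_norm_eq_inner fc_sym[OF ZU cg] fc_apply_mult[OF ZU cg cg])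
  also have "\<dots> \<le> inner \<Omega> (fc Z (\<lambda>x. s * x) \<Omega>)"
  proof (rule fc_mono[OF ZU])
   show "cont01 (\<lambda>x. g x * g x)" "cont01 (\<lambda>x. s * x)" by (intro continuous_intros cg)+
   fix x :: real assume x: "x \<in> {0..1}"
   have p: "0 \<le> s * x" using x s by simp
   have gx: "g x = - (s * x / (1 + s * x))" using fpos[OF x] by (simp add: g_def f_def field_simps)
   have "s * x / (1 + s * x) \<le> 1" "s * x / (1 + s * x) \<le> s * x" "0 \<le> s * x / (1 + s * x)"
   proof -
    have "t / (1 + t) \<le> 1 \<and> t / (1 + t) \<le> t \<and> 0 \<le> t / (1 + t)" if "0 \<le> t" for t :: real
     using that by (simp add: divide_le_eq algebra_simps)
    from this[OF p] show "s * x / (1 + s * x) \<le> 1" "s * x / (1 + s * x) \<le> s * x" "0 \<le> s * x / (1 + s * x)" by auto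
   qed
   then have "(s * x / (1 + s * x)) * (s * x / (1 + s * x)) \<le> 1 * (s * x)" by (intro mult_mono) auto
   then show "g x * g x \<le> s * x" unfolding gx by simp
  qed
  also have "fc Z (\<lambda>x. s * x) = s *\<^sub>R Z" using fc_cmult[OF ZU continuous_on_id, of s] by (simp add: fc_ident[OF ZU])
  finally show ?thesis by (simp add: YZ blinfun.scaleR_left)
 qed
 then show ?thesis using vA sav nv inv inv' by blast
qed

lemma Q_Omega: "Q \<Omega> = (1 / 2) *\<^sub>R \<Omega>"
 unfolding modQ_def using fc_eigen[OF unit_op_R R_Omega _ sqrt_cont] by (simp add: real_sqrt_divide)

text \<open>Expand the square norm of x \<Omega> = x v \<Omega> + x v Y \<Omega>. By
  \<open>rel\<close> the cross term is exactly the contribution of J y J, and the remaining square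
  is dropped.\<close>

lemma multiplier_inequality:
 assumes y: "y \<in> A" and Y: "Y \<in> A"
  and rel: "\<And>X. X \<in> A \<Longrightarrow> sa X \<Longrightarrow> inner (app X \<Omega>) (J (y \<Omega>)) = 2 * inner (X \<Omega>) (app Y \<Omega>)"
  and v: "v \<in> A" "sa v" "\<And>u. app v (u + Y u) = u" and x: "x \<in> A"
 shows "(norm (app x (v \<Omega>)))\<^sup>2 + inner (app x (v \<Omega>)) (J (y (J (app x (v \<Omega>))))) \<le> (norm (app x \<Omega>))\<^sup>2"
proof -
 define a where "a = J o\<^sub>L y o\<^sub>L J"
 have aA: "a \<in> A'" unfolding a_def by (rule J_A_J[OF y])
 define X where "X = v o\<^sub>L adj x o\<^sub>L x o\<^sub>L v"
 have XA: "X \<in> A" unfolding X_def by (intro A_intros adjA v x)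
 have vv: "adj v = v" using v(2) by (simp add: sa_adj)
 have vs: "inner (v p) q = inner p (v q)" for p q using v(2) by (simp add: sa_def)
 have X: "sa X" unfolding sa_adj X_def by (simp add: adj_compose vv blinfun_compose_assoc)
 have X1: "inner (X p) q = inner (x (v p)) (x (v q))" for p q by (simp add: X_def vs adj)
 have "inner (x (v \<Omega>)) (a (x (v \<Omega>))) = inner (X \<Omega>) (a \<Omega>)"
  by (simp add: X1 A_comm[OF x aA] A_comm[OF v(1) aA])
 also have "\<dots> = 2 * inner (X \<Omega>) (Y \<Omega>)" using rel[OF XA X] by (simp add: a_def J_Omega)
 also have "\<dots> = 2 * inner (x (v \<Omega>)) (x (v (Y \<Omega>)))" by (simp add: X1)
 finally have 1: "inner (x (v \<Omega>)) (a (x (v \<Omega>))) = 2 * inner (x (v \<Omega>)) (x (v (Y \<Omega>)))" .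
 have "x \<Omega> = x (v \<Omega>) + x (v (Y \<Omega>))" using v(3)[of \<Omega>] by (simp flip: blinfun.add_right)
 then have "(norm (x \<Omega>))\<^sup>2 = (norm (x (v \<Omega>)))\<^sup>2 + 2 * inner (x (v \<Omega>)) (x (v (Y \<Omega>))) + (norm (x (v (Y \<Omega>))))\<^sup>2"
  by (simp add: power2_norm_eq_inner inner_add inner_commute)
 then have "(norm (x (v \<Omega>)))\<^sup>2 + inner (x (v \<Omega>)) (a (x (v \<Omega>))) \<le> (norm (x \<Omega>))\<^sup>2" using 1 by simp
 then show ?thesis by (simp add: a_def)
qed

lemma kms_form_sym: "x \<in> A \<Longrightarrow> y \<in> A \<Longrightarrow> kms_form x y = kms_form y x"
 by (metis inner_iota inner_commute)

text \<open>The power trick for \<open>\<sigma> \<circ> \<tau>\<close>, which is symmetric for the form of the symmetric embedding.\<close>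

lemma kms_contraction:
 assumes \<tau>: "\<And>x. x \<in> A \<Longrightarrow> \<tau> x \<in> A" "\<And>x. x \<in> A \<Longrightarrow> norm (\<tau> x) \<le> norm x"
  and \<sigma>: "\<And>x. x \<in> A \<Longrightarrow> \<sigma> x \<in> A" "\<And>x. x \<in> A \<Longrightarrow> norm (\<sigma> x) \<le> norm x"
  and dual: "\<And>x y. x \<in> A \<Longrightarrow> y \<in> A \<Longrightarrow> kms_form (\<tau> x) y = kms_form x (\<sigma> y)" and x: "x \<in> A"
 shows "norm (iota (\<tau> x)) \<le> norm (iota x)"
proof -
 define D where "D y = \<sigma> (\<tau> y)" for y
 have DA: "(D ^^ m) y \<in> A" if "y \<in> A" for m y by (induction m) (auto simp: that D_def \<tau> \<sigma>)
 have Dn: "norm ((D ^^ m) y) \<le> norm y" if y: "y \<in> A" for m y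
 proof (induction m)
  case (Suc m)
  have "norm (D z) \<le> norm z" if "z \<in> A" for z
   unfolding D_def by (rule order_trans[OF \<sigma>(2)[OF \<tau>(1)[OF that]] \<tau>(2)[OF that]])
  from this[OF DA[OF y]] have "norm (D ((D ^^ m) y)) \<le> norm ((D ^^ m) y)" .
  then show ?case using Suc by simp
 qed simp
 have D1: "kms_form y (D z) = kms_form (\<tau> y) (\<tau> z)" if "y \<in> A" "z \<in> A" for y z
  using dual[OF that(1) \<tau>(1)[OF that(2)]] by (simp add: D_def)
 have Dsym: "kms_form (D y) z = kms_form y (D z)" if "y \<in> A" "z \<in> A" for y z
  using D1[OF that] D1[OF that(2,1)] kms_form_sym[OF \<tau>(1)[OF that(1)] \<tau>(1)[OF that(2)]]
   kms_form_sym[of "D y" z] DA[OF that(1), of 1] that by simp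
 have Dm: "kms_form ((D ^^ m) y) z = kms_form y ((D ^^ m) z)" if "y \<in> A" "z \<in> A" for y z m
  using that
 proof (induction m arbitrary: z)
  case (Suc m)
  have "kms_form ((D ^^ Suc m) y) z = kms_form ((D ^^ m) y) (D z)" using Dsym[OF DA Suc.prems(2)] Suc.prems by simp
  also have "\<dots> = kms_form y ((D ^^ m) (D z))" using Suc.IH[OF Suc.prems(1), of "D z"] DA[OF Suc.prems(2), of 1] by simp
  finally show ?case by (simp add: funpow_swap1)
 qed simp
 define a where "a m = kms_form x ((D ^^ m) x)" for m
 have a0: "a 0 = (norm (iota x))\<^sup>2" using inner_iota[OF x x] by (simp add: a_def power2_norm_eq_inner)
 have "a 1 \<le> 1 * a 0"
 proof (rule power_trick)
  show "a 0 \<ge> 0" using a0 by simp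
  show "(0::real) \<le> 1" by simp
  show "0 \<le> norm (x \<Omega>) * (norm x * norm \<Omega>)" by simp
  show "(a m)\<^sup>2 \<le> a 0 * a (2 * m)" for m
  proof -
   have e: "(D ^^ (2 * m)) x = (D ^^ m) ((D ^^ m) x)" by (simp add: mult_2 funpow_add)
   have "a (2 * m) = inner (iota ((D ^^ m) x)) (iota ((D ^^ m) x))"
    unfolding a_def e using Dm[OF x DA[OF x], of m m] inner_iota[OF DA[OF x] DA[OF x], of m m] by simp
   moreover have "a m = inner (iota x) (iota ((D ^^ m) x))" using inner_iota[OF x DA[OF x]] by (simp add: a_def)
   ultimately show ?thesis using Cauchy_Schwarz_ineq[of "iota x" "iota ((D ^^ m) x)"] by (simp add: a0 power2_norm_eq_inner)
  qed
  \<comment> \<open>Contractivity in operator norm gives growth rate 1, although no bound for the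
    embedded vectors is known at this point.\<close>
  show "a m \<le> norm (x \<Omega>) * (norm x * norm \<Omega>) * 1 ^ m" for m
  proof -
   have "a m \<le> norm (x \<Omega>) * norm (J (adj ((D ^^ m) x) \<Omega>))" unfolding a_def kms_form_def by (rule norm_cauchy_schwarz)
   also have "norm (J (adj ((D ^^ m) x) \<Omega>)) \<le> norm (adj ((D ^^ m) x)) * norm \<Omega>" unfolding norm_J by (rule norm_blinfun)
   also have "\<dots> \<le> norm x * norm \<Omega>" using Dn[OF x] by (intro mult_right_mono) auto
   finally show ?thesis by (simp add: mult_left_mono)
  qed
 qed
 moreover have "a 1 = (norm (iota (\<tau> x)))\<^sup>2"
  using D1[OF x x] inner_iota[OF \<tau>(1)[OF x] \<tau>(1)[OF x]] by (simp add: a_def power2_norm_eq_inner)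
 ultimately have "(norm (iota (\<tau> x)))\<^sup>2 \<le> (norm (iota x))\<^sup>2" using a0 by simp
 then show ?thesis by (rule power2_le_imp_le) simp
qed

lemma norm_conj_le:
 fixes u v x :: "'k \<Rightarrow>\<^sub>L 'k"
 assumes "norm u \<le> 1" "norm v \<le> 1"
 shows "norm (u o\<^sub>L x o\<^sub>L v) \<le> norm x"
proof -
 have "norm (u o\<^sub>L x o\<^sub>L v) \<le> norm (u o\<^sub>L x) * norm v" by (rule norm_blinfun_compose)
 also have "\<dots> \<le> (norm u * norm x) * norm v" by (intro mult_right_mono norm_blinfun_compose) simp
 also have "\<dots> \<le> (1 * norm x) * 1" using assms by (intro mult_mono) auto
 finally show ?thesis by simp
qed

text \<open>Two contractions take the value \<open>v \<Omega>\<close> at \<Omega>: \<open>v\<close>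
  in \<open>A\<close> and \<open>V\<close> in \<open>A'\<close>. With w = J (\<open>adj V\<close>)
  J, the vector \<open>adj w \<Omega>\<close> equals J v \<Omega>, which is also the value of J v J
  in \<open>A'\<close>. The bound by 1 comes from \<open>V\<close>, the estimate of
  \<open>z (adj w \<Omega>)\<close> from J v J, and contractivity on the embedding from the duality
  of the compressions by \<open>w\<close> and by \<open>v\<close>.\<close>

lemma contractive_multiplier:
 assumes g: "g \<in> A" "sa g" and \<delta>: "norm (iota g) < \<delta>" and \<Omega>: "norm \<Omega> = 1"
 shows "\<exists>w\<in>A. norm w \<le> 1 \<and> pos (id_blinfun - (w o\<^sub>L (id_blinfun + g) o\<^sub>L adj w)) \<and>
  (\<forall>z\<in>A. norm (app z (adj w \<Omega>)) \<le> norm (app z \<Omega>)) \<and>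
  (\<forall>x\<in>A. norm (iota (w o\<^sub>L x o\<^sub>L adj w)) \<le> norm (iota x)) \<and> (norm (adj w \<Omega> - \<Omega>))\<^sup>2 \<le> 4 * \<delta>"
proof -
 interpret s: tomita A' A \<Omega> by (rule tomita_swap)
 obtain y where y: "y \<in> A" "pos y" "pos (y - g)" "inner \<Omega> (app y \<Omega>) \<le> 8 * \<delta>"
  using small_majorant[OF g \<delta> \<Omega>] by blast
 obtain Y where Y: "Y \<in> A" "pos Y" "app Y \<Omega> = Q (y \<Omega>)"
  and rel: "\<And>X. X \<in> A \<Longrightarrow> sa X \<Longrightarrow> inner (app X \<Omega>) (J (y \<Omega>)) = 2 * inner (X \<Omega>) (app Y \<Omega>)"
  using half_sakai[OF y(1,2)] by blast
 obtain v where v: "v \<in> A" "sa v" "norm v \<le> 1" "\<And>u. v (u + Y u) = u" "(norm (v \<Omega> - \<Omega>))\<^sup>2 \<le> inner \<Omega> (Y \<Omega>)"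
  using resolvent[OF Y(1,2)] by blast
 have vs: "inner (v p) q = inner p (v q)" for p q using v(2) by (simp add: sa_def)
 have vv: "adj v = v" using v(2) by (simp add: sa_adj)
 have apos: "0 \<le> inner u (J (y (J u)))" for u using y(2) by (simp add: J_sym[symmetric] pos_def)
 have ineq: "(norm (app x (v \<Omega>)))\<^sup>2 + inner (app x (v \<Omega>)) (J (y (J (app x (v \<Omega>))))) \<le> (norm (app x \<Omega>))\<^sup>2" if "x \<in> A" for x
  by (rule multiplier_inequality[OF y(1) Y(1) rel v(1,2,4) that])
 have bd: "norm (app b (v \<Omega>)) \<le> 1 * norm (app b \<Omega>)" if "b \<in> A" for b
 proof -
  have "(norm (b (v \<Omega>)))\<^sup>2 \<le> (norm (b \<Omega>))\<^sup>2" using ineq[OF that] apos[of "b (v \<Omega>)"] by linarith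
  from power2_le_imp_le[OF this norm_ge_zero] show ?thesis by simp
 qed
 \<comment> \<open>The bound \<open>bd\<close> says that \<open>v \<Omega>\<close> is a bounded
   vector with the roles of \<open>A\<close> and \<open>A'\<close> exchanged.\<close>
 obtain V where V: "V \<in> A'" "app V \<Omega> = v \<Omega>" "norm V \<le> 1" using s.left_bounded[of "v \<Omega>" 1, OF bd] by auto
 have Vx: "V (x \<Omega>) = x (v \<Omega>)" if "x \<in> A" for x using A_comm[OF that V(1), of \<Omega>] V(2) by simp
 define w where "w = J o\<^sub>L adj V o\<^sub>L J"
 have wA: "w \<in> A" unfolding w_def by (intro J_A'_J adjA' V)
 have w': "adj w u = J (V (J u))" for u by (simp add: w_def adj_compose adj_J)
 have w'\<Omega>: "adj w \<Omega> = J (v \<Omega>)" by (simp add: w' J_Omega V(2))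
 have nw: "norm w \<le> 1"
  unfolding norm_le_one_iff
 proof
  fix u
  have "norm (w u) = norm (adj V (J u))" by (simp add: w_def norm_J)
  also have "\<dots> \<le> norm (J u)" using V(3) norm_le_one_iff[of "adj V"] by simp
  finally show "norm (w u) \<le> norm u" by (simp add: norm_J)
 qed
 \<comment> \<open>On the orbit of \<open>A\<close> this is \<open>multiplier_inequality\<close>. By
   density, \<open>adj V\<close> (1 + J y J) \<open>V\<close> is at most 1, and conjugation by
   \<open>J\<close> turns this into the statement on \<open>w\<close>.\<close>
 have Vineq: "inner (V t) (V t) + inner (V t) (J (y (J (V t)))) \<le> inner t t" for t
 proof -
  have cl: "closed {t. inner (V t) (V t) + inner (V t) (J (y (J (V t)))) \<le> inner t t}"
   by (intro closed_Collect_le continuous_intros)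
  have "(\<lambda>x. app x \<Omega>) ` A \<subseteq> {t. inner (V t) (V t) + inner (V t) (J (y (J (V t)))) \<le> inner t t}"
   using ineq by (auto simp: Vx power2_norm_eq_inner)
  from closure_minimal[OF this cl] show ?thesis unfolding denseA by auto
 qed
 have P2: "pos (id_blinfun - (w o\<^sub>L (id_blinfun + g) o\<^sub>L adj w))"
  unfolding pos_def
 proof (intro conjI allI)
  have "adj g = g" using g(2) by (simp add: sa_adj)
  then show "sa (id_blinfun - (w o\<^sub>L (id_blinfun + g) o\<^sub>L adj w))"
   by (simp add: sa_adj adj_diff adj_compose adj_add blinfun_compose_assoc)
  fix u
  define t where "t = J u"
  have "inner u (w (adj w u + g (adj w u))) = inner (adj w u) (adj w u) + inner (adj w u) (g (adj w u))"
   unfolding adj[of w u, symmetric] by (rule inner_add_right)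
  also have "inner (adj w u) (g (adj w u)) \<le> inner (adj w u) (y (adj w u))"
   using y(3) by (simp add: pos_def blinfun.diff_left inner_diff)
  also have "inner (adj w u) (adj w u) + inner (adj w u) (y (adj w u)) = inner (V t) (V t) + inner (V t) (J (y (J (V t))))"
   by (simp add: w' t_def J_sym J_J)
  also have "\<dots> \<le> inner t t" by (rule Vineq)
  also have "\<dots> = inner u u" by (simp add: t_def inner_J_J)
  finally show "0 \<le> inner u ((id_blinfun - (w o\<^sub>L (id_blinfun + g) o\<^sub>L adj w)) u)"
   by (simp add: blinfun.bilinear_simps inner_diff)
 qed
 have P3: "norm (app z (adj w \<Omega>)) \<le> norm (app z \<Omega>)" if z: "z \<in> A" for z
 proof -
  define b where "b = J o\<^sub>L z o\<^sub>L J"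
  have bA: "b \<in> A'" unfolding b_def by (rule J_A_J[OF z])
  have "norm (z (adj w \<Omega>)) = norm (b (v \<Omega>))" by (simp add: w'\<Omega> b_def norm_J)
  also have "b (v \<Omega>) = v (b \<Omega>)" using A_comm[OF v(1) bA] by simp
  also have "norm (v (b \<Omega>)) \<le> norm (b \<Omega>)" using v(3) norm_le_one_iff by blast
  finally show ?thesis by (simp add: b_def J_Omega norm_J)
 qed
 have P4: "norm (iota (w o\<^sub>L x o\<^sub>L adj w)) \<le> norm (iota x)" if x: "x \<in> A" for x
 proof (rule kms_contraction[where \<sigma> = "\<lambda>x. v o\<^sub>L x o\<^sub>L v"])
  show "w o\<^sub>L z o\<^sub>L adj w \<in> A" "v o\<^sub>L z o\<^sub>L v \<in> A" if "z \<in> A" for z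
   by (intro A_intros wA adjA v that)+
  show "norm (w o\<^sub>L z o\<^sub>L adj w) \<le> norm z" "norm (v o\<^sub>L z o\<^sub>L v) \<le> norm z" for z
   using nw v(3) by (auto intro!: norm_conj_le)
  show "kms_form (w o\<^sub>L z o\<^sub>L adj w) u = kms_form z (v o\<^sub>L u o\<^sub>L v)" if z: "z \<in> A" and u: "u \<in> A" for z u
  proof -
   define v' where "v' = J o\<^sub>L v o\<^sub>L J"
   have v'A: "v' \<in> A'" unfolding v'_def by (rule J_A_J[OF v(1)])
   have v'\<Omega>: "adj w \<Omega> = v' \<Omega>" by (simp add: w'\<Omega> v'_def J_Omega)
   have v's: "inner (v' p) q = inner p (v' q)" for p q by (simp add: v'_def J_sym vs)
   have "kms_form (w o\<^sub>L z o\<^sub>L adj w) u = inner (z (adj w \<Omega>)) (adj w (J (adj u \<Omega>)))"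
    by (simp add: kms_form_def adj'[of w])
   also have "adj w (J (adj u \<Omega>)) = J (adj u (v \<Omega>))" by (simp add: w' J_J Vx[OF adjA[OF u]])
   also have "z (adj w \<Omega>) = v' (z \<Omega>)" unfolding v'\<Omega> by (rule A_comm[OF z v'A])
   also have "inner (v' (z \<Omega>)) (J (adj u (v \<Omega>))) = inner (z \<Omega>) (J (v (adj u (v \<Omega>))))"
    unfolding v's by (simp add: v'_def J_J)
   finally show ?thesis by (simp add: kms_form_def adj_compose vv)
  qed
 qed (rule x)
 have "(norm (adj w \<Omega> - \<Omega>))\<^sup>2 = (norm (v \<Omega> - \<Omega>))\<^sup>2"
 proof -
  have "adj w \<Omega> - \<Omega> = J (v \<Omega> - \<Omega>)" by (simp add: w'\<Omega> blinfun.diff_right J_Omega)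
  then show ?thesis by (simp add: norm_J)
 qed
 also have "\<dots> \<le> inner \<Omega> (Q (y \<Omega>))" using v(5) by (simp add: Y(3))
 also have "\<dots> = inner \<Omega> (y \<Omega>) / 2" by (simp add: Q_sym[symmetric] Q_Omega)
 also have "\<dots> \<le> 4 * \<delta>" using y(4) by simp
 finally show ?thesis using wA nw P2 P3 P4 by blast
qed

end

section \<open>Limits and implementations of multipliers\<close>

context tomita
begin

lemma norm_iota_le: "z \<in> A \<Longrightarrow> (norm (iota z))\<^sup>2 \<le> norm (app z \<Omega>) * norm (adj z \<Omega>)"
 using norm_cauchy_schwarz[of "z \<Omega>" "J (adj z \<Omega>)"] inner_iota[of z z]
 by (simp add: power2_norm_eq_inner kms_form_def norm_J)

text \<open>Convergence of \<open>adj (w n)\<close> at \<Omega> spreads to all vectors because these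
  operators commute with \<open>A'\<close>; contractivity then gives strong convergence of
  \<open>w n\<close> as well. So the differences \<open>z n\<close> and their adjoints tend to 0 at
  \<Omega>, which controls the embedding by \<open>norm_iota_le\<close>.\<close>

lemma multiplier_limit:
 assumes w: "\<And>n. w n \<in> A" "\<And>n. norm (w n) \<le> 1" and lim: "(\<lambda>n. adj (w n) \<Omega>) \<longlonglongrightarrow> \<Omega>" and x: "x \<in> A"
 shows "(\<lambda>n. iota (w n o\<^sub>L x o\<^sub>L adj (w n))) \<longlonglongrightarrow> iota x"
proof -
 have ws: "(\<lambda>n. adj (w n) \<xi>) \<longlonglongrightarrow> \<xi>" for \<xi>
 proof -
  have "(\<lambda>n. adj (w n) \<xi>) \<longlonglongrightarrow> id_blinfun \<xi>"
  proof (rule tendsto_dense[OF denseA', where c = 1])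
   show "norm (adj (w n)) \<le> 1" for n using w(2) by simp
   fix u assume "u \<in> (\<lambda>x. app x \<Omega>) ` A'"
   then obtain b where b: "u = app b \<Omega>" "b \<in> A'" by blast
   have "(\<lambda>n. b (adj (w n) \<Omega>)) \<longlonglongrightarrow> b \<Omega>" by (intro tendsto_intros lim)
   then show "(\<lambda>n. adj (w n) u) \<longlonglongrightarrow> id_blinfun u" using A_comm[OF adjA[OF w(1)] b(2)] b(1) by simp
  qed
  then show ?thesis by simp
 qed
 have wl: "(\<lambda>n. w n \<xi>) \<longlonglongrightarrow> \<xi>" for \<xi>
 proof -
  have "(\<lambda>n. w n \<xi> - \<xi>) \<longlonglongrightarrow> 0"
  proof (rule tendsto_norm_zero_cancel, rule Lim_null_comparison)
   have "(norm (w n \<xi> - \<xi>))\<^sup>2 \<le> 2 * (inner \<xi> \<xi> - inner \<xi> (adj (w n) \<xi>))" for n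
   proof -
    have "norm (w n \<xi>) \<le> norm \<xi>" using w(2) norm_le_one_iff by blast
    then have "inner (w n \<xi>) (w n \<xi>) \<le> inner \<xi> \<xi>" by (simp add: norm_le)
    moreover have "inner (w n \<xi>) \<xi> = inner \<xi> (adj (w n) \<xi>)" by (rule adj')
    ultimately show ?thesis by (simp add: power2_norm_eq_inner inner_diff inner_commute[of \<xi> "w n \<xi>"])
   qed
   then have "norm (w n \<xi> - \<xi>) \<le> sqrt (2 * (inner \<xi> \<xi> - inner \<xi> (adj (w n) \<xi>)))" for n by (rule real_le_rsqrt)
   then show "eventually (\<lambda>n. norm (norm (w n \<xi> - \<xi>)) \<le> sqrt (2 * (inner \<xi> \<xi> - inner \<xi> (adj (w n) \<xi>)))) sequentially" by simp
   have "(\<lambda>n. sqrt (2 * (inner \<xi> \<xi> - inner \<xi> (adj (w n) \<xi>)))) \<longlonglongrightarrow> sqrt (2 * (inner \<xi> \<xi> - inner \<xi> \<xi>))" by (intro tendsto_intros ws)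
   then show "(\<lambda>n. sqrt (2 * (inner \<xi> \<xi> - inner \<xi> (adj (w n) \<xi>)))) \<longlonglongrightarrow> 0" by simp
  qed
  then show ?thesis by (simp add: LIM_zero_iff)
 qed
 have vec: "(\<lambda>n. w n (z (adj (w n) \<Omega>)) - z \<Omega>) \<longlonglongrightarrow> 0" for z :: "'k \<Rightarrow>\<^sub>L 'k"
 proof -
  have "(\<lambda>n. norm (z (adj (w n) \<Omega>) - z \<Omega>) + norm (w n (z \<Omega>) - z \<Omega>)) \<longlonglongrightarrow> norm (z \<Omega> - z \<Omega>) + norm (z \<Omega> - z \<Omega>)"
   by (intro tendsto_intros ws wl)
  then have l: "(\<lambda>n. norm (z (adj (w n) \<Omega>) - z \<Omega>) + norm (w n (z \<Omega>) - z \<Omega>)) \<longlonglongrightarrow> 0" by simp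
  have b: "norm (w n (z (adj (w n) \<Omega>)) - z \<Omega>) \<le> norm (z (adj (w n) \<Omega>) - z \<Omega>) + norm (w n (z \<Omega>) - z \<Omega>)" for n
  proof -
   have "w n (z (adj (w n) \<Omega>)) - z \<Omega> = w n (z (adj (w n) \<Omega>) - z \<Omega>) + (w n (z \<Omega>) - z \<Omega>)" by (simp add: blinfun.diff_right)
   also have "norm \<dots> \<le> norm (w n (z (adj (w n) \<Omega>) - z \<Omega>)) + norm (w n (z \<Omega>) - z \<Omega>)" by (rule norm_triangle_ineq)
   also have "norm (w n (z (adj (w n) \<Omega>) - z \<Omega>)) \<le> norm (z (adj (w n) \<Omega>) - z \<Omega>)" using w(2) norm_le_one_iff by blast
   finally show ?thesis by simp
  qed
  show ?thesis by (rule Lim_null_comparison[OF always_eventually[OF allI[OF b]] l])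
 qed
 define z where "z n = (w n o\<^sub>L x o\<^sub>L adj (w n)) - x" for n
 have zA: "z n \<in> A" for n unfolding z_def by (intro A_intros w adjA x)
 have z1: "(\<lambda>n. z n \<Omega>) \<longlonglongrightarrow> 0" using vec[of x] by (simp add: z_def blinfun.diff_left)
 have z2: "(\<lambda>n. adj (z n) \<Omega>) \<longlonglongrightarrow> 0" using vec[of "adj x"] by (simp add: z_def blinfun.diff_left adj_diff adj_compose)
 have "(\<lambda>n. norm (z n \<Omega>) * norm (adj (z n) \<Omega>)) \<longlonglongrightarrow> norm (0::'k) * norm (0::'k)" by (intro tendsto_intros z1 z2)
 then have "(\<lambda>n. (norm (iota (z n)))\<^sup>2) \<longlonglongrightarrow> 0"
  by (intro Lim_null_comparison[of "\<lambda>n. (norm (iota (z n)))\<^sup>2" "\<lambda>n. norm (z n \<Omega>) * norm (adj (z n) \<Omega>)"] always_eventually allI)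
   (simp_all add: norm_iota_le[OF zA])
 from tendsto_real_sqrt[OF this] have "(\<lambda>n. norm (iota (z n))) \<longlonglongrightarrow> 0" by simp
 then have "(\<lambda>n. iota (z n)) \<longlonglongrightarrow> 0" by (rule tendsto_norm_zero_cancel)
 then show ?thesis by (simp add: z_def iota_diff LIM_zero_iff)
qed

lemma ex_kms_multiplier:
 assumes w: "w \<in> A" "\<And>x. x \<in> A \<Longrightarrow> norm (iota (w o\<^sub>L x o\<^sub>L adj w)) \<le> norm (iota x)"
 shows "\<exists>S\<in>bounded_ops. norm S \<le> 1 \<and> (\<forall>x\<in>A. app S (iota x) = iota (w o\<^sub>L x o\<^sub>L adj w))"
proof -
 define \<tau> where "\<tau> x = w o\<^sub>L x o\<^sub>L adj w" for x
 have \<tau>A: "\<tau> x \<in> A" if "x \<in> A" for x unfolding \<tau>_def by (intro A_intros w adjA that)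
 have \<tau>_add: "\<tau> (x + y) = \<tau> x + \<tau> y" and \<tau>_scale: "\<tau> (r *\<^sub>R x) = r *\<^sub>R \<tau> x" for x y r
  by (auto intro!: blinfun_eqI simp: \<tau>_def blinfun.bilinear_simps)
 have \<tau>_i: "\<tau> (\<i> *\<^sub>C x) = \<i> *\<^sub>C \<tau> x" for x
  by (intro blinfun_eqI) (simp add: \<tau>_def scaleC_blinfun_apply A_i[OF w(1)])
 define G where "G = (\<lambda>x. (iota x, iota (\<tau> x))) ` A"
 have sub: "subspace G" unfolding G_def
  by (intro linear_subspace_image linearI subspace_A) (simp_all add: iota_scaleR \<tau>_scale iota_add \<tau>_add)
 have bd: "norm v \<le> 1 * norm u" if "(u, v) \<in> G" for u v using that w(2) by (auto simp: G_def \<tau>_def)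
 have dense: "closure (fst ` G) = UNIV" using iota_dense by (simp add: G_def image_image)
 have "\<exists>S :: 'k \<Rightarrow>\<^sub>L 'k. (\<forall>u v. (u, v) \<in> G \<longrightarrow> app S u = v) \<and> norm S \<le> 1"
 proof (rule extend_graph[OF sub bd dense])
  fix T :: "'k \<Rightarrow>\<^sub>L 'k" assume T: "\<And>x y. (x, y) \<in> G \<Longrightarrow> T x = y" "\<And>x. norm (T x) \<le> 1 * norm x"
  then have "norm T \<le> 1" using norm_le_one_iff by auto
  then show ?thesis using T(1) by blast
 qed
 then obtain S :: "'k \<Rightarrow>\<^sub>L 'k" where S: "\<And>u v. (u, v) \<in> G \<Longrightarrow> app S u = v" "norm S \<le> 1" by blast
 have S\<iota>: "S (iota x) = iota (\<tau> x)" if "x \<in> A" for x using S(1)[of "iota x" "iota (\<tau> x)"] that unfolding G_def by blast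
 have "S (\<i> *\<^sub>C \<xi>) = \<i> *\<^sub>C S \<xi>" for \<xi>
 proof -
  have cl: "closed {\<xi>. S (\<i> *\<^sub>C \<xi>) = \<i> *\<^sub>C S \<xi>}" by (intro closed_Collect_eq continuous_intros continuous_on_iC)
  have "S (\<i> *\<^sub>C iota x) = \<i> *\<^sub>C S (iota x)" if "x \<in> A" for x
   using S\<iota>[OF A_intros(7)[OF that, of \<i>]] by (simp add: iota_i[OF that] \<tau>_i iota_i[OF \<tau>A[OF that]] S\<iota>[OF that])
  then have "iota ` A \<subseteq> {\<xi>. S (\<i> *\<^sub>C \<xi>) = \<i> *\<^sub>C S \<xi>}" by blast
  from closure_minimal[OF this cl] show ?thesis unfolding iota_dense by blast
 qed
 then have "S \<in> bounded_ops" by (simp add: bounded_ops_iff)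
 then show ?thesis using S(2) S\<iota> unfolding \<tau>_def by blast
qed

end

section \<open>Compact operators, positive matrices and normal maps\<close>

lemma compact_opI:
 assumes "compact K" "app T ` cball 0 1 \<subseteq> K"
 shows "compact_op T"
proof -
 have "closure (app T ` cball 0 1) \<subseteq> K" using assms by (intro closure_minimal compact_imp_closed)
 then have "closure (app T ` cball 0 1) = K \<inter> closure (app T ` cball 0 1)" by blast
 then show ?thesis unfolding compact_op_def using compact_Int_closed[OF assms(1), of "closure (app T ` cball 0 1)"] by simp
qed

lemma compact_op_compose:
 fixes S T :: "'a::complex_inner \<Rightarrow>\<^sub>L 'a"
 assumes "compact_op T"
 shows "compact_op (S o\<^sub>L T)"
proof (rule compact_opI)
 show "compact (app S ` closure (app T ` cball 0 1))"
  using assms unfolding compact_op_def by (intro compact_continuous_image continuous_intros)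
 show "app (S o\<^sub>L T) ` cball 0 1 \<subseteq> app S ` closure (app T ` cball 0 1)"
  using closure_subset[of "app T ` cball 0 1"] by auto
qed

lemma compact_op_scaleR:
 fixes T :: "'a::complex_inner \<Rightarrow>\<^sub>L 'a"
 assumes "compact_op T"
 shows "compact_op (r *\<^sub>R T)"
proof -
 have "r *\<^sub>R T = (r *\<^sub>R id_blinfun) o\<^sub>L T" by (intro blinfun_eqI) (simp add: blinfun.scaleR_left)
 then show ?thesis using compact_op_compose[OF assms] by simp
qed

lemma compact_op_add:
 fixes S T :: "'a::complex_inner \<Rightarrow>\<^sub>L 'a"
 assumes "compact_op S" "compact_op T"
 shows "compact_op (S + T)"
proof (rule compact_opI)
 define K where "K = closure (app S ` cball 0 1)"
 define L where "L = closure (app T ` cball 0 1)"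
 show "compact (\<Union>x\<in>K. \<Union>y\<in>L. {x + y})" using assms unfolding compact_op_def K_def L_def by (rule compact_sums')
 show "app (S + T) ` cball 0 1 \<subseteq> (\<Union>x\<in>K. \<Union>y\<in>L. {x + y})"
 proof
  fix v assume "v \<in> app (S + T) ` cball 0 1"
  then obtain u where u: "u \<in> cball 0 1" "v = S u + T u" by (auto simp: blinfun.add_left)
  have "S u \<in> K" unfolding K_def by (rule closure_subset[THEN subsetD, OF imageI[OF u(1)]])
  moreover have "T u \<in> L" unfolding L_def by (rule closure_subset[THEN subsetD, OF imageI[OF u(1)]])
  ultimately show "v \<in> (\<Union>x\<in>K. \<Union>y\<in>L. {x + y})" using u(2) by auto
 qed
qed

lemma ex_rank_one:
 fixes u z :: "'a::complex_inner"
 shows "\<exists>\<rho>\<in>bounded_ops. compact_op \<rho> \<and> (\<forall>\<xi>. app \<rho> \<xi> = cinner z \<xi> *\<^sub>C u)"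
proof -
 have bl: "bounded_linear (\<lambda>\<xi>. cinner z \<xi> *\<^sub>C u)"
 proof (rule bounded_linear_intro[where K = "norm z * norm u"])
  show "cinner z (x + y) *\<^sub>C u = cinner z x *\<^sub>C u + cinner z y *\<^sub>C u" for x y by (simp add: cinner_add_right scaleC_add_left)
  show "cinner z (r *\<^sub>R x) *\<^sub>C u = r *\<^sub>R cinner z x *\<^sub>C u" for r x
   by (simp add: scaleR_scaleC scaleC_scaleC cinner_scaleC_right)
  show "norm (cinner z x *\<^sub>C u) \<le> norm x * (norm z * norm u)" for x
   using mult_right_mono[OF norm_cinner_le[of z x], of "norm u"] by (simp add: norm_scaleC mult_ac)
 qed
 define \<rho> where "\<rho> = Blinfun (\<lambda>\<xi>. cinner z \<xi> *\<^sub>C u)"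
 have \<rho>: "app \<rho> \<xi> = cinner z \<xi> *\<^sub>C u" for \<xi> by (simp add: \<rho>_def bounded_linear_Blinfun_apply[OF bl])
 have "\<rho> \<in> bounded_ops" by (simp add: bounded_ops_def \<rho> cinner_scaleC_right scaleC_scaleC)
 moreover have "compact_op \<rho>"
 proof (rule compact_opI)
  have bl2: "bounded_linear (\<lambda>c. c *\<^sub>C u)"
  proof (rule bounded_linear_intro[where K = "norm u"])
   show "(r *\<^sub>R c) *\<^sub>C u = r *\<^sub>R c *\<^sub>C u" for r c
    by (simp add: scaleR_conv_of_real scaleR_scaleC[of r "c *\<^sub>C u"] scaleC_scaleC)
  qed (simp_all add: scaleC_add_left norm_scaleC)
  show "compact ((\<lambda>c. c *\<^sub>C u) ` cball 0 (norm z))"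
   by (intro compact_continuous_image linear_continuous_on[OF bl2] compact_cball)
  show "app \<rho> ` cball 0 1 \<subseteq> (\<lambda>c. c *\<^sub>C u) ` cball 0 (norm z)"
  proof
   fix v assume "v \<in> app \<rho> ` cball 0 1"
   then obtain \<xi> where x: "norm \<xi> \<le> 1" "v = cinner z \<xi> *\<^sub>C u" by (auto simp: \<rho>)
   have "cmod (cinner z \<xi>) \<le> norm z" using norm_cinner_le[of z \<xi>] mult_left_le[OF x(1), of "norm z"] by simp
   then show "v \<in> (\<lambda>c. c *\<^sub>C u) ` cball 0 (norm z)" using x(2) by auto
  qed
 qed
 ultimately show ?thesis using \<rho> by blast
qed

lemma cinner_diff_right: "cinner x (y - z) = cinner x y - cinner x (z::'a::complex_inner)"
 using cinner_add_right[of x "y - z" z] by simp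

lemma cinner_scaleC_left: "cinner (c *\<^sub>C x) y = cnj c * cinner x (y::'a::complex_inner)"
 by (metis cinner_commute cinner_scaleC_right complex_cnj_mult)

lemma cinner_diff_left: "cinner (x - y) z = cinner x z - cinner y (z::'a::complex_inner)"
 by (metis cinner_commute cinner_diff_right complex_cnj_diff)

lemma cinner_sum_right: "cinner x (\<Sum>i\<in>I. f i) = (\<Sum>i\<in>I. cinner x (f i :: 'a::complex_inner))"
proof (induction I rule: infinite_finite_induct)
 case (insert i I)
 then show ?case by (simp add: cinner_add_right)
qed (simp_all add: cinner_eq complex_eq_iff)

lemma cinner_self: "cinner x x = complex_of_real ((norm (x::'a::complex_inner))\<^sup>2)"
 by (simp add: cinner_eq power2_norm_eq_inner complex_of_real_def)

text \<open>Subtracting from all vectors their components along the last one splits off a nonnegative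
 term and makes the last vector vanish.\<close>

lemma schur_gram:
 fixes u :: "nat \<Rightarrow> 'a::complex_inner"
 assumes "\<And>z. (\<Sum>i<n. \<Sum>j<n. cnj (z i) * z j * a i j) \<in> \<real>\<^sub>\<ge>\<^sub>0"
 shows "(\<Sum>i<n. \<Sum>j<n. a i j * cinner (u i) (u j)) \<in> \<real>\<^sub>\<ge>\<^sub>0"
 using assms
proof (induction n arbitrary: u)
 case (Suc n)
 define e where "e = u n"
 define q where "q = (norm e)\<^sup>2"
 \<comment> \<open>For \<open>q = 0\<close> division by zero yields 0, which fits because then
   \<open>e\<close> vanishes.\<close>
 define \<alpha> where "\<alpha> i = cinner e (u i) / complex_of_real q" for i
 define u' where "u' i = u i - \<alpha> i *\<^sub>C e" for i
 have ee: "cinner e e = complex_of_real q" by (simp add: cinner_self q_def)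
 have eu: "cinner e (u i) = \<alpha> i * complex_of_real q" for i
 proof (cases "q = 0")
  case True
  then have "e = 0" by (simp add: q_def)
  then show ?thesis using True norm_cinner_le[of e "u i"] by simp
 qed (simp add: \<alpha>_def)
 have ue: "cinner (u i) e = cnj (\<alpha> i) * complex_of_real q" for i
  using cinner_commute[of "u i" e] by (simp add: eu)
 have "cinner (u i) (u j) = complex_of_real q * (cnj (\<alpha> i) * \<alpha> j) + cinner (u' i) (u' j)" for i j
  by (simp add: u'_def cinner_diff_left cinner_diff_right cinner_scaleC_left cinner_scaleC_right ee eu ue algebra_simps)
 then have split: "(\<Sum>i<Suc n. \<Sum>j<Suc n. a i j * cinner (u i) (u j)) =
  complex_of_real q * (\<Sum>i<Suc n. \<Sum>j<Suc n. cnj (\<alpha> i) * \<alpha> j * a i j) + (\<Sum>i<Suc n. \<Sum>j<Suc n. a i j * cinner (u' i) (u' j))"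
  by (simp only: sum_distrib_left sum.distrib[symmetric]) (simp add: algebra_simps)
 have last: "u' n = 0"
 proof (cases "q = 0")
  case True
  then show ?thesis by (simp add: u'_def q_def e_def)
 next
  case False
  then have "\<alpha> n = 1" using ee by (simp add: \<alpha>_def e_def)
  then show ?thesis by (simp add: u'_def e_def)
 qed
 have c0: "cinner x 0 = 0" "cinner 0 x = 0" for x :: 'a by (simp_all add: cinner_eq complex_eq_iff)
 have "(\<Sum>i<Suc n. \<Sum>j<Suc n. a i j * cinner (u' i) (u' j)) = (\<Sum>i<n. \<Sum>j<n. a i j * cinner (u' i) (u' j))"
  by (simp add: last c0)
 also have "\<dots> \<in> \<real>\<^sub>\<ge>\<^sub>0"
 proof (rule Suc.IH)
  fix z
  have "(\<Sum>i<Suc n. \<Sum>j<Suc n. cnj ((z(n := 0)) i) * (z(n := 0)) j * a i j) \<in> \<real>\<^sub>\<ge>\<^sub>0" by (rule Suc.prems)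
  then show "(\<Sum>i<n. \<Sum>j<n. cnj (z i) * z j * a i j) \<in> \<real>\<^sub>\<ge>\<^sub>0" by simp
 qed
 finally have "(\<Sum>i<Suc n. \<Sum>j<Suc n. a i j * cinner (u' i) (u' j)) \<in> \<real>\<^sub>\<ge>\<^sub>0" .
 then show ?case unfolding split
  by (intro nonneg_Reals_add_I nonneg_Reals_mult_I Suc.prems) (simp_all add: q_def)
qed simp

lemma sigma_weak_functional:
 assumes "l2 \<xi>" "l2 \<eta>"
 shows "continuous_map (sigma_weak M) euclidean (\<lambda>x. \<Sum>n. cinner (\<xi> n) (app x (\<eta> n)))"
 unfolding continuous_map_def topspace_sigma_weak
proof (intro conjI allI impI)
 fix U :: "complex set" assume "openin euclidean U"
 then have "open U" by (simp only: open_openin)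
 then show "openin (sigma_weak M) {x \<in> M. (\<Sum>n. cinner (\<xi> n) (app x (\<eta> n))) \<in> U}"
  unfolding sigma_weak_def
  by (intro topology_generated_by_Basis CollectI exI[of _ \<xi>] exI[of _ \<eta>] exI[of _ U] conjI refl assms)
qed simp

text \<open>The sigma-weak topology is the initial topology of its defining functionals. Normality
  is checked functional by functional, so linear combinations of maps reduce to sums of scalar
  functions.\<close>

lemma normal_map_iff:
 "normal_map M \<Phi> \<longleftrightarrow> \<Phi> ` M \<subseteq> M \<and> (\<forall>\<xi> \<eta>. l2 \<xi> \<longrightarrow> l2 \<eta> \<longrightarrow>
   continuous_map (sigma_weak M) euclidean (\<lambda>x. \<Sum>n. cinner (\<xi> n) (app (\<Phi> x) (\<eta> n))))"
proof (intro iffI conjI allI impI)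
 assume n: "normal_map M \<Phi>"
 show sub: "\<Phi> ` M \<subseteq> M"
  using n unfolding normal_map_def by (metis continuous_map_image_subset_topspace topspace_sigma_weak)
 fix \<xi> \<eta> :: "nat \<Rightarrow> 'a" assume s: "l2 \<xi>" "l2 \<eta>"
 from continuous_map_compose[OF n[unfolded normal_map_def] sigma_weak_functional[OF s]]
 show "continuous_map (sigma_weak M) euclidean (\<lambda>x. \<Sum>n. cinner (\<xi> n) (app (\<Phi> x) (\<eta> n)))"
  by (simp add: o_def)
next
 assume h: "\<Phi> ` M \<subseteq> M \<and> (\<forall>\<xi> \<eta>. l2 \<xi> \<longrightarrow> l2 \<eta> \<longrightarrow>
   continuous_map (sigma_weak M) euclidean (\<lambda>x. \<Sum>n. cinner (\<xi> n) (app (\<Phi> x) (\<eta> n))))"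
 show "normal_map M \<Phi>"
  unfolding normal_map_def
 proof (subst (2) sigma_weak_def, subst continuous_on_generated_topo_iff, intro conjI allI impI)
  fix V assume "V \<in> {{x \<in> M. (\<Sum>n. cinner (\<xi> n) (app x (\<eta> n))) \<in> U} | \<xi> \<eta> U. l2 \<xi> \<and> l2 \<eta> \<and> open U}"
  then obtain \<xi> \<eta> U where V: "V = {x \<in> M. (\<Sum>n. cinner (\<xi> n) (app x (\<eta> n))) \<in> U}"
   "l2 \<xi>" "l2 \<eta>" "open U" by blast
  have "continuous_map (sigma_weak M) euclidean (\<lambda>x. \<Sum>n. cinner (\<xi> n) (app (\<Phi> x) (\<eta> n)))" using h V by blast
  from openin_continuous_map_preimage[OF this iffD1[OF open_openin V(4)]]
  have "openin (sigma_weak M) {x \<in> M. (\<Sum>n. cinner (\<xi> n) (app (\<Phi> x) (\<eta> n))) \<in> U}"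
   unfolding topspace_sigma_weak .
  moreover have "\<Phi> -` V \<inter> topspace (sigma_weak M) = {x \<in> M. (\<Sum>n. cinner (\<xi> n) (app (\<Phi> x) (\<eta> n))) \<in> U}"
   unfolding topspace_sigma_weak V(1) using conjunct1[OF h] by (auto simp only: vimage_def)
  ultimately show "openin (sigma_weak M) (\<Phi> -` V \<inter> topspace (sigma_weak M))" by simp
 next
  show "\<Phi> ` topspace (sigma_weak M) \<subseteq> \<Union>{{x \<in> M. (\<Sum>n. cinner (\<xi> n) (app x (\<eta> n))) \<in> U} | \<xi> \<eta> U. l2 \<xi> \<and> l2 \<eta> \<and> open U}"
   unfolding topspace_sigma_weak topspace_sigma_weak[of M, unfolded sigma_weak_def topology_generated_by_topspace]
   by (rule conjunct1[OF h])
 qed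
qed

lemma summable_cinner:
 fixes x :: "'a::complex_inner \<Rightarrow>\<^sub>L 'a"
 assumes "l2 \<xi>" "l2 \<eta>"
 shows "summable (\<lambda>n. cinner (\<xi> n) (app x (\<eta> n)))"
 by (rule l2_comparison[OF assms(1) l2_blinfun[OF assms(2), of x], of _ 1]) (simp add: order_trans[OF norm_cinner_le mult_le_sum_squares])

lemma continuous_map_cmult:
 fixes f :: "'a \<Rightarrow> complex"
 assumes "continuous_map X euclidean f"
 shows "continuous_map X euclidean (\<lambda>x. c * f x)"
proof -
 have "continuous_map euclidean euclidean (\<lambda>z::complex. c * z)" by (simp add: continuous_intros)
 from continuous_map_compose[OF assms this] show ?thesis by (simp add: o_def)
qed

section \<open>Unital and state-preserving maps\<close>

context gns_rep
begin

abbreviation kap :: "('h \<Rightarrow>\<^sub>L 'h) \<Rightarrow> 'k" where "kap x \<equiv> T.iota (\<pi> x)"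

lemma kap_add: "x \<in> M \<Longrightarrow> y \<in> M \<Longrightarrow> kap (x + y) = kap x + kap y"
 and kap_diff: "x \<in> M \<Longrightarrow> y \<in> M \<Longrightarrow> kap (x - y) = kap x - kap y"
 and kap_scaleR: "x \<in> M \<Longrightarrow> kap (r *\<^sub>R x) = r *\<^sub>R kap x"
 and kap_scaleC: "x \<in> M \<Longrightarrow> kap (c *\<^sub>C x) = c *\<^sub>C kap x"
 by (simp_all add: pi_add pi_diff pi_scaleR pi_scaleC T.iota_add T.iota_diff T.iota_scaleR T.iota_scaleC)

lemma kap_id: "kap id_blinfun = \<Omega>"
 by (simp add: pi_id T.iota_one)

text \<open>Since \<Omega> is fixed by all powers of \<Delta>, the state is also the inner product
  with \<Omega> of the symmetric embedding; \<phi>(\<Phi>(x)) can thus be read off from the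
  implementation of \<Phi>.\<close>

lemma phi_kap: "x \<in> M \<Longrightarrow> \<phi> x = cinner \<Omega> (kap x)"
 by (simp add: phi_eq T.cinner_Omega_iota)

lemma norm_Omega: "norm \<Omega> = 1"
proof -
 have "\<phi> id_blinfun = 1" using fns by (simp add: faithful_normal_state_def)
 then have "complex_of_real ((norm \<Omega>)\<^sup>2) = 1" using phi_eq[OF M_intros(1)] by (simp add: pi_id cinner_self)
 then have "(norm \<Omega>)\<^sup>2 = 1" using of_real_eq_1_iff by blast
 then show ?thesis by (simp add: power2_eq_1_iff) (use norm_ge_zero[of \<Omega>] in linarith)
qed

lemma phi_add: "x \<in> M \<Longrightarrow> y \<in> M \<Longrightarrow> \<phi> (x + y) = \<phi> x + \<phi> y"
 and phi_diff: "x \<in> M \<Longrightarrow> y \<in> M \<Longrightarrow> \<phi> (x - y) = \<phi> x - \<phi> y"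
 and phi_scaleC: "x \<in> M \<Longrightarrow> \<phi> (c *\<^sub>C x) = c * \<phi> x"
 and phi_scaleR: "x \<in> M \<Longrightarrow> \<phi> (r *\<^sub>R x) = complex_of_real r * \<phi> x"
 by (simp_all add: phi_kap M_intros kap_add kap_diff kap_scaleC kap_scaleR cinner_add_right cinner_diff_right cinner_scaleC_right cinner_scaleR_right)

lemma phi_id: "\<phi> id_blinfun = 1"
 using fns by (simp add: faithful_normal_state_def)

lemma phi_pos: "x \<in> M \<Longrightarrow> positive_op x \<Longrightarrow> \<phi> x \<in> \<real>\<^sub>\<ge>\<^sub>0"
 using fns by (simp add: faithful_normal_state_def)

lemma M_sqrt: "x \<in> M \<Longrightarrow> pos x \<Longrightarrow> \<exists>s\<in>M. adj s = s \<and> s o\<^sub>L s = x"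
proof -
 assume x: "x \<in> M" "pos x"
 obtain s where "pos s" "s \<in> commutant (commutant M)" "s o\<^sub>L s = x"
  using ex_sqrt[OF x(2) _ commutant_M_bounded] x(1) M_eq by blast
 then show ?thesis using M_eq by (intro bexI[of _ s]) (auto simp: pos_def sa_adj)
qed

lemma pi_pos: "x \<in> M \<Longrightarrow> pos x \<Longrightarrow> pos (\<pi> x)"
proof -
 assume x: "x \<in> M" "pos x"
 obtain s where s: "s \<in> M" "adj s = s" "s o\<^sub>L s = x" using M_sqrt[OF x] by blast
 have "\<pi> x = adj (\<pi> s) o\<^sub>L \<pi> s" using s pi_mult[of s s] pi_adj[of s] by simp
 then show ?thesis by (simp add: pos_adj_compose)
qed

text \<open>The positive square root of \<open>\<pi> x\<close> comes from an element of
  \<open>M\<close>, because the GNS image equals its double commutant.\<close>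

lemma pi_pos_reflect: "x \<in> M \<Longrightarrow> pos (\<pi> x) \<Longrightarrow> pos x"
proof -
 assume x: "x \<in> M" "pos (\<pi> x)"
 have nb: "commutant N \<subseteq> bounded_ops" by (auto simp: commutant_def)
 have "\<pi> x \<in> commutant (commutant N)" using x(1) bicommutant by blast
 then obtain t where t: "pos t" "t \<in> commutant (commutant N)" "t o\<^sub>L t = \<pi> x"
  using ex_sqrt[OF x(2) _ nb] by blast
 then obtain s where s: "s \<in> M" "t = \<pi> s" using bicommutant by blast
 have "adj s = s" using t(1) s by (intro pi_inj M_adj) (auto simp: pi_adj pos_def sa_adj)
 have "x = s o\<^sub>L s" using t(3) s by (intro pi_inj x M_intros) (auto simp: pi_mult)
 then have "x = adj s o\<^sub>L s" using \<open>adj s = s\<close> by simp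
 then show ?thesis by (simp add: pos_adj_compose)
qed

lemma positive_map_positive:
 assumes "completely_positive M \<Phi>" "x \<in> M" "positive_op x"
 shows "positive_op (\<Phi> x)"
proof -
 have "positive_matrix 1 (\<lambda>i j. x)" using assms(3) by (simp add: positive_matrix_def positive_op_def)
 then have "positive_matrix 1 (\<lambda>i j. \<Phi> x)" using assms(1,2) unfolding completely_positive_def by auto
 then have "cinner (\<xi> (0::nat)) (\<Phi> x (\<xi> 0)) \<in> \<real>\<^sub>\<ge>\<^sub>0" for \<xi> by (simp add: positive_matrix_def)
 from this[of "\<lambda>_. _"] show ?thesis by (simp add: positive_op_def)
qed

lemma positive_op_id: "positive_op (id_blinfun :: 'h \<Rightarrow>\<^sub>L 'h)"
 by (simp add: positive_op_def cinner_self)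

lemma cp_into: "completely_positive M \<Phi> \<Longrightarrow> x \<in> M \<Longrightarrow> \<Phi> x \<in> M"
 by (auto simp: completely_positive_def)

lemma cp_linear:
 assumes "completely_positive M \<Phi>"
 shows "x \<in> M \<Longrightarrow> y \<in> M \<Longrightarrow> \<Phi> (x + y) = \<Phi> x + \<Phi> y" "x \<in> M \<Longrightarrow> \<Phi> (c *\<^sub>C x) = c *\<^sub>C \<Phi> x"
 using assms by (auto simp: completely_positive_def clinear_on_def)

lemma normal_compress:
 assumes m: "m \<in> M" and \<Phi>: "normal_map M \<Phi>"
 shows "normal_map M (\<lambda>x. m o\<^sub>L \<Phi> x o\<^sub>L adj m)"
 unfolding normal_map_iff
proof (intro conjI allI impI)
 have sub: "\<Phi> ` M \<subseteq> M" using \<Phi> by (simp add: normal_map_iff)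
 then show "(\<lambda>x. m o\<^sub>L \<Phi> x o\<^sub>L adj m) ` M \<subseteq> M" using m by (auto intro!: M_intros M_adj)
 fix \<xi> \<eta> :: "nat \<Rightarrow> 'h" assume s: "l2 \<xi>" "l2 \<eta>"
 have "continuous_map (sigma_weak M) euclidean (\<lambda>x. \<Sum>n. cinner (adj m (\<xi> n)) (\<Phi> x (adj m (\<eta> n))))"
  using \<Phi>[unfolded normal_map_iff, THEN conjunct2, rule_format, OF l2_blinfun[OF s(1)] l2_blinfun[OF s(2)]] .
 then show "continuous_map (sigma_weak M) euclidean (\<lambda>x. \<Sum>n. cinner (\<xi> n) ((m o\<^sub>L \<Phi> x o\<^sub>L adj m) (\<eta> n)))"
  by (simp add: cinner_adj[OF M_bounded[OF m]])
qed

lemma cp_compress: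
 assumes m: "m \<in> M" and \<Phi>: "completely_positive M \<Phi>"
 shows "completely_positive M (\<lambda>x. m o\<^sub>L \<Phi> x o\<^sub>L adj m)"
 unfolding completely_positive_def
proof (intro conjI allI impI)
 show "(\<lambda>x. m o\<^sub>L \<Phi> x o\<^sub>L adj m) ` M \<subseteq> M" using m cp_into[OF \<Phi>] by (auto intro!: M_intros M_adj)
 show "clinear_on M (\<lambda>x. m o\<^sub>L \<Phi> x o\<^sub>L adj m)"
  unfolding clinear_on_def
  by (auto intro!: blinfun_eqI simp: cp_linear[OF \<Phi>] blinfun.bilinear_simps scaleC_blinfun_apply bounded_opsD[OF M_bounded[OF m]])
 fix n x assume x: "(\<forall>i<n. \<forall>j<n. x i j \<in> M) \<and> positive_matrix n x"
 then have p: "positive_matrix n (\<lambda>i j. \<Phi> (x i j))" using \<Phi> unfolding completely_positive_def by blast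
 show "positive_matrix n (\<lambda>i j. m o\<^sub>L \<Phi> (x i j) o\<^sub>L adj m)"
  unfolding positive_matrix_def
 proof
  fix \<xi> :: "nat \<Rightarrow> 'h"
  have "(\<Sum>i<n. \<Sum>j<n. cinner (adj m (\<xi> i)) (\<Phi> (x i j) (adj m (\<xi> j)))) \<in> \<real>\<^sub>\<ge>\<^sub>0"
   using p unfolding positive_matrix_def by (rule allE[of _ "\<lambda>i. adj m (\<xi> i)"])
  then show "(\<Sum>i<n. \<Sum>j<n. cinner (\<xi> i) ((m o\<^sub>L \<Phi> (x i j) o\<^sub>L adj m) (\<xi> j))) \<in> \<real>\<^sub>\<ge>\<^sub>0"
   by (simp add: cinner_adj[OF M_bounded[OF m]])
 qed
qed

lemma kms_implementation_iff:
 assumes "\<And>x. x \<in> M \<Longrightarrow> \<Phi> x \<in> M"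
 shows "kms_implementation M \<pi> \<Omega> \<Phi> S \<longleftrightarrow> S \<in> bounded_ops \<and> (\<forall>x\<in>M. app S (kap x) = kap (\<Phi> x))"
 using assms by (auto simp: kms_implementation_def kms_embedding_eq)

text \<open>The element \<open>g = \<pi> (\<Phi> id_blinfun) - id_blinfun\<close> embeds as
  \<open>S \<Omega> - \<Omega>\<close>. Its size is all that is needed to apply
  \<open>contractive_multiplier\<close>.\<close>

lemma contractive_step:
 assumes \<Phi>: "completely_positive M \<Phi>" "\<forall>x\<in>M. positive_op x \<longrightarrow> Re (\<phi> (\<Phi> x)) \<le> Re (\<phi> x)"
  and S: "kms_implementation M \<pi> \<Omega> \<Phi> S" and \<delta>: "norm (app S \<Omega> - \<Omega>) < \<delta>"
 shows "\<exists>m\<in>M. norm (\<pi> m) \<le> 1 \<and> pos (id_blinfun - (m o\<^sub>L \<Phi> id_blinfun o\<^sub>L adj m)) \<and>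
  (norm (adj (\<pi> m) \<Omega> - \<Omega>))\<^sup>2 \<le> 4 * \<delta> \<and>
  (\<forall>x\<in>M. positive_op x \<longrightarrow> Re (\<phi> (m o\<^sub>L \<Phi> x o\<^sub>L adj m)) \<le> Re (\<phi> x)) \<and>
  (\<exists>V\<in>bounded_ops. norm V \<le> 1 \<and> (\<forall>x\<in>M. app V (kap x) = kap (m o\<^sub>L x o\<^sub>L adj m)))"
proof -
 have SK: "S (kap x) = kap (\<Phi> x)" if "x \<in> M" for x
  using S that by (simp add: kms_implementation_iff cp_into[OF \<Phi>(1)])
 define h where "h = \<Phi> id_blinfun"
 have hM: "h \<in> M" unfolding h_def by (rule cp_into[OF \<Phi>(1) M_intros(1)])
 have "pos h" using positive_map_positive[OF \<Phi>(1) M_intros(1) positive_op_id] positive_op_iff[OF M_bounded[OF hM]]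
  by (simp add: h_def)
 define g where "g = \<pi> h - id_blinfun"
 have gN: "g \<in> N" unfolding g_def by (intro T.A_intros imageI hM)
 have gs: "sa g" using pi_pos[OF hM \<open>pos h\<close>] unfolding g_def by (intro sa_intros) (simp add: pos_def)
 have ig: "T.iota g = S \<Omega> - \<Omega>"
  using SK[OF M_intros(1)] by (simp add: g_def T.iota_diff T.iota_one kap_id h_def)
 have "norm (T.iota g) < \<delta>" using \<delta> by (simp add: ig)
 from T.contractive_multiplier[OF gN gs this norm_Omega] obtain w where w: "w \<in> N" "norm w \<le> 1"
  "pos (id_blinfun - (w o\<^sub>L (id_blinfun + g) o\<^sub>L adj w))"
  "\<And>z. z \<in> N \<Longrightarrow> norm (app z (adj w \<Omega>)) \<le> norm (app z \<Omega>)"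
  "\<And>x. x \<in> N \<Longrightarrow> norm (T.iota (w o\<^sub>L x o\<^sub>L adj w)) \<le> norm (T.iota x)"
  "(norm (adj w \<Omega> - \<Omega>))\<^sup>2 \<le> 4 * \<delta>" by blast
 obtain m where m: "m \<in> M" "w = \<pi> m" using w(1) by blast
 have pim: "\<pi> (m o\<^sub>L x o\<^sub>L adj m) = w o\<^sub>L \<pi> x o\<^sub>L adj w" if "x \<in> M" for x
  using m that by (simp add: pi_mult pi_adj M_intros M_adj)
 have 1: "pos (id_blinfun - (m o\<^sub>L \<Phi> id_blinfun o\<^sub>L adj m))"
 proof (rule pi_pos_reflect)
  show "id_blinfun - (m o\<^sub>L \<Phi> id_blinfun o\<^sub>L adj m) \<in> M"
   using m hM by (intro M_intros M_adj) (auto simp: h_def)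
  have "\<pi> (id_blinfun - (m o\<^sub>L \<Phi> id_blinfun o\<^sub>L adj m)) = id_blinfun - (w o\<^sub>L \<pi> h o\<^sub>L adj w)"
   using m hM by (subst pi_diff) (auto simp: h_def pi_id pim intro!: M_intros M_adj)
  then show "pos (\<pi> (id_blinfun - (m o\<^sub>L \<Phi> id_blinfun o\<^sub>L adj m)))" using w(3) by (simp add: g_def)
 qed
 have 2: "Re (\<phi> (m o\<^sub>L \<Phi> x o\<^sub>L adj m)) \<le> Re (\<phi> x)" if x: "x \<in> M" "positive_op x" for x
 proof -
  have yM: "\<Phi> x \<in> M" by (rule cp_into[OF \<Phi>(1) x(1)])
  have "pos (\<Phi> x)" using positive_map_positive[OF \<Phi>(1) x] positive_op_iff[OF M_bounded[OF yM]] by simp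
  then obtain s where s: "s \<in> M" "adj s = s" "s o\<^sub>L s = \<Phi> x" using M_sqrt[OF yM] by blast
  have ss: "inner (\<pi> s u) v = inner u (\<pi> s v)" for u v using adj[of "\<pi> s" u v] pi_adj[OF s(1)] s(2) by simp
  have ps: "\<pi> (\<Phi> x) v = \<pi> s (\<pi> s v)" for v using pi_mult[OF s(1) s(1)] s(3) by simp
  have "Re (\<phi> (m o\<^sub>L \<Phi> x o\<^sub>L adj m)) = inner \<Omega> (w (\<pi> (\<Phi> x) (adj w \<Omega>)))"
   using m yM by (subst phi_eq) (auto simp: pim Re_cinner intro!: M_intros M_adj)
  also have "\<dots> = (norm (\<pi> s (adj w \<Omega>)))\<^sup>2"
   unfolding ps by (simp add: power2_norm_eq_inner ss adj)
  \<comment> \<open>The estimate for \<open>z (adj w \<Omega>)\<close> with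
    \<open>z = \<pi> s\<close>, where \<open>s\<close> is the root of
    \<open>\<Phi> x\<close>.\<close>
  also have "\<dots> \<le> (norm (\<pi> s \<Omega>))\<^sup>2" using w(4)[of "\<pi> s"] s(1) by (intro power_mono) auto
  also have "\<dots> = Re (\<phi> (\<Phi> x))" using yM by (simp add: phi_eq Re_cinner ps power2_norm_eq_inner ss)
  also have "\<dots> \<le> Re (\<phi> x)" using \<Phi>(2) x by blast
  finally show ?thesis .
 qed
 obtain V where V: "V \<in> bounded_ops" "norm V \<le> 1" "\<And>x. x \<in> N \<Longrightarrow> app V (T.iota x) = T.iota (w o\<^sub>L x o\<^sub>L adj w)"
  using T.ex_kms_multiplier[OF w(1,5)] by blast
 have "\<forall>x\<in>M. app V (kap x) = kap (m o\<^sub>L x o\<^sub>L adj m)" using V(3) by (auto simp: pim)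
 then show ?thesis using m w(2,6) 1 2 V(1,2) by blast
qed

text \<open>The scalar \<open>c\<close> is both \<open>\<omega> id_blinfun\<close> and
  \<open>\<phi> d\<close>, so a single normalisation makes the map unital and state-preserving; the
  factor 1 - \<epsilon> guarantees \<open>\<epsilon> \<le> c\<close>. The correction is implemented
  by a rank-one operator because \<omega> is an inner product with a fixed vector on embedded
  elements.\<close>

lemma unital_step:
 assumes n: "normal_map M \<Phi>" and cp: "completely_positive M \<Phi>"
  and sub: "\<forall>x\<in>M. positive_op x \<longrightarrow> Re (\<phi> (\<Phi> x)) \<le> Re (\<phi> x)"
  and S: "kms_implementation M \<pi> \<Omega> \<Phi> S" "compact_op S" and le1: "pos (id_blinfun - \<Phi> id_blinfun)"
  and \<epsilon>: "0 < \<epsilon>" "\<epsilon> \<le> 1"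
 shows "\<exists>\<Psi> V. normal_map M \<Psi> \<and> completely_positive M \<Psi> \<and> \<Psi> id_blinfun = id_blinfun \<and> (\<forall>x\<in>M. \<phi> (\<Psi> x) = \<phi> x) \<and>
  kms_implementation M \<pi> \<Omega> \<Psi> V \<and> compact_op V \<and>
  (\<forall>\<xi>. norm (app V \<xi> - (1 - \<epsilon>) *\<^sub>R app S \<xi>)
   \<le> cmod (cinner \<Omega> \<xi> - complex_of_real (1 - \<epsilon>) * cinner \<Omega> (app S \<xi>)) * (norm (\<Omega> - (1 - \<epsilon>) *\<^sub>R app S \<Omega>) / \<epsilon>))"
proof -
 define t where "t = 1 - \<epsilon>"
 have t: "0 \<le> t" "t < 1" using \<epsilon> by (auto simp: t_def)
 have SB: "S \<in> bounded_ops" and SK: "\<And>x. x \<in> M \<Longrightarrow> S (kap x) = kap (\<Phi> x)"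
  using S(1) by (simp_all add: kms_implementation_iff cp_into[OF cp])
 have \<Phi>M: "\<Phi> x \<in> M" if "x \<in> M" for x by (rule cp_into[OF cp that])
 define d where "d = id_blinfun - t *\<^sub>R \<Phi> id_blinfun"
 have dM: "d \<in> M" unfolding d_def by (intro M_intros \<Phi>M)
 have "d = \<epsilon> *\<^sub>R id_blinfun + t *\<^sub>R (id_blinfun - \<Phi> id_blinfun)"
  by (simp add: d_def t_def algebra_simps)
 then have dpos: "pos d" using \<epsilon> t le1 by (auto intro!: pos_intros)
 define \<omega> where "\<omega> x = \<phi> x - complex_of_real t * \<phi> (\<Phi> x)" for x
 define c where "c = 1 - t * Re (\<phi> (\<Phi> id_blinfun))"
 have \<phi>\<Phi>: "\<phi> (\<Phi> x) = complex_of_real (Re (\<phi> (\<Phi> x)))" "0 \<le> Re (\<phi> (\<Phi> x))" if "x \<in> M" "positive_op x" for x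
  using phi_pos[OF \<Phi>M[OF that(1)] positive_map_positive[OF cp that]] by (auto simp: complex_nonneg_Reals_iff complex_eq_iff)
 have \<omega>pos: "\<omega> x \<in> \<real>\<^sub>\<ge>\<^sub>0" if x: "x \<in> M" "positive_op x" for x
 proof -
  have p: "\<phi> x \<in> \<real>\<^sub>\<ge>\<^sub>0" by (rule phi_pos[OF x])
  have "t * Re (\<phi> (\<Phi> x)) \<le> 1 * Re (\<phi> (\<Phi> x))" using \<phi>\<Phi>(2)[OF x] t by (intro mult_right_mono) auto
  also have "\<dots> \<le> Re (\<phi> x)" using sub x by simp
  finally show ?thesis using p \<phi>\<Phi>[OF x] by (simp add: \<omega>_def complex_nonneg_Reals_iff complex_eq_iff)
 qed
 have ceps: "\<epsilon> \<le> c"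
 proof -
  have "Re (\<phi> (\<Phi> id_blinfun)) \<le> 1" using sub M_intros(1) positive_op_id phi_id by fastforce
  then have "t * Re (\<phi> (\<Phi> id_blinfun)) \<le> t * 1" using t by (intro mult_left_mono) auto
  then show ?thesis by (simp add: c_def t_def)
 qed
 then have c: "0 < c" using \<epsilon> by simp
 have \<omega>1: "\<omega> id_blinfun = complex_of_real c"
  using \<phi>\<Phi>(1)[OF M_intros(1) positive_op_id] by (simp add: \<omega>_def c_def phi_id)
 have \<phi>d: "\<phi> d = complex_of_real c"
  using \<phi>\<Phi>(1)[OF M_intros(1) positive_op_id] by (simp add: d_def c_def phi_diff phi_scaleR M_intros \<Phi>M phi_id)
 have \<omega>_add: "\<omega> (x + y) = \<omega> x + \<omega> y" if "x \<in> M" "y \<in> M" for x y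
  using that by (simp add: \<omega>_def cp_linear[OF cp] phi_add \<Phi>M algebra_simps)
 have \<omega>_scale: "\<omega> (z *\<^sub>C x) = z * \<omega> x" if "x \<in> M" for x z
  using that by (simp add: \<omega>_def cp_linear[OF cp] phi_scaleC \<Phi>M algebra_simps)
 define \<Psi> where "\<Psi> x = t *\<^sub>R \<Phi> x + (\<omega> x / complex_of_real c) *\<^sub>C d" for x
 have \<Psi>M: "\<Psi> x \<in> M" if "x \<in> M" for x unfolding \<Psi>_def using that by (intro M_intros \<Phi>M dM)
 have \<Psi>1: "\<Psi> id_blinfun = id_blinfun" using c by (simp add: \<Psi>_def \<omega>1 d_def)
 have \<phi>\<Psi>: "\<phi> (\<Psi> x) = \<phi> x" if x: "x \<in> M" for x
  using x c by (simp add: \<Psi>_def phi_add phi_scaleR phi_scaleC M_intros \<Phi>M dM \<phi>d) (simp add: \<omega>_def)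
 have normal: "normal_map M \<Psi>"
  unfolding normal_map_iff
 proof (intro conjI allI impI)
  show "\<Psi> ` M \<subseteq> M" using \<Psi>M by blast
  fix \<xi> \<eta> :: "nat \<Rightarrow> 'h" assume s: "l2 \<xi>" "l2 \<eta>"
  have c\<phi>: "continuous_map (sigma_weak M) euclidean \<phi>"
   using fns by (simp add: faithful_normal_state_def predual_def)
  have c\<phi>\<Phi>: "continuous_map (sigma_weak M) euclidean (\<lambda>x. \<phi> (\<Phi> x))"
   using continuous_map_compose[OF n[unfolded normal_map_def] c\<phi>] by (simp add: o_def)
  have c\<Phi>: "continuous_map (sigma_weak M) euclidean (\<lambda>x. \<Sum>n. cinner (\<xi> n) (\<Phi> x (\<eta> n)))"
   using n[unfolded normal_map_iff, THEN conjunct2, rule_format, OF s] .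
  have eq: "(\<Sum>n. cinner (\<xi> n) (\<Psi> x (\<eta> n))) = complex_of_real t * (\<Sum>n. cinner (\<xi> n) (\<Phi> x (\<eta> n)))
   + (\<Sum>n. cinner (\<xi> n) (d (\<eta> n))) / complex_of_real c * \<omega> x" for x
  proof -
   have "cinner (\<xi> n) (\<Psi> x (\<eta> n)) = complex_of_real t * cinner (\<xi> n) (\<Phi> x (\<eta> n)) + (\<omega> x / complex_of_real c) * cinner (\<xi> n) (d (\<eta> n))" for n
    by (simp add: \<Psi>_def blinfun.add_left blinfun.scaleR_left scaleC_blinfun_apply cinner_add_right cinner_scaleR_right cinner_scaleC_right)
   then have "(\<Sum>n. cinner (\<xi> n) (\<Psi> x (\<eta> n))) = (\<Sum>n. complex_of_real t * cinner (\<xi> n) (\<Phi> x (\<eta> n)) + (\<omega> x / complex_of_real c) * cinner (\<xi> n) (d (\<eta> n)))"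
    by simp
   also have "\<dots> = (\<Sum>n. complex_of_real t * cinner (\<xi> n) (\<Phi> x (\<eta> n))) + (\<Sum>n. (\<omega> x / complex_of_real c) * cinner (\<xi> n) (d (\<eta> n)))"
    by (intro suminf_add[symmetric] summable_mult summable_cinner s)
   also have "\<dots> = complex_of_real t * (\<Sum>n. cinner (\<xi> n) (\<Phi> x (\<eta> n))) + (\<omega> x / complex_of_real c) * (\<Sum>n. cinner (\<xi> n) (d (\<eta> n)))"
    by (simp only: suminf_mult[OF summable_cinner[OF s]])
   finally show ?thesis by simp
  qed
  show "continuous_map (sigma_weak M) euclidean (\<lambda>x. \<Sum>n. cinner (\<xi> n) (\<Psi> x (\<eta> n)))"
   unfolding eq \<omega>_def by (intro continuous_map_add continuous_map_diff continuous_map_cmult c\<phi> c\<phi>\<Phi> c\<Phi>)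
 qed
 have CP: "completely_positive M \<Psi>"
  unfolding completely_positive_def
 proof (intro conjI allI impI)
  show "\<Psi> ` M \<subseteq> M" using \<Psi>M by blast
  show "clinear_on M \<Psi>"
   unfolding clinear_on_def
  proof (intro conjI ballI allI)
   show "\<Psi> (x + y) = \<Psi> x + \<Psi> y" if "x \<in> M" "y \<in> M" for x y
    using that by (simp add: \<Psi>_def cp_linear[OF cp] \<omega>_add add_divide_distrib scaleC_add_left scaleR_add_right)
   show "\<Psi> (z *\<^sub>C x) = z *\<^sub>C \<Psi> x" if "x \<in> M" for z x
    using that by (simp add: \<Psi>_def cp_linear[OF cp] \<omega>_scale scaleC_add_right scaleC_scaleC scaleC_scaleR_commute)
  qed
  fix n x assume x: "(\<forall>i<n. \<forall>j<n. x i j \<in> M) \<and> positive_matrix n x"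
  then have p: "positive_matrix n (\<lambda>i j. \<Phi> (x i j))" using cp unfolding completely_positive_def by blast
  \<comment> \<open>Entrywise application of \<omega> to a positive matrix gives a positive scalar
    matrix: its form at \<open>z\<close> is the value of \<omega> at the positive element
    \<open>X\<close>.\<close>
  have psd: "(\<Sum>i<n. \<Sum>j<n. cnj (z i) * z j * \<omega> (x i j)) \<in> \<real>\<^sub>\<ge>\<^sub>0" for z
  proof -
   define X where "X = (\<Sum>i<n. \<Sum>j<n. (cnj (z i) * z j) *\<^sub>C x i j)"
   have sum: "(\<Sum>i\<in>I. f i) \<in> M \<and> \<omega> (\<Sum>i\<in>I. f i) = (\<Sum>i\<in>I. \<omega> (f i))" if "\<And>i. i \<in> I \<Longrightarrow> f i \<in> M" for I :: "nat set" and f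
    using that
   proof (induction I rule: infinite_finite_induct)
    case (insert i I)
    then show ?case by (simp add: \<omega>_add M_intros)
   next
    case (infinite I)
    then show ?case using \<omega>_scale[OF zero_M, of 0] zero_M by simp
   next
    case empty
    then show ?case using \<omega>_scale[OF zero_M, of 0] zero_M by simp
   qed
   have xM: "(cnj (z i) * z j) *\<^sub>C x i j \<in> M" if "i < n" "j < n" for i j using x that by (intro M_intros) auto
   have row: "(\<Sum>j<n. (cnj (z i) * z j) *\<^sub>C x i j) \<in> M" "\<omega> (\<Sum>j<n. (cnj (z i) * z j) *\<^sub>C x i j) = (\<Sum>j<n. cnj (z i) * z j * \<omega> (x i j))"
    if i: "i < n" for i
   proof -
    have "(\<Sum>j<n. (cnj (z i) * z j) *\<^sub>C x i j) \<in> M \<and> \<omega> (\<Sum>j<n. (cnj (z i) * z j) *\<^sub>C x i j) = (\<Sum>j<n. \<omega> ((cnj (z i) * z j) *\<^sub>C x i j))"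
     by (rule sum) (use xM[OF i] in auto)
    then show "(\<Sum>j<n. (cnj (z i) * z j) *\<^sub>C x i j) \<in> M" "\<omega> (\<Sum>j<n. (cnj (z i) * z j) *\<^sub>C x i j) = (\<Sum>j<n. cnj (z i) * z j * \<omega> (x i j))"
     using x i by (simp_all add: \<omega>_scale)
   qed
   have "X \<in> M \<and> \<omega> X = (\<Sum>i<n. \<omega> (\<Sum>j<n. (cnj (z i) * z j) *\<^sub>C x i j))" unfolding X_def by (rule sum) (use row in auto)
   then have XM: "X \<in> M" and \<omega>X: "\<omega> X = (\<Sum>i<n. \<Sum>j<n. cnj (z i) * z j * \<omega> (x i j))" using row(2) by simp_all
   have "positive_op X"
    unfolding positive_op_def
   proof
    fix \<xi>
    have "cinner \<xi> (X \<xi>) = (\<Sum>i<n. \<Sum>j<n. cinner (z i *\<^sub>C \<xi>) (x i j (z j *\<^sub>C \<xi>)))"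
    proof -
     have "cinner \<xi> (X \<xi>) = (\<Sum>i<n. \<Sum>j<n. cinner \<xi> ((cnj (z i) * z j) *\<^sub>C x i j \<xi>))"
      unfolding X_def by (simp only: blinfun.sum_left cinner_sum_right scaleC_blinfun_apply)
     also have "\<dots> = (\<Sum>i<n. \<Sum>j<n. cinner (z i *\<^sub>C \<xi>) (x i j (z j *\<^sub>C \<xi>)))"
      using x by (intro sum.cong refl) (simp add: bounded_opsD[OF M_bounded] cinner_scaleC_left cinner_scaleC_right)
     finally show ?thesis .
    qed
    also have "\<dots> \<in> \<real>\<^sub>\<ge>\<^sub>0"
     using x unfolding positive_matrix_def by (elim conjE) (rule allE[of _ "\<lambda>i. z i *\<^sub>C \<xi>"])
    finally show "cinner \<xi> (X \<xi>) \<in> \<real>\<^sub>\<ge>\<^sub>0" .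
   qed
   from \<omega>pos[OF XM this] show ?thesis unfolding \<omega>X .
  qed
  \<comment> \<open>With \<open>d\<close> split as a square, the form of the correction combines the
    positive scalar matrix with the Gram matrix of the vectors \<open>s (\<xi> i)\<close>, the
    situation of \<open>schur_gram\<close>.\<close>
  obtain s where s: "s \<in> M" "adj s = s" "s o\<^sub>L s = d" using M_sqrt[OF dM dpos] by blast
  have ds: "cinner u (d v) = cinner (s u) (s v)" for u v
   using cinner_adj[OF M_bounded[OF s(1)], of u "s v"] s(2) s(3)[symmetric] by simp
  show "positive_matrix n (\<lambda>i j. \<Psi> (x i j))"
   unfolding positive_matrix_def
  proof
   fix \<xi> :: "nat \<Rightarrow> 'h"
   have "(\<Sum>i<n. \<Sum>j<n. cinner (\<xi> i) (\<Psi> (x i j) (\<xi> j))) =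
    complex_of_real t * (\<Sum>i<n. \<Sum>j<n. cinner (\<xi> i) (\<Phi> (x i j) (\<xi> j)))
    + complex_of_real (1 / c) * (\<Sum>i<n. \<Sum>j<n. \<omega> (x i j) * cinner (s (\<xi> i)) (s (\<xi> j)))"
    by (simp add: \<Psi>_def blinfun.add_left blinfun.scaleR_left scaleC_blinfun_apply cinner_add_right cinner_scaleR_right cinner_scaleC_right ds
      sum.distrib sum_distrib_left)
   moreover have "(\<Sum>i<n. \<Sum>j<n. cinner (\<xi> i) (\<Phi> (x i j) (\<xi> j))) \<in> \<real>\<^sub>\<ge>\<^sub>0"
    using p unfolding positive_matrix_def by blast
   moreover have "(\<Sum>i<n. \<Sum>j<n. \<omega> (x i j) * cinner (s (\<xi> i)) (s (\<xi> j))) \<in> \<real>\<^sub>\<ge>\<^sub>0"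
    by (rule schur_gram[OF psd])
   moreover have "complex_of_real t \<in> \<real>\<^sub>\<ge>\<^sub>0" "complex_of_real (1 / c) \<in> \<real>\<^sub>\<ge>\<^sub>0" using t c by simp_all
   ultimately show "(\<Sum>i<n. \<Sum>j<n. cinner (\<xi> i) (\<Psi> (x i j) (\<xi> j))) \<in> \<real>\<^sub>\<ge>\<^sub>0"
    by (simp only: nonneg_Reals_add_I nonneg_Reals_mult_I)
  qed
 qed
 \<comment> \<open>Chosen so that \<open>cinner \<zeta> (kap x) = \<omega> x\<close>.\<close>
 define \<zeta> where "\<zeta> = \<Omega> - t *\<^sub>R adj S \<Omega>"
 have \<zeta>: "cinner \<zeta> \<xi> = cinner \<Omega> \<xi> - complex_of_real t * cinner \<Omega> (S \<xi>)" for \<xi>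
  by (simp add: \<zeta>_def cinner_diff_left scaleR_scaleC cinner_scaleC_left cinner_adj[OF SB])
 have kd: "kap d = \<Omega> - t *\<^sub>R S \<Omega>"
  using SK[OF M_intros(1)] by (simp add: d_def kap_diff kap_scaleR M_intros \<Phi>M kap_id)
 obtain \<rho> where \<rho>: "\<rho> \<in> bounded_ops" "compact_op \<rho>" "\<And>\<xi>. app \<rho> \<xi> = cinner \<zeta> \<xi> *\<^sub>C ((1 / c) *\<^sub>R kap d)"
  using ex_rank_one[of \<zeta> "(1 / c) *\<^sub>R kap d"] by blast
 define V where "V = t *\<^sub>R S + \<rho>"
 have VB: "V \<in> bounded_ops" unfolding V_def using SB \<rho>(1) by (simp add: bounded_ops_iff blinfun.add_left blinfun.scaleR_left scaleC_add_right scaleC_scaleR_commute)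
 have VC: "compact_op V" unfolding V_def by (intro compact_op_add compact_op_scaleR S \<rho>)
 have VK: "V (kap x) = kap (\<Psi> x)" if x: "x \<in> M" for x
 proof -
  have "cinner \<zeta> (kap x) = \<omega> x" using x by (simp add: \<zeta> SK \<omega>_def phi_kap \<Phi>M)
  then have "V (kap x) = t *\<^sub>R kap (\<Phi> x) + \<omega> x *\<^sub>C ((1 / c) *\<^sub>R kap d)"
   using x by (simp add: V_def blinfun.add_left blinfun.scaleR_left SK \<rho>(3))
  also have "\<omega> x *\<^sub>C ((1 / c) *\<^sub>R kap d) = (\<omega> x / complex_of_real c) *\<^sub>C kap d"
   by (simp add: scaleR_scaleC scaleC_scaleC)
  finally show ?thesis using x by (simp add: \<Psi>_def kap_add kap_scaleR kap_scaleC M_intros \<Phi>M dM)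
 qed
 have "norm (V \<xi> - t *\<^sub>R S \<xi>) \<le> cmod (cinner \<Omega> \<xi> - complex_of_real t * cinner \<Omega> (S \<xi>)) * (norm (\<Omega> - t *\<^sub>R S \<Omega>) / \<epsilon>)" for \<xi>
 proof -
  have "norm (V \<xi> - t *\<^sub>R S \<xi>) = cmod (cinner \<zeta> \<xi>) * (norm (kap d) / c)"
   using c by (simp add: V_def blinfun.add_left blinfun.scaleR_left \<rho>(3) norm_scaleC)
  also have "\<dots> \<le> cmod (cinner \<zeta> \<xi>) * (norm (kap d) / \<epsilon>)"
   using ceps \<epsilon> by (intro mult_left_mono divide_left_mono) auto
  finally show ?thesis by (simp add: \<zeta> kd)
 qed
 moreover have "kms_implementation M \<pi> \<Omega> \<Psi> V" using VB VK \<Psi>M by (simp add: kms_implementation_iff)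
 ultimately show ?thesis using normal CP \<Psi>1 \<phi>\<Psi> VC unfolding t_def by blast
qed

end

section \<open>Assembling the sequences of maps\<close>

context gns_rep
begin

lemma contractive_witnesses:
 assumes "symmetric_haagerup_property M \<phi> \<pi> \<Omega>"
 shows "\<exists>\<Phi> S. (\<forall>k::nat. normal_map M (\<Phi> k) \<and> completely_positive M (\<Phi> k) \<and>
   (\<forall>x\<in>M. positive_op x \<longrightarrow> Re (\<phi> (\<Phi> k x)) \<le> Re (\<phi> x)) \<and> pos (id_blinfun - \<Phi> k id_blinfun) \<and>
   kms_implementation M \<pi> \<Omega> (\<Phi> k) (S k) \<and> compact_op (S k)) \<and>
  (\<forall>\<xi>. (\<lambda>k. app (S k) \<xi>) \<longlonglongrightarrow> \<xi>)"
proof -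
 obtain \<Phi> :: "nat \<Rightarrow> 'h \<Rightarrow>\<^sub>L 'h \<Rightarrow> 'h \<Rightarrow>\<^sub>L 'h" and S :: "nat \<Rightarrow> 'k \<Rightarrow>\<^sub>L 'k" where
  n: "\<And>k. normal_map M (\<Phi> k)" and cp: "\<And>k. completely_positive M (\<Phi> k)"
  and sub: "\<And>k. \<forall>x\<in>M. positive_op x \<longrightarrow> Re (\<phi> (\<Phi> k x)) \<le> Re (\<phi> x)"
  and kms: "\<And>k. kms_implementation M \<pi> \<Omega> (\<Phi> k) (S k)" and comp: "\<And>k. compact_op (S k)"
  and lim: "\<And>\<xi>. (\<lambda>k. S k \<xi>) \<longlonglongrightarrow> \<xi>"
  using assms unfolding symmetric_haagerup_property_def by blast
 \<comment> \<open>The summand makes the bound strict, as \<open>contractive_step\<close> requires,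
   even where \<open>S k \<Omega> = \<Omega>\<close>.\<close>
 define \<delta> where "\<delta> k = norm (S k \<Omega> - \<Omega>) + 1 / real (Suc k)" for k
 have \<delta>: "norm (S k \<Omega> - \<Omega>) < \<delta> k" for k by (simp add: \<delta>_def)
 have \<delta>0: "\<delta> \<longlonglongrightarrow> 0"
 proof -
  have "(\<lambda>k. 1 / real (Suc k)) \<longlonglongrightarrow> 0" using LIMSEQ_inverse_real_of_nat by (simp add: inverse_eq_divide)
  then have "(\<lambda>k. norm (S k \<Omega> - \<Omega>) + 1 / real (Suc k)) \<longlonglongrightarrow> norm (\<Omega> - \<Omega>) + 0" by (intro tendsto_intros lim)
  then show ?thesis by (simp add: \<delta>_def[abs_def])
 qed
 define P where "P k m V \<longleftrightarrow> m \<in> M \<and> norm (\<pi> m) \<le> 1 \<and> pos (id_blinfun - (m o\<^sub>L \<Phi> k id_blinfun o\<^sub>L adj m)) \<and>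
  (norm (adj (\<pi> m) \<Omega> - \<Omega>))\<^sup>2 \<le> 4 * \<delta> k \<and>
  (\<forall>x\<in>M. positive_op x \<longrightarrow> Re (\<phi> (m o\<^sub>L \<Phi> k x o\<^sub>L adj m)) \<le> Re (\<phi> x)) \<and>
  V \<in> bounded_ops \<and> norm V \<le> 1 \<and> (\<forall>x\<in>M. app V (kap x) = kap (m o\<^sub>L x o\<^sub>L adj m))" for k m V
 have "\<forall>k. \<exists>m V. P k m V"
  using contractive_step[OF cp sub kms \<delta>] unfolding P_def by (simp add: Bex_def)
 then obtain m V where P: "\<And>k. P k (m k) (V k)" by metis
 have mM: "m k \<in> M" and m1: "norm (\<pi> (m k)) \<le> 1" and mp: "pos (id_blinfun - (m k o\<^sub>L \<Phi> k id_blinfun o\<^sub>L adj (m k)))"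
  and ml: "(norm (adj (\<pi> (m k)) \<Omega> - \<Omega>))\<^sup>2 \<le> 4 * \<delta> k"
  and ms: "\<forall>x\<in>M. positive_op x \<longrightarrow> Re (\<phi> (m k o\<^sub>L \<Phi> k x o\<^sub>L adj (m k))) \<le> Re (\<phi> x)"
  and VB: "V k \<in> bounded_ops" and V1: "norm (V k) \<le> 1"
  and VK: "\<forall>x\<in>M. app (V k) (kap x) = kap (m k o\<^sub>L x o\<^sub>L adj (m k))" for k
  using P[of k] unfolding P_def by simp_all
 have mlim: "(\<lambda>k. adj (\<pi> (m k)) \<Omega>) \<longlonglongrightarrow> \<Omega>"
 proof -
  have "(\<lambda>k. sqrt (4 * \<delta> k)) \<longlonglongrightarrow> sqrt (4 * 0)" by (intro tendsto_intros \<delta>0)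
  then have "(\<lambda>k. sqrt (4 * \<delta> k)) \<longlonglongrightarrow> 0" by simp
  then have "(\<lambda>k. adj (\<pi> (m k)) \<Omega> - \<Omega>) \<longlonglongrightarrow> 0"
   by (rule Lim_null_comparison[rotated]) (use ml real_le_rsqrt in \<open>auto intro!: always_eventually\<close>)
  then show ?thesis by (simp add: LIM_zero_iff)
 qed
 have Vlim: "(\<lambda>k. V k \<xi>) \<longlonglongrightarrow> \<xi>" for \<xi>
 proof -
  have "(\<lambda>k. V k \<xi>) \<longlonglongrightarrow> id_blinfun \<xi>"
  proof (rule tendsto_dense[OF T.iota_dense V1])
   fix u assume "u \<in> T.iota ` N"
   then obtain x where x: "x \<in> M" "u = kap x" by blast
   have "V k u = T.iota (\<pi> (m k) o\<^sub>L \<pi> x o\<^sub>L adj (\<pi> (m k)))" for k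
    using VK[of k] x mM[of k] by (simp add: pi_mult pi_adj M_intros M_adj)
   then show "(\<lambda>k. V k u) \<longlonglongrightarrow> id_blinfun u"
    using T.multiplier_limit[of "\<lambda>k. \<pi> (m k)", OF _ m1 mlim, of "\<pi> x"] mM x by simp
  qed
  then show ?thesis by simp
 qed
 \<comment> \<open>The compression of \<open>\<Phi> k\<close> is implemented by the product of
   \<open>V k\<close> and \<open>S k\<close>. Since the \<open>V k\<close> are contractions
   converging strongly to the identity, so does the product.\<close>
 have SVlim: "(\<lambda>k. (V k o\<^sub>L S k) \<xi>) \<longlonglongrightarrow> \<xi>" for \<xi>
 proof -
  have "(\<lambda>k. norm (S k \<xi> - \<xi>)) \<longlonglongrightarrow> norm (\<xi> - \<xi>)" by (intro tendsto_intros lim)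
  then have l: "(\<lambda>k. norm (S k \<xi> - \<xi>)) \<longlonglongrightarrow> 0" by simp
  have b: "norm (V k (S k \<xi> - \<xi>)) \<le> norm (S k \<xi> - \<xi>)" for k using V1[of k] unfolding norm_le_one_iff by blast
  have "(\<lambda>k. V k (S k \<xi> - \<xi>)) \<longlonglongrightarrow> 0"
   by (rule Lim_null_comparison[OF always_eventually[OF allI[OF b]] l])
  from tendsto_add[OF this Vlim[of \<xi>]] show ?thesis by (simp add: blinfun.diff_right)
 qed
 have kms': "kms_implementation M \<pi> \<Omega> (\<lambda>x. m k o\<^sub>L \<Phi> k x o\<^sub>L adj (m k)) (V k o\<^sub>L S k)" for k
 proof -
  have S: "S k \<in> bounded_ops" "\<forall>x\<in>M. app (S k) (kap x) = kap (\<Phi> k x)"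
   using kms[of k] by (auto simp: kms_implementation_iff cp_into[OF cp])
  have "m k o\<^sub>L \<Phi> k x o\<^sub>L adj (m k) \<in> M" if "x \<in> M" for x using mM that by (intro M_intros M_adj cp_into[OF cp])
  then show ?thesis using S VB[of k] VK[of k] cp_into[OF cp]
   by (simp add: kms_implementation_iff bounded_ops_iff)
 qed
 show ?thesis
  by (intro exI[of _ "\<lambda>k x. m k o\<^sub>L \<Phi> k x o\<^sub>L adj (m k)"] exI[of _ "\<lambda>k. V k o\<^sub>L S k"] conjI allI
    normal_compress cp_compress mM n cp ms mp kms' compact_op_compose comp SVlim)
qed

end

theorem theorem3p13:
 fixes M :: "('h::complex_hilbert \<Rightarrow>\<^sub>L 'h) set"
  and \<phi> :: "'h \<Rightarrow>\<^sub>L 'h \<Rightarrow> complex"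
  and \<pi> :: "'h \<Rightarrow>\<^sub>L 'h \<Rightarrow> 'k::complex_hilbert \<Rightarrow>\<^sub>L 'k"
  and \<Omega> :: 'k
 assumes "von_neumann_algebra M"
  and "separable_predual M"
  and "faithful_normal_state M \<phi>"
  and "gns_triple M \<phi> \<pi> \<Omega>"
  and "symmetric_haagerup_property M \<phi> \<pi> \<Omega>"
 shows "\<exists>(\<Phi> :: nat \<Rightarrow> 'h \<Rightarrow>\<^sub>L 'h \<Rightarrow> 'h \<Rightarrow>\<^sub>L 'h) (T :: nat \<Rightarrow> 'k \<Rightarrow>\<^sub>L 'k).
   (\<forall>k. normal_map M (\<Phi> k) \<and> completely_positive M (\<Phi> k) \<and>
      \<Phi> k id_blinfun = id_blinfun \<and>
      (\<forall>x\<in>M. \<phi> (\<Phi> k x) = \<phi> x) \<and>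
      kms_implementation M \<pi> \<Omega> (\<Phi> k) (T k) \<and> compact_op (T k)) \<and>
   (\<forall>\<xi>. (\<lambda>k. blinfun_apply (T k) \<xi>) \<longlonglongrightarrow> \<xi>)"
proof -
 interpret gns_rep M \<phi> \<pi> \<Omega> using assms(1,3,4) by (rule gns_rep.intro)
 obtain \<Phi> :: "nat \<Rightarrow> 'h \<Rightarrow>\<^sub>L 'h \<Rightarrow> 'h \<Rightarrow>\<^sub>L 'h" and S :: "nat \<Rightarrow> 'k \<Rightarrow>\<^sub>L 'k" where
  n: "\<And>k. normal_map M (\<Phi> k)" and cp: "\<And>k. completely_positive M (\<Phi> k)"
  and sub: "\<And>k. \<forall>x\<in>M. positive_op x \<longrightarrow> Re (\<phi> (\<Phi> k x)) \<le> Re (\<phi> x)"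
  and le1: "\<And>k. pos (id_blinfun - \<Phi> k id_blinfun)"
  and kms: "\<And>k. kms_implementation M \<pi> \<Omega> (\<Phi> k) (S k)" and comp: "\<And>k. compact_op (S k)"
  and lim: "\<And>\<xi>. (\<lambda>k. S k \<xi>) \<longlonglongrightarrow> \<xi>"
  using contractive_witnesses[OF assms(5)] by blast
 define \<eta> where "\<eta> k = norm (\<Omega> - S k \<Omega>)" for k
 \<comment> \<open>It has to tend to 0 but eventually stay above \<open>\<eta>\<close>, so that the
   vector of the rank-one correction divided by \<open>\<epsilon> k\<close> remains bounded. The
   summand keeps it positive, and the minimum ensures \<open>\<epsilon> k \<le> 1\<close>.\<close>
 define \<epsilon> where "\<epsilon> k = min 1 (\<eta> k + 1 / real (Suc k))" for k
 have \<epsilon>: "0 < \<epsilon> k" "\<epsilon> k \<le> 1" for k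
  by (auto simp: \<epsilon>_def \<eta>_def add_nonneg_pos)
 have sum0: "(\<lambda>k. \<eta> k + 1 / real (Suc k)) \<longlonglongrightarrow> 0"
 proof -
  have "(\<lambda>k. 1 / real (Suc k)) \<longlonglongrightarrow> 0" using LIMSEQ_inverse_real_of_nat by (simp add: inverse_eq_divide)
  then have "(\<lambda>k. norm (\<Omega> - S k \<Omega>) + 1 / real (Suc k)) \<longlonglongrightarrow> norm (\<Omega> - \<Omega>) + 0" by (intro tendsto_intros lim)
  then show ?thesis by (simp add: \<eta>_def[abs_def])
 qed
 have \<epsilon>0: "\<epsilon> \<longlonglongrightarrow> 0"
  using tendsto_min[OF tendsto_const[of 1] sum0] by (simp add: \<epsilon>_def[abs_def])
 define P where "P k \<Psi> V \<longleftrightarrow> normal_map M \<Psi> \<and> completely_positive M \<Psi> \<and> \<Psi> id_blinfun = id_blinfun \<and> (\<forall>x\<in>M. \<phi> (\<Psi> x) = \<phi> x) \<and>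
  kms_implementation M \<pi> \<Omega> \<Psi> V \<and> compact_op V \<and>
  (\<forall>\<xi>. norm (app V \<xi> - (1 - \<epsilon> k) *\<^sub>R app (S k) \<xi>)
   \<le> cmod (cinner \<Omega> \<xi> - complex_of_real (1 - \<epsilon> k) * cinner \<Omega> (S k \<xi>)) * (norm (\<Omega> - (1 - \<epsilon> k) *\<^sub>R S k \<Omega>) / \<epsilon> k))" for k \<Psi> V
 have "\<forall>k. \<exists>\<Psi> V. P k \<Psi> V"
  using unital_step[OF n cp sub kms comp le1 \<epsilon>] unfolding P_def by simp
 then obtain \<Psi> V where P: "\<And>k. P k (\<Psi> k) (V k)" by metis
 have "(\<lambda>k. V k \<xi>) \<longlonglongrightarrow> \<xi>" for \<xi>
 proof -
  \<comment> \<open>The scalar factor of the rank-one correction. It tends to 0 for each \<xi>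
    because both inner products converge to the same value, while the vector factor is eventually at
    most 2.\<close>
  define a where "a k = cmod (cinner \<Omega> \<xi> - complex_of_real (1 - \<epsilon> k) * cinner \<Omega> (S k \<xi>))" for k
  have ci: "(\<lambda>k. cinner \<Omega> (S k \<xi>)) \<longlonglongrightarrow> cinner \<Omega> \<xi>"
   unfolding cinner_eq by (intro tendsto_Complex tendsto_intros lim)
  have "a \<longlonglongrightarrow> cmod (cinner \<Omega> \<xi> - complex_of_real (1 - 0) * cinner \<Omega> \<xi>)"
   unfolding a_def by (intro tendsto_intros ci \<epsilon>0)
  then have "(\<lambda>k. a k * 2) \<longlonglongrightarrow> 0" by (intro tendsto_mult_left_zero) simp
  moreover have "eventually (\<lambda>k. norm (V k \<xi> - (1 - \<epsilon> k) *\<^sub>R S k \<xi>) \<le> a k * 2) sequentially"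
  proof -
   have "eventually (\<lambda>k. \<eta> k + 1 / real (Suc k) < 1) sequentially"
    by (rule order_tendstoD(2)[OF sum0]) simp
   then show ?thesis
   proof (rule eventually_mono)
    fix k assume k: "\<eta> k + 1 / real (Suc k) < 1"
    then have "\<epsilon> k = \<eta> k + 1 / real (Suc k)" by (simp add: \<epsilon>_def)
    then have "\<eta> k \<le> \<epsilon> k" by simp
    \<comment> \<open>The first part has norm at most \<open>\<eta> k\<close>, the second has norm
      \<open>\<epsilon> k\<close>; by the choice of \<open>\<epsilon>\<close> their sum is at most
      \<open>2 * \<epsilon> k\<close>.\<close>
    have "\<Omega> - (1 - \<epsilon> k) *\<^sub>R S k \<Omega> = (1 - \<epsilon> k) *\<^sub>R (\<Omega> - S k \<Omega>) + \<epsilon> k *\<^sub>R \<Omega>" by (simp add: algebra_simps)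
    then have "norm (\<Omega> - (1 - \<epsilon> k) *\<^sub>R S k \<Omega>) \<le> norm ((1 - \<epsilon> k) *\<^sub>R (\<Omega> - S k \<Omega>)) + norm (\<epsilon> k *\<^sub>R \<Omega>)"
     using norm_triangle_ineq by metis
    also have "\<dots> \<le> 1 * \<eta> k + \<epsilon> k"
    proof -
     have "(1 - \<epsilon> k) * \<eta> k \<le> 1 * \<eta> k" using \<epsilon>[of k] by (intro mult_right_mono) (simp_all add: \<eta>_def)
     then show ?thesis using \<epsilon>[of k] norm_Omega by (simp add: \<eta>_def)
    qed
    also have "\<dots> \<le> 2 * \<epsilon> k" using \<open>\<eta> k \<le> \<epsilon> k\<close> by simp
    finally have "norm (\<Omega> - (1 - \<epsilon> k) *\<^sub>R S k \<Omega>) / \<epsilon> k \<le> 2" using \<epsilon>(1)[of k] by (simp add: divide_le_eq)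
    then have "a k * (norm (\<Omega> - (1 - \<epsilon> k) *\<^sub>R S k \<Omega>) / \<epsilon> k) \<le> a k * 2" by (intro mult_left_mono) (simp_all add: a_def)
    moreover have "norm (V k \<xi> - (1 - \<epsilon> k) *\<^sub>R S k \<xi>) \<le> a k * (norm (\<Omega> - (1 - \<epsilon> k) *\<^sub>R S k \<Omega>) / \<epsilon> k)"
     using P[of k] unfolding P_def a_def by blast
    ultimately show "norm (V k \<xi> - (1 - \<epsilon> k) *\<^sub>R S k \<xi>) \<le> a k * 2" by simp
   qed
  qed
  ultimately have "(\<lambda>k. V k \<xi> - (1 - \<epsilon> k) *\<^sub>R S k \<xi>) \<longlonglongrightarrow> 0" by (rule Lim_null_comparison[rotated])
  moreover have "(\<lambda>k. (1 - \<epsilon> k) *\<^sub>R S k \<xi>) \<longlonglongrightarrow> (1 - 0) *\<^sub>R \<xi>" by (intro tendsto_intros lim \<epsilon>0)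
  ultimately have "(\<lambda>k. (V k \<xi> - (1 - \<epsilon> k) *\<^sub>R S k \<xi>) + (1 - \<epsilon> k) *\<^sub>R S k \<xi>) \<longlonglongrightarrow> 0 + (1 - 0) *\<^sub>R \<xi>" by (rule tendsto_add)
  then show ?thesis by simp
 qed
 moreover have "\<forall>k. normal_map M (\<Psi> k) \<and> completely_positive M (\<Psi> k) \<and> \<Psi> k id_blinfun = id_blinfun \<and>
      (\<forall>x\<in>M. \<phi> (\<Psi> k x) = \<phi> x) \<and> kms_implementation M \<pi> \<Omega> (\<Psi> k) (V k) \<and> compact_op (V k)"
  using P unfolding P_def by simp
 ultimately show ?thesis by (intro exI[of _ \<Psi>] exI[of _ V] conjI allI) simp_all
qed

end
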